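(* Assume (A1), (A2), (B1)-(B5) (written out in the context) and $\lambda:=\limsup_{\alpha\to0}\alpha v_\alpha(z)>\mu(f)$. Let $w$ and $V^*=(\tau_i^*,\xi_i^* )$ be the Bellman function and the associated strategy described in the context. Then, for every $x\in E$: 1. $\lambda=\sup_V\hat J(x,V)$, where the supremum is over all integrable strategies $V=(\tau_i,\xi_i)$. The strategy $V^*$ realizes the supremum: $\lambda=\hat J(x,V^* )$. 2. $\lambda\ge J(x,V)$ for any admissible strategy $V=(\tau_i,\xi_i)$. 3. The strategy $V^*$ is optimal for the functional $J$, that is $\lambda=J(x,V^* )$, when $c(x,\xi)=e(\xi)$ for some continuous function $e$ (the cost depends only on the target of the impulse), or when $w$ is bounded from above.
   Context: Setting. $(X_t)$ is a Feller-Markov process with right-continuous, left-limited paths and values in a locally compact space $E$ with metric $\rho$ and Borel $\sigma$-field $\mathcal E$; $(\mathcal F_t)$ is its filtration, $\mathbb P^x,\mathbb E^x$ the law and expectation when started at $x$, $P_t\phi(x)=\mathbb E^x\{\phi(X_t)\}$, $P_t(x,\cdot)=\mathbb P^x\{X_t\in\cdot\}$. $U\subseteq E$ is compact, $f:E\to\mathbb R$ is continuous and bounded, $\|\cdot\|$ is the supremum norm, and the impulse cost $c:E\times U\to\mathbb R$ is continuous, negative and bounded away from zero. A point $z\in U$ is fixed. Impulse strategies. A strategy $V=(\tau_i,\xi_i)_{i\ge1}$ is an increasing (non-decreasing) sequence of stopping times $\tau_i\in[0,\infty]$ and $U$-valued $\mathcal F_{\tau_i}$-measurable random variables $\xi_i$;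 it is admissible for $x$ if $\tau_i\to\infty$ $\mathbb P^x$-a.s., and integrable if in addition $\mathbb E^x\{\tau_i\}<\infty$ for all $i$. The controlled process (also denoted $X$, under $\mathbb P^x$) is realised on the countable product of the canonical path space $D(\mathbb R^+,E)$ with coordinates $x^1,x^2,\dots$: $x^1$ has the law of the uncontrolled process from $x$; $\tau_n$ is a stopping time, and $\xi_n$ is measurable, with respect to the filtration generated by $x^1,\dots,x^n$; after $\tau_n$ the coordinate $x^{n+1}$ evolves as the uncontrolled process restarted at time $\tau_n$ from $\xi_n$; $X_t=x^n_t$ for $t\in[\tau_{n-1},\tau_n)$, $\tau_0=0$. $X_{\tau_i-}:=x^i_{\tau_i}$ is the state just before the $i$-th impulse. Functionals. $J(x,V)=\liminf_{T\to\infty}\frac1T\mathbb E^x\{\int_0^Tf(X_s)ds+\sum_{i=1}^\infty1_{\tau_i\le T}c(X_{\tau_i-},\xi_i)\}$ for admissible $V$; $\hat J(x,V)=\liminf_{n\to\infty}\frac1{\mathbb E^x\{\tau_n\}}\mathbb E^x\{\int_0^{\tau_n}f(X_s)ds+\sum_{i=1}^nc(X_{\tau_i-},\xi_i)\}$ for integrable $V$; for $\alpha>0$, $v_\alpha(x)=\sup_V\mathbb E^x\{\int_0^\infty e^{-\alpha s}f(X_s)ds+\sum_{i\ge1}1_{\tau_i<\infty}e^{-\alpha\tau_i}c(X_{\tau_i-},\xi_i)\}$ over admissible strategies. Notation. $Mw(x)=\sup_{\xi\in U}[c(x,\xi)+w(\xi)]$; $\underline c(x)=\inf_{a\in U}c(x,a)$;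 $\kappa=\sup_{x\in U}\{|c(x,z)|\vee|c(z,x)|\}$; $D_U=\inf\{s\ge0:X_s\in U\}$ (uncontrolled process); for $\alpha\ge0$, $q_\alpha(x)=\mathbb E^x\{\int_0^\infty e^{-\alpha t}(f(X_t)-\mu(f))dt\}$ (uncontrolled process), where $\mu(f)=\int f\,d\mu$; $q_\alpha^-$ is the negative part of $q_\alpha$. Assumptions. (A1) $P_t\mathcal C_0\subseteq\mathcal C_0$, where $\mathcal C_0$ is the space of continuous bounded functions on $E$ vanishing at infinity. (A2) There are a unique probability measure $\mu$ on $\mathcal E$, a function $K:E\to(0,\infty)$ bounded on compacts and $h:[0,\infty)\to\mathbb R_+$ with $\int_0^\infty h(t)dt<\infty$ such that $\|P_t(x,\cdot)-\mu\|_{TV}\le K(x)h(t)$ for all $x\in E$ (total variation norm). Furthermore $\mathbb E^x\{K(X_T)\}<\infty$ for each $T\ge0$, and for any compact $\Gamma\subset E$ and any sets $A_T\in\mathcal F_T$, $\lim_{T\to\infty}\sup_{x\in\Gamma}\mathbb P^x\{A_T\}=0$ implies $\lim_{T\to\infty}\sup_{x\in\Gamma}\mathbb E^x\{1_{A_T}K(X_T)\}=0$. (B1) There is a constant $c_0<0$ with $c(x,x')\le c_0$ for $(x,x')\in E\times U$, and $c(x,y)\ge c(x,y')+c(y',y)$ for $x\in E$, $y,y'\in U$. (B2) For any compact $\Gamma\subset E$ and $T>0$, with $\zeta_T=\sup_{t\in[0,T]}|\underline c(X_t)|$, $\lim_{n\to\infty}\sup_{y\in\Gamma}\mathbb E^y\{\zeta_T1_{\zeta_T>n}\}=0$.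 (B3) $\sup_{x\in\Gamma}\mathbb E^x\{D_U\}<\infty$ for any compact $\Gamma\subset E$. (B4) $\sup_{\alpha\in[0,1]}\|q_\alpha^-\|<\infty$. (B5) For any compact $\Gamma\subset E$ and events $A_T\in\mathcal F_T$, $T>0$: $\lim_{T\to\infty}\sup_{x\in\Gamma}\mathbb P^x\{A_T\}=0$ implies $\lim_{T\to\infty}\sup_{x\in\Gamma}\mathbb E^x\{1_{A_T}|\underline c(X_T)|\}=0$. The function $w$ and strategy $V^*$. Under (A1), (A2), (B1)-(B5) and $\lambda>\mu(f)$ there exists a continuous $w:E\to\mathbb R$ such that: (i) $w(x)=\sup_\tau\liminf_{T\to\infty}\mathbb E^x\{\int_0^{\tau\wedge T}(f(X_s)-\lambda)ds+Mw(X_{\tau\wedge T})\}$ (supremum over all stopping times, possibly infinite; uncontrolled process); (ii) $w(z)=0$, $c(x,z)\le w(x)\le\mathbb E^x\{D_U\}\|f-\lambda\|+\kappa$ and $\underline c(x)-\kappa\le Mw(x)\le\kappa$; (iii) for every impulse strategy $V$ with all $\mathbb E^x\{\tau_i\}<\infty$ and every $n$, $w(x)\ge\mathbb E^x\{\int_0^{\tau_n}(f(X_s)-\lambda)ds+\sum_{i=1}^nc(X_{\tau_i-},\xi_i)+w(\xi_n)\}$ (controlled process); (iv) equality holds in (iii) for $V^*=(\tau_i^*,\xi_i^* )$, where $\tau_1^*=\inf\{s\ge0:w(X_s)=Mw(X_s)\}$, $\tau_{n+1}^*=\tau_n^*+\tau_1^*\circ\theta_{\tau_n^*}$ ($\theta_t$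 the Markov shift), $\xi_n^*=\hat\xi(X_{\tau_n^*-})$ with $\hat\xi:E\to U$ Borel such that $Mw(y)=c(y,\hat\xi(y))+w(\hat\xi(y))$ for $y\in E$, and $x\mapsto\mathbb E^x\{\tau_1^*\}$ is bounded on compact sets. Here $w$ and $V^*$ denote such a function and strategy. *)

theory Defs
  imports "HOL-Probability.Probability"
begin

text \<open>
  First entry times of closed sets by right-continuous paths need not be measurable for the
  filtration generated by the coordinates, but they are measurable for its universal completion.
  The stopping times and strategies below therefore refer to universally completed filtrations,
  and expectations of functionals depending on them are taken under the completed law.
\<close>

definition universal_completion :: "'a measure \<Rightarrow> 'a measure" where
  "universal_completion M = sigma (space M)
     {A. A \<subseteq> space M \<and>
         (\<forall>N. prob_space N \<longrightarrow> sets N = sets M \<longrightarrow> A \<in> sets (completion N))}"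

lemma space_universal_completion [simp]: "space (universal_completion M) = space M"
  unfolding universal_completion_def by (rule space_measure_of) auto

lemma sets_universal_completion:
  "sets (universal_completion M) =
     {A. A \<subseteq> space M \<and>
         (\<forall>N. prob_space N \<longrightarrow> sets N = sets M \<longrightarrow> A \<in> sets (completion N))}"
  (is "_ = ?S")
proof -
  have "sigma_algebra (space M) ?S"
    unfolding sigma_algebra_iff2
  proof (intro conjI ballI allI impI)
    fix A assume A: "A \<in> ?S"
    have "space M - A \<in> sets (completion N)" if "prob_space N" "sets N = sets M" for N
    proof -
      have "space (completion N) - A \<in> sets (completion N)"
        using A that by blast
      thus ?thesis using sets_eq_imp_space_eq[OF that(2)] by simp
    qed
    thus "space M - A \<in> ?S" by auto
  next
    fix A :: "nat \<Rightarrow> 'a set" assume A: "range A \<subseteq> ?S"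
    have "(\<Union>i. A i) \<in> sets (completion N)" if "prob_space N" "sets N = sets M" for N
      using A that by (intro sets.countable_UN) auto
    moreover have "(\<Union>i. A i) \<subseteq> space M" using A by auto
    ultimately show "(\<Union>i. A i) \<in> ?S" by auto
  qed auto
  thus ?thesis
    unfolding universal_completion_def by (rule sigma_algebra.sets_measure_of_eq)
qed

lemma sets_universal_completion_mono:
  assumes sp: "space M = space M'" and le: "sets M \<subseteq> sets M'"
  shows "sets (universal_completion M) \<subseteq> sets (universal_completion M')"
proof
  fix A assume A: "A \<in> sets (universal_completion M)"
  have "A \<in> sets (completion N)" if N: "prob_space N" "sets N = sets M'" for N
  proof -
    have spN: "space N = space M'" using sets_eq_imp_space_eq[OF N(2)] .
    have sub: "subalgebra N M" using sp le N(2) spN by (simp add: subalgebra_def)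
    interpret prob_space N by (rule N(1))
    have "prob_space (restr_to_subalg N M)"
      by (rule prob_space_restr_to_subalg[OF sub N(1)])
    hence "A \<in> sets (completion (restr_to_subalg N M))"
      using A sets_restr_to_subalg[OF sub] by (auto simp: sets_universal_completion)
    then obtain S N0 N' where *: "A = S \<union> N0" "N0 \<subseteq> N'"
        "N' \<in> null_sets (restr_to_subalg N M)" "S \<in> sets (restr_to_subalg N M)"
      unfolding sets_completion by blast
    hence "N' \<in> null_sets N" using null_sets_restr_to_subalg[OF sub] by auto
    moreover have "S \<in> sets N"
      using *(4) le N(2) sets_restr_to_subalg[OF sub] by auto
    ultimately show ?thesis using sets_completionI *(1,2) by metis
  qed
  thus "A \<in> sets (universal_completion M')"
    using A sp by (auto simp: sets_universal_completion)
qed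

text \<open>
  Expectation with values in the extended reals. It is only ever applied to functions whose
  positive part or negative part has finite integral.
\<close>

definition eexpectation :: "'a measure \<Rightarrow> ('a \<Rightarrow> ereal) \<Rightarrow> ereal" where
  "eexpectation M g =
     enn2ereal (\<integral>\<^sup>+\<omega>. e2ennreal (g \<omega>) \<partial>completion M)
       - enn2ereal (\<integral>\<^sup>+\<omega>. e2ennreal (- g \<omega>) \<partial>completion M)"

definition tv_norm :: "'a measure \<Rightarrow> 'a measure \<Rightarrow> real" where
  "tv_norm M N =
     (SUP \<A>\<in>{\<A>. finite \<A> \<and> disjoint \<A> \<and> \<A> \<subseteq> sets M}.
        \<Sum>A\<in>\<A>. \<bar>measure M A - measure N A\<bar>)"

definition cadlag :: "(real \<Rightarrow> 'e::metric_space) \<Rightarrow> bool" where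
  "cadlag p \<longleftrightarrow>
     (\<forall>t\<ge>0. (p \<longlongrightarrow> p t) (at_right t)) \<and> (\<forall>t>0. \<exists>l. (p \<longlongrightarrow> l) (at_left t))"

text \<open>Paths are functions on the nonnegative half-line, extended by \<open>undefined\<close>.\<close>

definition path_space :: "(real \<Rightarrow> 'e::metric_space) measure" where
  "path_space = restrict_space (\<Pi>\<^sub>M t\<in>{0..}. borel) {p. cadlag p}"

definition raw_filt :: "ennreal \<Rightarrow> (real \<Rightarrow> 'e::metric_space) measure" where
  "raw_filt t = sigma (space path_space)
     {{p \<in> space path_space. p s \<in> B} | s B. 0 \<le> s \<and> ennreal s \<le> t \<and> B \<in> sets borel}"

definition filt :: "ennreal \<Rightarrow> (real \<Rightarrow> 'e::metric_space) measure" where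
  "filt t = universal_completion (raw_filt t)"

definition shift :: "real \<Rightarrow> (real \<Rightarrow> 'e) \<Rightarrow> real \<Rightarrow> 'e" where
  "shift r p = (\<lambda>s\<in>{0..}. p (r + s))"

definition markov_family :: "('e::metric_space \<Rightarrow> (real \<Rightarrow> 'e) measure) \<Rightarrow> bool" where
  "markov_family P \<longleftrightarrow>
     P \<in> borel \<rightarrow>\<^sub>M prob_algebra path_space \<and>
     (\<forall>x. AE p in P x. p 0 = x) \<and>
     (\<forall>x. \<forall>s\<ge>0. \<forall>A\<in>sets (raw_filt (ennreal s)). \<forall>B\<in>sets path_space.
        emeasure (P x) (A \<inter> {p \<in> space path_space. shift s p \<in> B})
          = (\<integral>\<^sup>+p\<in>A. emeasure (P (p s)) B \<partial>P x))"

definition trans_prob ::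
  "('e::metric_space \<Rightarrow> (real \<Rightarrow> 'e) measure) \<Rightarrow> real \<Rightarrow> 'e \<Rightarrow> 'e measure" where
  "trans_prob P t x = distr (P x) borel (\<lambda>p. p t)"

definition semigroup ::
  "('e::metric_space \<Rightarrow> (real \<Rightarrow> 'e) measure) \<Rightarrow> real \<Rightarrow> ('e \<Rightarrow> real) \<Rightarrow> 'e \<Rightarrow> real" where
  "semigroup P t \<phi> x = (\<integral>p. \<phi> (p t) \<partial>P x)"

definition entry_time :: "'e set \<Rightarrow> (real \<Rightarrow> 'e) \<Rightarrow> ennreal" where
  "entry_time B p = (INF s\<in>{s. 0 \<le> s \<and> p s \<in> B}. ennreal s)"

lemma filtration_filt: "filtration (space path_space) filt"
proof
  show "space (filt t) = space path_space" for t :: ennreal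
    unfolding filt_def raw_filt_def by (simp add: space_measure_of_conv)
  show "sets (filt s) \<subseteq> sets (filt t)" if "s \<le> t" for s t :: ennreal
    unfolding filt_def
  proof (rule sets_universal_completion_mono)
    show "sets (raw_filt s) \<subseteq> sets (raw_filt t)"
      unfolding raw_filt_def using that
      by (subst (1 2) sets_measure_of, blast, blast, intro sigma_sets_mono')
         (blast intro: order_trans)
  qed (simp add: raw_filt_def space_measure_of_conv)
qed

text \<open>
  Sequences are indexed from 0: the coordinate \<open>\<omega> n\<close> of an element of \<open>multi_path_space\<close> is the
  path followed before the impulse number \<open>n\<close>, which takes place at time \<open>fst V n \<omega>\<close> and moves the
  process to \<open>snd V n \<omega>\<close>.
\<close>

definition multi_path_space :: "(nat \<Rightarrow> real \<Rightarrow> 'e::metric_space) measure" where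
  "multi_path_space = (\<Pi>\<^sub>M n\<in>UNIV. path_space)"

definition raw_multi_filt :: "nat \<Rightarrow> ennreal \<Rightarrow> (nat \<Rightarrow> real \<Rightarrow> 'e::metric_space) measure" where
  "raw_multi_filt n t = sigma (space multi_path_space)
     {{\<omega> \<in> space multi_path_space. \<omega> i s \<in> B} | i s B.
        i \<le> n \<and> 0 \<le> s \<and> ennreal s \<le> t \<and> B \<in> sets borel}"

definition multi_filt :: "nat \<Rightarrow> ennreal \<Rightarrow> (nat \<Rightarrow> real \<Rightarrow> 'e::metric_space) measure" where
  "multi_filt n t = universal_completion (raw_multi_filt n t)"

lemma filtration_multi_filt: "filtration (space multi_path_space) (multi_filt n)"
proof
  show "space (multi_filt n t) = space multi_path_space" for t :: ennreal
    unfolding multi_filt_def raw_multi_filt_def by (simp add: space_measure_of_conv)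
  show "sets (multi_filt n s) \<subseteq> sets (multi_filt n t)" if "s \<le> t" for s t :: ennreal
    unfolding multi_filt_def
  proof (rule sets_universal_completion_mono)
    show "sets (raw_multi_filt n s) \<subseteq> sets (raw_multi_filt n t)"
      unfolding raw_multi_filt_def using that
      by (subst (1 2) sets_measure_of, blast, blast, intro sigma_sets_mono')
         (blast intro: order_trans)
  qed (simp add: raw_multi_filt_def space_measure_of_conv)
qed

type_synonym 'e strategy =
  "(nat \<Rightarrow> (nat \<Rightarrow> real \<Rightarrow> 'e) \<Rightarrow> ennreal) \<times> (nat \<Rightarrow> (nat \<Rightarrow> real \<Rightarrow> 'e) \<Rightarrow> 'e)"

definition impulse_strategy :: "'e::metric_space set \<Rightarrow> 'e strategy \<Rightarrow> bool" where
  "impulse_strategy U V \<longleftrightarrow>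
     (\<forall>n. stopping_time (multi_filt n) (fst V n) \<and>
          (\<forall>\<omega>\<in>space multi_path_space. fst V n \<omega> \<le> fst V (Suc n) \<omega>) \<and>
          snd V n \<in> filtration.pre_sigma (space multi_path_space) (multi_filt n) (fst V n)
                      \<rightarrow>\<^sub>M restrict_space borel U)"

text \<open>
  \<open>restart s y p\<close> delays the path \<open>p\<close> by \<open>s\<close>. Its value \<open>y\<close> before \<open>s\<close> only serves to make the law
  of the coordinates well-defined: the controlled process never visits that part of the path.
\<close>

definition restart :: "ennreal \<Rightarrow> 'e \<Rightarrow> (real \<Rightarrow> 'e) \<Rightarrow> real \<Rightarrow> 'e" where
  "restart s y p = (\<lambda>t\<in>{0..}. if ennreal t < s then y else p (t - enn2real s))"

text \<open>
  The last clause says that, conditionally on the coordinates up to \<open>n\<close>, the coordinate \<open>n + 1\<close> is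
  the uncontrolled process restarted at the time and from the target of the impulse number \<open>n\<close>.
  For an impulse strategy and a Markov family there is exactly one such law.
\<close>

definition is_controlled_law ::
  "('e::metric_space \<Rightarrow> (real \<Rightarrow> 'e) measure) \<Rightarrow> 'e \<Rightarrow> 'e strategy
     \<Rightarrow> (nat \<Rightarrow> real \<Rightarrow> 'e) measure \<Rightarrow> bool" where
  "is_controlled_law P x V Q \<longleftrightarrow>
     prob_space Q \<and> sets Q = sets multi_path_space \<and>
     distr Q path_space (\<lambda>\<omega>. \<omega> 0) = P x \<and>
     (\<forall>n. \<forall>A\<in>sets (raw_multi_filt n \<top>). \<forall>B\<in>sets path_space.
        emeasure Q (A \<inter> {\<omega> \<in> space multi_path_space. \<omega> (Suc n) \<in> B})
          = (\<integral>\<^sup>+\<omega>\<in>A. emeasure (distr (P (snd V n \<omega>)) path_space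
                                       (restart (fst V n \<omega>) (snd V n \<omega>))) B \<partial>completion Q))"

definition controlled_law ::
  "('e::metric_space \<Rightarrow> (real \<Rightarrow> 'e) measure) \<Rightarrow> 'e \<Rightarrow> 'e strategy
     \<Rightarrow> (nat \<Rightarrow> real \<Rightarrow> 'e) measure" where
  "controlled_law P x V = (THE Q. is_controlled_law P x V Q)"

definition controlled :: "'e strategy \<Rightarrow> (nat \<Rightarrow> real \<Rightarrow> 'e) \<Rightarrow> real \<Rightarrow> 'e" where
  "controlled V \<omega> t = \<omega> (LEAST n. ennreal t < fst V n \<omega>) t"

definition pre_impulse :: "'e strategy \<Rightarrow> (nat \<Rightarrow> real \<Rightarrow> 'e) \<Rightarrow> nat \<Rightarrow> 'e" where
  "pre_impulse V \<omega> i = \<omega> i (enn2real (fst V i \<omega>))"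

definition mean_time ::
  "('e::metric_space \<Rightarrow> (real \<Rightarrow> 'e) measure) \<Rightarrow> 'e \<Rightarrow> 'e strategy \<Rightarrow> nat \<Rightarrow> ennreal" where
  "mean_time P x V n = (\<integral>\<^sup>+\<omega>. fst V n \<omega> \<partial>completion (controlled_law P x V))"

definition admissible ::
  "('e::metric_space \<Rightarrow> (real \<Rightarrow> 'e) measure) \<Rightarrow> 'e set \<Rightarrow> 'e \<Rightarrow> 'e strategy \<Rightarrow> bool" where
  "admissible P U x V \<longleftrightarrow>
     impulse_strategy U V \<and>
     (AE \<omega> in controlled_law P x V. (\<lambda>i. fst V i \<omega>) \<longlonglongrightarrow> \<top>)"

definition integrable_strategy ::
  "('e::metric_space \<Rightarrow> (real \<Rightarrow> 'e) measure) \<Rightarrow> 'e set \<Rightarrow> 'e \<Rightarrow> 'e strategy \<Rightarrow> bool" where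
  "integrable_strategy P U x V \<longleftrightarrow>
     admissible P U x V \<and> (\<forall>i. mean_time P x V i < \<infinity>)"

definition J ::
  "('e::metric_space \<Rightarrow> (real \<Rightarrow> 'e) measure) \<Rightarrow> ('e \<Rightarrow> real) \<Rightarrow> ('e \<Rightarrow> 'e \<Rightarrow> real)
     \<Rightarrow> 'e \<Rightarrow> 'e strategy \<Rightarrow> ereal" where
  "J P f c x V = Liminf at_top (\<lambda>T::real.
     eexpectation (controlled_law P x V) (\<lambda>\<omega>.
       ereal (LBINT s:{0..T}. f (controlled V \<omega> s))
       + (\<Sum>i. if fst V i \<omega> \<le> ennreal T then ereal (c (pre_impulse V \<omega> i) (snd V i \<omega>)) else 0))
     / ereal T)"

definition J_hat ::
  "('e::metric_space \<Rightarrow> (real \<Rightarrow> 'e) measure) \<Rightarrow> ('e \<Rightarrow> real) \<Rightarrow> ('e \<Rightarrow> 'e \<Rightarrow> real)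
     \<Rightarrow> 'e \<Rightarrow> 'e strategy \<Rightarrow> ereal" where
  "J_hat P f c x V = Liminf sequentially (\<lambda>n.
     eexpectation (controlled_law P x V) (\<lambda>\<omega>. ereal (
       (LBINT s:{s. 0 \<le> s \<and> ennreal s < fst V n \<omega>}. f (controlled V \<omega> s))
       + (\<Sum>i\<le>n. c (pre_impulse V \<omega> i) (snd V i \<omega>))))
     / enn2ereal (mean_time P x V n))"

definition v_discounted ::
  "('e::metric_space \<Rightarrow> (real \<Rightarrow> 'e) measure) \<Rightarrow> 'e set \<Rightarrow> ('e \<Rightarrow> real) \<Rightarrow> ('e \<Rightarrow> 'e \<Rightarrow> real)
     \<Rightarrow> real \<Rightarrow> 'e \<Rightarrow> ereal" where
  "v_discounted P U f c \<alpha> x = (SUP V\<in>{V. admissible P U x V}.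
     eexpectation (controlled_law P x V) (\<lambda>\<omega>.
       ereal (LBINT s:{0..}. exp (- \<alpha> * s) * f (controlled V \<omega> s))
       + (\<Sum>i. if fst V i \<omega> < \<infinity>
               then ereal (exp (- \<alpha> * enn2real (fst V i \<omega>)) * c (pre_impulse V \<omega> i) (snd V i \<omega>))
               else 0)))"

definition M_op :: "'e set \<Rightarrow> ('e \<Rightarrow> 'e \<Rightarrow> real) \<Rightarrow> ('e \<Rightarrow> real) \<Rightarrow> 'e \<Rightarrow> real" where
  "M_op U c w x = (SUP \<xi>\<in>U. c x \<xi> + w \<xi>)"

definition c_low :: "'e set \<Rightarrow> ('e \<Rightarrow> 'e \<Rightarrow> real) \<Rightarrow> 'e \<Rightarrow> real" where
  "c_low U c x = (INF a\<in>U. c x a)"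

definition kappa :: "'e set \<Rightarrow> ('e \<Rightarrow> 'e \<Rightarrow> real) \<Rightarrow> 'e \<Rightarrow> real" where
  "kappa U c z = (SUP x\<in>U. max \<bar>c x z\<bar> \<bar>c z x\<bar>)"

text \<open>
  For \<open>\<alpha> = 0\<close> the integral over the whole half-line does not converge pathwise, so it is the
  expectation of the integral over \<open>[0, T]\<close> whose limit is taken. For \<open>\<alpha> > 0\<close> and bounded \<open>f\<close> this
  is the expectation of the integral over the half-line.
\<close>

definition q_pot ::
  "('e::metric_space \<Rightarrow> (real \<Rightarrow> 'e) measure) \<Rightarrow> ('e \<Rightarrow> real) \<Rightarrow> 'e measure
     \<Rightarrow> real \<Rightarrow> 'e \<Rightarrow> real" where
  "q_pot P f \<mu> \<alpha> x = Lim at_top (\<lambda>T::real.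
     \<integral>p. (LBINT t:{0..T}. exp (- \<alpha> * t) * (f (p t) - (\<integral>y. f y \<partial>\<mu>))) \<partial>P x)"

definition C0 :: "('e::metric_space \<Rightarrow> real) set" where
  "C0 = {\<phi>. continuous_on UNIV \<phi> \<and> bounded (range \<phi>) \<and>
            (\<forall>\<epsilon>>0. \<exists>\<Gamma>. compact \<Gamma> \<and> (\<forall>x. x \<notin> \<Gamma> \<longrightarrow> \<bar>\<phi> x\<bar> < \<epsilon>))}"

definition cond_A1 :: "('e::metric_space \<Rightarrow> (real \<Rightarrow> 'e) measure) \<Rightarrow> bool" where
  "cond_A1 P \<longleftrightarrow> (\<forall>t\<ge>0. \<forall>\<phi>\<in>C0. semigroup P t \<phi> \<in> C0)"

definition asymp_unif_integrable ::
  "('e::metric_space \<Rightarrow> (real \<Rightarrow> 'e) measure) \<Rightarrow> ('e \<Rightarrow> real) \<Rightarrow> bool" where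
  "asymp_unif_integrable P k \<longleftrightarrow>
     (\<forall>\<Gamma> A. compact \<Gamma> \<longrightarrow> (\<forall>T>0. A T \<in> sets (filt (ennreal T))) \<longrightarrow>
        ((\<lambda>T. SUP x\<in>\<Gamma>. emeasure (completion (P x)) (A T)) \<longlongrightarrow> 0) at_top \<longrightarrow>
        ((\<lambda>T. SUP x\<in>\<Gamma>. \<integral>\<^sup>+p\<in>A T. ennreal (k (p T)) \<partial>completion (P x)) \<longlongrightarrow> 0) at_top)"

definition tv_rate ::
  "('e::metric_space \<Rightarrow> (real \<Rightarrow> 'e) measure) \<Rightarrow> 'e measure \<Rightarrow> ('e \<Rightarrow> real) \<Rightarrow> (real \<Rightarrow> real)
     \<Rightarrow> bool" where
  "tv_rate P \<mu> K h \<longleftrightarrow>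
     prob_space \<mu> \<and> sets \<mu> = sets borel \<and>
     K \<in> borel_measurable borel \<and> (\<forall>x. 0 < K x) \<and> (\<forall>\<Gamma>. compact \<Gamma> \<longrightarrow> bounded (K ` \<Gamma>)) \<and>
     (\<forall>t\<ge>0. 0 \<le> h t) \<and> set_integrable lborel {0..} h \<and>
     (\<forall>x. \<forall>t\<ge>0. tv_norm (trans_prob P t x) \<mu> \<le> K x * h t)"

definition cond_A2 ::
  "('e::metric_space \<Rightarrow> (real \<Rightarrow> 'e) measure) \<Rightarrow> 'e measure \<Rightarrow> bool" where
  "cond_A2 P \<mu> \<longleftrightarrow>
     (\<exists>K h. tv_rate P \<mu> K h \<and>
            (\<forall>x. \<forall>T\<ge>0. (\<integral>\<^sup>+p. ennreal (K (p T)) \<partial>P x) < \<infinity>) \<and>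
            asymp_unif_integrable P K) \<and>
     (\<forall>\<mu>' K' h'. tv_rate P \<mu>' K' h' \<longrightarrow> \<mu>' = \<mu>)"

definition cond_B1 :: "'e set \<Rightarrow> ('e \<Rightarrow> 'e \<Rightarrow> real) \<Rightarrow> bool" where
  "cond_B1 U c \<longleftrightarrow>
     (\<exists>c0<0. \<forall>x. \<forall>x'\<in>U. c x x' \<le> c0) \<and>
     (\<forall>x. \<forall>y\<in>U. \<forall>y'\<in>U. c x y \<ge> c x y' + c y' y)"

definition zeta :: "'e set \<Rightarrow> ('e \<Rightarrow> 'e \<Rightarrow> real) \<Rightarrow> real \<Rightarrow> (real \<Rightarrow> 'e) \<Rightarrow> real" where
  "zeta U c T p = (SUP t\<in>{0..T}. \<bar>c_low U c (p t)\<bar>)"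

definition cond_B2 ::
  "('e::metric_space \<Rightarrow> (real \<Rightarrow> 'e) measure) \<Rightarrow> 'e set \<Rightarrow> ('e \<Rightarrow> 'e \<Rightarrow> real) \<Rightarrow> bool" where
  "cond_B2 P U c \<longleftrightarrow>
     (\<forall>\<Gamma> T. compact \<Gamma> \<longrightarrow> 0 < T \<longrightarrow>
        (\<lambda>n::nat. SUP y\<in>\<Gamma>. \<integral>\<^sup>+p\<in>{p. zeta U c T p > real n}. ennreal (zeta U c T p)
                     \<partial>completion (P y)) \<longlonglongrightarrow> 0)"

definition cond_B3 ::
  "('e::metric_space \<Rightarrow> (real \<Rightarrow> 'e) measure) \<Rightarrow> 'e set \<Rightarrow> bool" where
  "cond_B3 P U \<longleftrightarrow>
     (\<forall>\<Gamma>. compact \<Gamma> \<longrightarrow> (SUP x\<in>\<Gamma>. \<integral>\<^sup>+p. entry_time U p \<partial>completion (P x)) < \<infinity>)"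

definition cond_B4 ::
  "('e::metric_space \<Rightarrow> (real \<Rightarrow> 'e) measure) \<Rightarrow> ('e \<Rightarrow> real) \<Rightarrow> 'e measure \<Rightarrow> bool" where
  "cond_B4 P f \<mu> \<longleftrightarrow> (\<exists>C. \<forall>\<alpha>\<in>{0..1}. \<forall>x. max 0 (- q_pot P f \<mu> \<alpha> x) \<le> C)"

definition cond_B5 ::
  "('e::metric_space \<Rightarrow> (real \<Rightarrow> 'e) measure) \<Rightarrow> 'e set \<Rightarrow> ('e \<Rightarrow> 'e \<Rightarrow> real) \<Rightarrow> bool" where
  "cond_B5 P U c \<longleftrightarrow> asymp_unif_integrable P (\<lambda>x. \<bar>c_low U c x\<bar>)"

text \<open>
  The Markov shift at the impulse time \<open>n\<close> acts on the coordinate that is followed from then on.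
\<close>

primrec star_time ::
  "'e set \<Rightarrow> ('e \<Rightarrow> 'e \<Rightarrow> real) \<Rightarrow> ('e \<Rightarrow> real) \<Rightarrow> nat \<Rightarrow> (nat \<Rightarrow> real \<Rightarrow> 'e) \<Rightarrow> ennreal" where
  "star_time U c w 0 \<omega> = entry_time {y. w y = M_op U c w y} (\<omega> 0)"
| "star_time U c w (Suc n) \<omega> = star_time U c w n \<omega>
     + entry_time {y. w y = M_op U c w y} (shift (enn2real (star_time U c w n \<omega>)) (\<omega> (Suc n)))"

definition star_strategy ::
  "'e set \<Rightarrow> ('e \<Rightarrow> 'e \<Rightarrow> real) \<Rightarrow> ('e \<Rightarrow> real) \<Rightarrow> ('e \<Rightarrow> 'e) \<Rightarrow> 'e strategy" where
  "star_strategy U c w xihat =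
     (star_time U c w, \<lambda>n \<omega>. xihat (\<omega> n (enn2real (star_time U c w n \<omega>))))"

definition impulse_payoff ::
  "('e::metric_space \<Rightarrow> (real \<Rightarrow> 'e) measure) \<Rightarrow> ('e \<Rightarrow> real) \<Rightarrow> ('e \<Rightarrow> 'e \<Rightarrow> real) \<Rightarrow> real
     \<Rightarrow> ('e \<Rightarrow> real) \<Rightarrow> 'e \<Rightarrow> 'e strategy \<Rightarrow> nat \<Rightarrow> ereal" where
  "impulse_payoff P f c lam w x V n =
     eexpectation (controlled_law P x V) (\<lambda>\<omega>. ereal (
       (LBINT s:{s. 0 \<le> s \<and> ennreal s < fst V n \<omega>}. f (controlled V \<omega> s) - lam)
       + (\<Sum>i\<le>n. c (pre_impulse V \<omega> i) (snd V i \<omega>)) + w (snd V n \<omega>)))"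

definition bellman_pair ::
  "('e::metric_space \<Rightarrow> (real \<Rightarrow> 'e) measure) \<Rightarrow> 'e set \<Rightarrow> ('e \<Rightarrow> real) \<Rightarrow> ('e \<Rightarrow> 'e \<Rightarrow> real)
     \<Rightarrow> 'e \<Rightarrow> real \<Rightarrow> ('e \<Rightarrow> real) \<Rightarrow> ('e \<Rightarrow> 'e) \<Rightarrow> bool" where
  "bellman_pair P U f c z lam w xihat \<longleftrightarrow>
     continuous_on UNIV w \<and>
     (\<forall>x. ereal (w x) = (SUP \<tau>\<in>{\<tau>. stopping_time filt \<tau>}. Liminf at_top (\<lambda>T::real.
        eexpectation (P x) (\<lambda>p. ereal (
          (LBINT s:{s. 0 \<le> s \<and> ennreal s < min (\<tau> p) (ennreal T)}. f (p s) - lam)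
          + M_op U c w (p (enn2real (min (\<tau> p) (ennreal T))))))))) \<and>
     w z = 0 \<and>
     (\<forall>x. c x z \<le> w x) \<and>
     (\<forall>x. ereal (w x) \<le> enn2ereal (\<integral>\<^sup>+p. entry_time U p \<partial>completion (P x))
                            * ereal (SUP y. \<bar>f y - lam\<bar>) + ereal (kappa U c z)) \<and>
     (\<forall>x. c_low U c x - kappa U c z \<le> M_op U c w x \<and> M_op U c w x \<le> kappa U c z) \<and>
     (\<forall>x V n. impulse_strategy U V \<longrightarrow> (\<forall>i. mean_time P x V i < \<infinity>) \<longrightarrow>
        impulse_payoff P f c lam w x V n \<le> ereal (w x)) \<and>
     xihat \<in> borel \<rightarrow>\<^sub>M restrict_space borel U \<and>
     (\<forall>y. M_op U c w y = c y (xihat y) + w (xihat y)) \<and>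
     impulse_strategy U (star_strategy U c w xihat) \<and>
     (\<forall>x n. impulse_payoff P f c lam w x (star_strategy U c w xihat) n = ereal (w x)) \<and>
     (\<forall>\<Gamma>. compact \<Gamma> \<longrightarrow>
        (SUP x\<in>\<Gamma>. \<integral>\<^sup>+p. entry_time {y. w y = M_op U c w y} p \<partial>completion (P x)) < \<infinity>)"

end

theory Submission
  imports Defs
begin

text \<open>
  Applied to the strategies that act once, at a stopping time of the coordinate followed at the
  moment, the Bellman inequality (iii) and the Bellman equality (iv) are inequalities between
  integrals over a single uncontrolled path; integrating them over the past gives one inequality for
  every stage of a controlled process, and an equality for the Bellman strategy. Since \<open>w\<close> is bounded
  on \<open>insert x U\<close>, the values of \<open>w\<close> at the starting points of the stages telescope.

  Part 1 divides (iii) and (iv) by the expectation of the impulse time, which tends to infinity.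

  For part 2 the strategy is cut at time \<open>T\<close> by an additional impulse to \<open>z\<close>. Its cost
  \<open>\<bar>c (X T) z\<bar>\<close> is integrable uniformly in the starting point in \<open>insert x U\<close> and in \<open>T\<close>: for short
  times by (B2), for long times by (B5) and the convergence to \<open>\<mu>\<close>. It is thus at most
  \<open>m + \<epsilon> N\<close>, with \<open>N\<close> the expected number of stages begun before \<open>T\<close>, which is controlled by the
  total impulse cost as each impulse costs at least \<open>c0\<close>.

  For the Bellman strategy, the potential of \<open>f - \<mu>(f)\<close>, bounded below by (B4), and \<open>lam > \<mu>(f)\<close>
  bound the expected time to the first impulse by \<open>K\<close> and \<open>\<bar>c _ z\<bar>\<close>; by (A2) and (B5) these times are
  uniformly integrable over the starting points. Hence only \<open>O(T)\<close> impulses occur before \<open>T\<close> on average,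
  and the last stage exceeds \<open>T\<close> by \<open>o(T)\<close>, so that the balance of the stages yields \<open>J \<ge> lam\<close>.
\<close>

text \<open>Impulse times and targets are only universally measurable, and the controlled law is a
  definite description. So existence and uniqueness of that law come before any expectation can be
  computed, and change of variables, mixtures and the Markov property are needed for universally
  measurable integrands. Impulse costs may have infinite expectation. Therefore the reward is raised
  by \<open>G\<close>, the values of \<open>w\<close> by \<open>C\<close>, and every balance is an
  inequality between sums of nonnegative integrals; differences are formed only at the end. The
  Bellman inequality asks for finite mean impulse times, which an admissible strategy need not have.
  For a single stage cut at a deterministic time this is harmless. A Markov family yields the Markov
  property at deterministic times only. Hence stopping times are followed along the integer grid,
  and the tail of the first action time is estimated by restarting at a fixed time. The rate
  \<open>h\<close> is integrable but need not decrease: late times are reached through one earlier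
  time at which \<open>h\<close> is small.\<close>

section \<open>Integration of universally measurable functions\<close>

lemma sets_le_universal_completion: "sets M \<subseteq> sets (universal_completion M)"
  using sets.sets_into_space by (fastforce simp: sets_universal_completion)

lemma measurable_universal_completion:
  "f \<in> M \<rightarrow>\<^sub>M N \<Longrightarrow> f \<in> universal_completion M \<rightarrow>\<^sub>M N"
  using sets_le_universal_completion[of M] by (auto simp: measurable_def)

lemma sets_universal_completionD:
  assumes "A \<in> sets (universal_completion M)" "prob_space N" "space M = space N" "sets M \<subseteq> sets N"
  shows "A \<in> sets (completion N)"
  using sets_universal_completion_mono[OF assms(3,4)] assms(1,2) by (auto simp: sets_universal_completion)

lemma measurable_universal_completionD:
  assumes "f \<in> universal_completion M \<rightarrow>\<^sub>M L" "prob_space N" "space M = space N" "sets M \<subseteq> sets N"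
  shows "f \<in> completion N \<rightarrow>\<^sub>M L"
proof (rule measurableI)
  show "f x \<in> space L" if "x \<in> space (completion N)" for x
    using measurable_space[OF assms(1), of x] that assms(3) by simp
  show "f -` A \<inter> space (completion N) \<in> sets (completion N)" if "A \<in> sets L" for A
    using sets_universal_completionD[OF measurable_sets[OF assms(1) that] assms(2-4)] assms(3) by simp
qed

lemma measurable_universal_completion_mono:
  assumes "f \<in> universal_completion M \<rightarrow>\<^sub>M L" "space M = space N" "sets M \<subseteq> sets N"
  shows "f \<in> universal_completion N \<rightarrow>\<^sub>M L"
proof (rule measurableI)
  show "f x \<in> space L" if "x \<in> space (universal_completion N)" for x
    using measurable_space[OF assms(1), of x] that assms(2) by simp
  show "f -` A \<inter> space (universal_completion N) \<in> sets (universal_completion N)" if "A \<in> sets L" for A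
    using subsetD[OF sets_universal_completion_mono[OF assms(2,3)] measurable_sets[OF assms(1) that]] assms(2) by simp
qed

text \<open>A law \<open>L\<close> on \<open>M\<close> is tested through its image under
  \<open>f\<close>: there \<open>A\<close> splits into a measurable set and a subset of a null set,
  and the preimages of the two parts have the same properties for \<open>L\<close>. Universal
  measurability is thus stable under composition with measurable maps, which fails for completions
  under unrelated laws.\<close>

lemma measurable_universal_completion2:
  assumes f: "f \<in> M \<rightarrow>\<^sub>M N"
  shows "f \<in> universal_completion M \<rightarrow>\<^sub>M universal_completion N"
proof (rule measurableI)
  show "f x \<in> space (universal_completion N)" if "x \<in> space (universal_completion M)" for x
    using that f by (auto simp: measurable_space)
  fix A assume A: "A \<in> sets (universal_completion N)"
  have "f -` A \<inter> space M \<in> sets (completion L)" if L: "prob_space L" "sets L = sets M" for L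
  proof -
    interpret L: prob_space L by fact
    have spL: "space L = space M" using L sets_eq_imp_space_eq by blast
    have fL: "f \<in> L \<rightarrow>\<^sub>M N" using f measurable_cong_sets[OF L(2) refl] by blast
    have "A \<in> sets (completion (distr L N f))"
      using A L.prob_space_distr[OF fL] by (auto simp: sets_universal_completion)
    then obtain S N0 N' where *: "A = S \<union> N0" "N0 \<subseteq> N'"
        "N' \<in> null_sets (distr L N f)" "S \<in> sets (distr L N f)"
      unfolding sets_completion by blast
    have "f -` N' \<inter> space L \<in> null_sets L"
      using *(3) fL by (auto simp: null_sets_distr_iff)
    moreover have "f -` S \<inter> space L \<in> sets L" using *(4) fL by auto
    moreover have "f -` A \<inter> space M = (f -` S \<inter> space L) \<union> (f -` N0 \<inter> space L)"
      using *(1) spL by auto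
    moreover have "f -` N0 \<inter> space L \<subseteq> f -` N' \<inter> space L" using *(2) by auto
    ultimately show ?thesis using sets_completionI by metis
  qed
  then show "f -` A \<inter> space (universal_completion M) \<in> sets (universal_completion M)"
    by (auto simp: sets_universal_completion)
qed

lemma universal_completion_version:
  fixes F :: "'a \<Rightarrow> ennreal"
  assumes "F \<in> borel_measurable (universal_completion M)" "prob_space N" "space M = space N" "sets M \<subseteq> sets N"
  obtains F' where "F' \<in> borel_measurable N" "AE x in N. F x = F' x"
  using completion_ex_borel_measurable[OF measurable_universal_completionD[OF assms]] that by blast

text \<open>\<open>nn_integral\<close> is a supremum over the simple functions below the integrand,
  so it makes sense for \<open>F\<close> and agrees with the integral under the completed law.
  Replacing \<open>F\<close> by a measurable version under the image law reduces the claim to the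
  usual change of variables.\<close>

lemma nn_integral_distr_uc:
  fixes F :: "'b \<Rightarrow> ennreal"
  assumes F: "F \<in> borel_measurable (universal_completion N)" and M: "prob_space M" and g: "g \<in> M \<rightarrow>\<^sub>M N"
  shows "(\<integral>\<^sup>+x. F x \<partial>distr M N g) = (\<integral>\<^sup>+x. F (g x) \<partial>M)"
proof -
  interpret M: prob_space M by fact
  obtain F' where F': "F' \<in> borel_measurable (distr M N g)" "AE x in distr M N g. F x = F' x"
    by (rule universal_completion_version[OF F M.prob_space_distr[OF g]]) auto
  have "(\<integral>\<^sup>+x. F x \<partial>distr M N g) = (\<integral>\<^sup>+x. F' x \<partial>distr M N g)"
    using F'(2) by (rule nn_integral_cong_AE)
  also have "\<dots> = (\<integral>\<^sup>+x. F' (g x) \<partial>M)"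
    using F'(1) g by (subst nn_integral_distr) auto
  also have "\<dots> = (\<integral>\<^sup>+x. F (g x) \<partial>M)"
    using AE_distrD[OF g F'(2)] by (intro nn_integral_cong_AE) auto
  finally show ?thesis .
qed

text \<open>The version of \<open>F\<close> is taken under the mixture \<open>M \<bind> k\<close>.
  The exceptional null set of the mixture is null under \<open>k x\<close> for almost every
  \<open>x\<close>, so one version serves almost all inner integrals.\<close>

lemma nn_integral_bind_uc:
  fixes F :: "'b \<Rightarrow> ennreal"
  assumes F: "F \<in> borel_measurable (universal_completion N)" and M: "prob_space M"
    and k: "k \<in> M \<rightarrow>\<^sub>M prob_algebra N"
  shows "(\<integral>\<^sup>+x. F x \<partial>(M \<bind> k)) = (\<integral>\<^sup>+x. (\<integral>\<^sup>+y. F y \<partial>k x) \<partial>M)"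
proof -
  interpret M: prob_space M by fact
  have k': "k \<in> M \<rightarrow>\<^sub>M subprob_algebra N" by (rule measurable_prob_algebraD[OF k])
  have ne: "space M \<noteq> {}" by (rule M.not_empty)
  have st: "sets (M \<bind> k) = sets N" using k' ne by (rule sets_bind_measurable)
  have pr: "prob_space (M \<bind> k)"
  proof (rule M.prob_space_bind[OF _ k'], rule AE_I2)
    show "prob_space (k x)" if "x \<in> space M" for x
      using measurable_space[OF k that] by (simp add: space_prob_algebra)
  qed
  have sp: "space N = space (M \<bind> k)" using sets_eq_imp_space_eq[OF st] by simp
  obtain F' where F': "F' \<in> borel_measurable (M \<bind> k)" "AE x in M \<bind> k. F x = F' x"
    by (rule universal_completion_version[OF F pr sp]) (auto simp: st)
  have F'N: "F' \<in> borel_measurable N" using F'(1) measurable_cong_sets[OF st refl] by blast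
  obtain N0 where N0: "N0 \<in> sets N" "emeasure (M \<bind> k) N0 = 0"
     "{x \<in> space (M \<bind> k). F x \<noteq> F' x} \<subseteq> N0"
    using AE_E[OF F'(2)] st by metis
  have "(\<integral>\<^sup>+x. emeasure (k x) N0 \<partial>M) = 0"
    using emeasure_bind[OF ne k' N0(1)] N0(2) by simp
  then have ae: "AE x in M. emeasure (k x) N0 = 0"
    using nn_integral_0_iff_AE[OF measurable_emeasure_kernel[OF k' N0(1)]] by simp
  have "(\<integral>\<^sup>+x. F x \<partial>(M \<bind> k)) = (\<integral>\<^sup>+x. F' x \<partial>(M \<bind> k))"
    using F'(2) by (rule nn_integral_cong_AE)
  also have "\<dots> = (\<integral>\<^sup>+x. (\<integral>\<^sup>+y. F' y \<partial>k x) \<partial>M)"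
    using F'N k' by (rule nn_integral_bind)
  also have "\<dots> = (\<integral>\<^sup>+x. (\<integral>\<^sup>+y. F y \<partial>k x) \<partial>M)"
  proof (intro nn_integral_cong_AE)
    show "AE x in M. (\<integral>\<^sup>+y. F' y \<partial>k x) = (\<integral>\<^sup>+y. F y \<partial>k x)"
      using ae AE_space
    proof eventually_elim
      case (elim x)
      have s: "sets (k x) = sets N" using sets_kernel[OF k' elim(2)] .
      have "AE y in k x. F y = F' y"
      proof (rule AE_I[of _ _ N0])
        show "{y \<in> space (k x). F y \<noteq> F' y} \<subseteq> N0"
          using N0(3) sets_eq_imp_space_eq[OF s] sp by simp
      qed (use elim(1) N0(1) s in simp_all)
      then show ?case by (intro nn_integral_cong_AE) auto
    qed
  qed
  finally show ?thesis .
qed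

subsection \<open>Paths\<close>

lemma space_path_space: "space path_space = {p. p \<in> extensional {0..} \<and> cadlag p}"
  by (auto simp: path_space_def space_restrict_space space_PiM PiE_def)

lemma measurable_path_spaceI:
  assumes "\<And>x. x \<in> space N \<Longrightarrow> h x \<in> space path_space" "\<And>t. 0 \<le> t \<Longrightarrow> (\<lambda>x. h x t) \<in> N \<rightarrow>\<^sub>M borel"
  shows "h \<in> N \<rightarrow>\<^sub>M path_space"
  unfolding path_space_def
proof (rule measurable_restrict_space2)
  show "h \<in> space N \<rightarrow> {p. cadlag p}" using assms(1) by (auto simp: space_path_space)
  show "h \<in> N \<rightarrow>\<^sub>M Pi\<^sub>M {0..} (\<lambda>t. borel)"
    using assms by (intro measurable_PiM_single') (auto simp: space_path_space PiE_def)
qed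

lemma measurable_path_coord: "0 \<le> t \<Longrightarrow> (\<lambda>p. p t) \<in> path_space \<rightarrow>\<^sub>M borel"
  unfolding path_space_def by (intro measurable_restrict_space1 measurable_component_singleton) auto

text \<open>Right-continuity makes the value at a random time a limit of values at countably valued
  times. The grid times carry a \<open>+ 1\<close> so that they lie strictly above
  \<open>g x\<close> even when \<open>g x\<close> is itself a grid point; \<open>max 0\<close> only
  turns every integer into a legal time.\<close>

lemma measurable_path_eval:
  fixes h :: "'a \<Rightarrow> real \<Rightarrow> 'e::metric_space"
  assumes h: "h \<in> N \<rightarrow>\<^sub>M path_space" and g[measurable]: "g \<in> borel_measurable N"
    and g0: "\<And>x. x \<in> space N \<Longrightarrow> 0 \<le> g x"
  shows "(\<lambda>x. h x (g x)) \<in> N \<rightarrow>\<^sub>M borel"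
proof (rule borel_measurable_LIMSEQ_metric)
  let ?g = "\<lambda>k x. (of_int \<lfloor>real (Suc k) * g x\<rfloor> + 1) / real (Suc k)"
  show "(\<lambda>x. h x (max 0 (?g k x))) \<in> N \<rightarrow>\<^sub>M borel" for k
  proof -
    have "(\<lambda>x. h x (max 0 ((of_int i + 1) / real (Suc k)))) \<in> N \<rightarrow>\<^sub>M borel" for i :: int
      by (rule measurable_compose[OF h measurable_path_coord]) simp
    moreover have "(\<lambda>x. \<lfloor>real (Suc k) * g x\<rfloor>) \<in> N \<rightarrow>\<^sub>M count_space UNIV"
      by measurable
    ultimately show ?thesis
      by (rule measurable_compose_countable[where f="\<lambda>i x. h x (max 0 ((of_int i + 1) / real (Suc k)))"])
  qed
  fix x assume x: "x \<in> space N"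
  have c: "(h x \<longlongrightarrow> h x (g x)) (at_right (g x))"
    using measurable_space[OF h x] g0[OF x] by (auto simp: space_path_space cadlag_def)
  have gt: "?g k x > g x" for k
  proof -
    have "real_of_int \<lfloor>real (Suc k) * g x\<rfloor> + 1 > real (Suc k) * g x" by linarith
    then show ?thesis by (simp add: field_simps)
  qed
  have le: "?g k x \<le> g x + 1 / real (Suc k)" for k
  proof -
    have "real_of_int \<lfloor>real (Suc k) * g x\<rfloor> + 1 \<le> real (Suc k) * g x + 1" by linarith
    from divide_right_mono[OF this, of "real (Suc k)"] show ?thesis by (simp add: add_divide_distrib)
  qed
  have "(\<lambda>k. ?g k x) \<longlonglongrightarrow> g x"
  proof (rule tendsto_sandwich[OF _ _ tendsto_const])
    show "(\<lambda>k. g x + 1 / real (Suc k)) \<longlonglongrightarrow> g x"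
      using tendsto_add[OF tendsto_const[of "g x"] LIMSEQ_inverse_real_of_nat] by (simp add: inverse_eq_divide)
  qed (use gt le in \<open>auto intro!: always_eventually less_imp_le\<close>)
  then have "filterlim (\<lambda>k. ?g k x) (at_right (g x)) sequentially"
    using gt[THEN order_less_imp_not_eq2] gt by (auto simp: filterlim_at intro!: always_eventually)
  from filterlim_compose[OF c this] have "(\<lambda>k. h x (?g k x)) \<longlonglongrightarrow> h x (g x)" .
  moreover have "max 0 (?g k x) = ?g k x" for k using gt[of k] g0[OF x] by linarith
  ultimately show "(\<lambda>k. h x (max 0 (?g k x))) \<longlonglongrightarrow> h x (g x)" by simp
qed

lemma tendsto_at_right_shift:
  fixes p :: "real \<Rightarrow> 'e::metric_space"
  assumes "(p \<longlongrightarrow> l) (at_right (t - r))" shows "((\<lambda>u. p (u - r)) \<longlongrightarrow> l) (at_right t)"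
  using assms filtermap_at_right_shift[of r t, symmetric] by (simp add: filterlim_filtermap)

lemma tendsto_at_left_shift:
  fixes p :: "real \<Rightarrow> 'e::metric_space"
  assumes "(p \<longlongrightarrow> l) (at_left (t - r))" shows "((\<lambda>u. p (u - r)) \<longlongrightarrow> l) (at_left t)"
proof -
  have "filtermap (\<lambda>x. x - r) (at_left t) = at_left (t - r)"
    using filtermap_at_left_shift[of r t] by simp
  then show ?thesis using assms by (metis filterlim_filtermap)
qed

lemma const_path_in_space: "(\<lambda>t\<in>{0..}. y) \<in> space (path_space :: (real \<Rightarrow> 'e::metric_space) measure)"
proof -
  have "((\<lambda>t\<in>{0..}. y) \<longlongrightarrow> y) (at_right t)" if "0 \<le> t" for t :: real
    by (rule Lim_transform_eventually[OF tendsto_const])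
       (use that in \<open>auto simp: eventually_at_filter intro!: always_eventually\<close>)
  moreover have "((\<lambda>t\<in>{0..}. y) \<longlongrightarrow> y) (at_left t)" if "0 < t" for t :: real
    by (rule Lim_transform_eventually[OF tendsto_const])
       (use that eventually_at_left_field[of _ t] in \<open>auto intro!: exI[of _ 0]\<close>)
  ultimately show ?thesis by (auto simp: space_path_space cadlag_def)
qed

lemma shift_in_space:
  assumes "p \<in> space path_space" "0 \<le> r" shows "shift r p \<in> space path_space"
proof -
  have c: "cadlag p" using assms by (simp add: space_path_space)
  have "(shift r p \<longlongrightarrow> shift r p t) (at_right t)" if "0 \<le> t" for t :: real
  proof (rule Lim_transform_eventually)
    show "((\<lambda>u. p (u - (-r))) \<longlongrightarrow> shift r p t) (at_right t)"
      using c that assms(2) by (intro tendsto_at_right_shift) (auto simp: shift_def cadlag_def add_ac)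
    show "\<forall>\<^sub>F u in at_right t. p (u - - r) = shift r p u"
      using that by (auto simp: eventually_at_filter shift_def add_ac intro!: always_eventually)
  qed
  moreover have "\<exists>l. (shift r p \<longlongrightarrow> l) (at_left t)" if t: "0 < t" for t :: real
  proof -
    obtain l where l: "(p \<longlongrightarrow> l) (at_left (t - - r))"
      using c t assms(2) unfolding cadlag_def by (metis add_pos_nonneg diff_minus_eq_add)
    have "(shift r p \<longlongrightarrow> l) (at_left t)"
    proof (rule Lim_transform_eventually[OF tendsto_at_left_shift[OF l]])
      show "\<forall>\<^sub>F u in at_left t. p (u - - r) = shift r p u"
        using t eventually_at_left_field[of _ t] by (auto simp: shift_def add_ac intro!: exI[of _ 0])
    qed
    then show ?thesis by blast
  qed
  ultimately show ?thesis by (auto simp: space_path_space cadlag_def shift_def)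
qed

lemma restart_in_space:
  assumes "p \<in> space path_space" shows "restart s y p \<in> space path_space"
proof (cases s)
  case top
  then have "restart s y p = (\<lambda>t\<in>{0..}. y)" by (auto simp: restart_def)
  then show ?thesis using const_path_in_space by simp
next
  case (real r)
  have c: "cadlag p" using assms by (simp add: space_path_space)
  have e: "restart s y p = (\<lambda>t\<in>{0..}. if t < r then y else p (t - r))"
    using real by (auto simp: restart_def ennreal_less_iff)
  have "(restart s y p \<longlongrightarrow> restart s y p t) (at_right t)" if "0 \<le> t" for t :: real
  proof (cases "t < r")
    case True
    have "restart s y p t = y" using True that by (simp add: e)
    moreover have "\<forall>\<^sub>F u in at_right t. y = restart s y p u"
      using True that eventually_at_right_field[of _ t] by (auto simp: e intro!: exI[of _ r])
    ultimately show ?thesis by (auto intro: Lim_transform_eventually[OF tendsto_const])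
  next
    case False
    show ?thesis
    proof (rule Lim_transform_eventually)
      show "((\<lambda>u. p (u - r)) \<longlongrightarrow> restart s y p t) (at_right t)"
        using c that False by (intro tendsto_at_right_shift) (auto simp: e cadlag_def)
      show "\<forall>\<^sub>F u in at_right t. p (u - r) = restart s y p u"
        using that False by (auto simp: eventually_at_filter e intro!: always_eventually)
    qed
  qed
  moreover have "\<exists>l. (restart s y p \<longlongrightarrow> l) (at_left t)" if t: "0 < t" for t :: real
  proof (cases "t \<le> r")
    case True
    have "\<forall>\<^sub>F u in at_left t. y = restart s y p u"
      using True that eventually_at_left_field[of _ t] by (auto simp: e intro!: exI[of _ 0])
    then show ?thesis by (auto intro: Lim_transform_eventually[OF tendsto_const])
  next
    case False
    obtain l where l: "(p \<longlongrightarrow> l) (at_left (t - r))"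
      using c False unfolding cadlag_def by (metis diff_gt_0_iff_gt not_le)
    have "(restart s y p \<longlongrightarrow> l) (at_left t)"
    proof (rule Lim_transform_eventually[OF tendsto_at_left_shift[OF l]])
      show "\<forall>\<^sub>F u in at_left t. p (u - r) = restart s y p u"
        using t False real(1) eventually_at_left_field[of _ t] by (auto simp: e intro!: exI[of _ r])
    qed
    then show ?thesis by blast
  qed
  ultimately show ?thesis by (auto simp: space_path_space cadlag_def restart_def)
qed

lemma shift_restart:
  assumes "p \<in> space path_space" "s < \<infinity>" shows "shift (enn2real s) (restart s y p) = p"
proof
  fix t show "shift (enn2real s) (restart s y p) t = p t"
    using assms by (cases s) (auto simp: shift_def restart_def space_path_space extensional_def ennreal_less_iff)
qed

lemma restart_0: "p \<in> space path_space \<Longrightarrow> restart 0 y p = p"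
  by (auto simp: restart_def space_path_space extensional_def)

lemma measurable_shift: "0 \<le> r \<Longrightarrow> shift r \<in> path_space \<rightarrow>\<^sub>M path_space"
  by (rule measurable_path_spaceI) (simp add: shift_in_space, simp add: shift_def measurable_path_coord)

text \<open>Joint measurability in delay, initial value and path: at a fixed \<open>t\<close> the
  delayed path is the path evaluated at the random time \<open>t - s\<close>. \<open>max 0\<close>
  keeps this argument legal before the restart, where the other branch is taken.\<close>

lemma measurable_restart:
  fixes y :: "'a \<Rightarrow> 'e::metric_space"
  assumes s[measurable]: "s \<in> borel_measurable N" and y[measurable]: "y \<in> N \<rightarrow>\<^sub>M borel" and p: "p \<in> N \<rightarrow>\<^sub>M path_space"
  shows "(\<lambda>x. restart (s x) (y x) (p x)) \<in> N \<rightarrow>\<^sub>M path_space"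
proof (rule measurable_path_spaceI)
  show "restart (s x) (y x) (p x) \<in> space path_space" if "x \<in> space N" for x
    using restart_in_space measurable_space[OF p that] by blast
  fix t :: real assume t: "0 \<le> t"
  have "(\<lambda>x. p x (max 0 (t - enn2real (s x)))) \<in> N \<rightarrow>\<^sub>M borel"
    by (rule measurable_path_eval[OF p]) auto
  then have "(\<lambda>x. if ennreal t < s x then y x else p x (max 0 (t - enn2real (s x)))) \<in> N \<rightarrow>\<^sub>M borel"
    by measurable
  also have "(\<lambda>x. if ennreal t < s x then y x else p x (max 0 (t - enn2real (s x)))) = (\<lambda>x. restart (s x) (y x) (p x) t)"
  proof
    fix x show "(if ennreal t < s x then y x else p x (max 0 (t - enn2real (s x)))) = restart (s x) (y x) (p x) t"
      using t by (cases "s x") (auto simp: restart_def ennreal_less_iff max_def)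
  qed
  finally show "(\<lambda>x. restart (s x) (y x) (p x) t) \<in> N \<rightarrow>\<^sub>M borel" .
qed

subsection \<open>Filtrations generated by the coordinates\<close>

lemma space_raw_filt [simp]: "space (raw_filt t) = space path_space"
  by (simp add: raw_filt_def space_measure_of_conv)

lemma space_filt [simp]: "space (filt t) = space path_space"
  by (simp add: filt_def)

lemma sets_raw_filt:
  "sets (raw_filt t) = sigma_sets (space path_space)
     {{p \<in> space path_space. p s \<in> B} | s B. 0 \<le> s \<and> ennreal s \<le> t \<and> B \<in> sets borel}"
  unfolding raw_filt_def by (rule sets_measure_of) auto

lemma measurable_raw_filt_coord:
  "0 \<le> s \<Longrightarrow> ennreal s \<le> t \<Longrightarrow> (\<lambda>p. p s) \<in> raw_filt t \<rightarrow>\<^sub>M borel"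
  by (rule measurableI) (auto simp: sets_raw_filt vimage_def Int_def intro!: sigma_sets.Basic)

lemma measurable_raw_filtI:
  fixes h :: "'a \<Rightarrow> real \<Rightarrow> 'c::metric_space"
  assumes "\<And>x. x \<in> space N \<Longrightarrow> h x \<in> space path_space"
    "\<And>s. 0 \<le> s \<Longrightarrow> ennreal s \<le> t \<Longrightarrow> (\<lambda>x. h x s) \<in> N \<rightarrow>\<^sub>M borel"
  shows "h \<in> N \<rightarrow>\<^sub>M raw_filt t"
  unfolding raw_filt_def
proof (rule measurable_measure_of)
  show "h \<in> space N \<rightarrow> space path_space" using assms by auto
  fix A :: "(real \<Rightarrow> 'c) set" assume "A \<in> {{p \<in> space path_space. p s \<in> B} | s B. 0 \<le> s \<and> ennreal s \<le> t \<and> B \<in> sets borel}"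
  then obtain s B where *: "A = {p \<in> space path_space. p s \<in> B}" "0 \<le> s" "ennreal s \<le> t" "B \<in> sets borel" by auto
  have "h -` A \<inter> space N = (\<lambda>x. h x s) -` B \<inter> space N" using assms(1) * by auto
  then show "h -` A \<inter> space N \<in> sets N" using assms(2)[OF *(2,3)] *(4) by auto
qed auto

lemma sets_raw_filt_subset: "sets (raw_filt t) \<subseteq> sets path_space"
proof -
  have "(\<lambda>x. x) \<in> path_space \<rightarrow>\<^sub>M raw_filt t"
    by (rule measurable_raw_filtI) (auto simp: measurable_path_coord)
  from measurable_sets[OF this] show ?thesis
    using sets.sets_into_space[of _ "raw_filt t"] by (fastforce simp: Int_absorb2)
qed

lemma sets_filt_subset: "sets (filt t) \<subseteq> sets (universal_completion path_space)"
  unfolding filt_def by (rule sets_universal_completion_mono) (auto simp: sets_raw_filt_subset)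

lemma space_multi_path_space: "space multi_path_space = {\<omega>. \<forall>i. \<omega> i \<in> space path_space}"
  by (auto simp: multi_path_space_def space_PiM PiE_def)

lemma measurable_multi_coord: "(\<lambda>\<omega>. \<omega> i) \<in> multi_path_space \<rightarrow>\<^sub>M path_space"
  unfolding multi_path_space_def by (rule measurable_component_singleton) auto

lemma space_raw_multi_filt [simp]: "space (raw_multi_filt n t) = space multi_path_space"
  by (simp add: raw_multi_filt_def space_measure_of_conv)

lemma space_multi_filt [simp]: "space (multi_filt n t) = space multi_path_space"
  by (simp add: multi_filt_def)

lemma sets_raw_multi_filt:
  "sets (raw_multi_filt n t) = sigma_sets (space multi_path_space)
     {{\<omega> \<in> space multi_path_space. \<omega> i s \<in> B} | i s B.
        i \<le> n \<and> 0 \<le> s \<and> ennreal s \<le> t \<and> B \<in> sets borel}"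
  unfolding raw_multi_filt_def by (rule sets_measure_of) auto

lemma measurable_raw_multi_coord:
  "i \<le> n \<Longrightarrow> 0 \<le> s \<Longrightarrow> ennreal s \<le> t \<Longrightarrow> (\<lambda>\<omega>. \<omega> i s) \<in> raw_multi_filt n t \<rightarrow>\<^sub>M borel"
  by (rule measurableI) (auto simp: sets_raw_multi_filt vimage_def Int_def intro!: sigma_sets.Basic)

lemma measurable_raw_multi_path:
  "i \<le> n \<Longrightarrow> (\<lambda>\<omega>. \<omega> i) \<in> raw_multi_filt n \<top> \<rightarrow>\<^sub>M path_space"
  by (rule measurable_path_spaceI) (auto simp: space_multi_path_space intro!: measurable_raw_multi_coord)

lemma measurable_raw_multiI:
  fixes h :: "'a \<Rightarrow> nat \<Rightarrow> real \<Rightarrow> 'c::metric_space"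
  assumes "\<And>x. x \<in> space N \<Longrightarrow> h x \<in> space multi_path_space"
    "\<And>i s. i \<le> n \<Longrightarrow> 0 \<le> s \<Longrightarrow> ennreal s \<le> t \<Longrightarrow> (\<lambda>x. h x i s) \<in> N \<rightarrow>\<^sub>M borel"
  shows "h \<in> N \<rightarrow>\<^sub>M raw_multi_filt n t"
  unfolding raw_multi_filt_def
proof (rule measurable_measure_of)
  show "h \<in> space N \<rightarrow> space multi_path_space" using assms by auto
  fix A :: "(nat \<Rightarrow> real \<Rightarrow> 'c) set" assume "A \<in> {{\<omega> \<in> space multi_path_space. \<omega> i s \<in> B} | i s B.
        i \<le> n \<and> 0 \<le> s \<and> ennreal s \<le> t \<and> B \<in> sets borel}"
  then obtain i s B where *: "A = {p \<in> space multi_path_space. p i s \<in> B}" "i \<le> n" "0 \<le> s" "ennreal s \<le> t" "B \<in> sets borel" by auto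
  have "h -` A \<inter> space N = (\<lambda>x. h x i s) -` B \<inter> space N" using assms(1) * by auto
  then show "h -` A \<inter> space N \<in> sets N" using assms(2)[OF *(2,3,4)] *(5) by auto
qed auto

lemma sets_raw_multi_mono:
  "n \<le> m \<Longrightarrow> t \<le> u \<Longrightarrow> sets (raw_multi_filt n t) \<subseteq> sets (raw_multi_filt m u)"
proof -
  assume "n \<le> m" "t \<le> u"
  then have "(\<lambda>x. x) \<in> raw_multi_filt m u \<rightarrow>\<^sub>M raw_multi_filt n t"
    by (intro measurable_raw_multiI) (auto intro!: measurable_raw_multi_coord)
  from measurable_sets[OF this] show ?thesis
    using sets.sets_into_space[of _ "raw_multi_filt n t"] by (fastforce simp: Int_absorb2)
qed

lemma sets_raw_multi_subset: "sets (raw_multi_filt n t) \<subseteq> sets multi_path_space"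
proof -
  have "(\<lambda>x. x) \<in> multi_path_space \<rightarrow>\<^sub>M raw_multi_filt n t"
    by (intro measurable_raw_multiI measurable_compose[OF measurable_multi_coord measurable_path_coord]) auto
  from measurable_sets[OF this] show ?thesis
    using sets.sets_into_space[of _ "raw_multi_filt n t"] by (fastforce simp: Int_absorb2)
qed

lemma sets_multi_filt_mono:
  "n \<le> m \<Longrightarrow> t \<le> u \<Longrightarrow> sets (multi_filt n t) \<subseteq> sets (multi_filt m u)"
  unfolding multi_filt_def by (rule sets_universal_completion_mono) (auto simp: sets_raw_multi_mono)

text \<open>A point mass shows that a universally measurable set does not separate points that the
  generators do not separate.\<close>

lemma universal_completion_saturated:
  assumes A: "A \<in> sets (universal_completion M)" and gen: "sets M = sigma_sets (space M) G" "G \<subseteq> Pow (space M)"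
    and ab: "a \<in> space M" "b \<in> space M" "\<And>B. B \<in> G \<Longrightarrow> a \<in> B \<longleftrightarrow> b \<in> B"
    and "a \<in> A"
  shows "b \<in> A"
proof -
  have sat: "a \<in> B \<longleftrightarrow> b \<in> B" if "B \<in> sets M" for B
  proof -
    from that have "B \<in> sigma_sets (space M) G" using gen by simp
    then show ?thesis by induction (use ab in auto)
  qed
  have "prob_space (return M a)" using ab by (rule_tac prob_space_return)
  then have "A \<in> sets (completion (return M a))" using A by (auto simp: sets_universal_completion)
  then obtain S N0 N' where *: "A = S \<union> N0" "N0 \<subseteq> N'" "N' \<in> null_sets (return M a)" "S \<in> sets (return M a)"
    unfolding sets_completion by blast
  have "a \<notin> N'" using *(3) by (auto simp: null_sets_def indicator_def split: if_splits)
  then have "a \<in> S" using * \<open>a \<in> A\<close> by auto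
  then show ?thesis using sat *(1,4) by auto
qed

text \<open>Replaces a factorisation through the first \<open>n + 1\<close> coordinates. It holds
  pointwise and not just almost surely, so the later coordinates may be altered freely when a
  strategy is evaluated.\<close>

lemma multi_filt_depends:
  assumes f: "f \<in> multi_filt n \<top> \<rightarrow>\<^sub>M N" and sing: "{f \<omega>} \<in> sets N"
    and w: "\<omega> \<in> space multi_path_space" "\<omega>' \<in> space multi_path_space" "\<And>i. i \<le> n \<Longrightarrow> \<omega> i = \<omega>' i"
  shows "f \<omega>' = f \<omega>"
proof -
  have "f -` {f \<omega>} \<inter> space multi_path_space \<in> sets (universal_completion (raw_multi_filt n \<top>))"
    using measurable_sets[OF f sing] by (simp add: multi_filt_def)
  from universal_completion_saturated[OF this sets_raw_multi_filt[of n \<top>, folded space_raw_multi_filt[of n \<top>]], of \<omega> \<omega>']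
  show ?thesis using w by fastforce
qed

subsection \<open>Markov families\<close>

lemma markov_family_prob: "markov_family P \<Longrightarrow> prob_space (P x)"
  and markov_family_sets: "markov_family P \<Longrightarrow> sets (P x) = sets path_space"
  unfolding markov_family_def by (auto dest!: measurable_space[of P _ _ x] simp: space_prob_algebra)

lemma markov_family_space: "markov_family P \<Longrightarrow> space (P x) = space path_space"
  using markov_family_sets sets_eq_imp_space_eq by blast

lemma markov_family_measurable: "markov_family P \<Longrightarrow> P \<in> borel \<rightarrow>\<^sub>M prob_algebra path_space"
  unfolding markov_family_def by auto

lemma markov_family_cong:
  assumes "markov_family P" shows "measurable (P x) N = measurable path_space N"
  using markov_family_sets[OF assms] by (rule measurable_cong_sets) simp

text \<open>Rectangles form an intersection-stable generator, so conditional probabilities on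
  rectangles identify the whole joint law as a mixture. It serves twice: for the past and the
  shifted path of a Markov family, and for the history and the next coordinate of a controlled
  process.\<close>

lemma distr_pair_eq_bind:
  assumes M: "prob_space M" and g1: "g1 \<in> M \<rightarrow>\<^sub>M A" and g2: "g2 \<in> M \<rightarrow>\<^sub>M B"
    and k: "k \<in> A \<rightarrow>\<^sub>M prob_algebra B"
    and eq: "\<And>a b. a \<in> sets A \<Longrightarrow> b \<in> sets B \<Longrightarrow>
      emeasure M {\<omega> \<in> space M. g1 \<omega> \<in> a \<and> g2 \<omega> \<in> b} = (\<integral>\<^sup>+h\<in>a. emeasure (k h) b \<partial>distr M A g1)"
  shows "distr M (A \<Otimes>\<^sub>M B) (\<lambda>\<omega>. (g1 \<omega>, g2 \<omega>))
       = distr M A g1 \<bind> (\<lambda>h. distr (k h) (A \<Otimes>\<^sub>M B) (Pair h))"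
proof -
  interpret M: prob_space M by fact
  let ?N = "A \<Otimes>\<^sub>M B" and ?L = "distr M A g1"
  let ?k = "\<lambda>h. distr (k h) ?N (Pair h)"
  have g: "(\<lambda>\<omega>. (g1 \<omega>, g2 \<omega>)) \<in> M \<rightarrow>\<^sub>M ?N" using g1 g2 by (rule measurable_Pair)
  have k': "?k \<in> A \<rightarrow>\<^sub>M prob_algebra ?N" by (rule measurable_distr_prob_space2[OF k]) simp
  have kL: "?k \<in> ?L \<rightarrow>\<^sub>M subprob_algebra ?N" using measurable_prob_algebraD[OF k'] by simp
  have ne: "space ?L \<noteq> {}" using prob_space.not_empty[OF M.prob_space_distr[OF g1]] .
  have sk: "sets (k h) = sets B" if "h \<in> space A" for h
    using sets_kernel[OF measurable_prob_algebraD[OF k] that] .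
  have Pk: "Pair h \<in> k h \<rightarrow>\<^sub>M ?N" if "h \<in> space A" for h
    using that unfolding measurable_cong_sets[OF sk[OF that] refl] by simp
  show ?thesis
  proof (rule measure_eqI_generator_eq[where E="{a \<times> b |a b. a \<in> sets A \<and> b \<in> sets B}"
        and \<Omega>="space A \<times> space B" and A="\<lambda>_. space A \<times> space B"])
    fix X assume "X \<in> {a \<times> b |a b. a \<in> sets A \<and> b \<in> sets B}"
    then obtain a b where X: "X = a \<times> b" and a: "a \<in> sets A" and b: "b \<in> sets B" by auto
    have XN: "X \<in> sets ?N" using a b X by auto
    have "emeasure (distr M ?N (\<lambda>\<omega>. (g1 \<omega>, g2 \<omega>))) X = emeasure M {\<omega> \<in> space M. g1 \<omega> \<in> a \<and> g2 \<omega> \<in> b}"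
      by (subst emeasure_distr[OF g XN]) (auto simp: X intro!: arg_cong[where f="emeasure M"])
    also have "\<dots> = (\<integral>\<^sup>+h\<in>a. emeasure (k h) b \<partial>?L)" by (rule eq[OF a b])
    also have "\<dots> = (\<integral>\<^sup>+h. emeasure (?k h) X \<partial>?L)"
    proof (rule nn_integral_cong)
      fix h assume "h \<in> space ?L"
      then have h: "h \<in> space A" by simp
      have "Pair h -` X \<inter> space (k h) = (if h \<in> a then b else {})"
        using sets.sets_into_space[OF b] sets_eq_imp_space_eq[OF sk[OF h]] by (auto simp: X)
      then show "emeasure (k h) b * indicator a h = emeasure (?k h) X"
        by (subst emeasure_distr[OF Pk[OF h] XN]) auto
    qed
    also have "\<dots> = emeasure (?L \<bind> ?k) X"
      by (rule emeasure_bind[symmetric, OF ne kL XN])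
    finally show "emeasure (distr M ?N (\<lambda>\<omega>. (g1 \<omega>, g2 \<omega>))) X = emeasure (?L \<bind> ?k) X" .
  next
    show "emeasure (distr M ?N (\<lambda>\<omega>. (g1 \<omega>, g2 \<omega>))) (space A \<times> space B) \<noteq> \<infinity>"
      using prob_space.emeasure_space_1[OF M.prob_space_distr[OF g]] by (simp add: space_pair_measure)
  next
    show "sets (?L \<bind> ?k) = sigma_sets (space A \<times> space B) {a \<times> b |a b. a \<in> sets A \<and> b \<in> sets B}"
      using sets_bind_measurable[OF kL ne] by (simp add: sets_pair_measure)
    show "range (\<lambda>_. space A \<times> space B) \<subseteq> {a \<times> b |a b. a \<in> sets A \<and> b \<in> sets B}" by auto
  qed (auto simp: sets_pair_measure Int_stable_pair_measure_generator pair_measure_closed)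
qed

text \<open>The definition of a Markov family concerns raw events and measurable sets of paths. It
  determines the joint law of the past and the shifted path; since
  \<open>indicator A (fst z) * F (snd z)\<close> is universally measurable on the product,
  integrating it extends the property to completed events and to universally measurable
  \<open>F\<close> at once.\<close>

lemma markov_property:
  fixes F :: "(real \<Rightarrow> 'e::metric_space) \<Rightarrow> ennreal"
  assumes P: "markov_family P" and s: "0 \<le> s" and A: "A \<in> sets (filt (ennreal s))"
    and F: "F \<in> borel_measurable (universal_completion path_space)"
  shows "(\<integral>\<^sup>+p. indicator A p * F (shift s p) \<partial>P x)
       = (\<integral>\<^sup>+p. indicator A p * (\<integral>\<^sup>+q. F q \<partial>P (p s)) \<partial>P x)"
proof -
  interpret Px: prob_space "P x" by (rule markov_family_prob[OF P])
  let ?R = "raw_filt (ennreal s) :: (real \<Rightarrow> 'e) measure"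
  let ?S = "path_space :: (real \<Rightarrow> 'e) measure"
  let ?N = "?R \<Otimes>\<^sub>M ?S" and ?L = "distr (P x) ?R (\<lambda>p. p)"
  let ?k = "\<lambda>p. distr (P (p s)) ?N (Pair p)"
  note spP = markov_family_space[OF P] and prP = markov_family_prob[OF P]
  have idR: "(\<lambda>p. p) \<in> P x \<rightarrow>\<^sub>M ?R"
    unfolding markov_family_cong[OF P] by (rule measurable_raw_filtI) (auto simp: measurable_path_coord)
  have sh: "shift s \<in> P x \<rightarrow>\<^sub>M ?S"
    unfolding markov_family_cong[OF P] by (rule measurable_shift[OF s])
  have g: "(\<lambda>p. (p, shift s p)) \<in> P x \<rightarrow>\<^sub>M ?N"
    using idR sh by (rule measurable_Pair)
  have Pk: "(\<lambda>p. P (p s)) \<in> ?R \<rightarrow>\<^sub>M prob_algebra ?S"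
    by (rule measurable_compose[OF measurable_raw_filt_coord[OF s order_refl] markov_family_measurable[OF P]])
  have k: "?k \<in> ?R \<rightarrow>\<^sub>M prob_algebra ?N" by (rule measurable_distr_prob_space2[OF Pk]) simp
  have pqp: "Pair p \<in> P y \<rightarrow>\<^sub>M ?N" if "p \<in> space path_space" for p y
    unfolding markov_family_cong[OF P] using that by simp
  have eq: "distr (P x) ?N (\<lambda>p. (p, shift s p)) = ?L \<bind> ?k"
  proof (rule distr_pair_eq_bind[OF Px.prob_space_axioms idR sh Pk])
    fix a b assume a: "a \<in> sets ?R" and b: "b \<in> sets ?S"
    have "a \<subseteq> space ?S" using sets.sets_into_space[OF a] by simp
    then have "emeasure (P x) {p \<in> space (P x). p \<in> a \<and> shift s p \<in> b}
      = emeasure (P x) (a \<inter> {p \<in> space path_space. shift s p \<in> b})"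
      by (auto simp: spP intro!: arg_cong[where f="emeasure (P x)"])
    also have "\<dots> = (\<integral>\<^sup>+p\<in>a. emeasure (P (p s)) b \<partial>P x)"
      using P s a b unfolding markov_family_def by blast
    also have "\<dots> = (\<integral>\<^sup>+p\<in>a. emeasure (P (p s)) b \<partial>?L)"
      using a measurable_emeasure_kernel[OF measurable_prob_algebraD[OF Pk] b]
      by (subst nn_integral_distr[OF idR]) auto
    finally show "emeasure (P x) {p \<in> space (P x). p \<in> a \<and> shift s p \<in> b}
      = (\<integral>\<^sup>+p\<in>a. emeasure (P (p s)) b \<partial>?L)" .
  qed
  let ?G = "\<lambda>z. indicator A (fst z) * F (snd z)"
  have "(\<lambda>z. indicator A (fst z) :: ennreal) \<in> borel_measurable (universal_completion ?N)"
    using A unfolding filt_def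
    by (intro measurable_compose[OF measurable_universal_completion2[OF measurable_fst]] borel_measurable_indicator)
  moreover have "(\<lambda>z. F (snd z)) \<in> borel_measurable (universal_completion ?N)"
    by (rule measurable_compose[OF measurable_universal_completion2[OF measurable_snd] F])
  ultimately have G: "?G \<in> borel_measurable (universal_completion ?N)"
    by (rule borel_measurable_times_ennreal)
  have "(\<integral>\<^sup>+p. indicator A p * F (shift s p) \<partial>P x) = (\<integral>\<^sup>+z. ?G z \<partial>distr (P x) ?N (\<lambda>p. (p, shift s p)))"
    by (subst nn_integral_distr_uc[OF G Px.prob_space_axioms g]) simp
  also have "distr (P x) ?N (\<lambda>p. (p, shift s p)) = P x \<bind> ?k"
    unfolding eq by (rule bind_distr[OF idR measurable_prob_algebraD[OF k] Px.not_empty])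
  also have "(\<integral>\<^sup>+z. ?G z \<partial>(P x \<bind> ?k)) = (\<integral>\<^sup>+p. (\<integral>\<^sup>+z. ?G z \<partial>?k p) \<partial>P x)"
    by (rule nn_integral_bind_uc[OF G Px.prob_space_axioms measurable_compose[OF idR k]])
  also have "\<dots> = (\<integral>\<^sup>+p. indicator A p * (\<integral>\<^sup>+q. F q \<partial>P (p s)) \<partial>P x)"
  proof (rule nn_integral_cong)
    fix p assume "p \<in> space (P x)"
    then have p: "p \<in> space path_space" by (simp add: spP)
    show "(\<integral>\<^sup>+z. ?G z \<partial>?k p) = indicator A p * (\<integral>\<^sup>+q. F q \<partial>P (p s))"
      by (subst nn_integral_distr_uc[OF G prP pqp[OF p]]) (cases "p \<in> A", auto)
  qed
  finally show ?thesis .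
qed

subsection \<open>The law of the controlled process\<close>

text \<open>The state space is not assumed to have a countable base, but maps into a compact set are
  still limits of countably valued ones. \<open>fs k\<close> lists a finite net of mesh 1 / (k + 1),
  padded by \<open>z\<close>, and \<open>idx k\<close> selects measurably the first net point that
  is close enough.\<close>

lemma compact_nets:
  fixes K :: "'e::metric_space set"
  assumes K: "compact K" and z: "z \<in> K"
  obtains fs :: "nat \<Rightarrow> nat \<Rightarrow> 'e" and idx :: "nat \<Rightarrow> 'e \<Rightarrow> nat"
  where "\<And>k i. fs k i \<in> K" "\<And>k. idx k \<in> borel \<rightarrow>\<^sub>M count_space UNIV"
    "\<And>k y. y \<in> K \<Longrightarrow> dist (fs k (idx k y)) y < 1 / real (Suc k)"
proof -
  have "\<forall>k. \<exists>F. finite F \<and> F \<subseteq> K \<and> K \<subseteq> (\<Union>x\<in>F. ball x (1 / real (Suc k)))"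
    using seq_compact_imp_totally_bounded[OF compact_imp_seq_compact[OF K]] by simp
  then obtain F where F: "\<And>k. finite (F k)" "\<And>k. F k \<subseteq> K" "\<And>k. K \<subseteq> (\<Union>x\<in>F k. ball x (1 / real (Suc k)))" by metis
  have "\<forall>k. \<exists>xs. set xs = F k" using F(1) finite_list by blast
  then obtain xs where xs: "\<And>k. set (xs k) = F k" by metis
  define fs where "fs k i = (if i < length (xs k) then xs k ! i else z)" for k i
  define idx where "idx k y = (LEAST i. dist (fs k i) y < 1 / real (Suc k))" for k y
  show thesis
  proof (rule that)
    show "fs k i \<in> K" for k i using F(2)[of k] xs[of k] nth_mem[of i "xs k"] z by (auto simp: fs_def)
    show "idx k \<in> borel \<rightarrow>\<^sub>M count_space UNIV" for k
    proof -
      have "(\<lambda>y. dist (fs k i) y) \<in> borel_measurable borel" for i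
        by (intro borel_measurable_continuous_onI continuous_intros)
      then show ?thesis unfolding idx_def by (intro measurable_Least) measurable
    qed
    fix k y assume y: "y \<in> K"
    obtain u where u: "u \<in> F k" "dist u y < 1 / real (Suc k)"
      using F(3)[of k] y by fastforce
    then obtain i where "i < length (xs k)" "xs k ! i = u"
      using xs[of k] by (metis in_set_conv_nth)
    with u(2) have "dist (fs k i) y < 1 / real (Suc k)" by (simp add: fs_def)
    then show "dist (fs k (idx k y)) y < 1 / real (Suc k)" unfolding idx_def by (rule LeastI)
  qed
qed

text \<open>The net indices of \<open>y\<close> are real functions, each with a measurable version
  under \<open>L\<close>. Off a common null set \<open>N\<close> the selected net points converge to
  \<open>y\<close>, so \<open>y\<close> changed to \<open>z\<close> on \<open>N\<close> is a limit
  of measurable maps.\<close>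

lemma completion_version_into_compact:
  fixes y :: "'a \<Rightarrow> 'e::metric_space"
  assumes L: "prob_space L" and y: "y \<in> completion L \<rightarrow>\<^sub>M borel" and K: "compact K" and yK: "\<And>h. h \<in> space L \<Longrightarrow> y h \<in> K"
    and z: "z \<in> K"
  obtains y' where "y' \<in> L \<rightarrow>\<^sub>M borel" "AE h in L. y h = y' h" "\<And>h. h \<in> space L \<Longrightarrow> y' h \<in> K"
proof -
  interpret L: prob_space L by fact
  obtain fs idx where net: "\<And>k i. fs k i \<in> K" "\<And>k. idx k \<in> (borel :: 'e measure) \<rightarrow>\<^sub>M (count_space UNIV :: nat measure)"
    "\<And>k y. y \<in> K \<Longrightarrow> dist (fs k (idx k y)) y < 1 / real (Suc k)"
    by (rule compact_nets[OF K z]) blast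
  have idxm: "(\<lambda>h. real (idx k (y h))) \<in> borel_measurable (completion L)" for k
    by (rule measurable_compose[OF measurable_compose[OF y net(2)]]) simp
  have "\<forall>k. \<exists>g\<in>borel_measurable L. AE h in L. real (idx k (y h)) = g h"
    using completion_ex_borel_measurable_real[OF idxm] by blast
  then obtain g where g: "\<And>k. g k \<in> borel_measurable L" "\<And>k. AE h in L. real (idx k (y h)) = g k h" by metis
  have "AE h in L. \<forall>k. real (idx k (y h)) = g k h" using g(2) by (simp add: AE_all_countable)
  then obtain N where N: "N \<in> sets L" "emeasure L N = 0" "\<And>h. h \<in> space L - N \<Longrightarrow> \<forall>k. real (idx k (y h)) = g k h"
    by (auto elim!: AE_E)
  define y' where "y' h = (if h \<in> N then z else y h)" for h
  show ?thesis
  proof (rule that[of y'])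
    show "AE h in L. y h = y' h"
      using N by (intro AE_I[of _ _ N]) (auto simp: y'_def)
    show "y' h \<in> K" if "h \<in> space L" for h using yK[OF that] z by (simp add: y'_def)
    show "y' \<in> L \<rightarrow>\<^sub>M borel"
    proof (rule borel_measurable_LIMSEQ_metric)
      fix k
      have "(\<lambda>h. nat \<lfloor>g k h\<rfloor>) \<in> L \<rightarrow>\<^sub>M count_space UNIV" using g(1) by measurable
      then have [measurable]: "(\<lambda>h. fs k (nat \<lfloor>g k h\<rfloor>)) \<in> L \<rightarrow>\<^sub>M borel" by (rule measurable_compose) simp
      show "(\<lambda>h. if h \<in> N then z else fs k (nat \<lfloor>g k h\<rfloor>)) \<in> L \<rightarrow>\<^sub>M borel" using N(1) by measurable
    next
      fix h assume h: "h \<in> space L"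
      show "(\<lambda>k. if h \<in> N then z else fs k (nat \<lfloor>g k h\<rfloor>)) \<longlonglongrightarrow> y' h"
      proof (cases "h \<in> N")
        case False
        have "(\<lambda>k. dist (fs k (idx k (y h))) (y h)) \<longlonglongrightarrow> 0"
          using net(3)[OF yK[OF h]] LIMSEQ_inverse_real_of_nat
          by (intro tendsto_sandwich[OF _ _ tendsto_const LIMSEQ_inverse_real_of_nat])
             (auto intro!: always_eventually less_imp_le simp: inverse_eq_divide)
        then have "(\<lambda>k. fs k (idx k (y h))) \<longlonglongrightarrow> y h" by (rule iffD2[OF tendsto_dist_iff])
        moreover have "nat \<lfloor>g k h\<rfloor> = idx k (y h)" for k
          using N(3)[of h] False h by (metis DiffI floor_of_nat nat_int)
        ultimately show ?thesis using False by (simp add: y'_def)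
      qed (simp add: y'_def)
    qed
  qed
qed

section \<open>Stages, finite histories and their kernels\<close>

text \<open>Stage \<open>n\<close> is the period between the impulses \<open>n - 1\<close> and
  \<open>n\<close>, during which coordinate \<open>n\<close> is followed; stage 0 begins at time 0
  in \<open>x\<close>.\<close>

definition start_time :: "'e strategy \<Rightarrow> nat \<Rightarrow> (nat \<Rightarrow> real \<Rightarrow> 'e) \<Rightarrow> ennreal" where
  "start_time V n \<omega> = (case n of 0 \<Rightarrow> 0 | Suc k \<Rightarrow> fst V k \<omega>)"

definition start_point :: "'e strategy \<Rightarrow> 'e \<Rightarrow> nat \<Rightarrow> (nat \<Rightarrow> real \<Rightarrow> 'e) \<Rightarrow> 'e" where
  "start_point V x n \<omega> = (case n of 0 \<Rightarrow> x | Suc k \<Rightarrow> snd V k \<omega>)"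

lemma start_simps [simp]: "start_time V 0 \<omega> = 0" "start_time V (Suc n) \<omega> = fst V n \<omega>"
  "start_point V x 0 \<omega> = x" "start_point V x (Suc n) \<omega> = snd V n \<omega>"
  by (auto simp: start_time_def start_point_def)

text \<open>The conditional law of coordinate \<open>n\<close> given the earlier ones. For
  \<open>n = 0\<close> it reduces to \<open>P x\<close>, so both clauses of
  \<open>is_controlled_law\<close> are covered by one formula.\<close>

definition stage_kernel where
  "stage_kernel P V x n \<omega> = distr (P (start_point V x n \<omega>)) path_space
     (restart (start_time V n \<omega>) (start_point V x n \<omega>))"

text \<open>Strategies read infinite sequences of paths. A finite history is completed by constant
  paths, which are genuine elements of \<open>path_space\<close>; by
  \<open>multi_filt_depends\<close> the choice has no influence on impulses that are decided by the
  history.\<close>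

definition ext_path :: "nat \<Rightarrow> (nat \<Rightarrow> real \<Rightarrow> 'e) \<Rightarrow> nat \<Rightarrow> real \<Rightarrow> 'e" where
  "ext_path n h = (\<lambda>i. if i < n then h i else (\<lambda>t\<in>{0..}. undefined))"

abbreviation hist_space :: "nat \<Rightarrow> (nat \<Rightarrow> real \<Rightarrow> 'e::metric_space) measure" where
  "hist_space n \<equiv> Pi\<^sub>M {0..<n} (\<lambda>_. path_space)"

lemma ext_path_in_space: "h \<in> space (hist_space n) \<Longrightarrow> ext_path n h \<in> space multi_path_space"
  by (auto simp: space_multi_path_space ext_path_def space_PiM PiE_def const_path_in_space)

lemma restrict_in_hist: "\<omega> \<in> space multi_path_space \<Longrightarrow> restrict \<omega> {0..<n} \<in> space (hist_space n)"
  by (auto simp: space_multi_path_space space_PiM)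

lemma measurable_ext_path: "ext_path n \<in> hist_space n \<rightarrow>\<^sub>M raw_multi_filt m t"
proof (rule measurable_raw_multiI)
  fix i and s :: real assume s: "0 \<le> s"
  show "(\<lambda>h. ext_path n h i s) \<in> hist_space n \<rightarrow>\<^sub>M borel"
  proof (cases "i < n")
    case True
    then show ?thesis
      using measurable_compose[OF measurable_component_singleton[of i "{0..<n}" "\<lambda>_. path_space"] measurable_path_coord[OF s]]
      by (simp add: ext_path_def)
  qed (simp add: ext_path_def)
qed (rule ext_path_in_space)

lemma measurable_restrict_hist: "(\<lambda>\<omega>. restrict \<omega> {0..<n}) \<in> multi_path_space \<rightarrow>\<^sub>M hist_space n"
  by (intro measurable_restrict measurable_multi_coord)

lemma measurable_restrict_raw: "(\<lambda>\<omega>. restrict \<omega> {0..<Suc n}) \<in> raw_multi_filt n \<top> \<rightarrow>\<^sub>M hist_space (Suc n)"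
  by (intro measurable_restrict measurable_raw_multi_path) auto

lemma impulse_time_measurable:
  assumes "impulse_strategy U V"
  shows "fst V n \<in> borel_measurable (multi_filt n \<top>)"
proof (rule measurable_stopping_time)
  show "stopping_time (multi_filt n) (fst V n)" using assms by (simp add: impulse_strategy_def)
qed (simp_all add: sets_multi_filt_mono)

lemma impulse_point_measurable:
  fixes V :: "'e::metric_space strategy"
  assumes V: "impulse_strategy U V"
  shows "snd V n \<in> multi_filt n \<top> \<rightarrow>\<^sub>M restrict_space borel U"
proof (rule measurableI)
  interpret filtration "space multi_path_space" "multi_filt n" by (rule filtration_multi_filt)
  have st: "stopping_time (multi_filt n) (fst V n)" and m: "snd V n \<in> pre_sigma (fst V n) \<rightarrow>\<^sub>M restrict_space borel U"
    using V by (auto simp: impulse_strategy_def)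
  show "snd V n \<omega> \<in> space (restrict_space borel U)" if "\<omega> \<in> space (multi_filt n \<top>)" for \<omega>
    using measurable_space[OF m, of \<omega>] that by (simp add: space_pre_sigma)
  fix A assume "A \<in> sets (restrict_space borel U)"
  from sets_pre_sigmaD[OF st measurable_sets[OF m this], of \<top>]
  show "snd V n -` A \<inter> space (multi_filt n \<top>) \<in> sets (multi_filt n \<top>)"
    by (simp add: space_pre_sigma vimage_def Int_def)
qed

lemma impulse_point_in:
  assumes "impulse_strategy U V" "\<omega> \<in> space multi_path_space"
  shows "snd V n \<omega> \<in> U"
  using measurable_space[OF impulse_point_measurable[OF assms(1), of n], of \<omega>] assms(2) by (simp add: space_restrict_space)

lemma impulse_depends:
  assumes "impulse_strategy U V" "\<omega> \<in> space multi_path_space" "\<omega>' \<in> space multi_path_space" "\<And>i. i \<le> n \<Longrightarrow> \<omega> i = \<omega>' i"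
  shows "fst V n \<omega>' = fst V n \<omega>" "snd V n \<omega>' = snd V n \<omega>"
proof -
  show "fst V n \<omega>' = fst V n \<omega>"
    by (rule multi_filt_depends[OF impulse_time_measurable[OF assms(1)] _ assms(2-4)]) simp
  have "{snd V n \<omega>} \<in> sets (restrict_space borel U)"
    unfolding sets_restrict_space
    by (rule image_eqI[of _ _ "{snd V n \<omega>}"]) (simp_all add: impulse_point_in[OF assms(1,2)])
  then show "snd V n \<omega>' = snd V n \<omega>"
    by (rule multi_filt_depends[OF impulse_point_measurable[OF assms(1)] _ assms(2-4)])
qed

lemma start_depends:
  assumes "impulse_strategy U V" "\<omega> \<in> space multi_path_space" "\<omega>' \<in> space multi_path_space" "\<And>i. i < n \<Longrightarrow> \<omega> i = \<omega>' i"
  shows "start_time V n \<omega>' = start_time V n \<omega>" "start_point V x n \<omega>' = start_point V x n \<omega>"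
  by (cases n; simp add: impulse_depends[OF assms(1-3)] assms(4))+

lemma measurable_multi_filt_mono:
  "f \<in> multi_filt k t \<rightarrow>\<^sub>M N \<Longrightarrow> k \<le> n \<Longrightarrow> t \<le> u \<Longrightarrow> f \<in> multi_filt n u \<rightarrow>\<^sub>M N"
  unfolding multi_filt_def
  by (erule measurable_universal_completion_mono) (simp_all add: sets_raw_multi_mono)

lemma start_time_measurable:
  assumes "impulse_strategy U V" shows "start_time V n \<in> borel_measurable (multi_filt n \<top>)"
proof (cases n)
  case (Suc k)
  then show ?thesis
    using measurable_multi_filt_mono[OF impulse_time_measurable[OF assms, of k], of n \<top>]
    by (simp add: start_time_def[abs_def])
qed (simp add: start_time_def[abs_def])

lemma start_point_measurable:
  assumes "impulse_strategy U V" shows "start_point V x n \<in> multi_filt n \<top> \<rightarrow>\<^sub>M borel"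
proof (cases n)
  case (Suc k)
  have "snd V k \<in> multi_filt k \<top> \<rightarrow>\<^sub>M borel"
    using impulse_point_measurable[OF assms, of k] by (simp add: measurable_restrict_space2_iff)
  from measurable_multi_filt_mono[OF this, of n \<top>] show ?thesis
    using Suc by (simp add: start_point_def[abs_def])
qed (simp add: start_point_def[abs_def])

lemma start_point_in:
  assumes "impulse_strategy U V" "\<omega> \<in> space multi_path_space"
  shows "start_point V x n \<omega> \<in> insert x U"
  by (cases n) (simp_all add: impulse_point_in[OF assms])

text \<open>The coordinates 0, ..., n form a history of length \<open>Suc n\<close>, and an event of
  \<open>raw_multi_filt n \<top>\<close> can be recovered from its trace on such histories. This
  translates the clauses of \<open>is_controlled_law\<close> into statements on finite-dimensional
  laws.\<close>

lemma raw_multi_set_hist: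
  assumes A: "A \<in> sets (raw_multi_filt n \<top>)"
  defines "A' \<equiv> ext_path (Suc n) -` A \<inter> space (hist_space (Suc n))"
  shows "A' \<in> sets (hist_space (Suc n))" "\<omega> \<in> space multi_path_space \<Longrightarrow> restrict \<omega> {0..<Suc n} \<in> A' \<longleftrightarrow> \<omega> \<in> A"
proof -
  show "A' \<in> sets (hist_space (Suc n))"
    unfolding A'_def using measurable_ext_path A by (rule measurable_sets)
  assume \<omega>: "\<omega> \<in> space multi_path_space"
  have h: "restrict \<omega> {0..<Suc n} \<in> space (hist_space (Suc n))" by (rule restrict_in_hist[OF \<omega>])
  have f: "indicator A \<in> multi_filt n \<top> \<rightarrow>\<^sub>M (borel :: real measure)"
    unfolding multi_filt_def using A by (intro borel_measurable_indicator) (metis sets_le_universal_completion subsetD)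
  have "indicator A (ext_path (Suc n) (restrict \<omega> {0..<Suc n})) = (indicator A \<omega> :: real)"
    by (rule multi_filt_depends[OF f _ \<omega> ext_path_in_space[OF h]]) (auto simp: ext_path_def)
  then show "restrict \<omega> {0..<Suc n} \<in> A' \<longleftrightarrow> \<omega> \<in> A"
    using h by (auto simp: A'_def indicator_def split: if_splits)
qed

text \<open>
  Impulse times and targets are only universally measurable, so the kernel of a stage is replaced by
  a measurable version with respect to the law of the preceding coordinates.
\<close>

definition kernel_version where
  "kernel_version P V x n L = (SOME k. k \<in> hist_space n \<rightarrow>\<^sub>M prob_algebra path_space \<and>
      (AE h in L. k h = stage_kernel P V x n (ext_path n h)))"

primrec fdd :: "('e::metric_space \<Rightarrow> (real \<Rightarrow> 'e) measure) \<Rightarrow> 'e strategy \<Rightarrow> 'e \<Rightarrow> nat \<Rightarrow> (nat \<Rightarrow> real \<Rightarrow> 'e) measure" where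
  "fdd P V x 0 = return (hist_space 0) (\<lambda>_. undefined)"
| "fdd P V x (Suc n) = fdd P V x n \<bind> (\<lambda>h. distr (kernel_version P V x n (fdd P V x n) h) (hist_space (Suc n)) (fun_upd h n))"

locale impulse_control =
  fixes P :: "'e::metric_space \<Rightarrow> (real \<Rightarrow> 'e) measure" and U :: "'e set" and V :: "'e strategy" and x :: 'e
  assumes P: "markov_family P" and U: "compact U" and V: "impulse_strategy U V"
begin

abbreviation "Sp \<equiv> path_space :: (real \<Rightarrow> 'e) measure"
abbreviation "hs n \<equiv> hist_space n :: (nat \<Rightarrow> real \<Rightarrow> 'e) measure"

text \<open>The start time and the start point of the stage are universally measurable functions of
  the history. The start point stays in the compact set \<open>insert x U\<close>, which is what
  provides a measurable version of it.\<close>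

lemma kernel_version_ex:
  assumes L: "prob_space L" "sets L = sets (hs n)"
  shows "\<exists>k. k \<in> hs n \<rightarrow>\<^sub>M prob_algebra path_space \<and> (AE h in L. k h = stage_kernel P V x n (ext_path n h))"
proof -
  have sp: "space (hs n) = space L" using sets_eq_imp_space_eq[OF L(2)] by simp
  have sub: "sets (hs n) \<subseteq> sets L" using L(2) by simp
  have e: "ext_path n \<in> universal_completion (hs n) \<rightarrow>\<^sub>M multi_filt n \<top>"
    unfolding multi_filt_def by (rule measurable_universal_completion2[OF measurable_ext_path])
  have s: "(\<lambda>h. start_time V n (ext_path n h)) \<in> borel_measurable (completion L)"
    by (rule measurable_universal_completionD[OF measurable_compose[OF e start_time_measurable[OF V]] L(1) sp sub])
  have y: "(\<lambda>h. start_point V x n (ext_path n h)) \<in> completion L \<rightarrow>\<^sub>M borel"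
    by (rule measurable_universal_completionD[OF measurable_compose[OF e start_point_measurable[OF V]] L(1) sp sub])
  have K: "compact (insert x U)" using U by simp
  have yK: "start_point V x n (ext_path n h) \<in> insert x U" if "h \<in> space L" for h
    using start_point_in[OF V ext_path_in_space] that sp by simp
  obtain s' where s': "s' \<in> borel_measurable L" "AE h in L. start_time V n (ext_path n h) = s' h"
    using completion_ex_borel_measurable[OF s] by blast
  obtain y' where y': "y' \<in> L \<rightarrow>\<^sub>M borel" "AE h in L. start_point V x n (ext_path n h) = y' h"
    using completion_version_into_compact[OF L(1) y K yK] by blast
  let ?k = "\<lambda>h. distr (P (y' h)) path_space (restart (s' h) (y' h))"
  have "?k \<in> L \<rightarrow>\<^sub>M prob_algebra path_space"
  proof (rule measurable_distr_prob_space2[OF measurable_compose[OF y'(1) markov_family_measurable[OF P]]])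
    show "(\<lambda>(h, p). restart (s' h) (y' h) p) \<in> L \<Otimes>\<^sub>M path_space \<rightarrow>\<^sub>M path_space"
      unfolding split_def using s'(1) y'(1)
      by (intro measurable_restart measurable_snd measurable_compose[OF measurable_fst]) auto
  qed
  then have "?k \<in> hs n \<rightarrow>\<^sub>M prob_algebra path_space"
    using measurable_cong_sets[OF L(2) refl] by blast
  moreover have "AE h in L. ?k h = stage_kernel P V x n (ext_path n h)"
    using s'(2) y'(2) by eventually_elim (simp add: stage_kernel_def)
  ultimately show ?thesis by blast
qed

abbreviation "kv n \<equiv> kernel_version P V x n (fdd P V x n)"

text \<open>The kernel of stage \<open>n\<close> is chosen with respect to
  \<open>fdd P V x n\<close> and has its properties only once this is known to be a probability law
  on histories. Hence laws and kernels go through one induction.\<close>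

lemma fdd_kernel:
  shows fdd_prob: "prob_space (fdd P V x n)" and fdd_sets: "sets (fdd P V x n) = sets (hs n)"
    and kv_measurable: "kv n \<in> hs n \<rightarrow>\<^sub>M prob_algebra path_space"
    and kv_AE: "AE h in fdd P V x n. kv n h = stage_kernel P V x n (ext_path n h)"
proof -
  have kv: "kv n \<in> hs n \<rightarrow>\<^sub>M prob_algebra path_space \<and> (AE h in fdd P V x n. kv n h = stage_kernel P V x n (ext_path n h))"
    if "prob_space (fdd P V x n)" "sets (fdd P V x n) = sets (hs n)" for n
    unfolding kernel_version_def[of P V x n "fdd P V x n"] by (rule someI_ex[OF kernel_version_ex[OF that]])
  have *: "prob_space (fdd P V x n) \<and> sets (fdd P V x n) = sets (hs n)" for n
  proof (induction n)
    case 0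
    then show ?case by (auto simp: space_PiM intro!: prob_space_return)
  next
    case (Suc n)
    let ?K = "\<lambda>h. distr (kv n h) (hs (Suc n)) (fun_upd h n)"
    have k: "kv n \<in> hs n \<rightarrow>\<^sub>M prob_algebra path_space" using kv Suc by blast
    have K: "?K \<in> hs n \<rightarrow>\<^sub>M prob_algebra (hs (Suc n))"
      by (rule measurable_distr_prob_space2[OF k])
         (auto simp: measurable_split_conv intro!: measurable_fun_upd[where J="{0..<n}"])
    interpret L: prob_space "fdd P V x n" using Suc by blast
    have sL: "sets (fdd P V x n) = sets (hs n)" using Suc by blast
    have K': "?K \<in> fdd P V x n \<rightarrow>\<^sub>M prob_algebra (hs (Suc n))"
      using K measurable_cong_sets[OF sL refl] by blast
    have "AE h in fdd P V x n. prob_space (?K h)"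
      using measurable_space[OF K'] by (intro AE_I2) (auto simp: space_prob_algebra)
    from L.prob_space_bind[OF this measurable_prob_algebraD[OF K']]
    have "prob_space (fdd P V x (Suc n))" by simp
    moreover have "sets (fdd P V x (Suc n)) = sets (hs (Suc n))"
      using sets_bind_measurable[OF measurable_prob_algebraD[OF K'] L.not_empty] by simp
    ultimately show ?case by blast
  qed
  show "prob_space (fdd P V x n)" "sets (fdd P V x n) = sets (hs n)" using * by blast+
  then show "kv n \<in> hs n \<rightarrow>\<^sub>M prob_algebra path_space"
    "AE h in fdd P V x n. kv n h = stage_kernel P V x n (ext_path n h)" using kv by blast+
qed

text \<open>Ionescu-Tulcea for the kernels \<open>kv n\<close>, started from the empty history; its
  finite stages are the laws \<open>fdd\<close>.\<close>

lemma fdd_limit: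
  obtains Q where "prob_space Q" "sets Q = sets (multi_path_space :: (nat \<Rightarrow> real \<Rightarrow> 'e) measure)"
    "\<And>n. distr Q (hs n) (\<lambda>\<omega>. restrict \<omega> {0..<n}) = fdd P V x n"
proof -
  interpret IT: Ionescu_Tulcea "\<lambda>n. kv n" "\<lambda>_. path_space"
  proof (rule Ionescu_Tulcea.intro)
    show "kv n \<in> hs n \<rightarrow>\<^sub>M subprob_algebra path_space" for n
      by (rule measurable_prob_algebraD[OF kv_measurable])
    fix n h assume that: "h \<in> space (hs n)"
    show "prob_space (kv n h)"
      using measurable_space[OF kv_measurable that] by (simp add: space_prob_algebra)
  qed
  have C: "IT.C 0 n (\<lambda>_. undefined) = fdd P V x n" for n
    by (induction n) (simp_all add: IT.eP_def[abs_def])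
  let ?Q = "IT.PF.lim"
  have sQ: "sets ?Q = sets (multi_path_space :: (nat \<Rightarrow> real \<Rightarrow> 'e) measure)"
    by (simp add: multi_path_space_def)
  have m: "(\<lambda>\<omega>. restrict \<omega> {0..<n}) \<in> ?Q \<rightarrow>\<^sub>M hs n" for n
    using measurable_restrict_hist[of n] unfolding measurable_cong_sets[OF sQ refl] .
  show thesis
  proof (rule that[OF _ sQ])
    have e: "emeasure (distr ?Q (hs n) (\<lambda>\<omega>. restrict \<omega> {0..<n})) X = emeasure (fdd P V x n) X"
      if X: "X \<in> sets (hs n)" for n X
    proof -
      have "emeasure (distr ?Q (hs n) (\<lambda>\<omega>. restrict \<omega> {0..<n})) X = emeasure ?Q (IT.PF.emb UNIV {0..<n} X)"
        by (subst emeasure_distr[OF m X]) (simp add: prod_emb_def space_PiM)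
      also have "\<dots> = emeasure (fdd P V x n) X"
        using X sets.sets_into_space[OF X]
        by (subst IT.lim) (auto simp: IT.emeasure_CI[of _ n] C prod_emb_id space_PiM)
      finally show ?thesis .
    qed
    show d: "distr ?Q (hs n) (\<lambda>\<omega>. restrict \<omega> {0..<n}) = fdd P V x n" for n
      by (rule measure_eqI) (auto simp: fdd_sets e)
    show "prob_space ?Q"
      using prob_space_distrD[OF m[of 0]] d[of 0] fdd_prob[of 0] by simp
  qed
qed

lemma hist_pair_measurable:
  "(\<lambda>z. (fst z)(n := snd z)) \<in> hs n \<Otimes>\<^sub>M Sp \<rightarrow>\<^sub>M hs (Suc n)"
  by (rule measurable_fun_upd[where J="{0..<n}"]) auto

lemma fdd_Suc_pair:
  "fdd P V x (Suc n) = distr (fdd P V x n \<bind> (\<lambda>h. distr (kv n h) (hs n \<Otimes>\<^sub>M Sp) (Pair h))) (hs (Suc n)) (\<lambda>z. (fst z)(n := snd z))"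
proof -
  have k: "kv n \<in> fdd P V x n \<rightarrow>\<^sub>M prob_algebra Sp"
    using kv_measurable[of n] measurable_cong_sets[OF fdd_sets[of n] refl] by blast
  have kp: "(\<lambda>h. distr (kv n h) (hs n \<Otimes>\<^sub>M Sp) (Pair h)) \<in> fdd P V x n \<rightarrow>\<^sub>M prob_algebra (hs n \<Otimes>\<^sub>M Sp)"
    by (rule measurable_distr_prob_space2[OF k])
       (simp add: measurable_cong_sets[OF sets_pair_measure_cong[OF fdd_sets refl] refl])
  have "distr (fdd P V x n \<bind> (\<lambda>h. distr (kv n h) (hs n \<Otimes>\<^sub>M Sp) (Pair h))) (hs (Suc n)) (\<lambda>z. (fst z)(n := snd z))
     = fdd P V x n \<bind> (\<lambda>h. distr (distr (kv n h) (hs n \<Otimes>\<^sub>M Sp) (Pair h)) (hs (Suc n)) (\<lambda>z. (fst z)(n := snd z)))"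
    by (rule distr_bind[OF measurable_prob_algebraD[OF kp] prob_space.not_empty[OF fdd_prob] hist_pair_measurable])
  also have "\<dots> = fdd P V x (Suc n)"
    unfolding fdd.simps
  proof (rule bind_cong[OF refl])
    fix h assume "h \<in> space (fdd P V x n)"
    then have h: "h \<in> space (hs n)" using sets_eq_imp_space_eq[OF fdd_sets] by blast
    have sk: "sets (kv n h) = sets Sp" by (rule sets_kernel[OF measurable_prob_algebraD[OF kv_measurable] h])
    have Ph: "Pair h \<in> kv n h \<rightarrow>\<^sub>M hs n \<Otimes>\<^sub>M Sp"
      unfolding measurable_cong_sets[OF sk refl] using h by simp
    show "distr (distr (kv n h) (hs n \<Otimes>\<^sub>M Sp) (Pair h)) (hs (Suc n)) (\<lambda>z. (fst z)(n := snd z))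
      = distr (kv n h) (hs (Suc n)) (fun_upd h n)"
      by (subst distr_distr[OF hist_pair_measurable Ph]) (simp add: comp_def)
  qed
  finally show ?thesis by simp
qed

end

section \<open>Existence and uniqueness of the controlled law\<close>

text \<open>\<open>Q\<close> is any law on sequences of paths: uniqueness compares two of them,
  existence uses the projective limit, and afterwards \<open>Q\<close> is the controlled law
  itself.\<close>

locale impulse_law = impulse_control P U V x
  for P :: "'e::metric_space \<Rightarrow> (real \<Rightarrow> 'e) measure" and U V x +
  fixes Q :: "(nat \<Rightarrow> real \<Rightarrow> 'e) measure"
  assumes Q: "prob_space Q" and sQ: "sets Q = sets (multi_path_space :: (nat \<Rightarrow> real \<Rightarrow> 'e) measure)"
begin

sublocale Q: prob_space Q by (rule Q)

lemma spQ: "space Q = space multi_path_space"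
  by (rule sets_eq_imp_space_eq[OF sQ])

lemma measurable_Q: "measurable Q N = measurable multi_path_space N"
  by (rule measurable_cong_sets[OF sQ refl])

lemma restrict_Q: "(\<lambda>\<omega>. restrict \<omega> {0..<n}) \<in> Q \<rightarrow>\<^sub>M hs n"
  unfolding measurable_Q by (rule measurable_restrict_hist)

lemma coord_Q: "(\<lambda>\<omega>. \<omega> n) \<in> Q \<rightarrow>\<^sub>M Sp"
  unfolding measurable_Q by (rule measurable_multi_coord)

lemma multi_filt_measurable_completion:
  "f \<in> multi_filt n t \<rightarrow>\<^sub>M N \<Longrightarrow> f \<in> completion Q \<rightarrow>\<^sub>M N"
  unfolding multi_filt_def
  by (erule measurable_universal_completionD[OF _ Q]) (simp_all add: spQ sQ sets_raw_multi_subset)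

lemma stage_kernel_ext:
  assumes "\<omega> \<in> space multi_path_space"
  shows "stage_kernel P V x n (ext_path n (restrict \<omega> {0..<n})) = stage_kernel P V x n \<omega>"
proof -
  have *: "start_time V n (ext_path n (restrict \<omega> {0..<n})) = start_time V n \<omega>"
    "start_point V x n (ext_path n (restrict \<omega> {0..<n})) = start_point V x n \<omega>"
    by (rule start_depends[OF V assms ext_path_in_space[OF restrict_in_hist[OF assms]]]; simp add: ext_path_def)+
  show ?thesis unfolding stage_kernel_def * ..
qed

lemma kv_restrict_AE:
  assumes "distr Q (hs n) (\<lambda>\<omega>. restrict \<omega> {0..<n}) = fdd P V x n"
  shows "AE \<omega> in Q. kv n (restrict \<omega> {0..<n}) = stage_kernel P V x n \<omega>"
proof -
  have "AE h in distr Q (hs n) (\<lambda>\<omega>. restrict \<omega> {0..<n}). kv n h = stage_kernel P V x n (ext_path n h)"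
    unfolding assms by (rule kv_AE)
  from AE_distrD[OF restrict_Q this] AE_space
  show ?thesis by eventually_elim (simp add: stage_kernel_ext spQ)
qed

lemma fdd_rectangle:
  assumes d: "distr Q (hs n) (\<lambda>\<omega>. restrict \<omega> {0..<n}) = fdd P V x n"
    and A: "A \<in> sets (hs n)" and B: "B \<in> sets Sp"
  shows "(\<integral>\<^sup>+h\<in>A. emeasure (kv n h) B \<partial>fdd P V x n)
    = (\<integral>\<^sup>+\<omega>. emeasure (stage_kernel P V x n \<omega>) B * indicator {\<omega>\<in>space multi_path_space. restrict \<omega> {0..<n} \<in> A} \<omega> \<partial>Q)"
proof -
  have m: "(\<lambda>h. emeasure (kv n h) B * indicator A h) \<in> borel_measurable (hs n)"
    using measurable_emeasure_kernel[OF measurable_prob_algebraD[OF kv_measurable] B] A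
    by (intro borel_measurable_times_ennreal borel_measurable_indicator)
  have "(\<integral>\<^sup>+h\<in>A. emeasure (kv n h) B \<partial>fdd P V x n)
      = (\<integral>\<^sup>+\<omega>. emeasure (kv n (restrict \<omega> {0..<n})) B * indicator A (restrict \<omega> {0..<n}) \<partial>Q)"
    using nn_integral_distr[OF restrict_Q, of "\<lambda>h. emeasure (kv n h) B * indicator A h" n]
      m[folded measurable_cong_sets[OF fdd_sets refl]]
    unfolding d by blast
  also have "\<dots> = (\<integral>\<^sup>+\<omega>. emeasure (stage_kernel P V x n \<omega>) B * indicator {\<omega>\<in>space multi_path_space. restrict \<omega> {0..<n} \<in> A} \<omega> \<partial>Q)"
  proof (rule nn_integral_cong_AE)
    show "AE \<omega> in Q. emeasure (kv n (restrict \<omega> {0..<n})) B * indicator A (restrict \<omega> {0..<n})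
      = emeasure (stage_kernel P V x n \<omega>) B * indicator {\<omega>\<in>space multi_path_space. restrict \<omega> {0..<n} \<in> A} \<omega>"
      using kv_restrict_AE[OF d] AE_space by eventually_elim (auto simp: spQ indicator_def)
  qed
  finally show ?thesis .
qed

text \<open>The induction step of uniqueness. The rectangle identity \<open>e\<close> fixes the
  joint law of the history and the next coordinate by \<open>distr_pair_eq_bind\<close>, and joining
  the two gives the history of length \<open>Suc n\<close>.\<close>

lemma fdd_Suc_iff:
  assumes d: "distr Q (hs n) (\<lambda>\<omega>. restrict \<omega> {0..<n}) = fdd P V x n"
    and e: "\<And>A B. A \<in> sets (hs n) \<Longrightarrow> B \<in> sets Sp \<Longrightarrow>
      emeasure Q {\<omega> \<in> space Q. restrict \<omega> {0..<n} \<in> A \<and> \<omega> n \<in> B}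
      = (\<integral>\<^sup>+\<omega>. emeasure (stage_kernel P V x n \<omega>) B * indicator {\<omega>\<in>space multi_path_space. restrict \<omega> {0..<n} \<in> A} \<omega> \<partial>Q)"
  shows "distr Q (hs (Suc n)) (\<lambda>\<omega>. restrict \<omega> {0..<Suc n}) = fdd P V x (Suc n)"
proof -
  have "distr Q (hs n \<Otimes>\<^sub>M Sp) (\<lambda>\<omega>. (restrict \<omega> {0..<n}, \<omega> n))
      = distr Q (hs n) (\<lambda>\<omega>. restrict \<omega> {0..<n}) \<bind> (\<lambda>h. distr (kv n h) (hs n \<Otimes>\<^sub>M Sp) (Pair h))"
  proof (rule distr_pair_eq_bind[OF Q restrict_Q coord_Q kv_measurable])
    fix A B assume "A \<in> sets (hs n)" "B \<in> sets Sp"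
    then show "emeasure Q {\<omega> \<in> space Q. restrict \<omega> {0..<n} \<in> A \<and> \<omega> n \<in> B}
      = (\<integral>\<^sup>+h\<in>A. emeasure (kv n h) B \<partial>distr Q (hs n) (\<lambda>\<omega>. restrict \<omega> {0..<n}))"
      unfolding d by (simp add: e fdd_rectangle[OF d])
  qed
  then have "fdd P V x (Suc n) = distr (distr Q (hs n \<Otimes>\<^sub>M Sp) (\<lambda>\<omega>. (restrict \<omega> {0..<n}, \<omega> n))) (hs (Suc n)) (\<lambda>z. (fst z)(n := snd z))"
    unfolding fdd_Suc_pair d by simp
  also have "\<dots> = distr Q (hs (Suc n)) (\<lambda>\<omega>. (restrict \<omega> {0..<n})(n := \<omega> n))"
    by (subst distr_distr[OF hist_pair_measurable measurable_Pair[OF restrict_Q coord_Q]]) (simp add: comp_def)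
  also have "(\<lambda>\<omega>::nat \<Rightarrow> real \<Rightarrow> 'e. (restrict \<omega> {0..<n})(n := \<omega> n)) = (\<lambda>\<omega>. restrict \<omega> {0..<Suc n})"
    by (auto simp: fun_eq_iff)
  finally show ?thesis by (rule sym)
qed

lemma fdd_0: "distr Q (hs 0) (\<lambda>\<omega>. restrict \<omega> {0..<0}) = fdd P V x 0"
proof (rule measure_eqI)
  fix A assume "A \<in> sets (distr Q (hs 0) (\<lambda>\<omega>. restrict \<omega> {0..<0}))"
  then have A: "A \<in> sets (hs 0)" by simp
  show "emeasure (distr Q (hs 0) (\<lambda>\<omega>. restrict \<omega> {0..<0})) A = emeasure (fdd P V x 0) A"
    using A Q.emeasure_space_1
    by (subst emeasure_distr[OF restrict_Q A]) (auto simp: restrict_def indicator_def)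
qed (simp add: fdd_sets)

text \<open>Converse of \<open>fdd_Suc_iff\<close>: the finite-dimensional laws return the rectangle
  identity, from which the clauses of \<open>is_controlled_law\<close> are read off.\<close>

lemma fdd_emeasure_Suc:
  assumes d: "\<And>n. distr Q (hs n) (\<lambda>\<omega>. restrict \<omega> {0..<n}) = fdd P V x n"
    and A: "A \<in> sets (hs n)" and B: "B \<in> sets Sp"
  shows "emeasure Q {\<omega> \<in> space Q. restrict \<omega> {0..<n} \<in> A \<and> \<omega> n \<in> B}
    = (\<integral>\<^sup>+\<omega>. emeasure (stage_kernel P V x n \<omega>) B * indicator {\<omega>\<in>space multi_path_space. restrict \<omega> {0..<n} \<in> A} \<omega> \<partial>Q)"
proof -
  define C where "C = {h \<in> space (hs (Suc n)). restrict h {0..<n} \<in> A \<and> h n \<in> B}"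
  have C: "C \<in> sets (hs (Suc n))"
  proof -
    have 1: "(\<lambda>h. restrict h {0..<n}) \<in> hs (Suc n) \<rightarrow>\<^sub>M hs n" by (rule measurable_restrict_subset) auto
    have 2: "(\<lambda>h. h n) \<in> hs (Suc n) \<rightarrow>\<^sub>M Sp" by (rule measurable_component_singleton) auto
    have "C = ((\<lambda>h. restrict h {0..<n}) -` A \<inter> space (hs (Suc n))) \<inter> ((\<lambda>h. h n) -` B \<inter> space (hs (Suc n)))"
      by (auto simp: C_def)
    then show ?thesis using measurable_sets[OF 1 A] measurable_sets[OF 2 B] by (simp only: sets.Int)
  qed
  have kx: "(\<lambda>h. distr (kv n h) (hs (Suc n)) (fun_upd h n)) \<in> fdd P V x n \<rightarrow>\<^sub>M prob_algebra (hs (Suc n))"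
    unfolding measurable_cong_sets[OF fdd_sets refl]
    by (rule measurable_distr_prob_space2[OF kv_measurable])
       (auto simp: measurable_split_conv intro!: measurable_fun_upd[where J="{0..<n}"])
  have "emeasure Q {\<omega> \<in> space Q. restrict \<omega> {0..<n} \<in> A \<and> \<omega> n \<in> B} = emeasure (fdd P V x (Suc n)) C"
    unfolding d[symmetric]
    by (subst emeasure_distr[OF restrict_Q C])
       (auto simp: C_def spQ restrict_in_hist intro!: arg_cong[where f="emeasure Q"] cong: restrict_cong)
  also have "\<dots> = (\<integral>\<^sup>+h. emeasure (distr (kv n h) (hs (Suc n)) (fun_upd h n)) C \<partial>fdd P V x n)"
    unfolding fdd.simps
    by (rule emeasure_bind[OF prob_space.not_empty[OF fdd_prob] measurable_prob_algebraD[OF kx] C])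
  also have "\<dots> = (\<integral>\<^sup>+h\<in>A. emeasure (kv n h) B \<partial>fdd P V x n)"
  proof (rule nn_integral_cong)
    fix h assume "h \<in> space (fdd P V x n)"
    then have h: "h \<in> space (hs n)" using sets_eq_imp_space_eq[OF fdd_sets] by blast
    have sk: "sets (kv n h) = sets Sp" by (rule sets_kernel[OF measurable_prob_algebraD[OF kv_measurable] h])
    have u: "fun_upd h n \<in> kv n h \<rightarrow>\<^sub>M hs (Suc n)"
      unfolding measurable_cong_sets[OF sk refl] using h
      by (intro measurable_fun_upd[where J="{0..<n}"]) auto
    have rh: "restrict (h(n := q)) {0..<n} = h" for q
      using h by (auto simp: space_PiM PiE_def extensional_def fun_eq_iff)
    have "fun_upd h n -` C \<inter> space (kv n h) = (if h \<in> A then B else {})"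
      using measurable_space[OF u] sets.sets_into_space[OF B] sets_eq_imp_space_eq[OF sk]
      by (auto simp: C_def rh)
    then show "emeasure (distr (kv n h) (hs (Suc n)) (fun_upd h n)) C = emeasure (kv n h) B * indicator A h"
      by (subst emeasure_distr[OF u C]) auto
  qed
  also have "\<dots> = (\<integral>\<^sup>+\<omega>. emeasure (stage_kernel P V x n \<omega>) B * indicator {\<omega>\<in>space multi_path_space. restrict \<omega> {0..<n} \<in> A} \<omega> \<partial>Q)"
    by (rule fdd_rectangle[OF d A B])
  finally show ?thesis .
qed

end

lemma measurable_distr_restart:
  assumes "markov_family P"
  shows "restart s y \<in> P z \<rightarrow>\<^sub>M path_space"
  unfolding markov_family_cong[OF assms] by (rule measurable_restart) auto

lemma stage_kernel_0:
  assumes P: "markov_family P"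
  shows "stage_kernel P V x 0 \<omega> = P x"
proof -
  have "distr (P x) path_space (restart 0 x) = distr (P x) (P x) (\<lambda>p. p)"
    by (rule distr_cong) (simp_all add: markov_family_sets[OF P] markov_family_space[OF P] restart_0)
  then show ?thesis by (simp add: stage_kernel_def distr_id2)
qed

context impulse_law
begin

lemma hist_preimage_raw:
  assumes "A \<in> sets (hs (Suc n))"
  shows "{\<omega>\<in>space multi_path_space. restrict \<omega> {0..<Suc n} \<in> A} \<in> sets (raw_multi_filt n \<top>)"
  using measurable_sets[OF measurable_restrict_raw assms] by (simp add: vimage_def Int_def conj_commute)

text \<open>The clause on coordinate 0 is the rectangle identity for the empty history, the
  conditional clause is the one for nonempty histories. Together they determine every
  finite-dimensional law.\<close>

lemma is_controlled_law_fdd: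
  assumes law: "is_controlled_law P x V Q"
  shows "distr Q (hs n) (\<lambda>\<omega>. restrict \<omega> {0..<n}) = fdd P V x n"
proof (induction n)
  case (Suc n)
  show ?case
  proof (rule fdd_Suc_iff[OF Suc])
    fix A B assume A: "A \<in> sets (hs n)" and B: "B \<in> sets Sp"
    let ?A = "{\<omega>\<in>space multi_path_space. restrict \<omega> {0..<n} \<in> A}"
    show "emeasure Q {\<omega> \<in> space Q. restrict \<omega> {0..<n} \<in> A \<and> \<omega> n \<in> B}
      = (\<integral>\<^sup>+\<omega>. emeasure (stage_kernel P V x n \<omega>) B * indicator ?A \<omega> \<partial>Q)"
    proof (cases n)
      case 0
      have "emeasure Q {\<omega> \<in> space Q. \<omega> 0 \<in> B} = emeasure (distr Q path_space (\<lambda>\<omega>. \<omega> 0)) B"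
        by (subst emeasure_distr[OF coord_Q B]) (auto intro!: arg_cong[where f="emeasure Q"])
      also have "\<dots> = emeasure (P x) B" using law by (simp add: is_controlled_law_def)
      finally have e: "emeasure Q {\<omega> \<in> space Q. \<omega> 0 \<in> B} = emeasure (P x) B" .
      show ?thesis
      proof (cases "(\<lambda>_. undefined) \<in> A")
        case True
        then have "(\<integral>\<^sup>+\<omega>. emeasure (stage_kernel P V x n \<omega>) B * indicator ?A \<omega> \<partial>Q) = (\<integral>\<^sup>+\<omega>. emeasure (P x) B \<partial>Q)"
          by (intro nn_integral_cong) (simp add: 0 restrict_def spQ stage_kernel_0[OF P])
        then show ?thesis using e True by (simp add: 0 restrict_def Q.emeasure_space_1)
      qed (simp add: 0 restrict_def)
    next
      case (Suc k)
      have "emeasure Q (?A \<inter> {\<omega> \<in> space multi_path_space. \<omega> (Suc k) \<in> B})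
          = (\<integral>\<^sup>+\<omega>\<in>?A. emeasure (stage_kernel P V x n \<omega>) B \<partial>completion Q)"
        using law hist_preimage_raw[of A k] A B Suc unfolding is_controlled_law_def
        by (simp add: stage_kernel_def)
      then show ?thesis
        by (simp add: nn_integral_completion spQ Suc Int_def conj_ac cong: conj_cong)
    qed
  qed
qed (rule fdd_0)

lemma is_controlled_lawI:
  assumes d: "\<And>n. distr Q (hs n) (\<lambda>\<omega>. restrict \<omega> {0..<n}) = fdd P V x n"
  shows "is_controlled_law P x V Q"
  unfolding is_controlled_law_def
proof (intro conjI allI ballI)
  show "distr Q path_space (\<lambda>\<omega>. \<omega> 0) = P x"
  proof (rule measure_eqI)
    fix B assume "B \<in> sets (distr Q path_space (\<lambda>\<omega>. \<omega> 0))"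
    then have B: "B \<in> sets Sp" by simp
    have "emeasure (distr Q path_space (\<lambda>\<omega>. \<omega> 0)) B = emeasure Q {\<omega> \<in> space Q. restrict \<omega> {0..<0} \<in> space (hs 0) \<and> \<omega> 0 \<in> B}"
      by (subst emeasure_distr[OF coord_Q B]) (auto simp: space_PiM restrict_def intro!: arg_cong[where f="emeasure Q"])
    also have "\<dots> = (\<integral>\<^sup>+\<omega>. emeasure (P x) B \<partial>Q)"
      unfolding fdd_emeasure_Suc[OF d sets.top B]
    proof (rule nn_integral_cong)
      fix \<omega> assume "\<omega> \<in> space Q"
      then have "\<omega> \<in> {\<omega> \<in> space multi_path_space. restrict \<omega> {0..<0} \<in> space (hs 0)}"
        using restrict_in_hist[of \<omega> 0] by (simp only: spQ mem_Collect_eq)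
      then show "emeasure (stage_kernel P V x 0 \<omega>) B * indicator {\<omega> \<in> space multi_path_space. restrict \<omega> {0..<0} \<in> space (hs 0)} \<omega> = emeasure (P x) B"
        by (simp only: stage_kernel_0[OF P] indicator_simps mult_1_right)
    qed
    finally show "emeasure (distr Q path_space (\<lambda>\<omega>. \<omega> 0)) B = emeasure (P x) B"
      by (simp add: Q.emeasure_space_1)
  qed (simp add: markov_family_sets[OF P])
  fix n and A :: "(nat \<Rightarrow> real \<Rightarrow> 'e) set" and B assume A: "A \<in> sets (raw_multi_filt n \<top>)" and B: "B \<in> sets Sp"
  define A' where "A' = ext_path (Suc n) -` A \<inter> space (hs (Suc n))"
  note A' = raw_multi_set_hist[OF A, folded A'_def]
  have "A \<subseteq> space multi_path_space" using sets.sets_into_space[OF A] by simp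
  then have e: "{\<omega>\<in>space multi_path_space. restrict \<omega> {0..<Suc n} \<in> A'} = A"
    using A'(2) by auto
  have "emeasure Q (A \<inter> {\<omega> \<in> space multi_path_space. \<omega> (Suc n) \<in> B})
     = emeasure Q {\<omega> \<in> space Q. restrict \<omega> {0..<Suc n} \<in> A' \<and> \<omega> (Suc n) \<in> B}"
    by (subst e[symmetric]) (auto simp: spQ intro!: arg_cong[where f="emeasure Q"])
  also have "\<dots> = (\<integral>\<^sup>+\<omega>\<in>A. emeasure (stage_kernel P V x (Suc n) \<omega>) B \<partial>completion Q)"
    unfolding fdd_emeasure_Suc[OF d A'(1) B] e nn_integral_completion ..
  finally show "emeasure Q (A \<inter> {\<omega> \<in> space multi_path_space. \<omega> (Suc n) \<in> B})
     = (\<integral>\<^sup>+\<omega>\<in>A. emeasure (distr (P (snd V n \<omega>)) path_space (restart (fst V n \<omega>) (snd V n \<omega>))) B \<partial>completion Q)"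
    by (simp add: stage_kernel_def)
qed (use Q sQ in auto)

text \<open>Coordinate \<open>n\<close> may be resampled: given the earlier coordinates it is an
  uncontrolled path from the start point of the stage, delayed to its start time. The outer value of
  \<open>\<omega> n\<close> is overwritten, and neither the start time nor the start point reads it.
  All estimates of stages rest on this identity.\<close>

lemma nn_integral_stage_fdd:
  fixes F :: "(nat \<Rightarrow> real \<Rightarrow> 'e) \<Rightarrow> ennreal"
  assumes d: "\<And>n. distr Q (hs n) (\<lambda>\<omega>. restrict \<omega> {0..<n}) = fdd P V x n"
    and F: "F \<in> borel_measurable (multi_filt n \<top>)"
  shows "(\<integral>\<^sup>+\<omega>. F \<omega> \<partial>Q) = (\<integral>\<^sup>+\<omega>. (\<integral>\<^sup>+p. F (fun_upd \<omega> n (restart (start_time V n \<omega>) (start_point V x n \<omega>) p))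
      \<partial>P (start_point V x n \<omega>)) \<partial>Q)"
proof -
  let ?E = "ext_path (Suc n) :: (nat \<Rightarrow> real \<Rightarrow> 'e) \<Rightarrow> nat \<Rightarrow> real \<Rightarrow> 'e"
  let ?K = "\<lambda>h. distr (kv n h) (hs (Suc n)) (fun_upd h n)"
  have FE: "(\<lambda>h. F (?E h)) \<in> borel_measurable (universal_completion (hs (Suc n)))"
    by (rule measurable_compose[OF measurable_universal_completion2[OF measurable_ext_path] F[unfolded multi_filt_def]])
  have dep: "F \<omega>' = F \<omega>" if "\<omega> \<in> space multi_path_space" "\<omega>' \<in> space multi_path_space" "\<And>i. i \<le> n \<Longrightarrow> \<omega> i = \<omega>' i" for \<omega> \<omega>'
    by (rule multi_filt_depends[OF F _ that]) simp
  have K: "?K \<in> hs n \<rightarrow>\<^sub>M prob_algebra (hs (Suc n))"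
    by (rule measurable_distr_prob_space2[OF kv_measurable])
       (auto simp: measurable_split_conv intro!: measurable_fun_upd[where J="{0..<n}"])
  have "(\<integral>\<^sup>+\<omega>. F \<omega> \<partial>Q) = (\<integral>\<^sup>+\<omega>. F (?E (restrict \<omega> {0..<Suc n})) \<partial>Q)"
  proof (rule nn_integral_cong)
    fix \<omega> assume "\<omega> \<in> space Q"
    then have w: "\<omega> \<in> space multi_path_space" by (simp add: spQ)
    show "F \<omega> = F (?E (restrict \<omega> {0..<Suc n}))"
      by (rule dep[OF ext_path_in_space[OF restrict_in_hist[OF w]] w]) (simp add: ext_path_def)
  qed
  also have "\<dots> = (\<integral>\<^sup>+h. F (?E h) \<partial>fdd P V x (Suc n))"
    unfolding d[symmetric] by (rule nn_integral_distr_uc[OF FE Q restrict_Q, symmetric])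
  also have "fdd P V x (Suc n) = Q \<bind> (\<lambda>\<omega>. ?K (restrict \<omega> {0..<n}))"
    unfolding fdd.simps d[symmetric]
    by (rule bind_distr[OF restrict_Q measurable_prob_algebraD[OF K[unfolded d[symmetric]]] Q.not_empty])
  also have "(\<integral>\<^sup>+h. F (?E h) \<partial>(Q \<bind> (\<lambda>\<omega>. ?K (restrict \<omega> {0..<n}))))
      = (\<integral>\<^sup>+\<omega>. (\<integral>\<^sup>+h. F (?E h) \<partial>?K (restrict \<omega> {0..<n})) \<partial>Q)"
    by (rule nn_integral_bind_uc[OF FE Q measurable_compose[OF restrict_Q K]])
  also have "\<dots> = (\<integral>\<^sup>+\<omega>. (\<integral>\<^sup>+p. F (fun_upd \<omega> n (restart (start_time V n \<omega>) (start_point V x n \<omega>) p))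
      \<partial>P (start_point V x n \<omega>)) \<partial>Q)"
  proof (rule nn_integral_cong_AE)
    show "AE \<omega> in Q. (\<integral>\<^sup>+h. F (?E h) \<partial>?K (restrict \<omega> {0..<n}))
      = (\<integral>\<^sup>+p. F (fun_upd \<omega> n (restart (start_time V n \<omega>) (start_point V x n \<omega>) p)) \<partial>P (start_point V x n \<omega>))"
      using kv_restrict_AE[OF d, of n] AE_space
    proof eventually_elim
      case (elim \<omega>)
      let ?h = "restrict \<omega> {0..<n}"
      have w: "\<omega> \<in> space multi_path_space" using elim by (simp add: spQ)
      have h: "?h \<in> space (hs n)" by (rule restrict_in_hist[OF w])
      have sk: "sets (kv n ?h) = sets Sp" by (rule sets_kernel[OF measurable_prob_algebraD[OF kv_measurable] h])
      have prk: "prob_space (kv n ?h)" using measurable_space[OF kv_measurable h] by (simp add: space_prob_algebra)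
      have u': "fun_upd ?h n \<in> Sp \<rightarrow>\<^sub>M hs (Suc n)"
        using h by (intro measurable_fun_upd[where J="{0..<n}"]) auto
      have u: "fun_upd ?h n \<in> kv n ?h \<rightarrow>\<^sub>M hs (Suc n)"
        using u' unfolding measurable_cong_sets[OF sk refl] .
      let ?r = "restart (start_time V n \<omega>) (start_point V x n \<omega>)"
      have "(\<integral>\<^sup>+h. F (?E h) \<partial>?K ?h) = (\<integral>\<^sup>+q. F (?E (?h(n := q))) \<partial>kv n ?h)"
        by (rule nn_integral_distr_uc[OF FE prk u])
      also have "\<dots> = (\<integral>\<^sup>+q. F (?E (?h(n := q))) \<partial>distr (P (start_point V x n \<omega>)) path_space ?r)"
        using elim(1) by (simp add: stage_kernel_def)
      also have "\<dots> = (\<integral>\<^sup>+p. F (?E (?h(n := ?r p))) \<partial>P (start_point V x n \<omega>))"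
        by (rule nn_integral_distr_uc[OF measurable_compose[OF measurable_universal_completion2[OF u'] FE]
              markov_family_prob[OF P] measurable_distr_restart[OF P]])
      also have "\<dots> = (\<integral>\<^sup>+p. F (fun_upd \<omega> n (?r p)) \<partial>P (start_point V x n \<omega>))"
      proof (rule nn_integral_cong)
        fix p assume "p \<in> space (P (start_point V x n \<omega>))"
        then have rp: "?r p \<in> space path_space" using restart_in_space markov_family_space[OF P] by blast
        have 1: "?h(n := ?r p) \<in> space (hs (Suc n))" by (rule measurable_space[OF u' rp])
        have 2: "fun_upd \<omega> n (?r p) \<in> space multi_path_space" using w rp by (simp add: space_multi_path_space)
        show "F (?E (?h(n := ?r p))) = F (fun_upd \<omega> n (?r p))"
          by (rule dep[OF 2 ext_path_in_space[OF 1]]) (auto simp: ext_path_def)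
      qed
      finally show ?case .
    qed
  qed
  finally show ?thesis .
qed

end

text \<open>Every finite index set lies in some \<open>{0..<n}\<close>, so cylinders are decided by
  the finite-dimensional laws, which the clauses determine.\<close>

lemma impulse_law_unique:
  fixes P :: "'e::metric_space \<Rightarrow> (real \<Rightarrow> 'e) measure"
  assumes "impulse_law P U V Q" "impulse_law P U V Q'" "is_controlled_law P x V Q" "is_controlled_law P x V Q'"
  shows "Q = Q'"
proof -
  interpret Q: impulse_law P U V x Q by (rule assms)
  interpret Q': impulse_law P U V x Q' by (rule assms)
  show ?thesis
  proof (rule measure_eqI_PiM_infinite)
    show "sets Q = sets (Pi\<^sub>M UNIV (\<lambda>_. path_space))" "sets Q' = sets (Pi\<^sub>M UNIV (\<lambda>_. path_space))"
      using Q.sQ Q'.sQ by (simp_all add: multi_path_space_def)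
    show "finite_measure Q" by unfold_locales
    fix J :: "nat set" and A assume J: "finite J" and A: "\<And>i. i \<in> J \<Longrightarrow> A i \<in> sets (path_space :: (real \<Rightarrow> 'e) measure)"
    obtain n where n: "J \<subseteq> {0..<n}"
      using J by (metis finite_nat_iff_bounded atLeast0LessThan)
    define C where "C = prod_emb {0..<n} (\<lambda>_. path_space) J (Pi\<^sub>E J A)"
    have C: "C \<in> sets (Pi\<^sub>M {0..<n} (\<lambda>_. path_space))"
      unfolding C_def using n J A by (intro measurable_prod_emb sets_PiM_I_finite) auto
    have e: "prod_emb UNIV (\<lambda>_. path_space) J (Pi\<^sub>E J A) = (\<lambda>\<omega>. restrict \<omega> {0..<n}) -` C \<inter> space multi_path_space"
      unfolding C_def multi_path_space_def using n
      by (subst prod_emb_trans[symmetric, of J "{0..<n}"]) (auto simp: prod_emb_def space_PiM)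
    have "emeasure Q (prod_emb UNIV (\<lambda>_. path_space) J (Pi\<^sub>E J A)) = emeasure (fdd P V x n) C"
      unfolding Q.is_controlled_law_fdd[OF assms(3), symmetric] e Q.spQ[symmetric]
      by (rule emeasure_distr[OF Q.restrict_Q C, symmetric])
    also have "\<dots> = emeasure Q' (prod_emb UNIV (\<lambda>_. path_space) J (Pi\<^sub>E J A))"
      unfolding Q'.is_controlled_law_fdd[OF assms(4), symmetric] e Q'.spQ[symmetric]
      by (rule emeasure_distr[OF Q'.restrict_Q C])
    finally show "emeasure Q (prod_emb UNIV (\<lambda>_. path_space) J (Pi\<^sub>E J A)) = emeasure Q' (prod_emb UNIV (\<lambda>_. path_space) J (Pi\<^sub>E J A))" .
  qed
qed

lemma (in impulse_control) controlled_law_is: "is_controlled_law P x V (controlled_law P x V)"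
proof -
  obtain Q where Q: "prob_space Q" "sets Q = sets (multi_path_space :: (nat \<Rightarrow> real \<Rightarrow> 'e) measure)"
    and d: "\<And>n. distr Q (hs n) (\<lambda>\<omega>. restrict \<omega> {0..<n}) = fdd P V x n" by (rule fdd_limit) blast
  have il: "impulse_law P U V Q'" if "prob_space Q'" "sets Q' = sets (multi_path_space :: (nat \<Rightarrow> real \<Rightarrow> 'e) measure)" for Q'
    by (intro impulse_law.intro impulse_law_axioms.intro impulse_control_axioms that)
  show ?thesis
    unfolding controlled_law_def
  proof (rule theI')
    show "\<exists>!Q. is_controlled_law P x V Q"
    proof (rule ex1I)
      show "is_controlled_law P x V Q" by (rule impulse_law.is_controlled_lawI[OF il[OF Q] d])
      then show "Q' = Q" if "is_controlled_law P x V Q'" for Q'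
        using that impulse_law_unique[OF il il] unfolding is_controlled_law_def by blast
    qed
  qed
qed

sublocale impulse_control \<subseteq> impulse_law P U V x "controlled_law P x V"
  using controlled_law_is unfolding is_controlled_law_def
  by (intro impulse_law.intro impulse_law_axioms.intro impulse_control_axioms) auto

context impulse_control
begin

abbreviation "Q \<equiv> controlled_law P x V"

lemmas nn_integral_stage = nn_integral_stage_fdd[OF is_controlled_law_fdd[OF controlled_law_is]]

lemma distr_coord_0: "distr Q path_space (\<lambda>\<omega>. \<omega> 0) = P x"
  using controlled_law_is by (simp add: is_controlled_law_def)

end

subsection \<open>Payoffs as differences of nonnegative integrals\<close>

text \<open>Without a countable base the pair of \<open>a\<close> and \<open>u\<close> need not be
  Borel measurable into the product space. For a fixed net point the function is continuous in its
  first argument, selecting among countably many net points preserves measurability, and joint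
  continuity of \<open>c\<close> gives the limit.\<close>

lemma measurable_caratheodory:
  fixes c :: "'e::metric_space \<Rightarrow> 'e \<Rightarrow> real"
  assumes c: "continuous_on (UNIV \<times> U) (\<lambda>(x, \<xi>). c x \<xi>)" and U: "compact U"
    and a: "a \<in> N \<rightarrow>\<^sub>M borel" and u: "u \<in> N \<rightarrow>\<^sub>M borel" and uU: "\<And>x. x \<in> space N \<Longrightarrow> u x \<in> U"
  shows "(\<lambda>x. c (a x) (u x)) \<in> borel_measurable N"
proof (cases "U = {}")
  case True
  then have "space N = {}" using uU by auto
  then show ?thesis by (simp add: measurable_def)
next
  case False
  then obtain z where z: "z \<in> U" by blast
  obtain fs idx where net: "\<And>k i. fs k i \<in> U" "\<And>k. idx k \<in> (borel :: 'e measure) \<rightarrow>\<^sub>M (count_space UNIV :: nat measure)"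
    "\<And>k y. y \<in> U \<Longrightarrow> dist (fs k (idx k y)) y < 1 / real (Suc k)"
    by (rule compact_nets[OF U z]) blast
  show ?thesis
  proof (rule borel_measurable_LIMSEQ_metric)
    fix k
    have "(\<lambda>x. c (a x) (fs k i)) \<in> borel_measurable N" for i
    proof (rule measurable_compose[OF a])
      have "continuous_on UNIV (\<lambda>y. (\<lambda>(x, \<xi>). c x \<xi>) (y, fs k i))"
        by (rule continuous_on_compose2[OF c]) (auto intro!: continuous_intros net(1))
      then show "(\<lambda>y. c y (fs k i)) \<in> borel_measurable borel" by (simp add: borel_measurable_continuous_onI)
    qed
    then show "(\<lambda>x. c (a x) (fs k (idx k (u x)))) \<in> borel_measurable N"
      by (rule measurable_compose_countable[where g="\<lambda>x. idx k (u x)" and f="\<lambda>i x. c (a x) (fs k i)", OF _ measurable_compose[OF u net(2)]])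
  next
    fix x assume x: "x \<in> space N"
    have "(\<lambda>k. dist (fs k (idx k (u x))) (u x)) \<longlonglongrightarrow> 0"
      using net(3)[OF uU[OF x]]
      by (intro tendsto_sandwich[OF _ _ tendsto_const LIMSEQ_inverse_real_of_nat])
         (auto intro!: always_eventually less_imp_le simp: inverse_eq_divide)
    then have "(\<lambda>k. fs k (idx k (u x))) \<longlonglongrightarrow> u x" by (rule iffD2[OF tendsto_dist_iff])
    then have "(\<lambda>k. (a x, fs k (idx k (u x)))) \<longlonglongrightarrow> (a x, u x)" by (intro tendsto_intros)
    from continuous_on_tendsto_compose[OF c this]
    show "(\<lambda>k. c (a x) (fs k (idx k (u x)))) \<longlonglongrightarrow> c (a x) (u x)"
      using net(1) uU[OF x] by (auto intro!: always_eventually)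
  qed
qed

text \<open>With truncated differences, (a - b) + b = (b - a) + a; integrating this relates the
  positive and negative parts of \<open>g\<close> to \<open>a\<close> and \<open>b\<close>. The
  integral of \<open>b\<close> may be infinite: \<open>b\<close> will collect the impulse
  costs.\<close>

lemma eexpectation_diff:
  fixes a b :: "'a \<Rightarrow> ennreal"
  assumes a: "a \<in> borel_measurable (completion M)" and b: "b \<in> borel_measurable (completion M)"
    and fa: "(\<integral>\<^sup>+\<omega>. a \<omega> \<partial>M) < \<infinity>" and g: "AE \<omega> in M. g \<omega> = enn2ereal (a \<omega>) - enn2ereal (b \<omega>) \<and> b \<omega> < \<infinity>"
  shows "eexpectation M g = enn2ereal (\<integral>\<^sup>+\<omega>. a \<omega> \<partial>M) - enn2ereal (\<integral>\<^sup>+\<omega>. b \<omega> \<partial>M)"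
proof -
  let ?M = "completion M"
  have fa': "(\<integral>\<^sup>+\<omega>. a \<omega> \<partial>?M) < \<infinity>" using fa by (simp add: nn_integral_completion)
  have ae: "AE \<omega> in ?M. g \<omega> = enn2ereal (a \<omega>) - enn2ereal (b \<omega>) \<and> b \<omega> < \<infinity> \<and> a \<omega> < \<infinity>"
    using AE_completion[OF g] nn_integral_PInf_AE[OF a] fa' by (auto simp: less_top)
  have p: "e2ennreal (enn2ereal u - enn2ereal v) = u - v" if "u < \<infinity>" "v < \<infinity>" for u v :: ennreal
    using that by (cases u; cases v) (auto simp: ennreal_minus e2ennreal_ereal)
  have n: "e2ennreal (- (enn2ereal u - enn2ereal v)) = v - u" if "u < \<infinity>" "v < \<infinity>" for u v :: ennreal
    using that by (cases u; cases v) (auto simp: ennreal_minus e2ennreal_ereal)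
  have P: "(\<integral>\<^sup>+\<omega>. e2ennreal (g \<omega>) \<partial>?M) = (\<integral>\<^sup>+\<omega>. a \<omega> - b \<omega> \<partial>?M)"
    by (intro nn_integral_cong_AE eventually_mono[OF ae]) (simp add: p)
  have N: "(\<integral>\<^sup>+\<omega>. e2ennreal (- g \<omega>) \<partial>?M) = (\<integral>\<^sup>+\<omega>. b \<omega> - a \<omega> \<partial>?M)"
    by (intro nn_integral_cong_AE eventually_mono[OF ae]) (simp add: n)
  have m: "(\<lambda>\<omega>. a \<omega> - b \<omega>) \<in> borel_measurable ?M" "(\<lambda>\<omega>. b \<omega> - a \<omega>) \<in> borel_measurable ?M"
    using a b by (auto intro: borel_measurable_minus_ennreal)
  have eq: "(\<integral>\<^sup>+\<omega>. a \<omega> - b \<omega> \<partial>?M) + (\<integral>\<^sup>+\<omega>. b \<omega> \<partial>?M) = (\<integral>\<^sup>+\<omega>. b \<omega> - a \<omega> \<partial>?M) + (\<integral>\<^sup>+\<omega>. a \<omega> \<partial>?M)"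
  proof -
    have *: "u - v + v = v - u + u" if "u \<le> v" for u v :: ennreal
      using that by (cases "u = \<top>") (simp_all add: top_unique diff_add_cancel_ennreal diff_eq_0_ennreal less_top)
    have "u - v + v = v - u + u" for u v :: ennreal
      using *[of u v] *[of v u] by (metis linear)
    then have "(\<integral>\<^sup>+\<omega>. (a \<omega> - b \<omega>) + b \<omega> \<partial>?M) = (\<integral>\<^sup>+\<omega>. (b \<omega> - a \<omega>) + a \<omega> \<partial>?M)" by simp
    then show ?thesis using a b m by (simp add: nn_integral_add)
  qed
  have "(\<integral>\<^sup>+\<omega>. a \<omega> - b \<omega> \<partial>?M) \<le> (\<integral>\<^sup>+\<omega>. a \<omega> \<partial>?M)" by (intro nn_integral_mono) (simp add: diff_le_self_ennreal)
  from le_less_trans[OF this fa'] have fd: "(\<integral>\<^sup>+\<omega>. a \<omega> - b \<omega> \<partial>?M) < \<infinity>" .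
  have arith: "enn2ereal d - enn2ereal e = enn2ereal A - enn2ereal B"
    if "d + B = e + A" "d < \<infinity>" "A < \<infinity>" for d e A B :: ennreal
    using that by (cases d; cases e; cases A; cases B) (auto simp: ennreal_plus[symmetric] simp del: ennreal_plus)
  show ?thesis
    unfolding eexpectation_def P N
    using arith[OF eq fd fa'] by (simp add: nn_integral_completion)
qed

lemma set_integral_shift:
  fixes \<phi> :: "real \<Rightarrow> real"
  assumes m: "\<phi> \<in> borel_measurable borel" and A[measurable]: "A \<in> sets lborel" and fin: "emeasure lborel A < \<infinity>"
    and G: "\<And>s. \<bar>\<phi> s\<bar> \<le> G"
  shows "(LBINT s:A. \<phi> s) = enn2real (\<integral>\<^sup>+s. ennreal (\<phi> s + G) * indicator A s \<partial>lborel) - G * measure lborel A"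
    and "(\<integral>\<^sup>+s. ennreal (\<phi> s + G) * indicator A s \<partial>lborel) \<le> ennreal (2 * G) * emeasure lborel A"
proof -
  note m[measurable]
  have G0: "0 \<le> G" using G[of 0] by linarith
  show le: "(\<integral>\<^sup>+s. ennreal (\<phi> s + G) * indicator A s \<partial>lborel) \<le> ennreal (2 * G) * emeasure lborel A"
  proof -
    have "(\<integral>\<^sup>+s. ennreal (\<phi> s + G) * indicator A s \<partial>lborel) \<le> (\<integral>\<^sup>+s. ennreal (2 * G) * indicator A s \<partial>lborel)"
      using G by (intro nn_integral_mono mult_right_mono ennreal_leI) (auto simp: abs_le_iff intro: add_right_mono[THEN order_trans])
    then show ?thesis using A by (simp add: nn_integral_cmult_indicator)
  qed
  have nn: "0 \<le> \<phi> s + G" for s using G[of s] by linarith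
  have ind: "integrable lborel (indicat_real A)" using A fin by (rule integrable_real_indicator)
  have i1: "set_integrable lborel A \<phi>"
    unfolding set_integrable_def
  proof (rule Bochner_Integration.integrable_bound)
    show "integrable lborel (\<lambda>s. G * indicat_real A s)" using ind by simp
    show "AE s in lborel. norm (indicat_real A s *\<^sub>R \<phi> s) \<le> norm (G * indicat_real A s)"
      using G G0 by (intro AE_I2) (simp add: indicator_def)
  qed simp
  have i2: "set_integrable lborel A (\<lambda>s. G)"
    unfolding set_integrable_def using ind by simp
  have "(LBINT s:A. \<phi> s + G) = (LBINT s:A. \<phi> s) + (LBINT s:A. G)"
    by (rule set_integral_add(2)[OF i1 i2])
  moreover have "(LBINT s:A. G) = G * measure lborel A"
    using fin by (simp add: set_lebesgue_integral_def)
  moreover have "(LBINT s:A. \<phi> s + G) = enn2real (\<integral>\<^sup>+s. ennreal (\<phi> s + G) * indicator A s \<partial>lborel)"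
    unfolding set_lebesgue_integral_def
    by (subst integral_eq_nn_integral)
       (use nn in \<open>auto simp: indicator_def intro!: arg_cong[where f=enn2real] nn_integral_cong\<close>)
  ultimately show "(LBINT s:A. \<phi> s) = enn2real (\<integral>\<^sup>+s. ennreal (\<phi> s + G) * indicator A s \<partial>lborel) - G * measure lborel A"
    by linarith
qed

lemma before_interval:
  assumes "t < \<infinity>"
  shows "{s. 0 \<le> s \<and> ennreal s < t} = {0..<enn2real t}"
  using assms by (cases t) (auto simp: ennreal_less_iff)

lemma emeasure_before: "t < \<infinity> \<Longrightarrow> emeasure lborel {s. 0 \<le> s \<and> ennreal s < t} = t"
  by (simp add: before_interval)

lemma before_sets [measurable]: "{s. 0 \<le> s \<and> ennreal s < t} \<in> sets lborel"
proof -
  have "{s \<in> space borel. 0 \<le> s \<and> ennreal s < t} \<in> sets (borel :: real measure)" by measurable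
  then show ?thesis by simp
qed

text \<open>The running reward is shifted by the constant \<open>G\<close> to make it nonnegative.\<close>

locale running_reward =
  fixes f :: "'e::metric_space \<Rightarrow> real" and lam G :: real
  assumes f_cont: "continuous_on UNIV f" and G: "\<And>y. \<bar>f y\<bar> + \<bar>lam\<bar> \<le> G"
begin

definition area :: "(real \<Rightarrow> 'e) \<Rightarrow> ennreal \<Rightarrow> ennreal" where
  "area p t = (\<integral>\<^sup>+s. ennreal (f (p s) - lam + G) * indicator {s. 0 \<le> s \<and> ennreal s < t} s \<partial>lborel)"

text \<open>The argument of type \<open>ennreal\<close> cuts the stage at a time horizon;
  \<open>\<top>\<close> leaves it uncut.\<close>

definition seg :: "'e strategy \<Rightarrow> nat \<Rightarrow> ennreal \<Rightarrow> (nat \<Rightarrow> real \<Rightarrow> 'e) \<Rightarrow> ennreal" where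
  "seg V n t \<omega> = (\<integral>\<^sup>+s. ennreal (f (\<omega> n s) - lam + G) *
      indicator {s. 0 \<le> s \<and> start_time V n \<omega> \<le> ennreal s \<and> ennreal s < min (fst V n \<omega>) t} s \<partial>lborel)"

lemma G_nonneg: "0 \<le> G" using G[of undefined] by linarith

lemma reward_nonneg: "0 \<le> f y - lam + G" and reward_le: "f y - lam + G \<le> 2 * G"
  using G[of y] by (auto simp: abs_if split: if_splits)

lemma f_measurable: "f \<in> borel_measurable borel" using f_cont by (rule borel_measurable_continuous_onI)

lemma area_le: "area p t \<le> ennreal (2 * G) * t"
proof (cases "t = \<infinity>")
  case True
  show ?thesis
  proof (cases "G = 0")
    case True
    have "f y - lam + G = 0" for y using reward_nonneg[of y] reward_le[of y] True by linarith
    then show ?thesis by (simp add: area_def)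
  next
    case False
    then show ?thesis using True G_nonneg by (simp add: ennreal_mult_top)
  qed
next
  case False
  have "area p t \<le> (\<integral>\<^sup>+s. ennreal (2 * G) * indicator {s. 0 \<le> s \<and> ennreal s < t} s \<partial>lborel)"
    unfolding area_def by (intro nn_integral_mono mult_right_mono ennreal_leI reward_le) auto
  also have "\<dots> = ennreal (2 * G) * t"
    using False by (subst nn_integral_cmult_indicator) (auto simp: emeasure_before less_top)
  finally show ?thesis .
qed

lemma area_mono: "t \<le> u \<Longrightarrow> area p t \<le> area p u"
  unfolding area_def by (intro nn_integral_mono mult_left_mono) (auto simp: indicator_def dest: less_le_trans)

lemma measurable_reward_integral:
  fixes h :: "'a \<Rightarrow> real \<Rightarrow> 'e"
  assumes h: "h \<in> N \<rightarrow>\<^sub>M path_space" and a[measurable]: "a \<in> borel_measurable N" and b[measurable]: "b \<in> borel_measurable N"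
  shows "(\<lambda>\<omega>. \<integral>\<^sup>+s. ennreal (f (h \<omega> s) - lam + G) * indicator {s. 0 \<le> s \<and> a \<omega> \<le> ennreal s \<and> ennreal s < b \<omega>} s \<partial>lborel)
    \<in> borel_measurable N"
proof -
  have "(\<lambda>z. h (fst z) (max 0 (snd z))) \<in> N \<Otimes>\<^sub>M lborel \<rightarrow>\<^sub>M borel"
    by (rule measurable_path_eval[OF measurable_compose[OF measurable_fst h]]) auto
  from measurable_compose[OF this f_measurable]
  have [measurable]: "(\<lambda>z. f (h (fst z) (max 0 (snd z)))) \<in> borel_measurable (N \<Otimes>\<^sub>M lborel)" .
  have "(\<lambda>z. ennreal (f (h (fst z) (max 0 (snd z))) - lam + G) *
      indicator {z \<in> space (N \<Otimes>\<^sub>M lborel). 0 \<le> snd z \<and> a (fst z) \<le> ennreal (snd z) \<and> ennreal (snd z) < b (fst z)} z)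
    \<in> borel_measurable (N \<Otimes>\<^sub>M lborel)"
    by measurable
  from sigma_finite_measure.borel_measurable_nn_integral[OF sigma_finite_lborel, of "\<lambda>\<omega> s. ennreal (f (h \<omega> (max 0 s)) - lam + G) *
      indicator {z \<in> space (N \<Otimes>\<^sub>M lborel). 0 \<le> snd z \<and> a (fst z) \<le> ennreal (snd z) \<and> ennreal (snd z) < b (fst z)} (\<omega>, s)" N] this
  have m0: "(\<lambda>\<omega>. \<integral>\<^sup>+s. ennreal (f (h \<omega> (max 0 s)) - lam + G) *
      indicator {z \<in> space (N \<Otimes>\<^sub>M lborel). 0 \<le> snd z \<and> a (fst z) \<le> ennreal (snd z) \<and> ennreal (snd z) < b (fst z)} (\<omega>, s) \<partial>lborel) \<in> borel_measurable N"
    by (simp add: split_def)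
  have eq0: "(\<integral>\<^sup>+s. ennreal (f (h \<omega> (max 0 s)) - lam + G) *
      indicator {z \<in> space (N \<Otimes>\<^sub>M lborel). 0 \<le> snd z \<and> a (fst z) \<le> ennreal (snd z) \<and> ennreal (snd z) < b (fst z)} (\<omega>, s) \<partial>lborel)
    = (\<integral>\<^sup>+s. ennreal (f (h \<omega> s) - lam + G) * indicator {s. 0 \<le> s \<and> a \<omega> \<le> ennreal s \<and> ennreal s < b \<omega>} s \<partial>lborel)"
    if "\<omega> \<in> space N" for \<omega>
    using that by (intro nn_integral_cong) (auto simp: indicator_def space_pair_measure max_def)
  show ?thesis by (rule iffD1[OF measurable_cong m0]) (rule eq0)
qed

lemma area_measurable:
  assumes "h \<in> N \<rightarrow>\<^sub>M path_space" "b \<in> borel_measurable N"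
  shows "(\<lambda>\<omega>. area (h \<omega>) (b \<omega>)) \<in> borel_measurable N"
  using measurable_reward_integral[OF assms(1) measurable_const[of 0] assms(2)] by (simp add: area_def)

lemma seg_measurable:
  assumes V: "impulse_strategy U V"
  shows "seg V n t \<in> borel_measurable (multi_filt n \<top>)"
proof -
  have "(\<lambda>\<omega>. \<omega> n) \<in> multi_filt n \<top> \<rightarrow>\<^sub>M path_space"
    unfolding multi_filt_def by (intro measurable_universal_completion measurable_raw_multi_path) simp
  from measurable_reward_integral[OF this start_time_measurable[OF V] , of "\<lambda>\<omega>. min (fst V n \<omega>) t"]
    impulse_time_measurable[OF V, of n]
  show ?thesis unfolding seg_def[abs_def] by simp
qed

lemma impulse_times_mono:
  assumes V: "impulse_strategy U V" and w: "\<omega> \<in> space multi_path_space" and "i \<le> j"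
  shows "fst V i \<omega> \<le> fst V j \<omega>"
  using V w by (intro lift_Suc_mono_le[OF _ \<open>i \<le> j\<close>]) (auto simp: impulse_strategy_def)

lemma controlled_measurable:
  assumes w: "\<omega> \<in> space multi_path_space"
  shows "(\<lambda>s. f (controlled V \<omega> (max 0 s))) \<in> borel_measurable borel"
proof -
  have "(\<lambda>s. f (\<omega> k (max 0 s))) \<in> borel_measurable borel" for k
    by (rule measurable_compose[OF measurable_path_eval[of "\<lambda>_. \<omega> k"] f_measurable])
       (use w in \<open>auto simp: space_multi_path_space\<close>)
  moreover have "(\<lambda>s::real. LEAST n. ennreal (max 0 s) < fst V n \<omega>) \<in> borel \<rightarrow>\<^sub>M count_space UNIV"
    by (rule measurable_Least) measurable
  ultimately show ?thesis
    unfolding controlled_def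
    by (rule measurable_compose_countable[where f="\<lambda>k s. f (\<omega> k (max 0 s))"])
qed

text \<open>At each time before impulse \<open>n\<close> exactly one stage is running, the one whose
  index is the \<open>LEAST\<close> in \<open>controlled\<close>. So the reward of the controlled
  path splits into rewards that each depend on a single coordinate followed between two
  impulses.\<close>

lemma area_controlled:
  assumes V: "impulse_strategy U V" and w: "\<omega> \<in> space multi_path_space"
  shows "area (controlled V \<omega>) (min (fst V n \<omega>) t) = (\<Sum>k\<le>n. seg V k t \<omega>)"
proof -
  let ?g = "\<lambda>k s. ennreal (f (\<omega> k s) - lam + G) *
      indicator {s. 0 \<le> s \<and> start_time V k \<omega> \<le> ennreal s \<and> ennreal s < min (fst V k \<omega>) t} s"
  have pw: "ennreal (f (controlled V \<omega> s) - lam + G) * indicator {s. 0 \<le> s \<and> ennreal s < min (fst V n \<omega>) t} s = (\<Sum>k\<le>n. ?g k s)" for s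
  proof (cases "0 \<le> s \<and> ennreal s < min (fst V n \<omega>) t")
    case True
    define m where "m = (LEAST k. ennreal s < fst V k \<omega>)"
    have lt: "ennreal s < fst V m \<omega>" unfolding m_def using True by (intro LeastI[of "\<lambda>k. ennreal s < fst V k \<omega>" n]) simp
    have mn: "m \<le> n" unfolding m_def using True by (intro Least_le) simp
    have st: "start_time V m \<omega> \<le> ennreal s"
      using not_less_Least[of _ "\<lambda>k. ennreal s < fst V k \<omega>"] by (cases m) (auto simp: m_def not_less)
    have "?g k s = 0" if "k \<le> n" and km: "k \<noteq> m" for k
    proof (cases "k < m")
      case True
      have "\<not> ennreal s < fst V k \<omega>" using True unfolding m_def by (rule not_less_Least)
      then show ?thesis by (auto simp: indicator_def)
    next
      case False
      then obtain j where j: "k = Suc j" "m \<le> j" using km by (cases k) auto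
      have "ennreal s < fst V j \<omega>" using lt impulse_times_mono[OF V w j(2)] by simp
      then show ?thesis by (auto simp: indicator_def j not_le)
    qed
    then have "(\<Sum>k\<le>n. ?g k s) = (\<Sum>k\<le>n. if k = m then ?g m s else 0)"
      by (intro sum.cong) auto
    also have "\<dots> = ?g m s" using mn by simp
    also have "\<dots> = ennreal (f (controlled V \<omega> s) - lam + G) * indicator {s. 0 \<le> s \<and> ennreal s < min (fst V n \<omega>) t} s"
      using True lt st by (auto simp: indicator_def controlled_def m_def)
    finally show ?thesis by simp
  next
    case False
    have "?g k s = 0" if "k \<le> n" for k
      using False impulse_times_mono[OF V w that] by (auto simp: indicator_def)
    then show ?thesis using False by (auto simp: indicator_def)
  qed
  have "?g k \<in> borel_measurable lborel" for k
  proof -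
    have "(\<lambda>s. f (\<omega> k (max 0 s))) \<in> borel_measurable borel"
      by (rule measurable_compose[OF measurable_path_eval[of "\<lambda>_. \<omega> k"] f_measurable])
         (use w in \<open>auto simp: space_multi_path_space\<close>)
    then have "(\<lambda>s. ennreal (f (\<omega> k (max 0 s)) - lam + G) *
      indicator {s \<in> space borel. 0 \<le> s \<and> start_time V k \<omega> \<le> ennreal s \<and> ennreal s < min (fst V k \<omega>) t} s) \<in> borel_measurable borel"
      by measurable
    also have "?this \<longleftrightarrow> ?thesis"
      by (simp, intro measurable_cong) (auto simp: indicator_def max_def)
    finally show ?thesis .
  qed
  then show ?thesis
    unfolding area_def pw seg_def by (rule nn_integral_sum)
qed

lemma LBINT_controlled:
  assumes w: "\<omega> \<in> space multi_path_space" and t: "t < \<infinity>"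
  shows "(LBINT s:{s. 0 \<le> s \<and> ennreal s < t}. f (controlled V \<omega> s) - lam) = enn2real (area (controlled V \<omega>) t) - G * enn2real t"
    and "(LBINT s:{s. 0 \<le> s \<and> ennreal s < t}. f (controlled V \<omega> s)) = enn2real (area (controlled V \<omega>) t) - (G - lam) * enn2real t"
proof -
  let ?A = "{s. 0 \<le> s \<and> ennreal s < t}" and ?f = "\<lambda>s. f (controlled V \<omega> (max 0 s))"
  note [measurable] = controlled_measurable[OF w, of V]
  have mA: "measure lborel ?A = enn2real t" using emeasure_before[OF t] by (simp add: measure_def)
  have fin: "emeasure lborel ?A < \<infinity>" using emeasure_before[OF t] t by simp
  have a: "area (controlled V \<omega>) t = (\<integral>\<^sup>+s. ennreal (?f s - lam + G) * indicator ?A s \<partial>lborel)"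
    unfolding area_def by (intro nn_integral_cong) (auto simp: indicator_def max_def)
  have b1: "\<bar>?f s - lam\<bar> \<le> G" for s using G[of "controlled V \<omega> (max 0 s)"] by linarith
  have b2: "\<bar>?f s\<bar> \<le> G - lam" for s using G[of "controlled V \<omega> (max 0 s)"] by linarith
  have "(LBINT s:?A. ?f s - lam) = enn2real (area (controlled V \<omega>) t) - G * enn2real t"
    unfolding a mA[symmetric] by (rule set_integral_shift(1)[OF _ before_sets fin b1]) simp
  moreover have "(LBINT s:?A. ?f s - lam) = (LBINT s:?A. f (controlled V \<omega> s) - lam)"
    by (rule set_lebesgue_integral_cong[OF before_sets]) auto
  ultimately show "(LBINT s:?A. f (controlled V \<omega> s) - lam) = enn2real (area (controlled V \<omega>) t) - G * enn2real t" by simp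
  have a2: "area (controlled V \<omega>) t = (\<integral>\<^sup>+s. ennreal (?f s + (G - lam)) * indicator ?A s \<partial>lborel)"
    unfolding a by (simp add: algebra_simps)
  have "(LBINT s:?A. ?f s) = enn2real (area (controlled V \<omega>) t) - (G - lam) * enn2real t"
    unfolding a2 mA[symmetric] by (rule set_integral_shift(1)[OF _ before_sets fin b2]) simp
  moreover have "(LBINT s:?A. ?f s) = (LBINT s:?A. f (controlled V \<omega> s))"
    by (rule set_lebesgue_integral_cong[OF before_sets]) auto
  ultimately show "(LBINT s:?A. f (controlled V \<omega> s)) = enn2real (area (controlled V \<omega>) t) - (G - lam) * enn2real t" by simp
qed

end

text \<open>Turns an extended real difference into a comparison of sums of nonnegative terms. In the
  inequality \<open>B\<close> may be infinite; the equality forces it to be finite.\<close>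

lemma ennreal_eq_of_diff:
  fixes A B :: ennreal
  assumes "A < \<infinity>"
  shows "enn2ereal A - enn2ereal B \<le> ereal r \<Longrightarrow> 0 \<le> r + C \<Longrightarrow> 0 \<le> C \<Longrightarrow> A + ennreal C \<le> B + ennreal (r + C)"
    and "enn2ereal A - enn2ereal B = ereal r \<Longrightarrow> 0 \<le> r + C \<Longrightarrow> 0 \<le> C \<Longrightarrow> A + ennreal C = B + ennreal (r + C) \<and> B < \<infinity>"
  using assms by (cases A; cases B; auto simp: ennreal_plus[symmetric] simp del: ennreal_plus intro!: ennreal_leI)+

locale reward_control = impulse_control P U V x + running_reward f lam G
  for P :: "'e::metric_space \<Rightarrow> (real \<Rightarrow> 'e) measure" and U V x and f :: "'e \<Rightarrow> real" and lam G +
  fixes c :: "'e \<Rightarrow> 'e \<Rightarrow> real"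
  assumes c_cont: "continuous_on (UNIV \<times> U) (\<lambda>(x, \<xi>). c x \<xi>)"
    and c_nonpos: "\<And>y u. u \<in> U \<Longrightarrow> c y u \<le> 0"
begin

definition cost :: "nat \<Rightarrow> (nat \<Rightarrow> real \<Rightarrow> 'e) \<Rightarrow> ennreal" where
  "cost i \<omega> = ennreal (- c (pre_impulse V \<omega> i) (snd V i \<omega>))"

lemma coord_multi_filt: "i \<le> n \<Longrightarrow> (\<lambda>\<omega>. \<omega> i) \<in> multi_filt n \<top> \<rightarrow>\<^sub>M path_space"
  unfolding multi_filt_def by (intro measurable_universal_completion measurable_raw_multi_path)

lemma point_measurable: "snd V n \<in> multi_filt n \<top> \<rightarrow>\<^sub>M borel"
  using start_point_measurable[OF V, of x "Suc n"] impulse_point_measurable[OF V, of n]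
  by (simp add: measurable_restrict_space2_iff)

lemma cost_measurable: "cost n \<in> borel_measurable (multi_filt n \<top>)"
proof -
  have "(\<lambda>\<omega>. \<omega> n (enn2real (fst V n \<omega>))) \<in> multi_filt n \<top> \<rightarrow>\<^sub>M borel"
    by (rule measurable_path_eval[OF coord_multi_filt[OF order_refl]])
       (use impulse_time_measurable[OF V, of n] in auto)
  from measurable_caratheodory[OF c_cont U this point_measurable]
  have "(\<lambda>\<omega>. c (\<omega> n (enn2real (fst V n \<omega>))) (snd V n \<omega>)) \<in> borel_measurable (multi_filt n \<top>)"
    using impulse_point_in[OF V] by simp
  then show ?thesis unfolding cost_def[abs_def] pre_impulse_def by simp
qed

lemma completion_measurable:
  "seg V n t \<in> borel_measurable (completion Q)" "cost n \<in> borel_measurable (completion Q)"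
  "fst V n \<in> borel_measurable (completion Q)" "snd V n \<in> completion Q \<rightarrow>\<^sub>M borel"
  "start_time V n \<in> borel_measurable (completion Q)"
  by (rule multi_filt_measurable_completion, rule seg_measurable[OF V] cost_measurable
      impulse_time_measurable[OF V] point_measurable start_time_measurable[OF V])+

lemma mean_time_eq: "mean_time P x V n = (\<integral>\<^sup>+\<omega>. fst V n \<omega> \<partial>Q)"
  by (simp add: mean_time_def nn_integral_completion)

lemma time_finite_AE:
  assumes "mean_time P x V n < \<infinity>" shows "AE \<omega> in Q. fst V n \<omega> < \<infinity>"
  using nn_integral_PInf_AE[OF completion_measurable(3)[of n]] assms
  by (simp add: mean_time_def AE_completion_iff less_top)

lemma sum_seg: "\<omega> \<in> space multi_path_space \<Longrightarrow> area (controlled V \<omega>) (fst V n \<omega>) = (\<Sum>k\<le>n. seg V k \<top> \<omega>)"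
  using area_controlled[OF V, of \<omega> n \<top>] by simp

lemma sum_seg_le: "\<omega> \<in> space multi_path_space \<Longrightarrow> (\<Sum>k\<le>n. seg V k \<top> \<omega>) \<le> ennreal (2 * G) * fst V n \<omega>"
  unfolding sum_seg[symmetric] by (rule area_le)

lemma nn_integral_sum_seg_finite:
  assumes "mean_time P x V n < \<infinity>"
  shows "(\<integral>\<^sup>+\<omega>. (\<Sum>k\<le>n. seg V k \<top> \<omega>) \<partial>Q) < \<infinity>"
proof -
  have "(\<integral>\<^sup>+\<omega>. (\<Sum>k\<le>n. seg V k \<top> \<omega>) \<partial>Q) \<le> (\<integral>\<^sup>+\<omega>. ennreal (2 * G) * fst V n \<omega> \<partial>completion Q)"
    unfolding nn_integral_completion by (intro nn_integral_mono) (auto simp: spQ intro: sum_seg_le)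
  also have "\<dots> = ennreal (2 * G) * mean_time P x V n"
    unfolding mean_time_def by (rule nn_integral_cmult[OF completion_measurable(3)])
  also have "\<dots> < \<infinity>" using assms by (simp add: ennreal_mult_less_top less_top)
  finally show ?thesis .
qed

lemma sum_cost: "\<omega> \<in> space multi_path_space \<Longrightarrow>
  (\<Sum>i\<le>n. cost i \<omega>) = ennreal (- (\<Sum>i\<le>n. c (pre_impulse V \<omega> i) (snd V i \<omega>)))"
  unfolding cost_def using c_nonpos impulse_point_in[OF V] by (simp add: sum_ennreal sum_negf)

lemma sum_c_nonpos: "\<omega> \<in> space multi_path_space \<Longrightarrow> (\<Sum>i\<le>n. c (pre_impulse V \<omega> i) (snd V i \<omega>)) \<le> 0"
  using c_nonpos impulse_point_in[OF V] by (intro sum_nonpos) auto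

text \<open>\<open>C\<close> keeps the values of \<open>w\<close> at the targets nonnegative. The
  costs enter the subtrahend, whose integral may be infinite, while the minuend is finite because
  the mean time is.\<close>

lemma impulse_payoff_eq:
  assumes fin: "mean_time P x V n < \<infinity>" and w: "continuous_on UNIV w" and C: "\<And>u. u \<in> U \<Longrightarrow> \<bar>w u\<bar> \<le> C"
  shows "impulse_payoff P f c lam w x V n =
    enn2ereal (\<integral>\<^sup>+\<omega>. (\<Sum>k\<le>n. seg V k \<top> \<omega>) + ennreal (w (snd V n \<omega>) + C) \<partial>Q)
    - enn2ereal (\<integral>\<^sup>+\<omega>. ennreal G * fst V n \<omega> + (\<Sum>i\<le>n. cost i \<omega>) + ennreal C \<partial>Q)"
    (is "_ = enn2ereal (integral\<^sup>N Q ?a) - enn2ereal (integral\<^sup>N Q ?b)")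
    and "(\<integral>\<^sup>+\<omega>. (\<Sum>k\<le>n. seg V k \<top> \<omega>) + ennreal (w (snd V n \<omega>) + C) \<partial>Q) < \<infinity>"
proof -
  note [measurable] = completion_measurable
  have wm [measurable]: "(\<lambda>\<omega>. w (snd V n \<omega>)) \<in> borel_measurable (completion Q)"
    by (rule measurable_compose[OF completion_measurable(4) borel_measurable_continuous_onI[OF w]])
  have a: "?a \<in> borel_measurable (completion Q)" and b: "?b \<in> borel_measurable (completion Q)" by measurable
  have "integral\<^sup>N Q ?a \<le> (\<integral>\<^sup>+\<omega>. (\<Sum>k\<le>n. seg V k \<top> \<omega>) + ennreal (2 * C) \<partial>completion Q)"
    unfolding nn_integral_completion
  proof (intro nn_integral_mono add_left_mono ennreal_leI)
    fix \<omega> assume "\<omega> \<in> space Q"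
    then have "snd V n \<omega> \<in> U" using impulse_point_in[OF V] by (simp add: spQ)
    from C[OF this] show "w (snd V n \<omega>) + C \<le> 2 * C" by simp
  qed
  also have "\<dots> = (\<integral>\<^sup>+\<omega>. (\<Sum>k\<le>n. seg V k \<top> \<omega>) \<partial>completion Q) + ennreal (2 * C)"
    by (subst nn_integral_add) (auto simp: Q.emeasure_space_1)
  also have "\<dots> < \<infinity>" using nn_integral_sum_seg_finite[OF fin] by (simp add: nn_integral_completion)
  finally show fa: "integral\<^sup>N Q ?a < \<infinity>" .
  show "impulse_payoff P f c lam w x V n = enn2ereal (integral\<^sup>N Q ?a) - enn2ereal (integral\<^sup>N Q ?b)"
    unfolding impulse_payoff_def
  proof (rule eexpectation_diff[OF a b fa])
    show "AE \<omega> in Q. ereal ((LBINT s:{s. 0 \<le> s \<and> ennreal s < fst V n \<omega>}. f (controlled V \<omega> s) - lam) +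
             (\<Sum>i\<le>n. c (pre_impulse V \<omega> i) (snd V i \<omega>)) + w (snd V n \<omega>)) =
       enn2ereal (?a \<omega>) - enn2ereal (?b \<omega>) \<and> ?b \<omega> < \<infinity>"
      using time_finite_AE[OF fin] AE_space
    proof eventually_elim
      case (elim \<omega>)
      then have w: "\<omega> \<in> space multi_path_space" and t: "fst V n \<omega> < \<infinity>" by (auto simp: spQ)
      let ?S = "\<Sum>k\<le>n. seg V k \<top> \<omega>" and ?c = "\<Sum>i\<le>n. c (pre_impulse V \<omega> i) (snd V i \<omega>)"
      obtain r where r: "fst V n \<omega> = ennreal r" "0 \<le> r" using t by (cases "fst V n \<omega>") auto
      have "?S < \<infinity>" by (rule le_less_trans[OF sum_seg_le[OF w]]) (simp add: r(1) ennreal_mult_less_top)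
      then obtain s where s: "?S = ennreal s" "0 \<le> s" by (cases ?S) auto
      have C0: "0 \<le> w (snd V n \<omega>) + C" "0 \<le> C" using C[OF impulse_point_in[OF V w, of n]] by auto
      have c0: "0 \<le> - ?c" using sum_c_nonpos[OF w] by simp
      have L: "(LBINT s:{s. 0 \<le> s \<and> ennreal s < fst V n \<omega>}. f (controlled V \<omega> s) - lam) = s - G * r"
        unfolding LBINT_controlled(1)[OF w t] sum_seg[OF w] s(1) unfolding r(1) using s(2) r(2) by simp
      have gc: "0 \<le> G * r - ?c" using mult_nonneg_nonneg[OF G_nonneg r(2)] c0 by linarith
      have "?a \<omega> = ennreal (s + (w (snd V n \<omega>) + C))" using s C0 by (simp only: ennreal_plus)
      moreover have "?b \<omega> = ennreal (G * r - ?c + C)"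
        unfolding sum_cost[OF w] r(1) using G_nonneg r(2) c0 C0 gc by (simp add: ennreal_mult[symmetric] ennreal_plus[symmetric] del: ennreal_plus)
      ultimately show ?case
        unfolding L using s(2) C0 gc by (simp del: ennreal_plus add: algebra_simps)
    qed
  qed
qed

lemma J_hat_numerator:
  assumes fin: "mean_time P x V n < \<infinity>"
  shows "eexpectation Q (\<lambda>\<omega>. ereal (
       (LBINT s:{s. 0 \<le> s \<and> ennreal s < fst V n \<omega>}. f (controlled V \<omega> s))
       + (\<Sum>i\<le>n. c (pre_impulse V \<omega> i) (snd V i \<omega>))))
    = enn2ereal (\<integral>\<^sup>+\<omega>. (\<Sum>k\<le>n. seg V k \<top> \<omega>) \<partial>Q)
    - enn2ereal (\<integral>\<^sup>+\<omega>. ennreal (G - lam) * fst V n \<omega> + (\<Sum>i\<le>n. cost i \<omega>) \<partial>Q)"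
    (is "_ = enn2ereal (integral\<^sup>N Q ?a) - enn2ereal (integral\<^sup>N Q ?b)")
proof -
  note [measurable] = completion_measurable
  have Gl: "0 \<le> G - lam" using G[of undefined] by linarith
  have a: "?a \<in> borel_measurable (completion Q)" and b: "?b \<in> borel_measurable (completion Q)" by measurable
  show ?thesis
  proof (rule eexpectation_diff[OF a b nn_integral_sum_seg_finite[OF fin]])
    show "AE \<omega> in Q. ereal ((LBINT s:{s. 0 \<le> s \<and> ennreal s < fst V n \<omega>}. f (controlled V \<omega> s)) +
             (\<Sum>i\<le>n. c (pre_impulse V \<omega> i) (snd V i \<omega>))) =
       enn2ereal (?a \<omega>) - enn2ereal (?b \<omega>) \<and> ?b \<omega> < \<infinity>"
      using time_finite_AE[OF fin] AE_space
    proof eventually_elim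
      case (elim \<omega>)
      then have w: "\<omega> \<in> space multi_path_space" and t: "fst V n \<omega> < \<infinity>" by (auto simp: spQ)
      let ?S = "\<Sum>k\<le>n. seg V k \<top> \<omega>" and ?c = "\<Sum>i\<le>n. c (pre_impulse V \<omega> i) (snd V i \<omega>)"
      obtain r where r: "fst V n \<omega> = ennreal r" "0 \<le> r" using t by (cases "fst V n \<omega>") auto
      have "?S < \<infinity>" by (rule le_less_trans[OF sum_seg_le[OF w]]) (simp add: r(1) ennreal_mult_less_top)
      then obtain s where s: "?S = ennreal s" "0 \<le> s" by (cases ?S) auto
      have c0: "0 \<le> - ?c" using sum_c_nonpos[OF w] by simp
      have L: "(LBINT s:{s. 0 \<le> s \<and> ennreal s < fst V n \<omega>}. f (controlled V \<omega> s)) = s - (G - lam) * r"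
        unfolding LBINT_controlled(2)[OF w t] sum_seg[OF w] s(1) unfolding r(1) using s(2) r(2) by simp
      have gc: "0 \<le> (G - lam) * r - ?c" using mult_nonneg_nonneg[OF Gl r(2)] c0 by linarith
      have b: "?b \<omega> = ennreal ((G - lam) * r - ?c)"
        unfolding sum_cost[OF w] r(1) using Gl r(2) c0 gc by (simp add: ennreal_mult[symmetric] ennreal_plus[symmetric] del: ennreal_plus)
      with L show ?case
        unfolding s(1) using s(2) gc b by (simp del: ennreal_plus add: algebra_simps)
    qed
  qed
qed

lemma nn_integral_coord_0:
  fixes H :: "(real \<Rightarrow> 'e) \<Rightarrow> ennreal"
  assumes "H \<in> borel_measurable (universal_completion path_space)"
  shows "(\<integral>\<^sup>+\<omega>. H (\<omega> 0) \<partial>Q) = (\<integral>\<^sup>+p. H p \<partial>P x)"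
  using nn_integral_distr_uc[OF assms Q coord_Q[of 0]] by (simp add: distr_coord_0)

end

section \<open>One-step form of the Bellman relations\<close>

lemma measurable_coord_0_raw: "(\<lambda>\<omega>. \<omega> 0) \<in> raw_multi_filt n t \<rightarrow>\<^sub>M raw_filt t"
  by (rule measurable_raw_filtI) (auto simp: space_multi_path_space intro: measurable_raw_multi_coord)

lemma measurable_const_multi_raw: "(\<lambda>p _. p) \<in> raw_filt t \<rightarrow>\<^sub>M raw_multi_filt n t"
  by (rule measurable_raw_multiI) (auto simp: space_multi_path_space intro: measurable_raw_filt_coord)

lemma multi_coord_in: "\<omega> \<in> space multi_path_space \<Longrightarrow> \<omega> i \<in> space path_space"
  by (simp add: space_multi_path_space)

text \<open>The strategy that acts at \<open>\<sigma>\<close> with target \<open>\<eta>\<close>,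
  both read from coordinate 0, and repeats the same impulse at the same time ever after. Its times
  do not tend to infinity where \<open>\<sigma>\<close> is finite, but the Bellman inequality
  concerns impulse strategies with finite mean times, and only the first impulse is
  evaluated.\<close>

lemma impulse_strategy_coord_0:
  fixes \<sigma> :: "(real \<Rightarrow> 'e::metric_space) \<Rightarrow> ennreal"
  assumes s: "stopping_time filt \<sigma>" and e: "\<eta> \<in> filtration.pre_sigma (space path_space) filt \<sigma> \<rightarrow>\<^sub>M restrict_space borel U"
  shows "impulse_strategy U (\<lambda>_ \<omega>. \<sigma> (\<omega> 0), \<lambda>_ \<omega>. \<eta> (\<omega> 0))"
  unfolding impulse_strategy_def
proof (intro allI conjI ballI)
  interpret F: filtration "space path_space" "filt :: ennreal \<Rightarrow> (real \<Rightarrow> 'e) measure" by (rule filtration_filt)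
  fix n
  interpret M: filtration "space multi_path_space" "multi_filt n :: ennreal \<Rightarrow> (nat \<Rightarrow> real \<Rightarrow> 'e) measure" by (rule filtration_multi_filt)
  have c: "(\<lambda>\<omega>. \<omega> 0) \<in> multi_filt n t \<rightarrow>\<^sub>M filt t" for t
    unfolding multi_filt_def filt_def by (rule measurable_universal_completion2[OF measurable_coord_0_raw])
  show st: "stopping_time (multi_filt n) (fst (\<lambda>_ \<omega>. \<sigma> (\<omega> 0), \<lambda>_ \<omega>. \<eta> (\<omega> 0)) n)"
    using measurable_compose[OF c stopping_timeD[OF s]] by (auto intro!: stopping_timeI)
  then have st': "stopping_time (multi_filt n) (\<lambda>\<omega>. \<sigma> (\<omega> 0))" by simp
  show "snd (\<lambda>_ \<omega>. \<sigma> (\<omega> 0), \<lambda>_ \<omega>. \<eta> (\<omega> 0)) n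
    \<in> M.pre_sigma (fst (\<lambda>_ \<omega>. \<sigma> (\<omega> 0), \<lambda>_ \<omega>. \<eta> (\<omega> 0)) n) \<rightarrow>\<^sub>M restrict_space borel U"
  proof (simp, rule measurableI)
    fix \<omega> assume "\<omega> \<in> space (M.pre_sigma (\<lambda>\<omega>. \<sigma> (\<omega> 0)))"
    then have "\<omega> 0 \<in> space (F.pre_sigma \<sigma>)" by (simp add: M.space_pre_sigma F.space_pre_sigma multi_coord_in)
    then show "\<eta> (\<omega> 0) \<in> space (restrict_space borel U)" by (rule measurable_space[OF e])
  next
    fix A assume A: "A \<in> sets (restrict_space borel U)"
    show "(\<lambda>\<omega>. \<eta> (\<omega> 0)) -` A \<inter> space (M.pre_sigma (\<lambda>\<omega>. \<sigma> (\<omega> 0))) \<in> sets (M.pre_sigma (\<lambda>\<omega>. \<sigma> (\<omega> 0)))"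
    proof (rule M.sets_pre_sigmaI[OF st'])
      fix t
      from measurable_sets[OF c F.sets_pre_sigmaD[OF s measurable_sets[OF e A]]]
      have "(\<lambda>\<omega>. \<omega> 0) -` {p \<in> \<eta> -` A \<inter> space (F.pre_sigma \<sigma>). \<sigma> p \<le> t} \<inter> space (multi_filt n t) \<in> sets (multi_filt n t)" .
      also have "(\<lambda>\<omega>. \<omega> 0) -` {p \<in> \<eta> -` A \<inter> space (F.pre_sigma \<sigma>). \<sigma> p \<le> t} \<inter> space (multi_filt n t)
        = {\<omega> \<in> (\<lambda>\<omega>. \<eta> (\<omega> 0)) -` A \<inter> space (M.pre_sigma (\<lambda>\<omega>. \<sigma> (\<omega> 0))). \<sigma> (\<omega> 0) \<le> t}"
        by (auto simp: M.space_pre_sigma F.space_pre_sigma multi_coord_in)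
      finally show "{\<omega> \<in> (\<lambda>\<omega>. \<eta> (\<omega> 0)) -` A \<inter> space (M.pre_sigma (\<lambda>\<omega>. \<sigma> (\<omega> 0))). \<sigma> (\<omega> 0) \<le> t} \<in> sets (multi_filt n t)" .
    qed
  qed
qed simp

lemma stopping_time_measurable_uc:
  assumes "stopping_time filt \<sigma>" shows "\<sigma> \<in> borel_measurable (universal_completion path_space)"
  by (rule measurable_stopping_time[OF assms]) (simp_all add: sets_filt_subset)

lemma pre_sigma_measurable_uc:
  fixes \<sigma> :: "(real \<Rightarrow> 'e::metric_space) \<Rightarrow> ennreal"
  assumes s: "stopping_time filt \<sigma>" and e: "\<eta> \<in> filtration.pre_sigma (space path_space) filt \<sigma> \<rightarrow>\<^sub>M N"
  shows "\<eta> \<in> universal_completion path_space \<rightarrow>\<^sub>M N"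
proof (rule measurableI)
  interpret F: filtration "space path_space" "filt :: ennreal \<Rightarrow> (real \<Rightarrow> 'e) measure" by (rule filtration_filt)
  show "\<eta> p \<in> space N" if "p \<in> space (universal_completion path_space)" for p
    using measurable_space[OF e, of p] that by (simp add: F.space_pre_sigma)
  fix A assume "A \<in> sets N"
  from F.sets_pre_sigmaD[OF s measurable_sets[OF e this], of \<top>]
  have "\<eta> -` A \<inter> space path_space \<in> sets (filt \<top>)" by (simp add: F.space_pre_sigma vimage_def Int_def)
  then show "\<eta> -` A \<inter> space (universal_completion path_space) \<in> sets (universal_completion path_space)"
    using sets_filt_subset by auto
qed

text \<open>The level \<open>C\<close> shifts the values of \<open>w\<close> that occur along a controlled path to nonnegative ones.\<close>

locale ergodic_bellman = running_reward f lam G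
  for f :: "'e::metric_space \<Rightarrow> real" and lam G :: real +
  fixes P :: "'e \<Rightarrow> (real \<Rightarrow> 'e) measure" and U :: "'e set" and c :: "'e \<Rightarrow> 'e \<Rightarrow> real"
    and z :: 'e and \<mu> :: "'e measure" and w :: "'e \<Rightarrow> real" and xihat :: "'e \<Rightarrow> 'e" and x :: 'e and C c0 :: real
  assumes P: "markov_family P" and U: "compact U" and zU: "z \<in> U"
    and c_cont: "continuous_on (UNIV \<times> U) (\<lambda>(x, \<xi>). c x \<xi>)"
    and c0: "0 < c0" and c_le: "\<And>y u. u \<in> U \<Longrightarrow> c y u \<le> - c0"
    and A2: "cond_A2 P \<mu>" and B2: "cond_B2 P U c" and B4: "cond_B4 P f \<mu>" and B5: "cond_B5 P U c"
    and lam_gt: "(\<integral>y. f y \<partial>\<mu>) < lam"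
    and bellman: "bellman_pair P U f c z lam w xihat"
    and C: "\<And>u. u \<in> insert x U \<Longrightarrow> \<bar>w u\<bar> \<le> C"
begin

lemma C_nonneg: "0 \<le> C" using C[of x] by auto

lemma w_cont: "continuous_on UNIV w" using bellman by (simp add: bellman_pair_def)

lemma reward_control: "impulse_strategy U V \<Longrightarrow> reward_control P U V f lam G c"
proof -
  assume V: "impulse_strategy U V"
  have cn: "\<And>y u. u \<in> U \<Longrightarrow> c y u \<le> 0" using c_le c0 by (meson less_imp_le neg_le_0_iff_le order_trans)
  show "reward_control P U V f lam G c"
    by (intro reward_control.intro impulse_control.intro reward_control_axioms.intro running_reward_axioms P U V c_cont cn)
qed

text \<open>The Bellman inequality at impulse 0 of the strategy that acts at
  \<open>\<sigma>\<close>. As a comparison of nonnegative integrals it remains meaningful when the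
  expected cost is infinite.\<close>

lemma one_step_le:
  assumes y: "y \<in> insert x U" and s: "stopping_time filt \<sigma>"
    and e: "\<eta> \<in> filtration.pre_sigma (space path_space) filt \<sigma> \<rightarrow>\<^sub>M restrict_space borel U"
    and fin: "(\<integral>\<^sup>+p. \<sigma> p \<partial>P y) < \<infinity>"
  shows "(\<integral>\<^sup>+p. area p (\<sigma> p) + ennreal (w (\<eta> p) + C) \<partial>P y)
    \<le> (\<integral>\<^sup>+p. ennreal (w y + C) + ennreal G * \<sigma> p + ennreal (- c (p (enn2real (\<sigma> p))) (\<eta> p)) \<partial>P y)"
proof -
  let ?V = "(\<lambda>_ \<omega>. \<sigma> (\<omega> 0), \<lambda>_ \<omega>. \<eta> (\<omega> 0)) :: 'e strategy"
  let ?N = "universal_completion (path_space :: (real \<Rightarrow> 'e) measure)"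
  have V: "impulse_strategy U ?V" by (rule impulse_strategy_coord_0[OF s e])
  interpret V: reward_control P U ?V y f lam G c by (rule reward_control[OF V])
  note sm[measurable] = stopping_time_measurable_uc[OF s]
  have em: "\<eta> \<in> ?N \<rightarrow>\<^sub>M borel" and eU: "\<And>p. p \<in> space ?N \<Longrightarrow> \<eta> p \<in> U"
    using pre_sigma_measurable_uc[OF s e] by (auto simp: measurable_restrict_space2_iff)
  have idm: "(\<lambda>p. p) \<in> ?N \<rightarrow>\<^sub>M path_space" by (rule measurable_universal_completion) simp
  have am: "(\<lambda>p. area p (\<sigma> p)) \<in> borel_measurable ?N" by (rule area_measurable[OF idm sm])
  have wm: "(\<lambda>p. w (\<eta> p)) \<in> borel_measurable ?N"
    by (rule measurable_compose[OF em borel_measurable_continuous_onI[OF w_cont]])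
  have cm: "(\<lambda>p. c (p (enn2real (\<sigma> p))) (\<eta> p)) \<in> borel_measurable ?N"
    by (rule measurable_caratheodory[OF c_cont U measurable_path_eval[OF idm] em eU]) auto
  note [measurable] = am wm cm
  have mt: "mean_time P y ?V i < \<infinity>" for i
    unfolding V.mean_time_eq using V.nn_integral_coord_0[OF sm] fin by simp
  have pay: "impulse_payoff P f c lam w y ?V 0 \<le> ereal (w y)"
    using bellman V mt unfolding bellman_pair_def by blast
  have Cu: "\<bar>w u\<bar> \<le> C" if "u \<in> U" for u using C that by blast
  have wy: "0 \<le> w y + C" using C[OF y] by linarith
  have seg0: "seg ?V 0 \<top> \<omega> = area (\<omega> 0) (\<sigma> (\<omega> 0))" for \<omega>
    by (simp add: seg_def area_def)
  have cost0: "V.cost 0 \<omega> = ennreal (- c (\<omega> 0 (enn2real (\<sigma> (\<omega> 0)))) (\<eta> (\<omega> 0)))" for \<omega>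
    by (simp add: V.cost_def pre_impulse_def)
  let ?A = "\<integral>\<^sup>+p. area p (\<sigma> p) + ennreal (w (\<eta> p) + C) \<partial>P y"
  let ?B = "\<integral>\<^sup>+p. ennreal G * \<sigma> p + ennreal (- c (p (enn2real (\<sigma> p))) (\<eta> p)) + ennreal C \<partial>P y"
  have A: "(\<integral>\<^sup>+\<omega>. (\<Sum>k\<le>0. seg ?V k \<top> \<omega>) + ennreal (w (snd ?V 0 \<omega>) + C) \<partial>V.Q) = ?A"
    using V.nn_integral_coord_0[of "\<lambda>p. area p (\<sigma> p) + ennreal (w (\<eta> p) + C)"] by (simp add: seg0)
  have B: "(\<integral>\<^sup>+\<omega>. ennreal G * fst ?V 0 \<omega> + (\<Sum>i\<le>0. V.cost i \<omega>) + ennreal C \<partial>V.Q) = ?B"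
    using V.nn_integral_coord_0[of "\<lambda>p. ennreal G * \<sigma> p + ennreal (- c (p (enn2real (\<sigma> p))) (\<eta> p)) + ennreal C"]
    by (simp add: cost0)
  have "?A < \<infinity>" using V.impulse_payoff_eq(2)[OF mt w_cont Cu, of 0] by (simp only: A)
  moreover have "enn2ereal ?A - enn2ereal ?B \<le> ereal (w y)"
    using pay V.impulse_payoff_eq(1)[OF mt w_cont Cu, of 0] by (simp only: A B)
  ultimately have AB: "?A + ennreal C \<le> ?B + ennreal (w y + C)"
    by (rule ennreal_eq_of_diff(1)) (use wy C_nonneg in auto)
  have mP: "g \<in> borel_measurable (completion (P y))" if "g \<in> borel_measurable ?N" for g :: "_ \<Rightarrow> ennreal"
    by (rule measurable_universal_completionD[OF that markov_family_prob[OF P]])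
       (simp_all add: markov_family_space[OF P] markov_family_sets[OF P])
  interpret Py: prob_space "P y" by (rule markov_family_prob[OF P])
  let ?g = "\<lambda>p. ennreal G * \<sigma> p + ennreal (- c (p (enn2real (\<sigma> p))) (\<eta> p))"
  have g: "?g \<in> borel_measurable (completion (P y))" by (rule mP) measurable
  have e1: "?B = (\<integral>\<^sup>+p. ?g p \<partial>P y) + ennreal C"
    using nn_integral_add[OF g, of "\<lambda>_. ennreal C"] by (simp add: nn_integral_completion Py.emeasure_space_1)
  have e2: "(\<integral>\<^sup>+p. ennreal (w y + C) + ?g p \<partial>P y) = ennreal (w y + C) + (\<integral>\<^sup>+p. ?g p \<partial>P y)"
    using nn_integral_add[OF _ g, of "\<lambda>_. ennreal (w y + C)"] by (simp add: nn_integral_completion Py.emeasure_space_1)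
  have "?A + ennreal C \<le> (\<integral>\<^sup>+p. ennreal (w y + C) + ?g p \<partial>P y) + ennreal C"
    using AB unfolding e1 e2 by (simp add: ac_simps)
  then have "?A \<le> (\<integral>\<^sup>+p. ennreal (w y + C) + ?g p \<partial>P y)" by (simp add: add.commute[of _ "ennreal C"] ennreal_add_left_cancel_le)
  then show ?thesis by (simp add: add.assoc)
qed

definition act_set :: "'e set" where "act_set = {y. w y = M_op U c w y}"

definition act :: "(real \<Rightarrow> 'e) \<Rightarrow> ennreal" where "act p = entry_time act_set p"

abbreviation "star \<equiv> star_strategy U c w xihat"

lemma star_impulse: "impulse_strategy U star" using bellman by (simp add: bellman_pair_def)

lemma star_0: "fst star 0 \<omega> = act (\<omega> 0)" "snd star 0 \<omega> = xihat (\<omega> 0 (enn2real (act (\<omega> 0))))"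
  by (simp_all add: star_strategy_def act_def act_set_def)

text \<open>That an entry time is a stopping time would be a debut theorem. Here it is inherited
  from the Bellman strategy being an impulse strategy, by pulling its first time back along the map
  from a path to the constant sequence of that path.\<close>

lemma act_stopping: "stopping_time filt act"
proof
  fix t
  have "(\<lambda>p _. p) \<in> filt t \<rightarrow>\<^sub>M multi_filt 0 t"
    unfolding filt_def multi_filt_def by (rule measurable_universal_completion2[OF measurable_const_multi_raw])
  moreover have "Measurable.pred (multi_filt 0 t) (\<lambda>\<omega>. fst star 0 \<omega> \<le> t)"
    using star_impulse by (simp add: impulse_strategy_def stopping_timeD)
  ultimately show "Measurable.pred (filt t) (\<lambda>p. act p \<le> t)"
    unfolding star_0 by (rule measurable_compose)
qed

lemma xihat_U: "xihat y \<in> U"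
  and xihat_measurable: "xihat \<in> borel \<rightarrow>\<^sub>M borel"
  using bellman by (auto simp: bellman_pair_def measurable_restrict_space2_iff)

lemma act_compact: "compact \<Gamma> \<Longrightarrow> (SUP y\<in>\<Gamma>. \<integral>\<^sup>+p. act p \<partial>P y) < \<infinity>"
proof -
  assume "compact \<Gamma>"
  moreover have "\<forall>\<Gamma>. compact \<Gamma> \<longrightarrow> (SUP y\<in>\<Gamma>. \<integral>\<^sup>+p. entry_time {y. w y = M_op U c w y} p \<partial>completion (P y)) < \<infinity>"
    using bellman unfolding bellman_pair_def by blast
  ultimately show ?thesis by (simp add: act_def act_set_def nn_integral_completion)
qed

lemma act_finite: "(\<integral>\<^sup>+p. act p \<partial>P y) < \<infinity>"
  using act_compact[of "{y}"] by simp

text \<open>The starting point is arbitrary, because the time to the first impulse has to be bounded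
  at every point the uncontrolled process may reach. So the level \<open>D\<close> may depend on
  \<open>y\<close>, in contrast to \<open>C\<close>, which is tied to
  \<open>insert x U\<close>.\<close>

lemma one_step_star:
  assumes y: "0 \<le> w y + D" and D: "\<And>u. u \<in> U \<Longrightarrow> \<bar>w u\<bar> \<le> D"
  shows "(\<integral>\<^sup>+p. area p (act p) + ennreal (w (xihat (p (enn2real (act p)))) + D) \<partial>P y)
    = (\<integral>\<^sup>+p. ennreal (w y + D) + ennreal G * act p + ennreal (- c (p (enn2real (act p))) (xihat (p (enn2real (act p))))) \<partial>P y)"
    (is "?A = ?R")
proof -
  let ?N = "universal_completion (path_space :: (real \<Rightarrow> 'e) measure)"
  let ?X = "\<lambda>p. p (enn2real (act p))"
  interpret V: reward_control P U star y f lam G c by (rule reward_control[OF star_impulse])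
  note sm[measurable] = stopping_time_measurable_uc[OF act_stopping]
  have idm: "(\<lambda>p. p) \<in> ?N \<rightarrow>\<^sub>M path_space" by (rule measurable_universal_completion) simp
  have Xm: "?X \<in> ?N \<rightarrow>\<^sub>M borel" by (rule measurable_path_eval[OF idm]) auto
  have em: "(\<lambda>p. xihat (?X p)) \<in> ?N \<rightarrow>\<^sub>M borel" by (rule measurable_compose[OF Xm xihat_measurable])
  have am: "(\<lambda>p. area p (act p)) \<in> borel_measurable ?N" by (rule area_measurable[OF idm sm])
  have wm: "(\<lambda>p. w (xihat (?X p))) \<in> borel_measurable ?N"
    by (rule measurable_compose[OF em borel_measurable_continuous_onI[OF w_cont]])
  have cm: "(\<lambda>p. c (?X p) (xihat (?X p))) \<in> borel_measurable ?N"
    by (rule measurable_caratheodory[OF c_cont U Xm em xihat_U])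
  note [measurable] = am wm cm
  have mt: "mean_time P y star 0 < \<infinity>"
    unfolding V.mean_time_eq star_0 V.nn_integral_coord_0[OF sm] by (rule act_finite)
  have pay: "impulse_payoff P f c lam w y star 0 = ereal (w y)"
    using bellman unfolding bellman_pair_def by blast
  have D0: "0 \<le> D" using D[OF zU] by auto
  have seg0: "seg star 0 \<top> \<omega> = area (\<omega> 0) (act (\<omega> 0))" for \<omega>
    by (simp add: seg_def area_def star_0)
  have cost0: "V.cost 0 \<omega> = ennreal (- c (?X (\<omega> 0)) (xihat (?X (\<omega> 0))))" for \<omega>
    by (simp add: V.cost_def pre_impulse_def star_0)
  let ?B = "\<integral>\<^sup>+p. ennreal G * act p + ennreal (- c (?X p) (xihat (?X p))) + ennreal D \<partial>P y"
  have A: "(\<integral>\<^sup>+\<omega>. (\<Sum>k\<le>0. seg star k \<top> \<omega>) + ennreal (w (snd star 0 \<omega>) + D) \<partial>V.Q) = ?A"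
    using V.nn_integral_coord_0[of "\<lambda>p. area p (act p) + ennreal (w (xihat (?X p)) + D)"] by (simp add: seg0 star_0)
  have B: "(\<integral>\<^sup>+\<omega>. ennreal G * fst star 0 \<omega> + (\<Sum>i\<le>0. V.cost i \<omega>) + ennreal D \<partial>V.Q) = ?B"
    using V.nn_integral_coord_0[of "\<lambda>p. ennreal G * act p + ennreal (- c (?X p) (xihat (?X p))) + ennreal D"]
    by (simp add: cost0 star_0)
  have "?A < \<infinity>" using V.impulse_payoff_eq(2)[OF mt w_cont D] by (simp only: A)
  moreover have "enn2ereal ?A - enn2ereal ?B = ereal (w y)"
    using pay V.impulse_payoff_eq(1)[OF mt w_cont D] by (simp only: A B)
  ultimately have AB: "?A + ennreal D = ?B + ennreal (w y + D) \<and> ?B < \<infinity>"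
    by (rule ennreal_eq_of_diff(2)) (use y D0 in auto)
  have mP: "g \<in> borel_measurable (completion (P y))" if "g \<in> borel_measurable ?N" for g :: "_ \<Rightarrow> ennreal"
    by (rule measurable_universal_completionD[OF that markov_family_prob[OF P]])
       (simp_all add: markov_family_space[OF P] markov_family_sets[OF P])
  interpret Py: prob_space "P y" by (rule markov_family_prob[OF P])
  let ?g = "\<lambda>p. ennreal G * act p + ennreal (- c (?X p) (xihat (?X p)))"
  have g: "?g \<in> borel_measurable (completion (P y))" by (rule mP) measurable
  have e1: "?B = (\<integral>\<^sup>+p. ?g p \<partial>P y) + ennreal D"
    using nn_integral_add[OF g, of "\<lambda>_. ennreal D"] by (simp add: nn_integral_completion Py.emeasure_space_1)
  have e2: "(\<integral>\<^sup>+p. ennreal (w y + D) + ?g p \<partial>P y) = ennreal (w y + D) + (\<integral>\<^sup>+p. ?g p \<partial>P y)"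
    using nn_integral_add[OF _ g, of "\<lambda>_. ennreal (w y + D)"] by (simp add: nn_integral_completion Py.emeasure_space_1)
  have "?A + ennreal D = (\<integral>\<^sup>+p. ennreal (w y + D) + ?g p \<partial>P y) + ennreal D"
    using AB unfolding e1 e2 by (simp add: ac_simps)
  then have "?A = (\<integral>\<^sup>+p. ennreal (w y + D) + ?g p \<partial>P y)" by (simp add: add.commute[of _ "ennreal D"] ennreal_add_left_cancel)
  then show ?thesis by (simp add: add.assoc)
qed

end

subsection \<open>The potential of the centred reward\<close>

text \<open>\<open>tv_norm\<close> is a supremum of reals and dominates its members only if these
  are bounded above. They are at most 2, since disjoint sets have total mass at most 1 under each
  law.\<close>

lemma tv_norm_bdd:
  assumes M: "prob_space M" and N: "prob_space N" and sets: "sets N = sets M"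
  shows "bdd_above ((\<lambda>\<A>. \<Sum>A\<in>\<A>. \<bar>measure M A - measure N A\<bar>) ` {\<A>. finite \<A> \<and> disjoint \<A> \<and> \<A> \<subseteq> sets M})"
proof (rule bdd_aboveI2)
  fix \<A> assume A: "\<A> \<in> {\<A>. finite \<A> \<and> disjoint \<A> \<and> \<A> \<subseteq> sets M}"
  have s: "(\<Sum>A\<in>\<A>. measure L A) \<le> 1" if "prob_space L" "sets L = sets M" for L
  proof -
    interpret L: prob_space L by fact
    have "disjoint_family_on (\<lambda>A. A) \<A>" using A by (auto simp: disjoint_family_on_def disjoint_def)
    then have "measure L (\<Union>A\<in>\<A>. A) = (\<Sum>A\<in>\<A>. measure L A)"
      using A that(2) by (intro measure_finite_Union) auto
    then show ?thesis using L.prob_le_1 by metis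
  qed
  have "(\<Sum>A\<in>\<A>. \<bar>measure M A - measure N A\<bar>) \<le> (\<Sum>A\<in>\<A>. measure M A + measure N A)"
    by (intro sum_mono) (simp add: abs_if add_increasing add_increasing2)
  also have "\<dots> = (\<Sum>A\<in>\<A>. measure M A) + (\<Sum>A\<in>\<A>. measure N A)" by (rule sum.distrib)
  also have "\<dots> \<le> 2" using s[OF M] s[OF N sets] by simp
  finally show "(\<Sum>A\<in>\<A>. \<bar>measure M A - measure N A\<bar>) \<le> 2" .
qed

lemma tv_norm_ge:
  assumes "prob_space M" "prob_space N" "sets N = sets M" and A: "A \<in> sets M"
  shows "\<bar>measure M A - measure N A\<bar> \<le> tv_norm M N"
  unfolding tv_norm_def
  by (rule order_trans[OF _ cSUP_upper[OF _ tv_norm_bdd[OF assms(1-3)], of "{A}"]])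
     (use A in \<open>auto simp: disjoint_def\<close>)

lemma nn_integral_layer_cake:
  assumes M: "prob_space M" and \<phi>[measurable]: "\<phi> \<in> borel_measurable M"
  shows "(\<integral>\<^sup>+x. ennreal (\<phi> x) \<partial>M) = (\<integral>\<^sup>+u. emeasure M {x\<in>space M. u < \<phi> x} * indicator {0..} u \<partial>lborel)"
proof -
  interpret M: prob_space M by fact
  interpret pair_sigma_finite M lborel by unfold_locales
  have "(\<integral>\<^sup>+u. emeasure M {x\<in>space M. u < \<phi> x} * indicator {0..} u \<partial>lborel)
      = (\<integral>\<^sup>+u. (\<integral>\<^sup>+x. indicator {z\<in>space (M \<Otimes>\<^sub>M lborel). 0 \<le> snd z \<and> snd z < \<phi> (fst z)} (x, u) \<partial>M) \<partial>lborel)"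
  proof (rule nn_integral_cong)
    fix u :: real
    have "(\<integral>\<^sup>+x. indicator {z\<in>space (M \<Otimes>\<^sub>M lborel). 0 \<le> snd z \<and> snd z < \<phi> (fst z)} (x, u) \<partial>M)
      = (\<integral>\<^sup>+x. indicator {x\<in>space M. u < \<phi> x} x * indicator {0..} u \<partial>M)"
      by (intro nn_integral_cong) (auto simp: indicator_def space_pair_measure)
    also have "\<dots> = emeasure M {x\<in>space M. u < \<phi> x} * indicator {0..} u"
      by (subst nn_integral_multc) auto
    finally show "emeasure M {x\<in>space M. u < \<phi> x} * indicator {0..} u
      = (\<integral>\<^sup>+x. indicator {z\<in>space (M \<Otimes>\<^sub>M lborel). 0 \<le> snd z \<and> snd z < \<phi> (fst z)} (x, u) \<partial>M)" ..
  qed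
  also have "\<dots> = (\<integral>\<^sup>+x. (\<integral>\<^sup>+u. indicator {z\<in>space (M \<Otimes>\<^sub>M lborel). 0 \<le> snd z \<and> snd z < \<phi> (fst z)} (x, u) \<partial>lborel) \<partial>M)"
    by (rule Fubini') measurable
  also have "\<dots> = (\<integral>\<^sup>+x. ennreal (\<phi> x) \<partial>M)"
  proof (rule nn_integral_cong)
    fix x assume "x \<in> space M"
    then have "(\<integral>\<^sup>+u. indicator {z\<in>space (M \<Otimes>\<^sub>M lborel). 0 \<le> snd z \<and> snd z < \<phi> (fst z)} (x, u) \<partial>lborel)
      = (\<integral>\<^sup>+u. indicator {0..<\<phi> x} u \<partial>lborel)"
      by (intro nn_integral_cong) (auto simp: indicator_def space_pair_measure)
    also have "\<dots> = ennreal (\<phi> x)" by (cases "0 \<le> \<phi> x") (auto simp: ennreal_neg)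
    finally show "(\<integral>\<^sup>+u. indicator {z\<in>space (M \<Otimes>\<^sub>M lborel). 0 \<le> snd z \<and> snd z < \<phi> (fst z)} (x, u) \<partial>lborel) = ennreal (\<phi> x)" .
  qed
  finally show ?thesis ..
qed

text \<open>Layer cake for \<phi> + F, whose values lie in [0, 2 F]: each level contributes the
  difference of the probabilities of one set, at most \<open>tv_norm M N\<close>. This is the origin
  of the factor \<open>2 * F\<close>.\<close>

lemma integral_tv:
  fixes \<phi> :: "'a \<Rightarrow> real"
  assumes M: "prob_space M" and N: "prob_space N" and sets: "sets N = sets M"
    and \<phi>: "\<phi> \<in> borel_measurable M" and F: "\<And>x. \<bar>\<phi> x\<bar> \<le> F"
  shows "\<bar>(\<integral>x. \<phi> x \<partial>M) - (\<integral>x. \<phi> x \<partial>N)\<bar> \<le> 2 * F * tv_norm M N"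
proof -
  have F0: "0 \<le> F" using F[of undefined] by linarith
  have t0: "0 \<le> tv_norm M N" using tv_norm_ge[OF M N sets, of "{}"] by simp
  have nnb: "0 \<le> \<phi> x + F" for x using F[of x] by linarith
  have key: "(\<integral>x. \<phi> x \<partial>L) \<le> (\<integral>x. \<phi> x \<partial>L') + 2 * F * tv_norm M N"
    if L: "prob_space L" and L': "prob_space L'" and sL: "sets L = sets M" "sets L' = sets M"
      and d: "\<And>A. A \<in> sets M \<Longrightarrow> measure L A \<le> measure L' A + tv_norm M N" for L L'
  proof -
    interpret L: prob_space L by fact
    interpret L': prob_space L' by fact
    have \<phi>L: "\<phi> \<in> borel_measurable L" "\<phi> \<in> borel_measurable L'"
      using \<phi> measurable_cong_sets[OF sL(1) refl] measurable_cong_sets[OF sL(2) refl] by blast+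
    have sp: "space L = space M" "space L' = space M" using sL[THEN sets_eq_imp_space_eq] .
    have i: "integrable L \<phi>" "integrable L' \<phi>"
      using F \<phi>L by (auto intro!: L.integrable_const_bound[of _ F] L'.integrable_const_bound[of _ F])
    have em: "emeasure L {x\<in>space L. u < \<phi> x + F} \<le> emeasure L' {x\<in>space L'. u < \<phi> x + F} + ennreal (tv_norm M N)" for u
    proof -
      have "{x\<in>space M. u < \<phi> x + F} \<in> sets M" using \<phi> by measurable
      from d[OF this] show ?thesis
        unfolding sp by (simp add: L.emeasure_eq_measure L'.emeasure_eq_measure t0 ennreal_plus[symmetric] ennreal_leI del: ennreal_plus)
    qed
    have "(\<integral>\<^sup>+x. ennreal (\<phi> x + F) \<partial>L) = (\<integral>\<^sup>+u. emeasure L {x\<in>space L. u < \<phi> x + F} * indicator {0..} u \<partial>lborel)"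
      using \<phi>L by (intro nn_integral_layer_cake[OF L]) auto
    also have "\<dots> \<le> (\<integral>\<^sup>+u. emeasure L' {x\<in>space L'. u < \<phi> x + F} * indicator {0..} u + ennreal (tv_norm M N) * indicator {0..2 * F} u \<partial>lborel)"
    proof (rule nn_integral_mono)
      fix u :: real
      show "emeasure L {x\<in>space L. u < \<phi> x + F} * indicator {0..} u
        \<le> emeasure L' {x\<in>space L'. u < \<phi> x + F} * indicator {0..} u + ennreal (tv_norm M N) * indicator {0..2 * F} u"
      proof (cases "0 \<le> u \<and> u \<le> 2 * F")
        case True then show ?thesis using em[of u] by simp
      next
        case False
        show ?thesis
        proof (cases "0 \<le> u")
          case True
          then have "2 * F < u" using False by simp
          then have "{x\<in>space L. u < \<phi> x + F} = {}" using F by (smt (verit) Collect_empty_eq abs_le_iff)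
          then show ?thesis by (simp only: emeasure_empty mult_zero_left zero_le)
        qed simp
      qed
    qed
    also have "\<dots> = (\<integral>\<^sup>+x. ennreal (\<phi> x + F) \<partial>L') + ennreal (tv_norm M N) * ennreal (2 * F)"
    proof (subst nn_integral_add)
      show "(\<lambda>u. emeasure L' {x\<in>space L'. u < \<phi> x + F} * indicator {0..} u) \<in> borel_measurable lborel"
      proof (intro borel_measurable_times_ennreal borel_measurable_indicator)
        have "antimono (\<lambda>u. emeasure L' {x\<in>space L'. u < \<phi> x + F})"
        proof (rule antimonoI)
          fix u v :: real assume "u \<le> v"
          then show "emeasure L' {x\<in>space L'. v < \<phi> x + F} \<le> emeasure L' {x\<in>space L'. u < \<phi> x + F}"
            using \<phi>L by (intro emeasure_mono) auto
        qed
        then have m: "mono (\<lambda>u. - enn2real (emeasure L' {x\<in>space L'. u < \<phi> x + F}))"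
          by (auto simp: mono_def antimono_def L'.emeasure_eq_measure)
        have "(\<lambda>u. ennreal (- (- enn2real (emeasure L' {x\<in>space L'. u < \<phi> x + F})))) \<in> borel_measurable borel"
          by (intro measurable_compose[OF _ measurable_ennreal] borel_measurable_uminus borel_measurable_mono m)
        then show "(\<lambda>u. emeasure L' {x\<in>space L'. u < \<phi> x + F}) \<in> borel_measurable lborel"
          by (simp add: L'.emeasure_eq_measure)
      qed simp
      show "(\<integral>\<^sup>+u. emeasure L' {x\<in>space L'. u < \<phi> x + F} * indicator {0..} u \<partial>lborel) + (\<integral>\<^sup>+u. ennreal (tv_norm M N) * indicator {0..2 * F} u \<partial>lborel)
          = (\<integral>\<^sup>+x. ennreal (\<phi> x + F) \<partial>L') + ennreal (tv_norm M N) * ennreal (2 * F)"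
        using \<phi>L F0 by (subst nn_integral_layer_cake[OF L']) (auto simp: nn_integral_cmult_indicator)
    qed simp
    finally have le: "(\<integral>\<^sup>+x. ennreal (\<phi> x + F) \<partial>L) \<le> (\<integral>\<^sup>+x. ennreal (\<phi> x + F) \<partial>L') + ennreal (tv_norm M N * (2 * F))"
      using F0 t0 by (simp add: ennreal_mult)
    have e: "(\<integral>\<^sup>+x. ennreal (\<phi> x + F) \<partial>L) = ennreal ((\<integral>x. \<phi> x \<partial>L) + F)"
      using i nnb by (subst nn_integral_eq_integral) (auto simp: L.prob_space)
    have e': "(\<integral>\<^sup>+x. ennreal (\<phi> x + F) \<partial>L') = ennreal ((\<integral>x. \<phi> x \<partial>L') + F)"
      using i nnb by (subst nn_integral_eq_integral) (auto simp: L'.prob_space)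
    have p: "0 \<le> (\<integral>x. \<phi> x \<partial>L') + F"
    proof -
      have "0 \<le> (\<integral>x. \<phi> x + F \<partial>L')" using nnb by (rule integral_nonneg_AE[OF AE_I2])
      then show ?thesis using i by (simp add: L'.prob_space)
    qed
    show ?thesis
      using le p F0 t0 unfolding e e' by (simp add: ennreal_plus[symmetric] mult_ac del: ennreal_plus)
  qed
  have "(\<integral>x. \<phi> x \<partial>M) \<le> (\<integral>x. \<phi> x \<partial>N) + 2 * F * tv_norm M N"
    using tv_norm_ge[OF M N sets] by (intro key[OF M N refl sets]) (smt (verit))
  moreover have "(\<integral>x. \<phi> x \<partial>N) \<le> (\<integral>x. \<phi> x \<partial>M) + 2 * F * tv_norm M N"
    using tv_norm_ge[OF M N sets] by (intro key[OF N M sets refl]) (smt (verit))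
  ultimately show ?thesis by linarith
qed

context running_reward
begin

lemma path_reward_measurable:
  assumes "p \<in> space path_space"
  shows "(\<lambda>s. f (p (max 0 s))) \<in> borel_measurable borel"
  by (rule measurable_compose[OF measurable_path_eval[of "\<lambda>_. p"] f_measurable]) (use assms in auto)

lemma area_split:
  assumes p: "p \<in> space path_space" and r: "0 \<le> r"
  shows "area p (min t (ennreal r)) + area (shift r p) (t - ennreal r) = area p t"
proof -
  let ?H = "\<lambda>s. ennreal (f (p (max 0 s)) - lam + G) * indicator {s. 0 \<le> s \<and> r \<le> s \<and> ennreal s < t} s"
  have Hm: "?H \<in> borel_measurable borel"
  proof -
    have "{s \<in> space borel. 0 \<le> s \<and> r \<le> s \<and> ennreal s < t} \<in> sets (borel :: real measure)" by measurable
    then show ?thesis using path_reward_measurable[OF p] by simp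
  qed
  have lt: "ennreal s < t - ennreal r \<longleftrightarrow> ennreal (r + s) < t" if "0 \<le> s" for s
    using r that by (cases t) (auto simp: ennreal_minus ennreal_less_iff ennreal_plus[symmetric] simp del: ennreal_plus)
  have "area (shift r p) (t - ennreal r) = (\<integral>\<^sup>+s. ?H (r + 1 * s) \<partial>lborel)"
    unfolding area_def using r lt
    by (intro nn_integral_cong) (auto simp: indicator_def shift_def max_def)
  also have "\<dots> = (\<integral>\<^sup>+s. ?H s \<partial>lborel)"
    using nn_integral_real_affine[OF Hm, of 1 r] by simp
  finally have 1: "area (shift r p) (t - ennreal r) = (\<integral>\<^sup>+s. ?H s \<partial>lborel)" .
  let ?L = "\<lambda>s. ennreal (f (p (max 0 s)) - lam + G) * indicator {s. 0 \<le> s \<and> ennreal s < min t (ennreal r)} s"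
  have Lm: "?L \<in> borel_measurable borel"
    using path_reward_measurable[OF p] before_sets[of "min t (ennreal r)"] by simp
  have 2: "area p (min t (ennreal r)) = (\<integral>\<^sup>+s. ?L s \<partial>lborel)"
    unfolding area_def by (intro nn_integral_cong) (auto simp: indicator_def max_def)
  have "area p (min t (ennreal r)) + area (shift r p) (t - ennreal r) = (\<integral>\<^sup>+s. ?L s + ?H s \<partial>lborel)"
    unfolding 1 2 using Hm Lm by (simp add: nn_integral_add)
  also have "\<dots> = area p t"
    unfolding area_def using r by (intro nn_integral_cong) (auto simp: indicator_def max_def ennreal_less_iff)
  finally show ?thesis .
qed

end

text \<open>\<open>K\<close> and \<open>h\<close> are a rate from (A2), fixed once;
  \<open>Cq\<close> is the bound of (B4) for the potential at \<alpha> = 0.\<close>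

locale ergodic_rate = ergodic_bellman f lam G P U c z \<mu> w xihat x C c0
  for f :: "'e::metric_space \<Rightarrow> real" and lam G and P :: "'e \<Rightarrow> (real \<Rightarrow> 'e) measure" and U c z \<mu> w xihat x C c0 +
  fixes K :: "'e \<Rightarrow> real" and h :: "real \<Rightarrow> real" and Cq :: real
  assumes rate: "tv_rate P \<mu> K h" and KT: "\<And>y T. 0 \<le> T \<Longrightarrow> (\<integral>\<^sup>+p. ennreal (K (p T)) \<partial>P y) < \<infinity>"
    and AK: "asymp_unif_integrable P K" and Cq: "\<And>y. - q_pot P f \<mu> 0 y \<le> Cq" "0 \<le> Cq"
begin

lemma \<mu>: "prob_space \<mu>" and \<mu>_sets: "sets \<mu> = sets borel" and K_measurable: "K \<in> borel_measurable borel"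
  and K_pos: "0 < K y" and h_nonneg: "0 \<le> t \<Longrightarrow> 0 \<le> h t" and h_int: "set_integrable lborel {0..} h"
  and tv: "0 \<le> t \<Longrightarrow> tv_norm (trans_prob P t y) \<mu> \<le> K y * h t"
  using rate by (auto simp: tv_rate_def)

abbreviation "muf \<equiv> \<integral>y. f y \<partial>\<mu>"
abbreviation "gap \<equiv> lam - muf"
definition "Ih = (LBINT t:{0..}. h t)"

lemma coord_P: "0 \<le> t \<Longrightarrow> (\<lambda>p. p t) \<in> P y \<rightarrow>\<^sub>M borel"
  unfolding markov_family_cong[OF P] by (rule measurable_path_coord)

lemma id_P: "(\<lambda>p. p) \<in> P y \<rightarrow>\<^sub>M path_space"
  unfolding markov_family_cong[OF P] by simp

lemma P_prob: "prob_space (P y)" by (rule markov_family_prob[OF P])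

lemma P_uc: "g \<in> universal_completion path_space \<rightarrow>\<^sub>M N \<Longrightarrow> g \<in> completion (P y) \<rightarrow>\<^sub>M N"
  by (erule measurable_universal_completionD[OF _ P_prob])
     (simp_all add: markov_family_space[OF P] markov_family_sets[OF P])

lemma trans_prob: "0 \<le> t \<Longrightarrow> prob_space (trans_prob P t y)" "sets (trans_prob P t y) = sets borel"
  unfolding trans_prob_def by (auto intro: prob_space.prob_space_distr[OF P_prob coord_P])

lemma trans_prob_measure: "0 \<le> t \<Longrightarrow> B \<in> sets borel \<Longrightarrow> \<bar>measure (trans_prob P t y) B - measure \<mu> B\<bar> \<le> K y * h t"
  using tv_norm_ge[OF trans_prob(1) \<mu>, of t y B] tv[of t y] trans_prob(2)[of t y] \<mu>_sets by simp

definition m :: "real \<Rightarrow> 'e \<Rightarrow> real" where "m t y = (\<integral>p. f (p t) \<partial>P y) - muf"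

lemma f_bound: "\<bar>f y\<bar> \<le> G" using G[of y] by linarith

lemma m_bound: assumes "0 \<le> t" shows "\<bar>m t y\<bar> \<le> 2 * G * (K y * h t)"
proof -
  have "\<bar>(\<integral>y. f y \<partial>trans_prob P t y) - muf\<bar> \<le> 2 * G * tv_norm (trans_prob P t y) \<mu>"
    using trans_prob(2)[of t y] f_measurable \<mu>_sets
    by (intro integral_tv[OF trans_prob(1)[OF assms] \<mu> _ _ f_bound]) (auto simp: measurable_cong_sets[OF trans_prob(2) refl])
  also have "(\<integral>y. f y \<partial>trans_prob P t y) = (\<integral>p. f (p t) \<partial>P y)"
    unfolding trans_prob_def by (rule integral_distr[OF coord_P[OF assms] f_measurable])
  also have "2 * G * tv_norm (trans_prob P t y) \<mu> \<le> 2 * G * (K y * h t)"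
    using tv[OF assms] G_nonneg by (intro mult_left_mono) auto
  finally show ?thesis by (simp add: m_def)
qed

definition u :: "real \<Rightarrow> 'e \<Rightarrow> ennreal" where "u T y = (\<integral>\<^sup>+p. area p (ennreal T) \<partial>P y)"

lemma area_path_measurable: "(\<lambda>p. area p t) \<in> borel_measurable path_space"
  by (rule area_measurable[of "\<lambda>p. p"]) auto

lemma u_le: "0 \<le> T \<Longrightarrow> u T y \<le> ennreal (2 * G * T)"
proof -
  assume T: "0 \<le> T"
  interpret prob_space "P y" by (rule P_prob)
  have "u T y \<le> (\<integral>\<^sup>+p. ennreal (2 * G) * ennreal T \<partial>P y)"
    unfolding u_def by (intro nn_integral_mono area_le)
  then show ?thesis using T G_nonneg by (simp add: emeasure_space_1 ennreal_mult)
qed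

lemma u_measurable: "u T \<in> borel_measurable borel"
proof -
  have "(\<lambda>y. \<integral>\<^sup>+p. area p (ennreal T) \<partial>P y) \<in> borel_measurable borel"
    by (rule nn_integral_measurable_subprob_algebra2[OF _ measurable_prob_algebraD[OF markov_family_measurable[OF P]]])
       (use measurable_compose[OF measurable_snd area_path_measurable] in \<open>simp add: split_def\<close>)
  then show ?thesis by (simp add: u_def[abs_def])
qed

lemma u_add: assumes "0 \<le> T" shows "u (1 + T) y = u 1 y + (\<integral>\<^sup>+p. u T (p 1) \<partial>P y)"
proof -
  have am: "(\<lambda>p. area p t) \<in> borel_measurable (P y)" for t
    unfolding markov_family_cong[OF P] by (rule area_path_measurable)
  have sm: "(\<lambda>p. area (shift 1 p) t) \<in> borel_measurable (P y)" for t
    unfolding markov_family_cong[OF P]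
    by (rule measurable_compose[OF measurable_shift area_path_measurable]) simp
  have e: "min (ennreal (1 + T)) (ennreal 1) = ennreal 1" "ennreal (1 + T) - ennreal 1 = ennreal T"
    using assms by (simp_all add: min_def ennreal_minus ennreal_le_iff del: ennreal_1 ennreal_plus)
  have "area p (ennreal (1 + T)) = area p (ennreal 1) + area (shift 1 p) (ennreal T)" if "p \<in> space (P y)" for p
    using area_split[of p 1 "ennreal (1 + T)", unfolded e] that
    by (simp add: markov_family_space[OF P] del: ennreal_1 ennreal_plus)
  then have "u (1 + T) y = (\<integral>\<^sup>+p. area p (ennreal 1) + area (shift 1 p) (ennreal T) \<partial>P y)"
    unfolding u_def by (intro nn_integral_cong) simp
  also have "\<dots> = u 1 y + (\<integral>\<^sup>+p. area (shift 1 p) (ennreal T) \<partial>P y)"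
    unfolding u_def by (rule nn_integral_add[OF am sm])
  also have "(\<integral>\<^sup>+p. area (shift 1 p) (ennreal T) \<partial>P y) = (\<integral>\<^sup>+p. u T (p 1) \<partial>P y)"
  proof -
    have sp: "space (path_space :: (real \<Rightarrow> 'e) measure) \<in> sets (filt (ennreal 1))"
      using sets.top[of "filt (ennreal 1) :: (real \<Rightarrow> 'e) measure"] by simp
    have "(\<integral>\<^sup>+p. area (shift 1 p) (ennreal T) \<partial>P y) = (\<integral>\<^sup>+p. indicator (space path_space) p * area (shift 1 p) (ennreal T) \<partial>P y)"
      by (intro nn_integral_cong) (simp add: markov_family_space[OF P])
    also have "\<dots> = (\<integral>\<^sup>+p. indicator (space path_space) p * (\<integral>\<^sup>+q. area q (ennreal T) \<partial>P (p 1)) \<partial>P y)"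
      by (rule markov_property[OF P _ sp measurable_universal_completion[OF area_path_measurable]]) simp
    also have "\<dots> = (\<integral>\<^sup>+p. u T (p 1) \<partial>P y)"
      by (intro nn_integral_cong) (simp add: markov_family_space[OF P] u_def)
    finally show ?thesis .
  qed
  finally show ?thesis .
qed

lemma mean_reward: "0 \<le> t \<Longrightarrow> (\<integral>\<^sup>+p. ennreal (f (p t) - lam + G) \<partial>P y) = ennreal ((\<integral>p. f (p t) \<partial>P y) - lam + G)"
  and mean_bound: "0 \<le> t \<Longrightarrow> \<bar>(\<integral>p. f (p t) \<partial>P y) - lam\<bar> \<le> G"
proof -
  assume t: "0 \<le> t"
  interpret prob_space "P y" by (rule P_prob)
  have i: "integrable (P y) (\<lambda>p. f (p t))"
    by (rule integrable_const_bound[of _ G]) (auto simp: f_bound intro: measurable_compose[OF coord_P[OF t] f_measurable])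
  show "(\<integral>\<^sup>+p. ennreal (f (p t) - lam + G) \<partial>P y) = ennreal ((\<integral>p. f (p t) \<partial>P y) - lam + G)"
    using i reward_nonneg by (subst nn_integral_eq_integral) (auto simp: prob_space)
  have "\<bar>\<integral>p. f (p t) - lam \<partial>P y\<bar> \<le> (\<integral>p. \<bar>f (p t) - lam\<bar> \<partial>P y)" by (rule integral_abs_bound)
  also have "\<dots> \<le> (\<integral>p. G \<partial>P y)"
  proof (rule integral_mono)
    show "\<bar>f (p t) - lam\<bar> \<le> G" for p using G[of "p t"] by linarith
  qed (use i in auto)
  finally show "\<bar>(\<integral>p. f (p t) \<partial>P y) - lam\<bar> \<le> G" using i by (simp add: prob_space)
qed

lemma mean_measurable: "(\<lambda>t. \<integral>p. f (p (max 0 t)) \<partial>P y) \<in> borel_measurable borel"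
proof -
  interpret Py: prob_space "P y" by (rule P_prob)
  have "(\<lambda>z. (snd z) (max 0 (fst z))) \<in> borel \<Otimes>\<^sub>M P y \<rightarrow>\<^sub>M borel"
    by (rule measurable_path_eval[OF measurable_compose[OF measurable_snd id_P]]) auto
  from measurable_compose[OF this f_measurable]
  show ?thesis by (intro Py.borel_measurable_lebesgue_integral) (simp add: split_def)
qed

text \<open>The shifted reward is f - lam + G = (f - muf) + (G - gap). By Fubini, subtracting the
  linear term \<open>(G - gap) * T\<close> from its expectation leaves the integral of the centred
  means.\<close>

lemma u_eq: assumes T: "0 \<le> T" shows "enn2real (u T y) - (G - gap) * T = (LBINT t:{0..<T}. m (max 0 t) y)"
proof -
  interpret Py: prob_space "P y" by (rule P_prob)
  interpret pair_sigma_finite "P y" lborel by unfold_locales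
  let ?\<phi> = "\<lambda>t. (\<integral>p. f (p (max 0 t)) \<partial>P y) - lam"
  have A: "{s. 0 \<le> s \<and> ennreal s < ennreal T} = {0..<T}" using T by (auto simp: ennreal_less_iff)
  have "(\<lambda>z. (fst z) (max 0 (snd z))) \<in> P y \<Otimes>\<^sub>M lborel \<rightarrow>\<^sub>M borel"
    by (rule measurable_path_eval[OF measurable_compose[OF measurable_fst id_P]]) auto
  from measurable_compose[OF this f_measurable]
  have fm[measurable]: "(\<lambda>z. f ((fst z) (max 0 (snd z)))) \<in> borel_measurable (P y \<Otimes>\<^sub>M lborel)" .
  have "u T y = (\<integral>\<^sup>+p. (\<integral>\<^sup>+s. ennreal (f (p (max 0 s)) - lam + G) * indicator {0..<T} s \<partial>lborel) \<partial>P y)"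
    unfolding u_def area_def A by (intro nn_integral_cong) (auto simp: indicator_def max_def)
  also have "\<dots> = (\<integral>\<^sup>+s. (\<integral>\<^sup>+p. ennreal (f (p (max 0 s)) - lam + G) * indicator {0..<T} s \<partial>P y) \<partial>lborel)"
    by (rule Fubini'[symmetric]) (use fm in \<open>simp add: split_def\<close>)
  also have "\<dots> = (\<integral>\<^sup>+s. ennreal (?\<phi> s + G) * indicator {0..<T} s \<partial>lborel)"
  proof (rule nn_integral_cong)
    fix s :: real
    have "(\<lambda>p. ennreal (f (p (max 0 s)) - lam + G)) \<in> borel_measurable (P y)"
      using measurable_compose[OF coord_P[of "max 0 s"] f_measurable] by simp
    then show "(\<integral>\<^sup>+p. ennreal (f (p (max 0 s)) - lam + G) * indicator {0..<T} s \<partial>P y) = ennreal (?\<phi> s + G) * indicator {0..<T} s"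
      by (subst nn_integral_multc) (auto simp: mean_reward)
  qed
  finally have u: "u T y = (\<integral>\<^sup>+s. ennreal (?\<phi> s + G) * indicator {0..<T} s \<partial>lborel)" .
  have \<phi>m: "?\<phi> \<in> borel_measurable borel" using mean_measurable by simp
  have fin: "emeasure lborel {0..<T} < \<infinity>" using T by simp
  have "(LBINT s:{0..<T}. ?\<phi> s) = enn2real (u T y) - G * measure lborel {0..<T}"
    unfolding u by (rule set_integral_shift(1)[OF \<phi>m _ fin]) (auto simp: mean_bound)
  moreover have "(LBINT s:{0..<T}. m (max 0 s) y) = (LBINT s:{0..<T}. ?\<phi> s) + (LBINT s:{0..<T}. gap)"
  proof -
    have "set_integrable lborel {0..<T} ?\<phi>"
      unfolding set_integrable_def
    proof (rule Bochner_Integration.integrable_bound)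
      show "integrable lborel (\<lambda>s. G * indicat_real {0..<T} s)" using T by simp
      show "AE s in lborel. norm (indicat_real {0..<T} s *\<^sub>R ?\<phi> s) \<le> norm (G * indicat_real {0..<T} s)"
        using G_nonneg by (intro AE_I2) (simp add: indicator_def mean_bound)
    qed (use \<phi>m in simp)
    moreover have "set_integrable lborel {0..<T} (\<lambda>_. gap)" using T unfolding set_integrable_def by simp
    ultimately show ?thesis
      by (subst set_integral_add(2)[symmetric]) (auto simp: m_def)
  qed
  moreover have "(LBINT s:{0..<T}. gap) = gap * T" using T by (simp add: set_lebesgue_integral_def)
  ultimately show ?thesis using T by (simp add: algebra_simps)
qed

lemma m_int: "set_integrable lborel {0..} (\<lambda>t. m (max 0 t) y)"
  unfolding set_integrable_def
proof (rule Bochner_Integration.integrable_bound)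
  show "integrable lborel (\<lambda>t. 2 * G * (K y * (indicat_real {0..} t *\<^sub>R h t)))"
    using h_int unfolding set_integrable_def by simp
  have "(\<lambda>t. m (max 0 t) y) \<in> borel_measurable borel" unfolding m_def using mean_measurable by simp
  then show "(\<lambda>t. indicat_real {0..} t *\<^sub>R m (max 0 t) y) \<in> borel_measurable lborel" by simp
  show "AE t in lborel. norm (indicat_real {0..} t *\<^sub>R m (max 0 t) y) \<le> norm (2 * G * (K y * (indicat_real {0..} t *\<^sub>R h t)))"
  proof (rule AE_I2)
    fix t :: real
    show "norm (indicat_real {0..} t *\<^sub>R m (max 0 t) y) \<le> norm (2 * G * (K y * (indicat_real {0..} t *\<^sub>R h t)))"
    proof (cases "0 \<le> t")
      case True
      have "\<bar>m t y\<bar> \<le> 2 * G * (K y * h t)" by (rule m_bound[OF True])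
      also have "\<dots> \<le> \<bar>2 * G * (K y * h t)\<bar>" by simp
      finally show ?thesis using True by (simp add: max_def)
    qed simp
  qed
qed

text \<open>The bound is uniform in \<open>T\<close>. At the point reached after one unit of time it
  is integrable, by the moment condition on \<open>K\<close>, and serves there as a majorant for
  dominated convergence.\<close>

lemma u_bound: assumes T: "0 \<le> T" shows "\<bar>enn2real (u T y) - (G - gap) * T\<bar> \<le> 2 * G * Ih * K y"
proof -
  have i: "set_integrable lborel {0..<T} (\<lambda>t. m (max 0 t) y)" by (rule set_integrable_subset[OF m_int]) auto
  have "\<bar>LBINT t:{0..<T}. m (max 0 t) y\<bar> \<le> (LBINT t:{0..<T}. \<bar>m (max 0 t) y\<bar>)"
    using set_integral_norm_bound[OF i] by simp
  also have "\<dots> \<le> (LBINT t:{0..}. 2 * G * (K y * h t))"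
    unfolding set_lebesgue_integral_def
  proof (rule integral_mono')
    show "integrable lborel (\<lambda>t. indicat_real {0..} t *\<^sub>R (2 * G * (K y * h t)))"
      using integrable_mult_right[OF h_int[unfolded set_integrable_def], of "2 * G * K y"] by (simp add: ac_simps)
    fix t :: real
    show "indicat_real {0..<T} t *\<^sub>R \<bar>m (max 0 t) y\<bar> \<le> indicat_real {0..} t *\<^sub>R (2 * G * (K y * h t))"
      using m_bound[of t y] h_nonneg[of t] G_nonneg K_pos[of y] by (auto simp: indicator_def max_def)
    show "0 \<le> indicat_real {0..} t *\<^sub>R (2 * G * (K y * h t))"
      using h_nonneg[of t] G_nonneg K_pos[of y] by (auto simp: indicator_def)
  qed
  also have "\<dots> = 2 * G * Ih * K y" by (simp add: Ih_def)
  finally show ?thesis unfolding u_eq[OF T] .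
qed

definition q :: "'e \<Rightarrow> real" where "q y = (LBINT t:{0..}. m (max 0 t) y)"

lemma u_lim: "((\<lambda>T. enn2real (u T y) - (G - gap) * T) \<longlongrightarrow> q y) at_top"
proof -
  have "((\<lambda>T. LBINT t:{0..T}. m (max 0 t) y) \<longlongrightarrow> q y) at_top"
    unfolding q_def by (rule tendsto_set_lebesgue_integral_at_top[OF _ m_int]) simp
  moreover have "\<forall>\<^sub>F T in at_top. (LBINT t:{0..T}. m (max 0 t) y) = enn2real (u T y) - (G - gap) * T"
    using eventually_ge_at_top[of 0]
  proof eventually_elim
    case (elim T)
    have "(LBINT t:{0..T}. m (max 0 t) y) = (LBINT t:{0..<T}. m (max 0 t) y)"
      unfolding set_lebesgue_integral_def
      by (rule integral_cong_AE)
         (use AE_lborel_singleton[of T] m_int in \<open>auto simp: indicator_def m_def elim!: eventually_mono intro!: borel_measurable_times borel_measurable_scaleR borel_measurable_indicator borel_measurable_diff mean_measurable\<close>)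
    then show ?case using u_eq[OF elim] by simp
  qed
  ultimately show ?thesis by (rule Lim_transform_eventually)
qed

text \<open>Pathwise, the centred integral in \<open>q_pot\<close> is the shifted reward minus the
  linear term; closed and half-open intervals differ by a null set. So the lower bound from (B4)
  applies to \<open>q\<close>.\<close>

lemma q_pot_eq: "q_pot P f \<mu> 0 y = q y"
proof -
  have "\<forall>\<^sub>F T in at_top. enn2real (u T y) - (G - gap) * T
    = (\<integral>p. (LBINT t:{0..T}. exp (- 0 * t) * (f (p t) - muf)) \<partial>P y)"
    using eventually_ge_at_top[of 0]
  proof eventually_elim
    case (elim T)
    interpret prob_space "P y" by (rule P_prob)
    have A: "{s. 0 \<le> s \<and> ennreal s < ennreal T} = {0..<T}" using elim by (auto simp: ennreal_less_iff)
    have pw: "(LBINT t:{0..T}. exp (- 0 * t) * (f (p t) - muf)) = enn2real (area p (ennreal T)) - (G - gap) * T"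
      if p: "p \<in> space (P y)" for p
    proof -
      have p': "p \<in> space path_space" using p markov_family_space[OF P] by simp
      have fm: "(\<lambda>s. f (p (max 0 s)) - lam) \<in> borel_measurable borel" using path_reward_measurable[OF p'] by simp
      have fin: "emeasure lborel {0..<T} < \<infinity>" using elim by simp
      have b: "\<bar>f y - lam\<bar> \<le> G" for y using G[of y] by linarith
      have a: "area p (ennreal T) = (\<integral>\<^sup>+s. ennreal (f (p (max 0 s)) - lam + G) * indicator {0..<T} s \<partial>lborel)"
        unfolding area_def A by (intro nn_integral_cong) (auto simp: indicator_def max_def)
      have "(LBINT t:{0..T}. exp (- 0 * t) * (f (p t) - muf)) = (LBINT t:{0..<T}. f (p (max 0 t)) - muf)"
        unfolding set_lebesgue_integral_def
      proof (rule integral_cong_AE)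
        have "(\<lambda>t. indicat_real {0..T} t *\<^sub>R (f (p (max 0 t)) - muf)) \<in> borel_measurable lborel"
          using path_reward_measurable[OF p'] by simp
        also have "(\<lambda>t. indicat_real {0..T} t *\<^sub>R (f (p (max 0 t)) - muf)) = (\<lambda>t. indicat_real {0..T} t *\<^sub>R (exp (- 0 * t) * (f (p t) - muf)))"
          by (auto simp: indicator_def max_def)
        finally show "(\<lambda>t. indicat_real {0..T} t *\<^sub>R (exp (- 0 * t) * (f (p t) - muf))) \<in> borel_measurable lborel" .
        show "AE t in lborel. indicat_real {0..T} t *\<^sub>R (exp (- 0 * t) * (f (p t) - muf)) = indicat_real {0..<T} t *\<^sub>R (f (p (max 0 t)) - muf)"
          using AE_lborel_singleton[of T] by eventually_elim (auto simp: indicator_def max_def)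
      qed (use path_reward_measurable[OF p'] in simp)
      also have "\<dots> = (LBINT t:{0..<T}. (f (p (max 0 t)) - lam) + gap)" by simp
      also have "\<dots> = (LBINT t:{0..<T}. f (p (max 0 t)) - lam) + (LBINT t:{0..<T}. gap)"
      proof (rule set_integral_add(2))
        show "set_integrable lborel {0..<T} (\<lambda>t. f (p (max 0 t)) - lam)"
          unfolding set_integrable_def
        proof (rule Bochner_Integration.integrable_bound)
          show "integrable lborel (\<lambda>s. G * indicat_real {0..<T} s)" using elim by simp
          show "AE s in lborel. norm (indicat_real {0..<T} s *\<^sub>R (f (p (max 0 s)) - lam)) \<le> norm (G * indicat_real {0..<T} s)"
            using b G_nonneg by (intro AE_I2) (simp add: indicator_def)
        qed (use fm in simp)
        show "set_integrable lborel {0..<T} (\<lambda>_. gap)" using elim unfolding set_integrable_def by simp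
      qed
      also have "(LBINT t:{0..<T}. f (p (max 0 t)) - lam) = enn2real (area p (ennreal T)) - G * measure lborel {0..<T}"
        unfolding a by (rule set_integral_shift(1)[OF fm _ fin b]) simp
      also have "(LBINT t:{0..<T}. gap) = gap * T" using elim by (simp add: set_lebesgue_integral_def)
      finally show ?thesis using elim by (simp add: algebra_simps)
    qed
    have am: "(\<lambda>p. area p (ennreal T)) \<in> borel_measurable (P y)"
      unfolding markov_family_cong[OF P] by (rule area_path_measurable)
    have afin: "area p (ennreal T) < \<infinity>" for p
      by (rule le_less_trans[OF area_le]) (simp add: ennreal_mult_less_top)
    have e: "enn2real (u T y) = (\<integral>p. enn2real (area p (ennreal T)) \<partial>P y)"
      unfolding u_def using am afin by (subst integral_eq_nn_integral) (auto simp: less_top)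
    have i: "integrable (P y) (\<lambda>p. enn2real (area p (ennreal T)))"
    proof (rule integrable_const_bound[of _ "2 * G * T"])
      show "AE p in P y. norm (enn2real (area p (ennreal T))) \<le> 2 * G * T"
        using area_le[of _ "ennreal T"] G_nonneg elim
        by (intro AE_I2) (auto simp: ennreal_mult[symmetric] intro!: enn2real_leI)
    qed (use am in simp)
    have "(\<integral>p. (LBINT t:{0..T}. exp (- 0 * t) * (f (p t) - muf)) \<partial>P y) = (\<integral>p. enn2real (area p (ennreal T)) - (G - gap) * T \<partial>P y)"
      by (intro Bochner_Integration.integral_cong) (auto simp only: pw)
    also have "\<dots> = enn2real (u T y) - (G - gap) * T" using i by (simp add: e prob_space)
    finally show ?case ..
  qed
  from Lim_transform_eventually[OF u_lim this] show ?thesis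
    unfolding q_pot_def by (intro tendsto_Lim) auto
qed

end

section \<open>Poisson equation for the potential and bounds on stopping times\<close>

context ergodic_rate
begin

lemma Ih_nonneg: "0 \<le> Ih"
  unfolding Ih_def set_lebesgue_integral_def by (rule integral_nonneg_AE[OF AE_I2]) (simp add: h_nonneg indicator_def)

lemma q_bound: "\<bar>q y\<bar> \<le> 2 * G * Ih * K y"
proof (rule tendsto_upperbound[OF tendsto_rabs[OF u_lim]])
  show "\<forall>\<^sub>F T in at_top. \<bar>enn2real (u T y) - (G - gap) * T\<bar> \<le> 2 * G * Ih * K y"
    using eventually_ge_at_top[of 0] by eventually_elim (rule u_bound)
qed simp

lemma q_seq: "(\<lambda>n. enn2real (u (real n) y) - (G - gap) * real n) \<longlonglongrightarrow> q y"
  by (rule filterlim_compose[OF u_lim filterlim_real_sequentially])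

lemma q_measurable: "q \<in> borel_measurable borel"
  by (rule borel_measurable_LIMSEQ_real[OF q_seq]) (use u_measurable in measurable)

text \<open>The potential raised by its lower bound, so that it is nonnegative and may be discarded
  wherever the path has already been stopped.\<close>

definition r :: "'e \<Rightarrow> real" where "r y = q y + Cq"

lemma r_nonneg: "0 \<le> r y" using Cq(1)[of y] by (simp add: r_def q_pot_eq)

lemma r_le: "r y \<le> 2 * G * Ih * K y + Cq" using q_bound[of y] by (simp add: r_def abs_le_iff)

lemma r_measurable: "r \<in> borel_measurable borel" unfolding r_def[abs_def] using q_measurable by simp

lemma gap_pos: "0 < gap" using lam_gt by simp

text \<open>Poisson equation on the integer grid: iterating it up to a stopping time bounds the expectation
  of that time.\<close>

lemma r_step: "(\<integral>\<^sup>+p. area p 1 + (ennreal gap + ennreal (r (p 1))) \<partial>P y) = ennreal (r y) + ennreal G"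
proof -
  interpret prob_space "P y" by (rule P_prob)
  have ufin: "u T y' < \<infinity>" if "0 \<le> T" for T y' by (rule le_less_trans[OF u_le[OF that]]) simp
  let ?g = "\<lambda>n y'. enn2real (u (real n) y') - (G - gap) * real n"
  have c1: "(\<lambda>p. p 1) \<in> P y \<rightarrow>\<^sub>M borel" by (rule coord_P) simp
  have gm: "(\<lambda>p. ?g n (p 1)) \<in> borel_measurable (P y)" for n
    using measurable_compose[OF c1 u_measurable] by simp
  have Ki: "integrable (P y) (\<lambda>p. K (p 1))"
    using KT[of 1 y] K_pos by (intro integrableI_nonneg) (auto intro: measurable_compose[OF c1 K_measurable] less_imp_le)
  have qi: "integrable (P y) (\<lambda>p. q (p 1))"
    by (rule Bochner_Integration.integrable_bound[of _ "\<lambda>p. 2 * G * Ih * K (p 1)"])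
       (use Ki in \<open>auto intro!: measurable_compose[OF c1 q_measurable] order.trans[OF q_bound abs_ge_self] simp del: abs_mult\<close>)
  have lim: "(\<lambda>n. \<integral>p. ?g n (p 1) \<partial>P y) \<longlonglongrightarrow> (\<integral>p. q (p 1) \<partial>P y)"
  proof (rule integral_dominated_convergence[where w="\<lambda>p. 2 * G * Ih * K (p 1)"])
    show "AE p in P y. (\<lambda>n. ?g n (p 1)) \<longlonglongrightarrow> q (p 1)" using q_seq by simp
    show "AE p in P y. norm (?g n (p 1)) \<le> 2 * G * Ih * K (p 1)" for n using u_bound[of "real n"] by simp
  qed (use Ki gm measurable_compose[OF c1 q_measurable] in auto)
  have e: "(\<integral>p. ?g n (p 1) \<partial>P y) = ?g (Suc n) y + (G - gap) - enn2real (u 1 y)" for n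
  proof -
    have um: "(\<lambda>p. u (real n) (p 1)) \<in> borel_measurable (P y)" by (rule measurable_compose[OF c1 u_measurable])
    have i: "integrable (P y) (\<lambda>p. enn2real (u (real n) (p 1)))"
      using u_le[of "real n"] G_nonneg um by (intro integrable_const_bound[of _ "2 * G * real n"]) (auto intro!: enn2real_leI)
    have "(\<integral>p. enn2real (u (real n) (p 1)) \<partial>P y) = enn2real (\<integral>\<^sup>+p. u (real n) (p 1) \<partial>P y)"
      using um ufin[of "real n"] by (subst integral_eq_nn_integral) (auto simp: less_top)
    moreover have "enn2real (u (1 + real n) y) = enn2real (u 1 y) + enn2real (\<integral>\<^sup>+p. u (real n) (p 1) \<partial>P y)"
    proof -
      have "u 1 y + (\<integral>\<^sup>+p. u (real n) (p 1) \<partial>P y) < \<infinity>"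
        unfolding u_add[of "real n" y, simplified, symmetric] by (rule ufin) simp
      then show ?thesis unfolding u_add[of "real n" y, simplified] by (simp add: enn2real_plus less_top)
    qed
    ultimately show ?thesis using i by (simp add: prob_space algebra_simps)
  qed
  have "(\<lambda>n. ?g (Suc n) y + (G - gap) - enn2real (u 1 y)) \<longlonglongrightarrow> q y + (G - gap) - enn2real (u 1 y)"
    by (intro tendsto_intros LIMSEQ_Suc[OF q_seq])
  \<comment> \<open>Both sides of the additivity of \<open>u\<close>, freed from their linear terms,
    converge to values of the potential.\<close>
  from LIMSEQ_unique[OF lim[unfolded e] this]
  have E: "(\<integral>p. q (p 1) \<partial>P y) = q y + (G - gap) - enn2real (u 1 y)" .
  have rn: "(\<integral>\<^sup>+p. ennreal (r (p 1)) \<partial>P y) = ennreal ((\<integral>p. q (p 1) \<partial>P y) + Cq)"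
    using qi r_nonneg unfolding r_def by (subst nn_integral_eq_integral) (auto simp: prob_space)
  have rn0: "0 \<le> (\<integral>p. q (p 1) \<partial>P y) + Cq"
  proof -
    have "0 \<le> (\<integral>p. r (p 1) \<partial>P y)" using r_nonneg by (intro integral_nonneg_AE AE_I2)
    then show ?thesis using qi unfolding r_def by (simp add: prob_space)
  qed
  have am: "(\<lambda>p. area p 1) \<in> borel_measurable (P y)"
    unfolding markov_family_cong[OF P] by (rule area_path_measurable)
  have rm: "(\<lambda>p. ennreal (r (p 1))) \<in> borel_measurable (P y)"
    using measurable_compose[OF c1 r_measurable] by simp
  have "(\<integral>\<^sup>+p. area p 1 + (ennreal gap + ennreal (r (p 1))) \<partial>P y) = u 1 y + (ennreal gap + ennreal ((\<integral>p. q (p 1) \<partial>P y) + Cq))"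
    using am rm rn by (simp add: nn_integral_add u_def emeasure_space_1)
  also have "\<dots> = ennreal (enn2real (u 1 y)) + (ennreal gap + ennreal ((\<integral>p. q (p 1) \<partial>P y) + Cq))"
    using ufin[of 1 y] by (simp add: less_top)
  also have "\<dots> = ennreal (enn2real (u 1 y) + (gap + ((\<integral>p. q (p 1) \<partial>P y) + Cq)))"
    using gap_pos rn0 by (simp add: ennreal_plus[symmetric] del: ennreal_plus)
  also have "\<dots> = ennreal (r y + G)" unfolding E by (simp add: r_def algebra_simps)
  also have "\<dots> = ennreal (r y) + ennreal G" using r_nonneg G_nonneg by simp
  finally show ?thesis .
qed

text \<open>\<open>r_step\<close> is summed over the integers \<open>k\<close> on the events k <
  \<tau>, which requires the Markov property at integers only. Every unit step costs at most
  \<open>G\<close>, and at most \<tau> + 1 steps are begun; the extra 1 is the last step, which may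
  overshoot \<tau>.\<close>

lemma stopped_bound:
  assumes st: "stopping_time filt \<tau>"
  shows "(\<integral>\<^sup>+p. area p (\<tau> p) + ennreal gap * \<tau> p \<partial>P y) \<le> ennreal (r y) + ennreal G * ((\<integral>\<^sup>+p. \<tau> p \<partial>P y) + 1)"
proof (cases "(\<integral>\<^sup>+p. \<tau> p \<partial>P y) < \<infinity>")
  case False
  show ?thesis
  \<comment> \<open>If \<open>G = 0\<close>, then \<open>f\<close> and \<open>lam\<close> vanish,
    against \<open>gap > 0\<close>; otherwise the right-hand side is infinite.\<close>
  proof (cases "G = 0")
    case True
    then have "f y = 0" "lam = 0" for y using G[of y] by auto
    then show ?thesis using gap_pos by simp
  next
    case False
    then show ?thesis using \<open>\<not> (\<integral>\<^sup>+p. \<tau> p \<partial>P y) < \<infinity>\<close> G_nonneg by (simp add: not_less top_unique ennreal_mult_top)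
  qed
next
  case fin: True
  interpret prob_space "P y" by (rule P_prob)
  let ?N = "universal_completion (path_space :: (real \<Rightarrow> 'e) measure)"
  define A where "A k = {p \<in> space path_space. ennreal (real k) < \<tau> p}" for k
  have A: "A k \<in> sets (filt (ennreal (real k)))" for k
    using stopping_timeD2[OF st, of "ennreal (real k)"] by (simp add: A_def pred_def)
  have AN: "A k \<in> sets ?N" for k using A sets_filt_subset by blast
  note tm[measurable] = stopping_time_measurable_uc[OF st]
  have idN: "(\<lambda>p. p) \<in> ?N \<rightarrow>\<^sub>M path_space" by (rule measurable_universal_completion) simp
  have am[measurable]: "(\<lambda>p. area p (t p)) \<in> borel_measurable ?N" if "t \<in> borel_measurable ?N" for t
    by (rule area_measurable[OF idN that])
  have asm[measurable]: "(\<lambda>p. area (shift (real k) p) 1) \<in> borel_measurable ?N" for k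
    by (rule measurable_universal_completion[OF measurable_compose[OF measurable_shift area_path_measurable]]) simp
  have rm[measurable]: "(\<lambda>p. ennreal (r (p (real k)))) \<in> borel_measurable ?N" for k
    by (rule measurable_universal_completion) (use measurable_compose[OF measurable_path_coord r_measurable] in simp)
  note [measurable] = AN
  let ?I = "\<lambda>g. \<integral>\<^sup>+p. g p \<partial>P y"
  let ?a = "\<lambda>k. ?I (\<lambda>p. indicator (A k) p * (area (shift (real k) p) 1 + ennreal gap))"
  let ?b = "\<lambda>k. ?I (\<lambda>p. indicator (A k) p * ennreal (r (p (real k))))"
  let ?d = "\<lambda>k. ?I (indicator (A k))"
  have add: "?I (\<lambda>p. g1 p + g2 p) = ?I g1 + ?I g2" if "g1 \<in> borel_measurable ?N" "g2 \<in> borel_measurable ?N" for g1 g2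
    using nn_integral_add[OF P_uc[OF that(1)] P_uc[OF that(2)]] by (simp add: nn_integral_completion)
  \<comment> \<open>On n < \<tau> one step of the Poisson equation is made; on n < \<tau> \<le> n +
    1 the value of \<open>r\<close> at the end of the step is discarded, as \<open>r\<close> is
    nonnegative.\<close>
  have step: "?a n + ?b (Suc n) \<le> ?b n + ennreal G * ?d n" for n
  proof -
    let ?F = "\<lambda>q. area q 1 + (ennreal gap + ennreal (r (q 1)))"
    have F: "?F \<in> borel_measurable ?N" using rm[of 1] by simp
    have "?a n + ?b (Suc n) = ?I (\<lambda>p. indicator (A n) p * (area (shift (real n) p) 1 + ennreal gap) + indicator (A (Suc n)) p * ennreal (r (p (real (Suc n)))))"
      by (rule add[symmetric]) measurable
    also have "\<dots> \<le> ?I (\<lambda>p. indicator (A n) p * ?F (shift (real n) p))"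
    proof (rule nn_integral_mono)
      fix p
      have sub: "p \<in> A n" if "p \<in> A (Suc n)"
        using that order.strict_trans1[of "ennreal (real n)" "ennreal (real (Suc n))"] by (auto simp: A_def ennreal_leI simp del: of_nat_Suc)
      show "indicator (A n) p * (area (shift (real n) p) 1 + ennreal gap) + indicator (A (Suc n)) p * ennreal (r (p (real (Suc n))))
        \<le> indicator (A n) p * ?F (shift (real n) p)"
        using sub by (cases "p \<in> A n"; cases "p \<in> A (Suc n)") (auto simp: shift_def add.commute add.assoc intro!: add_left_mono)
    qed
    also have "\<dots> = ?I (\<lambda>p. indicator (A n) p * (\<integral>\<^sup>+q. ?F q \<partial>P (p (real n))))"
      by (rule markov_property[OF P _ A F]) simp
    also have "\<dots> = ?I (\<lambda>p. indicator (A n) p * ennreal (r (p (real n))) + ennreal G * indicator (A n) p)"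
      unfolding r_step by (simp add: algebra_simps)
    also have "\<dots> = ?b n + ?I (\<lambda>p. ennreal G * indicator (A n) p)" by (rule add) measurable
    also have "?I (\<lambda>p. ennreal G * indicator (A n) p) = ennreal G * ?d n"
      using nn_integral_cmult[OF P_uc[OF borel_measurable_indicator[OF AN[of n]]], of y "ennreal G"]
      by (simp add: nn_integral_completion)
    finally show ?thesis .
  qed
  have b0: "?b 0 \<le> ennreal (r y)"
  proof -
    have "AE p in P y. p 0 = y" using P by (simp add: markov_family_def)
    then have "?b 0 \<le> ?I (\<lambda>p. ennreal (r y))"
      by (intro nn_integral_mono_AE) (auto simp: indicator_def elim!: eventually_mono)
    then show ?thesis by (simp add: emeasure_space_1)
  qed
  have claim: "(\<Sum>k<n. ?a k) + ?b n \<le> ennreal (r y) + ennreal G * (\<Sum>k<n. ?d k)" for n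
  proof (induction n)
    case 0
    then show ?case using b0 by simp
  next
    case (Suc n)
    have "(\<Sum>k<Suc n. ?a k) + ?b (Suc n) = (\<Sum>k<n. ?a k) + (?a n + ?b (Suc n))" by (simp add: ac_simps)
    also have "\<dots> \<le> (\<Sum>k<n. ?a k) + (?b n + ennreal G * ?d n)" by (intro add_left_mono step)
    also have "\<dots> \<le> (ennreal (r y) + ennreal G * (\<Sum>k<n. ?d k)) + ennreal G * ?d n"
      using add_right_mono[OF Suc, of "ennreal G * ?d n"] by (simp add: ac_simps)
    also have "\<dots> = ennreal (r y) + ennreal G * (\<Sum>k<Suc n. ?d k)" by (simp add: distrib_left ac_simps)
    finally show ?case .
  qed
  have d: "(\<Sum>k<n. ?d k) \<le> ?I \<tau> + 1" for n
  proof -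
    have pw: "(\<Sum>k<n. indicator (A k) p) \<le> \<tau> p + 1" for p
    proof (induction n)
      case (Suc n)
      show ?case
      proof (cases "p \<in> A n")
        case True
        have "(\<Sum>k<Suc n. indicator (A k) p :: ennreal) \<le> (\<Sum>k<Suc n. 1)" by (intro sum_mono) (auto simp: indicator_def)
        also have "\<dots> = ennreal (real n) + 1" by (simp add: ennreal_of_nat_eq_real_of_nat add.commute)
        also have "\<dots> \<le> \<tau> p + 1" using True by (auto simp: A_def intro: less_imp_le)
        finally show ?thesis .
      qed (use Suc in simp)
    qed simp
    have "(\<Sum>k<n. ?d k) = (\<Sum>k<n. integral\<^sup>N (completion (P y)) (indicator (A k)))" by (simp only: nn_integral_completion)
    also have "\<dots> = (\<integral>\<^sup>+p. (\<Sum>k<n. indicator (A k) p) \<partial>completion (P y))"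
      by (rule nn_integral_sum[symmetric]) (rule P_uc[OF borel_measurable_indicator[OF AN]])
    also have "\<dots> \<le> (\<integral>\<^sup>+p. \<tau> p + 1 \<partial>completion (P y))" by (intro nn_integral_mono pw)
    also have "\<dots> = ?I \<tau> + 1"
      using nn_integral_add[OF P_uc[OF tm], of "\<lambda>_. 1"] by (simp add: nn_integral_completion emeasure_space_1)
    finally show ?thesis .
  qed
  have pw: "area p (min (\<tau> p) (ennreal (real n))) + ennreal gap * min (\<tau> p) (ennreal (real n))
      \<le> (\<Sum>k<n. indicator (A k) p * (area (shift (real k) p) 1 + ennreal gap))" if p: "p \<in> space path_space" for p n
  proof (induction n)
    case 0
    show ?case using area_le[of p 0] by (simp add: min_def)
  next
    case (Suc n)
    show ?case
    proof (cases "p \<in> A n")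
      case False
      then have "\<tau> p \<le> ennreal (real n)" using p by (auto simp: A_def)
      moreover then have "\<tau> p \<le> ennreal (real (Suc n))" by (rule order_trans) (simp add: ennreal_leI)
      ultimately show ?thesis using Suc False by (simp add: min_absorb1)
    next
      case True
      let ?t = "min (\<tau> p) (ennreal (real (Suc n)))"
      have nS: "ennreal (real (Suc n)) = ennreal (real n) + 1" by (simp add: ennreal_plus[symmetric] add.commute del: ennreal_plus flip: ennreal_1)
      have le: "?t - ennreal (real n) \<le> 1"
        unfolding nS by (metis ennreal_add_diff_cancel_left ennreal_minus_mono min.cobounded2 order_refl ennreal_neq_top infinity_ennreal_def add.commute)
      have m: "min ?t (ennreal (real n)) = min (\<tau> p) (ennreal (real n))"
        by (metis ennreal_leI min.absorb_iff2 min.assoc min.commute of_nat_le_iff le_SucI order_refl)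
      have "area p ?t = area p (min (\<tau> p) (ennreal (real n))) + area (shift (real n) p) (?t - ennreal (real n))"
        using area_split[OF p, of "real n" ?t] unfolding m by simp
      also have "\<dots> \<le> area p (min (\<tau> p) (ennreal (real n))) + area (shift (real n) p) 1"
        by (intro add_left_mono area_mono le)
      finally have 1: "area p ?t \<le> area p (min (\<tau> p) (ennreal (real n))) + area (shift (real n) p) 1" .
      have "?t \<le> min (\<tau> p) (ennreal (real n)) + 1"
        using True unfolding nS by (auto simp: A_def min_def)
      then have "ennreal gap * ?t \<le> ennreal gap * (min (\<tau> p) (ennreal (real n)) + 1)" by (rule mult_left_mono) simp
      with 1 have "area p ?t + ennreal gap * ?t \<le> (area p (min (\<tau> p) (ennreal (real n))) + area (shift (real n) p) 1)
          + (ennreal gap * min (\<tau> p) (ennreal (real n)) + ennreal gap)" by (intro add_mono) (simp_all add: distrib_left)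
      also have "\<dots> = (area p (min (\<tau> p) (ennreal (real n))) + ennreal gap * min (\<tau> p) (ennreal (real n))) + (area (shift (real n) p) 1 + ennreal gap)"
        by (simp add: ac_simps)
      also have "\<dots> \<le> (\<Sum>k<n. indicator (A k) p * (area (shift (real k) p) 1 + ennreal gap)) + (area (shift (real n) p) 1 + ennreal gap)"
        by (intro add_right_mono Suc)
      finally show ?thesis using True by simp
    qed
  qed
  have fn: "?I (\<lambda>p. area p (min (\<tau> p) (ennreal (real n))) + ennreal gap * min (\<tau> p) (ennreal (real n)))
      \<le> ennreal (r y) + ennreal G * (?I \<tau> + 1)" for n
  proof -
    have "?I (\<lambda>p. area p (min (\<tau> p) (ennreal (real n))) + ennreal gap * min (\<tau> p) (ennreal (real n)))
      \<le> (\<integral>\<^sup>+p. (\<Sum>k<n. indicator (A k) p * (area (shift (real k) p) 1 + ennreal gap)) \<partial>completion (P y))"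
      unfolding nn_integral_completion by (intro nn_integral_mono pw) (simp add: markov_family_space[OF P])
    also have "\<dots> = (\<Sum>k<n. \<integral>\<^sup>+p. indicator (A k) p * (area (shift (real k) p) 1 + ennreal gap) \<partial>completion (P y))"
      by (rule nn_integral_sum, rule P_uc) measurable
    also have "\<dots> = (\<Sum>k<n. ?a k)" by (simp only: nn_integral_completion)
    also have "\<dots> \<le> (\<Sum>k<n. ?a k) + ?b n" by simp
    also note claim[of n]
    also have "ennreal (r y) + ennreal G * (\<Sum>k<n. ?d k) \<le> ennreal (r y) + ennreal G * (?I \<tau> + 1)"
      by (intro add_left_mono mult_left_mono d) simp
    finally show ?thesis .
  qed
  let ?h = "\<lambda>n p. area p (min (\<tau> p) (ennreal (real n))) + ennreal gap * min (\<tau> p) (ennreal (real n))"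
  have "?I (\<lambda>p. area p (\<tau> p) + ennreal gap * \<tau> p) \<le> ?I (\<lambda>p. SUP n. ?h n p)"
  proof (rule nn_integral_mono_AE)
    have "AE p in completion (P y). \<tau> p \<noteq> \<infinity>"
      by (rule nn_integral_PInf_AE[OF P_uc[OF tm]]) (use fin in \<open>simp add: nn_integral_completion less_top\<close>)
    then have "AE p in P y. \<tau> p \<noteq> \<infinity>" by (simp add: AE_completion_iff)
    then show "AE p in P y. area p (\<tau> p) + ennreal gap * \<tau> p \<le> (SUP n. ?h n p)"
    proof eventually_elim
      case (elim p)
      then obtain t where t: "\<tau> p = ennreal t" "0 \<le> t" by (cases "\<tau> p") auto
      obtain n where "t \<le> real n" using real_arch_simple by blast
      then have "min (\<tau> p) (ennreal (real n)) = \<tau> p" using t by (simp add: min_def ennreal_leI)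
      then show ?case by (intro SUP_upper2[of n]) auto
    qed
  qed
  also have "\<dots> = (\<integral>\<^sup>+p. (SUP n. ?h n p) \<partial>completion (P y))" by (simp only: nn_integral_completion)
  also have "\<dots> = (SUP n. \<integral>\<^sup>+p. ?h n p \<partial>completion (P y))"
  proof (rule nn_integral_monotone_convergence_SUP)
    show "incseq ?h"
    proof (intro incseq_SucI le_funI)
      fix n p
      have "min (\<tau> p) (ennreal (real n)) \<le> min (\<tau> p) (ennreal (real (Suc n)))" by (intro min.mono ennreal_leI) auto
      then show "?h n p \<le> ?h (Suc n) p" by (intro add_mono area_mono mult_left_mono) auto
    qed
    show "?h n \<in> borel_measurable (completion (P y))" for n by (rule P_uc) measurable
  qed
  also have "\<dots> \<le> ennreal (r y) + ennreal G * (?I \<tau> + 1)"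
    unfolding nn_integral_completion by (intro SUP_least fn)
  finally show ?thesis .
qed

end

section \<open>Uniform integrability of the time to the first impulse\<close>

lemma ennreal_diff_zero: "a \<le> b \<Longrightarrow> b < \<infinity> \<Longrightarrow> a - b = (0::ennreal)"
  by (rule diff_eq_0_ennreal) auto

text \<open>Collects the constants of a bound that is affine in \<open>k\<close> and
  \<open>v\<close> into a single factor.\<close>

lemma prod_dominates:
  fixes a b k v :: real
  assumes "0 \<le> a" "0 \<le> b" "0 \<le> k" "0 \<le> v"
  shows "a * k + b + v \<le> (a + b + 1) * (k + (v + 1))"
  using mult_nonneg_nonneg[OF assms(1,4)] mult_nonneg_nonneg[OF assms(2,3)] mult_nonneg_nonneg[OF assms(2,4)] assms
  by (simp add: algebra_simps)

text \<open>Only an inequality: if the set is entered before \<open>T\<close>, the shifted path may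
  return to it late or never.\<close>

lemma entry_time_shift:
  assumes "0 \<le> T" shows "entry_time I p \<le> ennreal T + entry_time I (shift T p)"
proof (cases "ennreal T \<le> entry_time I p")
  case True
  have "entry_time I p - ennreal T \<le> entry_time I (shift T p)"
    unfolding entry_time_def[of I "shift T p"]
  proof (rule INF_greatest)
    fix s assume s: "s \<in> {s. 0 \<le> s \<and> shift T p s \<in> I}"
    then have "entry_time I p \<le> ennreal (T + s)"
      unfolding entry_time_def[of I p] using assms by (intro INF_lower) (auto simp: shift_def)
    then show "entry_time I p - ennreal T \<le> ennreal s"
      using s assms by (simp add: ennreal_minus_le_iff)
  qed
  then show ?thesis by (simp add: ennreal_minus_le_iff)
next
  case False
  then show ?thesis by (intro order_trans[OF less_imp_le add_increasing2]) (auto simp: not_le)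
qed

context ergodic_rate
begin

lemma c_cont_1: "v \<in> U \<Longrightarrow> continuous_on UNIV (\<lambda>y. c y v)"
proof -
  assume "v \<in> U"
  then have "continuous_on UNIV (\<lambda>y. (\<lambda>(x, \<xi>). c x \<xi>) (y, v))"
    by (intro continuous_on_compose2[OF c_cont]) (auto intro!: continuous_intros)
  then show ?thesis by simp
qed

lemma cz_measurable: "(\<lambda>y. \<bar>c y z\<bar>) \<in> borel_measurable borel"
  using borel_measurable_continuous_onI[OF c_cont_1[OF zU]] by simp

lemma c_bdd_below: "bdd_below (c y ` U)"
proof -
  have "continuous_on U (\<lambda>a. (\<lambda>(x, \<xi>). c x \<xi>) (y, a))"
    by (rule continuous_on_compose2[OF c_cont]) (auto intro!: continuous_intros)
  then have "compact ((\<lambda>a. c y a) ` U)" using U by (intro compact_continuous_image) simp_all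
  then show ?thesis by (rule bounded_imp_bdd_below[OF compact_imp_bounded])
qed

lemma cz_le_low: "\<bar>c y z\<bar> \<le> \<bar>c_low U c y\<bar>"
proof -
  have "c_low U c y \<le> c y z" unfolding c_low_def by (rule cINF_lower[OF c_bdd_below zU])
  then show ?thesis using c_le[OF zU, of y] c0 by linarith
qed

text \<open>Let e be the mean of \<open>act\<close> and \<alpha> the mean of the shifted reward up
  to it. The Bellman equality and the bound of \<open>M_op\<close> by \<open>kappa\<close> give w y
  + G e \<le> \<alpha> + k; \<open>stopped_bound\<close> gives \<alpha> + gap e \<le> r y + G (e +
  1). Adding cancels \<alpha> and G e and leaves gap e \<le> r y + G + k - w y, where w y \<ge> c y
  z. The result is affine in \<open>K y\<close> and |c y z|, the functions that (A2) and (B5)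
  control.\<close>

lemma act_bound:
  obtains B where "0 < B" "\<And>y. (\<integral>\<^sup>+p. act p \<partial>P y) \<le> ennreal B * (ennreal (K y) + (ennreal \<bar>c y z\<bar> + 1))"
proof -
  define k where "k = max 0 (kappa U c z)"
  define B where "B = (2 * G * Ih + k + G + Cq + 1) / gap"
  have B0: "0 < B" unfolding B_def using G_nonneg Ih_nonneg Cq(2) gap_pos by (auto simp: k_def intro!: divide_pos_pos add_nonneg_pos)
  show thesis
  proof (rule that[OF B0])
    fix y
    interpret prob_space "P y" by (rule P_prob)
    let ?N = "universal_completion (path_space :: (real \<Rightarrow> 'e) measure)"
    let ?X = "\<lambda>p. p (enn2real (act p))"
    let ?I = "\<lambda>g. \<integral>\<^sup>+p. g p \<partial>P y"
    define D where "D = C + \<bar>w y\<bar>"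
    have D: "\<bar>w v\<bar> \<le> D" if "v \<in> U" for v using C[of v] that by (auto simp: D_def)
    have yD: "0 \<le> w y + D" and D0: "0 \<le> D" using C_nonneg by (auto simp: D_def)
    note sm[measurable] = stopping_time_measurable_uc[OF act_stopping]
    have idm: "(\<lambda>p. p) \<in> ?N \<rightarrow>\<^sub>M path_space" by (rule measurable_universal_completion) simp
    have Xm: "?X \<in> ?N \<rightarrow>\<^sub>M borel" by (rule measurable_path_eval[OF idm]) auto
    have em: "(\<lambda>p. xihat (?X p)) \<in> ?N \<rightarrow>\<^sub>M borel" by (rule measurable_compose[OF Xm xihat_measurable])
    have am[measurable]: "(\<lambda>p. area p (act p)) \<in> borel_measurable ?N" by (rule area_measurable[OF idm sm])
    have cm[measurable]: "(\<lambda>p. c (?X p) (xihat (?X p))) \<in> borel_measurable ?N"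
      by (rule measurable_caratheodory[OF c_cont U Xm em xihat_U])
    have wm[measurable]: "(\<lambda>p. w (xihat (?X p))) \<in> borel_measurable ?N"
      by (rule measurable_compose[OF em borel_measurable_continuous_onI[OF w_cont]])
    have add: "?I (\<lambda>p. g1 p + g2 p) = ?I g1 + ?I g2" if "g1 \<in> borel_measurable ?N" "g2 \<in> borel_measurable ?N" for g1 g2
      using nn_integral_add[OF P_uc[OF that(1)] P_uc[OF that(2)]] by (simp add: nn_integral_completion)
    have cmult: "?I (\<lambda>p. ennreal a * g p) = ennreal a * ?I g" if "g \<in> borel_measurable ?N" for g a
      using nn_integral_cmult[OF P_uc[OF that]] by (simp add: nn_integral_completion)
    let ?c = "\<lambda>p. ennreal (- c (?X p) (xihat (?X p)))"
    obtain e where e: "?I act = ennreal e" "0 \<le> e" using act_finite[of y] by (cases "?I act") auto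
    have "?I (\<lambda>p. area p (act p)) \<le> ?I (\<lambda>p. ennreal (2 * G) * act p)" by (intro nn_integral_mono area_le)
    also have "\<dots> < \<infinity>" unfolding cmult[OF sm] e(1) by (simp add: ennreal_mult_less_top)
    finally obtain \<alpha> where \<alpha>: "?I (\<lambda>p. area p (act p)) = ennreal \<alpha>" "0 \<le> \<alpha>" by (cases "?I (\<lambda>p. area p (act p))") auto
    have eq: "?I (\<lambda>p. area p (act p) + ennreal (w (xihat (?X p)) + D)) = ?I (\<lambda>p. ennreal (w y + D) + ennreal G * act p + ?c p)"
      by (rule one_step_star[OF yD D])
    have rhs: "?I (\<lambda>p. ennreal (w y + D) + ennreal G * act p + ?c p) = ennreal (w y + D) + ennreal G * ennreal e + ?I ?c"
    proof -
      have "?I (\<lambda>p. ennreal (w y + D) + ennreal G * act p + ?c p) = ?I (\<lambda>p. ennreal (w y + D) + ennreal G * act p) + ?I ?c"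
        by (rule add) measurable
      also have "?I (\<lambda>p. ennreal (w y + D) + ennreal G * act p) = ?I (\<lambda>p. ennreal (w y + D)) + ?I (\<lambda>p. ennreal G * act p)"
        by (rule add) measurable
      finally show ?thesis by (simp add: cmult[OF sm] e(1) emeasure_space_1)
    qed
    have "?I (\<lambda>p. area p (act p) + ennreal (w (xihat (?X p)) + D)) \<le> ?I (\<lambda>p. area p (act p) + ennreal (2 * D))"
    proof (intro nn_integral_mono add_left_mono ennreal_leI)
      show "w (xihat (?X p)) + D \<le> 2 * D" for p using D[OF xihat_U, of "?X p"] by simp
    qed
    also have "\<dots> = ennreal \<alpha> + ennreal (2 * D)" by (subst add) (auto simp: \<alpha>(1) emeasure_space_1)
    also have "\<dots> < \<infinity>" by simp
    \<comment> \<open>The expected cost appears on both sides of the next comparison and can be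
      cancelled only because it is finite; the Bellman equality bounds it by the reward.\<close>
    finally have "?I ?c < \<infinity>" unfolding eq rhs by (simp add: less_top[symmetric])
    then obtain \<gamma> where \<gamma>: "?I ?c = ennreal \<gamma>" "0 \<le> \<gamma>" by (cases "?I ?c") auto
    have "?I (\<lambda>p. area p (act p) + ennreal (w (xihat (?X p)) + D)) \<le> ?I (\<lambda>p. area p (act p) + (ennreal (k + D) + ?c p))"
    proof (intro nn_integral_mono add_left_mono)
      fix p
      have "M_op U c w (?X p) = c (?X p) (xihat (?X p)) + w (xihat (?X p))" "M_op U c w (?X p) \<le> kappa U c z"
        using bellman unfolding bellman_pair_def by blast+
      then have "w (xihat (?X p)) + D \<le> (k + D) + (- c (?X p) (xihat (?X p)))" by (simp add: k_def)
      then have "ennreal (w (xihat (?X p)) + D) \<le> ennreal ((k + D) + (- c (?X p) (xihat (?X p))))" by (rule ennreal_leI)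
      also have "\<dots> = ennreal (k + D) + ?c p"
        using c_le[OF xihat_U, of "?X p" "?X p"] c0 D0 by (intro ennreal_plus) (auto simp: k_def)
      finally show "ennreal (w (xihat (?X p)) + D) \<le> ennreal (k + D) + ?c p" .
    qed
    also have "\<dots> = ennreal \<alpha> + (ennreal (k + D) + ennreal \<gamma>)"
    proof -
      have "?I (\<lambda>p. area p (act p) + (ennreal (k + D) + ?c p)) = ?I (\<lambda>p. area p (act p)) + ?I (\<lambda>p. ennreal (k + D) + ?c p)"
        by (rule add) measurable
      also have "?I (\<lambda>p. ennreal (k + D) + ?c p) = ?I (\<lambda>p. ennreal (k + D)) + ?I ?c" by (rule add) measurable
      finally show ?thesis by (simp only: \<alpha>(1) \<gamma>(1) nn_integral_const emeasure_space_1 mult_1_right)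
    qed
    finally have 1: "w y + D + G * e + \<gamma> \<le> \<alpha> + (k + D + \<gamma>)"
      unfolding eq rhs \<gamma>(1) using yD D0 e(2) G_nonneg \<alpha>(2) \<gamma>(2)
      by (simp add: k_def ennreal_mult[symmetric] ennreal_plus[symmetric] del: ennreal_plus)
    have "?I (\<lambda>p. area p (act p) + ennreal gap * act p) \<le> ennreal (r y) + ennreal G * (ennreal e + 1)"
      using stopped_bound[OF act_stopping, of y] unfolding e(1) .
    also have "?I (\<lambda>p. area p (act p) + ennreal gap * act p) = ennreal \<alpha> + ennreal gap * ennreal e"
      by (subst add) (auto simp: \<alpha>(1) cmult[OF sm] e(1))
    also have "ennreal (r y) + ennreal G * (ennreal e + 1) = ennreal (r y + G * (e + 1))"
      using r_nonneg[of y] G_nonneg e(2) by (simp add: ennreal_mult[symmetric] ennreal_plus[symmetric] del: ennreal_plus flip: ennreal_1)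
    also have "ennreal \<alpha> + ennreal gap * ennreal e = ennreal (\<alpha> + gap * e)"
      using \<alpha>(2) e(2) gap_pos by (simp add: ennreal_mult[symmetric] ennreal_plus[symmetric] del: ennreal_plus)
    finally have 2: "\<alpha> + gap * e \<le> r y + G * (e + 1)"
      using r_nonneg[of y] G_nonneg e(2) by (simp add: ennreal_le_iff del: ennreal_plus)
    have 3: "c y z \<le> w y" using bellman unfolding bellman_pair_def by (elim conjE) (erule spec)
    have "gap * e \<le> 2 * G * Ih * K y + Cq + k + G + \<bar>c y z\<bar>"
    proof -
      have "G * (e + 1) = G * e + G" by (simp add: algebra_simps)
      then show ?thesis using 1 2 3 r_le[of y] abs_ge_minus_self[of "c y z"] by linarith
    qed
    also have "\<dots> \<le> (2 * G * Ih + k + G + Cq + 1) * (K y + (\<bar>c y z\<bar> + 1))"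
    proof -
      have e: "2 * G * Ih + (k + G + Cq) + 1 = 2 * G * Ih + k + G + Cq + 1" by simp
      have "2 * G * Ih * K y + (k + G + Cq) + \<bar>c y z\<bar> \<le> (2 * G * Ih + k + G + Cq + 1) * (K y + (\<bar>c y z\<bar> + 1))"
        unfolding e[symmetric]
      proof (rule prod_dominates)
        show "0 \<le> 2 * G * Ih" using G_nonneg Ih_nonneg by simp
        show "0 \<le> k + G + Cq" using G_nonneg Cq(2) by (simp add: k_def)
        show "0 \<le> K y" using K_pos[of y] by simp
      qed simp
      then show ?thesis by linarith
    qed
    finally have "e \<le> B * (K y + (\<bar>c y z\<bar> + 1))"
      using gap_pos by (simp add: B_def field_simps)
    then show "?I act \<le> ennreal B * (ennreal (K y) + (ennreal \<bar>c y z\<bar> + 1))"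
      unfolding e(1) using B0 K_pos[of y]
      by (simp add: ennreal_mult[symmetric] ennreal_plus[symmetric] ennreal_leI del: ennreal_plus flip: ennreal_1)
  qed
qed

lemma compact_start: "compact (insert x U)" using U by simp

text \<open>On act > S the path is restarted at the fixed time \<open>S\<close>: the excess of
  \<open>act\<close> over \<open>S\<close> is at most the action time of the shifted path, whose
  mean \<open>act_bound\<close> controls at the point \<open>p S\<close>. The event is uniformly
  improbable by Markov's inequality, so (A2) and (B5) make the integral of this bound over it
  small.\<close>

lemma act_tail:
  assumes \<epsilon>: "0 < \<epsilon>"
  obtains S where "0 < S" "\<And>y. y \<in> insert x U \<Longrightarrow> (\<integral>\<^sup>+p. act p - ennreal S \<partial>P y) \<le> ennreal \<epsilon>"
proof -
  obtain B where B: "0 < B" "\<And>y. (\<integral>\<^sup>+p. act p \<partial>P y) \<le> ennreal B * (ennreal (K y) + (ennreal \<bar>c y z\<bar> + 1))"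
    by (rule act_bound) blast
  let ?\<Gamma> = "insert x U"
  let ?N = "universal_completion (path_space :: (real \<Rightarrow> 'e) measure)"
  define A where "A T = {p \<in> space path_space. ennreal T < act p}" for T
  have A: "A T \<in> sets (filt (ennreal T))" for T
    using stopping_timeD2[OF act_stopping, of "ennreal T"] by (simp add: A_def pred_def)
  have AN: "A T \<in> sets ?N" for T using A sets_filt_subset by blast
  have AP: "A T \<in> sets (completion (P y))" for T y
    by (rule sets_universal_completionD[OF AN P_prob]) (simp_all add: markov_family_space[OF P] markov_family_sets[OF P])
  note sm = stopping_time_measurable_uc[OF act_stopping]
  obtain E where E: "(SUP y\<in>?\<Gamma>. \<integral>\<^sup>+p. act p \<partial>P y) = ennreal E" "0 \<le> E"
    using act_compact[OF compact_start] by (cases "SUP y\<in>?\<Gamma>. \<integral>\<^sup>+p. act p \<partial>P y") auto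
  have lim0: "((\<lambda>T. SUP y\<in>?\<Gamma>. emeasure (completion (P y)) (A T)) \<longlongrightarrow> 0) at_top"
  proof (rule tendsto_sandwich[OF _ _ tendsto_const])
    have "((\<lambda>T. E / T) \<longlongrightarrow> 0) at_top"
      by (rule tendsto_divide_0[OF tendsto_const filterlim_at_top_imp_at_infinity[OF filterlim_ident]])
    from tendsto_ennrealI[OF this] show "((\<lambda>T. ennreal (E / T)) \<longlongrightarrow> 0) at_top" by simp
    show "\<forall>\<^sub>F T in at_top. (SUP y\<in>?\<Gamma>. emeasure (completion (P y)) (A T)) \<le> ennreal (E / T)"
      using eventually_gt_at_top[of 0]
    proof eventually_elim
      case (elim T)
      show ?case
      proof (rule SUP_least)
        fix y assume y: "y \<in> ?\<Gamma>"
        have "ennreal T * emeasure (completion (P y)) (A T) = (\<integral>\<^sup>+p. ennreal T * indicator (A T) p \<partial>completion (P y))"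
          using AP by (simp add: nn_integral_cmult_indicator)
        also have "\<dots> \<le> (\<integral>\<^sup>+p. act p \<partial>completion (P y))"
          by (intro nn_integral_mono) (auto simp: indicator_def A_def)
        also have "\<dots> \<le> ennreal E" unfolding E(1)[symmetric] nn_integral_completion by (rule SUP_upper[OF y])
        finally have "ennreal T * emeasure (completion (P y)) (A T) \<le> ennreal E" .
        then show "emeasure (completion (P y)) (A T) \<le> ennreal (E / T)"
          using elim E(2) by (cases "emeasure (completion (P y)) (A T)")
            (auto simp: ennreal_mult[symmetric] ennreal_mult_top top_unique field_simps split: if_splits)
      qed
    qed
  qed simp
  have limK: "((\<lambda>T. SUP y\<in>?\<Gamma>. \<integral>\<^sup>+p\<in>A T. ennreal (K (p T)) \<partial>completion (P y)) \<longlongrightarrow> 0) at_top"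
    using AK A lim0 compact_start unfolding asymp_unif_integrable_def by blast
  have limC: "((\<lambda>T. SUP y\<in>?\<Gamma>. \<integral>\<^sup>+p\<in>A T. ennreal \<bar>c_low U c (p T)\<bar> \<partial>completion (P y)) \<longlongrightarrow> 0) at_top"
    using B5 A lim0 compact_start unfolding cond_B5_def asymp_unif_integrable_def by blast
  \<comment> \<open>Three contributions of at most \<delta>, multiplied by \<open>B\<close>, add up
    to \<epsilon>.\<close>
  define \<delta> where "\<delta> = ennreal (\<epsilon> / (3 * B))"
  have \<delta>: "0 < \<delta>" using \<epsilon> B(1) by (simp add: \<delta>_def)
  have "\<forall>\<^sub>F T in at_top. 0 < T \<and> (SUP y\<in>?\<Gamma>. emeasure (completion (P y)) (A T)) < \<delta>
    \<and> (SUP y\<in>?\<Gamma>. \<integral>\<^sup>+p\<in>A T. ennreal (K (p T)) \<partial>completion (P y)) < \<delta>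
    \<and> (SUP y\<in>?\<Gamma>. \<integral>\<^sup>+p\<in>A T. ennreal \<bar>c_low U c (p T)\<bar> \<partial>completion (P y)) < \<delta>"
    by (intro eventually_conj eventually_gt_at_top order_tendstoD(2)[OF lim0 \<delta>] order_tendstoD(2)[OF limK \<delta>] order_tendstoD(2)[OF limC \<delta>])
  then obtain S :: real where S: "0 < S" "(SUP y\<in>?\<Gamma>. emeasure (completion (P y)) (A S)) < \<delta>"
    "(SUP y\<in>?\<Gamma>. \<integral>\<^sup>+p\<in>A S. ennreal (K (p S)) \<partial>completion (P y)) < \<delta>"
    "(SUP y\<in>?\<Gamma>. \<integral>\<^sup>+p\<in>A S. ennreal \<bar>c_low U c (p S)\<bar> \<partial>completion (P y)) < \<delta>"
    by (auto dest: eventually_happens'[OF trivial_limit_at_top_linorder])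
  show thesis
  proof (rule that[OF S(1)])
    fix y assume y: "y \<in> ?\<Gamma>"
    have cS: "(\<lambda>p. p S) \<in> completion (P y) \<rightarrow>\<^sub>M borel"
      using coord_P[of S y] S(1) by (intro measurable_completion) simp
    have [measurable]: "(\<lambda>p. ennreal (K (p S))) \<in> borel_measurable (completion (P y))"
      "(\<lambda>p. ennreal \<bar>c (p S) z\<bar>) \<in> borel_measurable (completion (P y))"
      using measurable_compose[OF cS K_measurable] measurable_compose[OF cS cz_measurable] by simp_all
    note [measurable] = AP
    have "(\<integral>\<^sup>+p. act p - ennreal S \<partial>P y) \<le> (\<integral>\<^sup>+p. indicator (A S) p * act (shift S p) \<partial>P y)"
    proof (rule nn_integral_mono)
      fix p assume p: "p \<in> space (P y)"
      show "act p - ennreal S \<le> indicator (A S) p * act (shift S p)"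
      proof (cases "p \<in> A S")
        case True
        then show ?thesis
          using entry_time_shift[of S act_set p] S(1) by (simp add: act_def ennreal_minus_le_iff add.commute)
      next
        case False
        then have "act p \<le> ennreal S" using p by (simp add: A_def markov_family_space[OF P])
        then show ?thesis by (simp add: ennreal_diff_zero)
      qed
    qed
    also have "\<dots> = (\<integral>\<^sup>+p. indicator (A S) p * (\<integral>\<^sup>+q. act q \<partial>P (p S)) \<partial>P y)"
      by (rule markov_property[OF P _ A sm]) (use S(1) in simp)
    also have "\<dots> \<le> (\<integral>\<^sup>+p. indicator (A S) p * (ennreal B * (ennreal (K (p S)) + (ennreal \<bar>c (p S) z\<bar> + 1))) \<partial>P y)"
      by (intro nn_integral_mono mult_left_mono B(2)) simp
    also have "\<dots> = (\<integral>\<^sup>+p. ennreal B * (ennreal (K (p S)) * indicator (A S) p + (ennreal \<bar>c (p S) z\<bar> * indicator (A S) p + indicator (A S) p)) \<partial>completion (P y))"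
      unfolding nn_integral_completion by (intro nn_integral_cong) (simp split: split_indicator)
    also have "\<dots> = ennreal B * ((\<integral>\<^sup>+p\<in>A S. ennreal (K (p S)) \<partial>completion (P y)) + ((\<integral>\<^sup>+p\<in>A S. ennreal \<bar>c (p S) z\<bar> \<partial>completion (P y)) + emeasure (completion (P y)) (A S)))"
      by (simp add: nn_integral_cmult nn_integral_add AP)
    also have "\<dots> \<le> ennreal B * (\<delta> + (\<delta> + \<delta>))"
    proof (intro mult_left_mono add_mono)
      show "(\<integral>\<^sup>+p\<in>A S. ennreal (K (p S)) \<partial>completion (P y)) \<le> \<delta>"
        using SUP_upper[OF y] S(3) by (rule order_trans[OF _ less_imp_le])
      show "emeasure (completion (P y)) (A S) \<le> \<delta>"
        using SUP_upper[OF y] S(2) by (rule order_trans[OF _ less_imp_le])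
      have "(\<integral>\<^sup>+p\<in>A S. ennreal \<bar>c (p S) z\<bar> \<partial>completion (P y)) \<le> (\<integral>\<^sup>+p\<in>A S. ennreal \<bar>c_low U c (p S)\<bar> \<partial>completion (P y))"
        by (intro nn_integral_mono mult_right_mono ennreal_leI cz_le_low) simp
      also have "\<dots> \<le> \<delta>"
        using SUP_upper[OF y] S(4) by (rule order_trans[OF _ less_imp_le])
      finally show "(\<integral>\<^sup>+p\<in>A S. ennreal \<bar>c (p S) z\<bar> \<partial>completion (P y)) \<le> \<delta>" .
    qed simp
    also have "\<dots> = ennreal \<epsilon>"
      unfolding \<delta>_def using \<epsilon> B(1) by (simp add: ennreal_mult[symmetric] ennreal_plus[symmetric] del: ennreal_plus)
    finally show "(\<integral>\<^sup>+p. act p - ennreal S \<partial>P y) \<le> ennreal \<epsilon>" .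
  qed
qed

end

section \<open>Uniform integrability of the cost of an impulse to \<open>z\<close>\<close>

context ergodic_rate
begin

text \<open>\<open>zeta\<close> is a supremum of reals and dominates the values on the path only if
  these are bounded. The proof uses compactness: along a monotone sequence of times the path
  converges, by right-continuity or by the existence of left limits, the nearly cheapest targets
  have a limit in \<open>U\<close>, and continuity of \<open>c\<close> at the limit pair excludes
  costs tending to minus infinity.\<close>

lemma c_low_bounded_on_path:
  assumes p: "p \<in> space path_space"
  shows "\<exists>M. \<forall>t\<in>{0..S}. \<bar>c_low U c (p t)\<bar> \<le> M"
proof (rule ccontr)
  assume "\<not> ?thesis"
  then have "\<forall>n::nat. \<exists>t\<in>{0..S}. real n < \<bar>c_low U c (p t)\<bar>" by (auto simp: not_le)
  then obtain t where t: "\<And>n. t n \<in> {0..S}" "\<And>n. real n < \<bar>c_low U c (p (t n))\<bar>" by metis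
  have "\<exists>a\<in>U. c (p (t n)) a < - real n" for n
  proof -
    have "c_low U c (p (t n)) \<le> 0"
      unfolding c_low_def using cINF_lower[OF c_bdd_below zU] c_le[OF zU] c0 by (meson less_imp_le neg_le_0_iff_le order_trans)
    then have "c_low U c (p (t n)) < - real n" using t(2)[of n] by linarith
    then show ?thesis unfolding c_low_def using zU c_bdd_below by (subst (asm) cINF_less_iff) auto
  qed
  then obtain a where a: "\<And>n. a n \<in> U" "\<And>n. c (p (t n)) (a n) < - real n" by metis
  obtain b r where b: "b \<in> U" "strict_mono r" "(a \<circ> r) \<longlonglongrightarrow> b"
    using compact_imp_seq_compact[OF U] a(1) unfolding seq_compact_def by blast
  obtain f' where f': "strict_mono f'" "monoseq (\<lambda>n. (t \<circ> r) (f' n))" using seq_monosub by blast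
  define s where "s n = t (r (f' n))" for n
  have ms: "monoseq s" using f'(2) by (simp add: s_def[abs_def])
  have sin: "s n \<in> {0..S}" for n unfolding s_def by (rule t(1))
  have "Bseq s" by (rule BseqI'[of _ S]) (use sin in auto)
  then obtain l where l: "s \<longlonglongrightarrow> l" using Bseq_monoseq_convergent[OF _ ms] convergent_def by blast
  have l0: "0 \<le> l" by (rule LIMSEQ_le_const[OF l]) (use sin in auto)
  have cp: "cadlag p" using p by (simp add: space_path_space)
  \<comment> \<open>A monotone sequence either reaches its limit and stays there, or approaches it
    strictly from one side.\<close>
  have "\<exists>e. (\<lambda>n. p (s n)) \<longlonglongrightarrow> e"
  proof (cases "\<exists>n. s n = l")
    case True
    then obtain n where n: "s n = l" by blast
    have "s k = l" if "n \<le> k" for k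
    proof (cases "incseq s")
      case True
      then have "s n \<le> s k" "s k \<le> l" using that incseq_le[OF True l] by (auto simp: incseqD)
      then show ?thesis using n by simp
    next
      case False
      then have "decseq s" using ms by (simp add: monoseq_iff)
      then have "s k \<le> s n" "l \<le> s k" using that decseq_ge[OF _ l] by (auto simp: decseqD)
      then show ?thesis using n by simp
    qed
    then have "\<forall>\<^sub>F k in sequentially. p l = p (s k)" by (auto simp: eventually_sequentially intro!: exI[of _ n])
    from Lim_transform_eventually[OF tendsto_const this] show ?thesis by blast
  next
    case ne: False
    show ?thesis
    proof (cases "incseq s")
      case True
      have lt: "s n < l" for n using incseq_le[OF True l, of n] ne by (metis order_le_less)
      then have "filterlim s (at_left l) sequentially" using l ne by (auto simp: filterlim_at intro!: always_eventually)
      moreover have "0 < l" using lt[of 0] sin[of 0] by auto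
      then obtain e where "(p \<longlongrightarrow> e) (at_left l)" using cp by (auto simp: cadlag_def)
      ultimately show ?thesis using filterlim_compose by blast
    next
      case False
      then have d: "decseq s" using ms by (simp add: monoseq_iff)
      have lt: "l < s n" for n using decseq_ge[OF d l, of n] ne by (metis order_le_less)
      then have "filterlim s (at_right l) sequentially" using l ne by (auto simp: filterlim_at intro!: always_eventually)
      moreover have "(p \<longlongrightarrow> p l) (at_right l)" using cp l0 by (auto simp: cadlag_def)
      ultimately show ?thesis using filterlim_compose by blast
    qed
  qed
  then obtain e where e: "(\<lambda>n. p (s n)) \<longlonglongrightarrow> e" by blast
  have "(\<lambda>n. a (r (f' n))) \<longlonglongrightarrow> b" using LIMSEQ_subseq_LIMSEQ[OF b(3) f'(1)] by (simp add: comp_def)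
  with e have "(\<lambda>n. (p (s n), a (r (f' n)))) \<longlonglongrightarrow> (e, b)" by (intro tendsto_intros)
  from continuous_on_tendsto_compose[OF c_cont this]
  have "(\<lambda>n. c (p (s n)) (a (r (f' n)))) \<longlonglongrightarrow> c e b" using a(1) b(1) by (auto intro!: always_eventually)
  then have "Bseq (\<lambda>n. c (p (s n)) (a (r (f' n))))" by (intro convergent_imp_Bseq) (auto simp: convergent_def)
  then obtain M where M: "\<And>n. \<bar>c (p (s n)) (a (r (f' n)))\<bar> \<le> M" unfolding Bseq_def by auto
  obtain n :: nat where n: "M < real n" using reals_Archimedean2 by blast
  have "n \<le> r (f' n)" using seq_suble[OF strict_mono_compose[OF b(2) f'(1)], of n] by simp
  then have "c (p (s n)) (a (r (f' n))) < - real n"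
    using a(2)[of "r (f' n)"] unfolding s_def by (meson le_less_trans neg_le_iff_le not_less of_nat_le_iff order_less_le_trans)
  with M[of n] n show False by linarith
qed

abbreviation tail_cost :: "real \<Rightarrow> real \<Rightarrow> 'e \<Rightarrow> ennreal" where
  "tail_cost n s y \<equiv> \<integral>\<^sup>+p. ennreal \<bar>c (p s) z\<bar> * indicator {p. n < \<bar>c (p s) z\<bar>} p \<partial>P y"

lemma tail_cost_antimono: "n \<le> n' \<Longrightarrow> tail_cost n' s y \<le> tail_cost n s y"
  by (intro nn_integral_mono mult_left_mono) (auto simp: indicator_def)

lemma tail_cost_short:
  assumes \<epsilon>: "0 < \<epsilon>" and S: "0 < S"
  obtains n :: nat where "\<And>s y. 0 \<le> s \<Longrightarrow> s \<le> S \<Longrightarrow> y \<in> insert x U \<Longrightarrow> tail_cost (real n) s y \<le> ennreal \<epsilon>"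
proof -
  have "(\<lambda>n::nat. SUP y\<in>insert x U. \<integral>\<^sup>+p\<in>{p. zeta U c S p > real n}. ennreal (zeta U c S p) \<partial>completion (P y)) \<longlonglongrightarrow> 0"
    using B2 compact_start S unfolding cond_B2_def by blast
  from order_tendstoD(2)[OF this, of "ennreal \<epsilon>"] \<epsilon>
  obtain n where n: "(SUP y\<in>insert x U. \<integral>\<^sup>+p\<in>{p. zeta U c S p > real n}. ennreal (zeta U c S p) \<partial>completion (P y)) < ennreal \<epsilon>"
    by (auto simp: eventually_sequentially)
  show thesis
  proof (rule that)
    fix s :: real and y assume s: "0 \<le> s" "s \<le> S" and y: "y \<in> insert x U"
    have "tail_cost (real n) s y \<le> (\<integral>\<^sup>+p\<in>{p. zeta U c S p > real n}. ennreal (zeta U c S p) \<partial>P y)"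
    proof (rule nn_integral_mono)
      fix p assume "p \<in> space (P y)"
      then have p: "p \<in> space path_space" by (simp add: markov_family_space[OF P])
      obtain M where M: "\<forall>t\<in>{0..S}. \<bar>c_low U c (p t)\<bar> \<le> M" using c_low_bounded_on_path[OF p] by blast
      have "\<bar>c_low U c (p s)\<bar> \<le> zeta U c S p"
        unfolding zeta_def using s M by (intro cSUP_upper) (auto intro!: bdd_aboveI2)
      then have "\<bar>c (p s) z\<bar> \<le> zeta U c S p" using cz_le_low[of "p s"] by linarith
      then show "ennreal \<bar>c (p s) z\<bar> * indicator {p. real n < \<bar>c (p s) z\<bar>} p \<le> ennreal (zeta U c S p) * indicator {p. zeta U c S p > real n} p"
        by (auto simp: indicator_def intro: ennreal_leI)
    qed
    also have "\<dots> \<le> (SUP y\<in>insert x U. \<integral>\<^sup>+p\<in>{p. zeta U c S p > real n}. ennreal (zeta U c S p) \<partial>completion (P y))"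
      unfolding nn_integral_completion by (rule SUP_upper[OF y])
    finally show "tail_cost (real n) s y \<le> ennreal \<epsilon>" using n by simp
  qed
qed

text \<open>Integrability of \<open>h\<close> on the half-line does not give convergence to 0. But
  if h s + h (s + t) stayed above \<eta>, its integral over the half-line would be infinite, while
  it is at most twice the integral of \<open>h\<close>.\<close>

lemma h_small:
  assumes t: "0 \<le> t" and \<eta>: "0 < \<eta>"
  obtains s where "0 \<le> s" "h s + h (s + t) < \<eta>"
proof -
  have "\<exists>s\<ge>0. h s + h (s + t) < \<eta>"
  proof (rule ccontr)
    assume "\<not> ?thesis"
    then have ge: "\<eta> \<le> h s + h (s + t)" if "0 \<le> s" for s using that by (meson not_le)
    let ?h = "\<lambda>s. ennreal (indicat_real {0..} s *\<^sub>R h s)"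
    have hi: "integrable lborel (\<lambda>s. indicat_real {0..} s *\<^sub>R h s)" using h_int by (simp add: set_integrable_def)
    have m: "?h \<in> borel_measurable borel" using borel_measurable_integrable[OF hi] by simp
    have fin: "(\<integral>\<^sup>+s. ?h s \<partial>lborel) < \<infinity>"
      using hi h_nonneg by (subst nn_integral_eq_integral) (auto simp: indicator_def)
    have "(\<integral>\<^sup>+(s::real). ennreal \<eta> * indicator {0..} s \<partial>lborel) \<le> (\<integral>\<^sup>+s. ?h s + ?h (t + 1 * s) \<partial>lborel)"
    proof (rule nn_integral_mono)
      fix s :: real
      show "ennreal \<eta> * indicator {0..} s \<le> ?h s + ?h (t + 1 * s)"
      proof (cases "0 \<le> s")
        case True
        have "ennreal \<eta> \<le> ennreal (h s + h (s + t))" by (rule ennreal_leI[OF ge[OF True]])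
        also have "\<dots> = ennreal (h s) + ennreal (h (s + t))" using True t h_nonneg by (intro ennreal_plus) auto
        finally show ?thesis using True t by (simp add: add.commute)
      qed simp
    qed
    also have "\<dots> = (\<integral>\<^sup>+s. ?h s \<partial>lborel) + (\<integral>\<^sup>+s. ?h (t + 1 * s) \<partial>lborel)"
      using m by (intro nn_integral_add) auto
    also have "(\<integral>\<^sup>+s. ?h (t + 1 * s) \<partial>lborel) = (\<integral>\<^sup>+s. ?h s \<partial>lborel)"
      using nn_integral_real_affine[OF m, of 1 t] by simp
    finally have "(\<integral>\<^sup>+(s::real). ennreal \<eta> * indicator {0..} s \<partial>lborel) < \<infinity>"
      by (rule le_less_trans) (use fin in simp)
    moreover have "emeasure lborel {0::real..} = \<infinity>"
    proof (rule ccontr)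
      assume "emeasure lborel {0::real..} \<noteq> \<infinity>"
      then obtain v where v: "emeasure lborel {0::real..} = ennreal v" "0 \<le> v" by (cases "emeasure lborel {0::real..}") auto
      have "ennreal (v + 1) = emeasure lborel {0..v + 1}" using v(2) by simp
      also have "\<dots> \<le> emeasure lborel {0::real..}" by (intro emeasure_mono) auto
      finally show False unfolding v(1) using v(2) by (simp add: ennreal_le_iff del: ennreal_plus)
    qed
    ultimately show False using \<eta> by (simp add: nn_integral_cmult_indicator ennreal_mult_top)
  qed
  then show thesis using that by blast
qed

lemma kernel_measurable:
  assumes t: "0 \<le> t" and B: "B \<in> sets borel"
  shows "(\<lambda>y. measure (trans_prob P t y) B) \<in> borel_measurable borel"
proof -
  have "(\<lambda>y. distr (P y) borel (\<lambda>p. p t)) \<in> borel \<rightarrow>\<^sub>M subprob_algebra borel"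
    by (rule measurable_distr2[OF _ measurable_prob_algebraD[OF markov_family_measurable[OF P]]])
       (use measurable_compose[OF measurable_snd measurable_path_coord[OF t]] in \<open>simp add: split_def\<close>)
  from measurable_emeasure_kernel[OF this B] show ?thesis by (simp add: trans_prob_def measure_def)
qed

lemma chapman_kolmogorov:
  assumes s: "0 \<le> s" and t: "0 \<le> t" and B: "B \<in> sets borel"
  shows "measure (trans_prob P (s + t) y) B = (\<integral>y'. measure (trans_prob P t y') B \<partial>trans_prob P s y)"
proof -
  interpret S: prob_space "trans_prob P s y" by (rule trans_prob(1)[OF s])
  have pr: "prob_space (trans_prob P t y')" for y' by (rule trans_prob(1)[OF t])
  have em: "emeasure (trans_prob P t y') B = (\<integral>\<^sup>+q. indicator B (q t) \<partial>P y')" if "0 \<le> t" for t y'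
    unfolding trans_prob_def using that B nn_integral_distr[OF coord_P[OF that], of "indicator B"] by simp
  have sp: "space (path_space :: (real \<Rightarrow> 'e) measure) \<in> sets (filt (ennreal s))"
    using sets.top[of "filt (ennreal s) :: (real \<Rightarrow> 'e) measure"] by simp
  have im: "(\<lambda>q. indicator B (q t) :: ennreal) \<in> borel_measurable path_space"
    by (rule measurable_compose[OF measurable_path_coord[OF t]]) (use B in simp)
  have "emeasure (trans_prob P (s + t) y) B = (\<integral>\<^sup>+p. indicator (space path_space) p * indicator B (shift s p t) \<partial>P y)"
    using s t by (subst em) (auto simp: shift_def markov_family_space[OF P] intro!: nn_integral_cong)
  also have "\<dots> = (\<integral>\<^sup>+p. indicator (space path_space) p * (\<integral>\<^sup>+q. indicator B (q t) \<partial>P (p s)) \<partial>P y)"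
    by (rule markov_property[OF P s sp measurable_universal_completion[OF im]])
  also have "\<dots> = (\<integral>\<^sup>+p. emeasure (trans_prob P t (p s)) B \<partial>P y)"
    using em[OF t] by (intro nn_integral_cong) (simp add: markov_family_space[OF P])
  also have "\<dots> = (\<integral>\<^sup>+p. ennreal (measure (trans_prob P t (p s)) B) \<partial>P y)"
    using prob_space.finite_measure[OF pr] by (simp add: finite_measure.emeasure_eq_measure)
  also have "\<dots> = (\<integral>\<^sup>+y'. ennreal (measure (trans_prob P t y') B) \<partial>trans_prob P s y)"
    unfolding trans_prob_def[of P s y] using kernel_measurable[OF t B]
    by (subst nn_integral_distr[OF coord_P[OF s]]) auto
  also have "\<dots> = ennreal (\<integral>y'. measure (trans_prob P t y') B \<partial>trans_prob P s y)"
    using kernel_measurable[OF t B] prob_space.prob_le_1[OF pr]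
    by (intro nn_integral_eq_integral S.integrable_const_bound[of _ 1])
       (auto simp: measurable_cong_sets[OF trans_prob(2) refl])
  finally show ?thesis
    using prob_space.finite_measure[OF trans_prob(1)[of "s + t" y]] s t
    by (simp add: finite_measure.emeasure_eq_measure integral_nonneg_AE)
qed

text \<open>By Chapman-Kolmogorov the two quantities integrate the same function under two laws,
  that at time \<open>s\<close> and \<mu>. The error is thus governed by \<open>h s\<close> alone
  and uniform in \<open>t\<close>, so a single good \<open>s\<close> controls all later
  times.\<close>

lemma kernel_mean_diff:
  assumes s: "0 \<le> s" and t: "0 \<le> t" and B: "B \<in> sets borel"
  shows "\<bar>measure (trans_prob P (s + t) y) B - (\<integral>y'. measure (trans_prob P t y') B \<partial>\<mu>)\<bar> \<le> 2 * (K y * h s)"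
proof -
  have "\<bar>(\<integral>y'. measure (trans_prob P t y') B \<partial>trans_prob P s y) - (\<integral>y'. measure (trans_prob P t y') B \<partial>\<mu>)\<bar>
     \<le> 2 * 1 * tv_norm (trans_prob P s y) \<mu>"
  proof (rule integral_tv[OF trans_prob(1)[OF s] \<mu>])
    show "sets \<mu> = sets (trans_prob P s y)" by (simp add: \<mu>_sets trans_prob(2))
    show "(\<lambda>y'. measure (trans_prob P t y') B) \<in> borel_measurable (trans_prob P s y)"
      unfolding measurable_cong_sets[OF trans_prob(2) refl] by (rule kernel_measurable[OF t B])
    show "\<bar>measure (trans_prob P t y') B\<bar> \<le> 1" for y' using prob_space.prob_le_1[OF trans_prob(1)[OF t]] by simp
  qed
  then show ?thesis using tv[OF s, of y] unfolding chapman_kolmogorov[OF assms] by linarith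
qed

text \<open>Invariance follows from convergence: at time s + t the law of the process is close to
  \<mu> moved by the kernel and to \<mu> itself, with errors 2 K h(s) and K h(s + t), and both can
  be made small by \<open>h_small\<close>.\<close>

lemma \<mu>_invariant:
  assumes t: "0 \<le> t" and B: "B \<in> sets borel"
  shows "(\<integral>y. measure (trans_prob P t y) B \<partial>\<mu>) = measure \<mu> B"
proof (rule ccontr)
  let ?d = "\<bar>(\<integral>y. measure (trans_prob P t y) B \<partial>\<mu>) - measure \<mu> B\<bar>"
  assume "(\<integral>y. measure (trans_prob P t y) B \<partial>\<mu>) \<noteq> measure \<mu> B"
  then have "0 < ?d / (2 * K x)" using K_pos[of x] by simp
  then obtain s where s: "0 \<le> s" "h s + h (s + t) < ?d / (2 * K x)" using h_small[OF t] by blast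
  have "?d \<le> 2 * (K x * h s) + K x * h (s + t)"
    using kernel_mean_diff[OF s(1) t B, of x] trans_prob_measure[of "s + t" B x] s(1) t B by linarith
  also have "\<dots> \<le> 2 * K x * (h s + h (s + t))"
    using K_pos[of x] h_nonneg[of "s + t"] s(1) t by (simp add: algebra_simps)
  also have "\<dots> < ?d" using s(2) K_pos[of x] by (simp add: field_simps)
  finally show False by simp
qed

text \<open>Under \<mu> the sets where |c v z| exceeds \<open>n\<close> shrink to the empty set. For
  T \<ge> s + 1 the law at time \<open>T\<close> exceeds \<mu> on them by at most 2 K h(s),
  uniformly over \<open>insert x U\<close>, where \<open>K\<close> is bounded.\<close>

lemma trans_prob_tail:
  assumes \<delta>: "0 < \<delta>"
  obtains N :: nat and T0 :: real where "0 < T0"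
    "\<And>n T y. N \<le> n \<Longrightarrow> T0 \<le> T \<Longrightarrow> y \<in> insert x U \<Longrightarrow> measure (trans_prob P T y) {v. real n < \<bar>c v z\<bar>} \<le> \<delta>"
proof -
  interpret \<mu>: prob_space \<mu> by (rule \<mu>)
  define A where "A n = {v. real n < \<bar>c v z\<bar>}" for n
  have Ab: "A n \<in> sets borel" for n unfolding A_def using cz_measurable by measurable
  have dec: "decseq A"
    unfolding decseq_def A_def by (auto intro: le_less_trans[rotated])
  have "(\<Inter>n. A n) = {}"
  proof (rule equals0I)
    fix v assume "v \<in> (\<Inter>n. A n)"
    then have "\<forall>n. real n < \<bar>c v z\<bar>" by (simp add: A_def)
    with reals_Archimedean2[of "\<bar>c v z\<bar>"] show False by (meson less_asym)
  qed
  then have "(\<lambda>n. measure \<mu> (A n)) \<longlonglongrightarrow> 0"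
    using \<mu>.finite_Lim_measure_decseq[OF _ dec] Ab \<mu>_sets by (auto simp: image_subset_iff)
  from order_tendstoD(2)[OF this, of "\<delta> / 2"] \<delta>
  obtain N where N: "measure \<mu> (A N) < \<delta> / 2" by (auto simp: eventually_sequentially)
  have "bounded (K ` insert x U)" using rate compact_start unfolding tv_rate_def by blast
  then obtain Kb where Kb: "\<And>y. y \<in> insert x U \<Longrightarrow> \<bar>K y\<bar> \<le> Kb"
    unfolding bounded_iff by (auto simp del: image_insert)
  have Kb0: "0 < Kb" using Kb[of x] K_pos[of x] by simp
  obtain s where s: "0 \<le> s" "h s + h (s + 0) < \<delta> / (2 * Kb)" using h_small[of 0 "\<delta> / (2 * Kb)"] \<delta> Kb0 by auto
  show thesis
  proof (rule that[of "s + 1" N])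
    show "0 < s + 1" using s by simp
    fix n T y assume n: "N \<le> n" and T: "s + 1 \<le> T" and y: "y \<in> insert x U"
    have "measure (trans_prob P T y) (A n) \<le> measure \<mu> (A n) + 2 * (K y * h s)"
      using kernel_mean_diff[OF s(1) _ Ab[of n], of "T - s" y] \<mu>_invariant[OF _ Ab[of n], of "T - s"] T by simp
    also have "\<dots> \<le> measure \<mu> (A N) + 2 * (Kb * h s)"
      using Kb[OF y] h_nonneg[OF s(1)] decseqD[OF dec n] Ab \<mu>_sets
      by (intro add_mono mult_left_mono mult_right_mono \<mu>.finite_measure_mono) auto
    also have "\<dots> \<le> \<delta>" using N s(2) Kb0 by (simp add: field_simps)
    finally show "measure (trans_prob P T y) {v. real n < \<bar>c v z\<bar>} \<le> \<delta>" by (simp add: A_def)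
  qed
qed

text \<open>(B5) speaks of one family of events indexed by time. If the claim fails at every level,
  there are times \<open>s N\<close>, at least 1 apart, where level \<open>N\<close> fails. The
  events N < |c(X, z)| at time \<open>s N\<close>, empty at all other times, are improbable by
  \<open>trans_prob_tail\<close>, so (B5) contradicts the choice.\<close>

lemma tail_cost_long:
  assumes \<epsilon>: "0 < \<epsilon>"
  shows "\<exists>(N::nat) T0. \<forall>T\<ge>T0. \<forall>y\<in>insert x U. tail_cost (real N) T y \<le> ennreal \<epsilon>"
proof (rule ccontr)
  assume "\<not> ?thesis"
  then have ex: "\<And>(N::nat) T0. \<exists>T\<ge>T0. \<exists>y\<in>insert x U. ennreal \<epsilon> < tail_cost (real N) T y" by (auto simp: not_le)
  have "\<exists>s. \<forall>N. (1 \<le> s N \<and> (\<exists>y\<in>insert x U. ennreal \<epsilon> < tail_cost (real N) (s N) y)) \<and> s N + 1 \<le> s (Suc N)"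
  proof (rule dependent_nat_choice)
    show "\<exists>T. 1 \<le> T \<and> (\<exists>y\<in>insert x U. ennreal \<epsilon> < tail_cost (real 0) T y)" using ex[of 1 0] by blast
    fix T N assume T: "1 \<le> T \<and> (\<exists>y\<in>insert x U. ennreal \<epsilon> < tail_cost (real N) T y)"
    obtain T' where "T + 1 \<le> T'" "\<exists>y\<in>insert x U. ennreal \<epsilon> < tail_cost (real (Suc N)) T' y"
      using ex[of "T + 1" "Suc N"] by blast
    moreover have "1 \<le> T'" using \<open>T + 1 \<le> T'\<close> T by linarith
    ultimately show "\<exists>T'. (1 \<le> T' \<and> (\<exists>y\<in>insert x U. ennreal \<epsilon> < tail_cost (real (Suc N)) T' y)) \<and> T + 1 \<le> T'"
      by blast
  qed
  then obtain s where s1: "\<And>N. 1 \<le> s N" and sy: "\<And>N. \<exists>y\<in>insert x U. ennreal \<epsilon> < tail_cost (real N) (s N) y"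
    and sS: "\<And>N. s N + 1 \<le> s (Suc N)" by blast
  have sN: "real N \<le> s N" for N
    by (induction N) (use s1[of 0] sS in \<open>auto intro: order_trans\<close>, smt (verit) sS)
  have sm: "strict_mono s" unfolding strict_mono_Suc_iff using sS by (smt (verit))
  then have inj: "inj s" by (rule strict_mono_imp_inj_on)
  \<comment> \<open>Strict growth of \<open>s\<close> makes it injective, so that each time in its
    range carries one level, \<open>inv s T\<close>.\<close>
  define A where "A T = (if T \<in> range s then {p \<in> space (path_space :: (real \<Rightarrow> 'e) measure). real (inv s T) < \<bar>c (p T) z\<bar>} else {})" for T
  have cm: "(\<lambda>p. \<bar>c (p T) z\<bar>) \<in> borel_measurable (raw_filt (ennreal T))" if "0 \<le> T" for T
    by (rule measurable_compose[OF measurable_raw_filt_coord[OF that order_refl] cz_measurable])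
  have A: "A T \<in> sets (filt (ennreal T))" if "0 < T" for T
  proof -
    have "{p \<in> space (raw_filt (ennreal T)). real (inv s T) < \<bar>c (p T) z\<bar>} \<in> sets (raw_filt (ennreal T))"
      using cm[OF less_imp_le[OF that]] by measurable
    from subsetD[OF sets_le_universal_completion this]
    have "{p \<in> space path_space. real (inv s T) < \<bar>c (p T) z\<bar>} \<in> sets (filt (ennreal T))" by (simp add: filt_def)
    then show ?thesis by (cases "T \<in> range s") (simp_all add: A_def)
  qed
  have lim0: "((\<lambda>T. SUP y\<in>insert x U. emeasure (completion (P y)) (A T)) \<longlongrightarrow> 0) at_top"
  proof (rule order_tendstoI)
    fix \<alpha> :: ennreal assume "0 < \<alpha>"
    then obtain \<delta> where \<delta>: "0 < \<delta>" "ennreal \<delta> < \<alpha>"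
    proof (cases \<alpha>)
      case (real v)
      then show ?thesis using \<open>0 < \<alpha>\<close> that[of "v / 2"] by (simp add: ennreal_less_iff)
    qed (use that[of 1] in simp)
    obtain N T0 where NT: "0 < T0" "\<And>n T y. N \<le> n \<Longrightarrow> T0 \<le> T \<Longrightarrow> y \<in> insert x U \<Longrightarrow> measure (trans_prob P T y) {v. real n < \<bar>c v z\<bar>} \<le> \<delta>"
      by (rule trans_prob_tail[OF \<delta>(1)]) blast
    show "\<forall>\<^sub>F T in at_top. (SUP y\<in>insert x U. emeasure (completion (P y)) (A T)) < \<alpha>"
      using eventually_ge_at_top[of "max T0 (s N)"]
    proof eventually_elim
      case (elim T)
      have "(SUP y\<in>insert x U. emeasure (completion (P y)) (A T)) \<le> ennreal \<delta>"
      proof (rule SUP_least)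
        fix y assume y: "y \<in> insert x U"
        show "emeasure (completion (P y)) (A T) \<le> ennreal \<delta>"
        proof (cases "T \<in> range s")
          case True
          then obtain k where k: "T = s k" by blast
          have "N \<le> k" using elim k strict_mono_less_eq[OF sm, of N k] by simp
          have T: "0 \<le> T" using elim NT(1) by simp
          have Bk: "{v. real k < \<bar>c v z\<bar>} \<in> sets borel" using cz_measurable by measurable
          have Ae: "A T = (\<lambda>p. p T) -` {v. real k < \<bar>c v z\<bar>} \<inter> space (P y)"
            using inj by (auto simp: A_def k markov_family_space[OF P] inv_f_f)
          have "A T \<in> sets (P y)" unfolding Ae by (rule measurable_sets[OF coord_P[OF T] Bk])
          then have "emeasure (completion (P y)) (A T) = emeasure (P y) (A T)" by simp
          also have "\<dots> = emeasure (trans_prob P T y) {v. real k < \<bar>c v z\<bar>}"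
            unfolding trans_prob_def Ae by (rule emeasure_distr[OF coord_P[OF T] Bk, symmetric])
          also have "\<dots> \<le> ennreal \<delta>"
            using NT(2)[OF \<open>N \<le> k\<close> _ y, of T] elim prob_space.finite_measure[OF trans_prob(1)[OF T]]
            by (simp add: finite_measure.emeasure_eq_measure ennreal_leI)
          finally show ?thesis .
        qed (simp add: A_def)
      qed
      then show ?case using \<delta>(2) by (rule le_less_trans)
    qed
  qed simp
  have "((\<lambda>T. SUP y\<in>insert x U. \<integral>\<^sup>+p\<in>A T. ennreal \<bar>c_low U c (p T)\<bar> \<partial>completion (P y)) \<longlongrightarrow> 0) at_top"
    using B5 A lim0 compact_start unfolding cond_B5_def asymp_unif_integrable_def by blast
  from order_tendstoD(2)[OF this, of "ennreal \<epsilon>"] \<epsilon>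
  obtain T1 where T1: "\<And>T. T1 \<le> T \<Longrightarrow> (SUP y\<in>insert x U. \<integral>\<^sup>+p\<in>A T. ennreal \<bar>c_low U c (p T)\<bar> \<partial>completion (P y)) < ennreal \<epsilon>"
    by (auto simp: eventually_at_top_linorder)
  obtain N :: nat where "T1 \<le> real N" using real_arch_simple by blast
  then have TN: "T1 \<le> s N" using sN[of N] by linarith
  obtain y where y: "y \<in> insert x U" "ennreal \<epsilon> < tail_cost (real N) (s N) y" using sy by blast
  have "tail_cost (real N) (s N) y \<le> (\<integral>\<^sup>+p\<in>A (s N). ennreal \<bar>c_low U c (p (s N))\<bar> \<partial>P y)"
    using inj cz_le_low by (intro nn_integral_mono) (auto simp: A_def indicator_def markov_family_space[OF P] inv_f_f intro!: ennreal_leI)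
  also have "\<dots> \<le> (SUP y\<in>insert x U. \<integral>\<^sup>+p\<in>A (s N). ennreal \<bar>c_low U c (p (s N))\<bar> \<partial>completion (P y))"
    unfolding nn_integral_completion by (rule SUP_upper[OF y(1)])
  also have "\<dots> < ennreal \<epsilon>" by (rule T1[OF TN])
  finally show False using y(2) by simp
qed

lemma tail_cost_uniform:
  assumes \<epsilon>: "0 < \<epsilon>"
  obtains n :: nat where "\<And>s y. 0 \<le> s \<Longrightarrow> y \<in> insert x U \<Longrightarrow> tail_cost (real n) s y \<le> ennreal \<epsilon>"
proof -
  obtain N T0 where NT: "\<And>T y. T0 \<le> T \<Longrightarrow> y \<in> insert x U \<Longrightarrow> tail_cost (real N) T y \<le> ennreal \<epsilon>"
    using tail_cost_long[OF \<epsilon>] by blast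
  obtain n where n: "\<And>s y. 0 \<le> s \<Longrightarrow> s \<le> max 1 T0 \<Longrightarrow> y \<in> insert x U \<Longrightarrow> tail_cost (real n) s y \<le> ennreal \<epsilon>"
    by (rule tail_cost_short[OF \<epsilon>, of "max 1 T0"]) auto
  show thesis
  proof (rule that[of "max n N"])
    fix s :: real and y assume s: "0 \<le> s" and y: "y \<in> insert x U"
    show "tail_cost (real (max n N)) s y \<le> ennreal \<epsilon>"
    proof (cases "T0 \<le> s")
      case True
      have "tail_cost (real (max n N)) s y \<le> tail_cost (real N) s y" by (rule tail_cost_antimono) simp
      then show ?thesis using NT[OF True y] by (rule order_trans)
    next
      case False
      have "tail_cost (real (max n N)) s y \<le> tail_cost (real n) s y" by (rule tail_cost_antimono) simp
      then show ?thesis using n[OF s _ y] False by (auto intro: order_trans)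
    qed
  qed
qed

end

subsection \<open>One stage of a controlled process\<close>

context running_reward
begin

text \<open>After resampling, the stage reads only the part of its coordinate behind the delay, so
  its reward is that of \<open>p\<close> over the elapsed time, cut in the same way.\<close>

lemma seg_restart:
  assumes V: "impulse_strategy U V" and w: "\<omega> \<in> space multi_path_space" and p: "p \<in> space path_space"
    and S: "start_time V n \<omega> = ennreal s0" "0 \<le> s0"
    and \<omega>': "\<omega>' = fun_upd \<omega> n (restart (start_time V n \<omega>) y p)"
  shows "seg V n t \<omega>' = area p (min (fst V n \<omega>' - ennreal s0) (t - ennreal s0))"
proof -
  have w': "\<omega>' \<in> space multi_path_space" using w restart_in_space[OF p] by (simp add: \<omega>' space_multi_path_space)
  have S': "start_time V n \<omega>' = ennreal s0"
    using start_depends(1)[OF V w w', of n] S by (simp add: \<omega>')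
  let ?\<tau> = "fst V n \<omega>'"
  let ?H = "\<lambda>s. ennreal (f (p (max 0 (s - s0))) - lam + G) * indicator {s. s0 \<le> s \<and> ennreal s < min ?\<tau> t} s"
  have pm: "(\<lambda>s. f (p (max 0 (s - s0)))) \<in> borel_measurable borel"
    using measurable_compose[of "\<lambda>s. s - s0" borel borel, OF _ path_reward_measurable[OF p]] by simp
  have Hm: "?H \<in> borel_measurable borel"
  proof -
    have "{s \<in> space borel. s0 \<le> s \<and> ennreal s < min ?\<tau> t} \<in> sets (borel :: real measure)" by measurable
    then show ?thesis using pm by simp
  qed
  have lt: "ennreal s < min (?\<tau> - ennreal s0) (t - ennreal s0) \<longleftrightarrow> ennreal (s0 + s) < min ?\<tau> t" if "0 \<le> s" for s
  proof -
    have "ennreal s < u - ennreal s0 \<longleftrightarrow> ennreal (s0 + s) < u" for u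
      using S(2) that by (cases u) (auto simp: ennreal_minus ennreal_less_iff ennreal_plus[symmetric] simp del: ennreal_plus)
    then show ?thesis by simp
  qed
  have "seg V n t \<omega>' = (\<integral>\<^sup>+s. ?H s \<partial>lborel)"
    unfolding seg_def S' using S(2)
    by (intro nn_integral_cong) (auto simp: indicator_def \<omega>' S(1) restart_def ennreal_less_iff max_def)
  also have "\<dots> = (\<integral>\<^sup>+s. ?H (s0 + 1 * s) \<partial>lborel)"
    using nn_integral_real_affine[OF Hm, of 1 s0] by simp
  also have "\<dots> = area p (min (?\<tau> - ennreal s0) (t - ennreal s0))"
    unfolding area_def using lt by (intro nn_integral_cong) (auto simp: indicator_def max_def)
  finally show ?thesis .
qed

lemma seg_after:
  assumes w: "\<omega> \<in> space multi_path_space" and fin: "fst V n \<omega> < \<infinity>" and T: "0 \<le> T"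
  shows "seg V n \<top> \<omega> \<le> seg V n (ennreal T) \<omega> + ennreal (2 * G) * (fst V n \<omega> - ennreal T)"
proof -
  obtain t where t: "fst V n \<omega> = ennreal t" "0 \<le> t" using fin by (cases "fst V n \<omega>") auto
  let ?A = "{s. 0 \<le> s \<and> start_time V n \<omega> \<le> ennreal s \<and> ennreal s < min (fst V n \<omega>) (ennreal T)}"
  let ?g = "\<lambda>s. ennreal (f (\<omega> n (max 0 s)) - lam + G) * indicator ?A s"
  have gm: "?g \<in> borel_measurable lborel"
  proof -
    have "{s \<in> space borel. 0 \<le> s \<and> start_time V n \<omega> \<le> ennreal s \<and> ennreal s < min (fst V n \<omega>) (ennreal T)} \<in> sets (borel :: real measure)"
      by measurable
    then show ?thesis using path_reward_measurable[of "\<omega> n"] w by (simp add: space_multi_path_space)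
  qed
  have g: "seg V n (ennreal T) \<omega> = (\<integral>\<^sup>+s. ?g s \<partial>lborel)"
    unfolding seg_def by (intro nn_integral_cong) (auto simp: indicator_def max_def)
  have "seg V n \<top> \<omega> \<le> (\<integral>\<^sup>+s. ?g s + ennreal (2 * G) * indicator {T..<max T t} s \<partial>lborel)"
    unfolding seg_def
  proof (rule nn_integral_mono)
    fix s :: real
    have "ennreal (f (\<omega> n s) - lam + G) \<le> ennreal (2 * G)" by (rule ennreal_leI[OF reward_le])
    then show "ennreal (f (\<omega> n s) - lam + G) * indicator {s. 0 \<le> s \<and> start_time V n \<omega> \<le> ennreal s \<and> ennreal s < min (fst V n \<omega>) \<top>} s
        \<le> ?g s + ennreal (2 * G) * indicator {T..<max T t} s"
      using t T by (cases "s < T") (auto simp: indicator_def ennreal_less_iff max_def)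
  qed
  also have "\<dots> = seg V n (ennreal T) \<omega> + (\<integral>\<^sup>+s. ennreal (2 * G) * indicator {T..<max T t} s \<partial>lborel)"
    unfolding g using gm by (intro nn_integral_add) auto
  also have "(\<integral>\<^sup>+s. ennreal (2 * G) * indicator {T..<max T t} s \<partial>lborel) = ennreal (2 * G) * (fst V n \<omega> - ennreal T)"
    using t T by (subst nn_integral_cmult_indicator) (auto simp: ennreal_minus max_def ennreal_neg)
  finally show ?thesis .
qed

end

context reward_control
begin

lemma multi_measurable:
  "seg V n t \<in> borel_measurable (multi_filt n \<top>)" "cost n \<in> borel_measurable (multi_filt n \<top>)"
  "fst V n \<in> borel_measurable (multi_filt n \<top>)" "start_time V n \<in> borel_measurable (multi_filt n \<top>)"
  by (rule seg_measurable[OF V] cost_measurable impulse_time_measurable[OF V] start_time_measurable[OF V])+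

lemma start_mono: "\<omega> \<in> space multi_path_space \<Longrightarrow> start_time V n \<omega> \<le> fst V n \<omega>"
  using impulse_times_mono[OF V, of \<omega> "n - 1" n] by (cases n) auto

lemma cost_restart:
  assumes w: "\<omega> \<in> space multi_path_space" and p: "p \<in> space path_space"
    and S: "start_time V n \<omega> = ennreal s0" "0 \<le> s0"
    and \<omega>': "\<omega>' = fun_upd \<omega> n (restart (start_time V n \<omega>) y p)" and fin: "fst V n \<omega>' < \<infinity>"
  shows "pre_impulse V \<omega>' n = p (enn2real (fst V n \<omega>' - ennreal s0))"
proof -
  have w': "\<omega>' \<in> space multi_path_space" using w restart_in_space[OF p] by (simp add: \<omega>' space_multi_path_space)
  have "ennreal s0 \<le> fst V n \<omega>'"
    using start_mono[OF w', of n] start_depends(1)[OF V w w', of n] S by (simp add: \<omega>')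
  then obtain t where t: "fst V n \<omega>' = ennreal t" "s0 \<le> t" using fin S(2) by (cases "fst V n \<omega>'") auto
  then show ?thesis
    using S(2) by (simp add: pre_impulse_def \<omega>' S(1) restart_def ennreal_less_iff ennreal_minus)
qed

text \<open>At most one stage is running at time \<open>T\<close>. The induction is carried by the
  second claim: if stage \<open>n\<close> begins by \<open>T\<close>, no earlier stage is running
  then.\<close>

lemma sum_crossing:
  assumes w: "\<omega> \<in> space multi_path_space"
  shows "(\<Sum>k<n. indicator {\<omega>. start_time V k \<omega> \<le> T \<and> T < fst V k \<omega>} \<omega>) \<le> (1::ennreal)"
    and "start_time V n \<omega> \<le> T \<Longrightarrow> (\<Sum>k<n. indicator {\<omega>. start_time V k \<omega> \<le> T \<and> T < fst V k \<omega>} \<omega>) = (0::ennreal)"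
proof -
  have *: "(start_time V n \<omega> \<le> T \<longrightarrow> (\<Sum>k<n. indicator {\<omega>. start_time V k \<omega> \<le> T \<and> T < fst V k \<omega>} \<omega>) = (0::ennreal))
    \<and> (\<Sum>k<n. indicator {\<omega>. start_time V k \<omega> \<le> T \<and> T < fst V k \<omega>} \<omega>) \<le> (1::ennreal)"
  proof (induction n)
    case (Suc n)
    show ?case
    proof (cases "start_time V n \<omega> \<le> T")
      case True
      then show ?thesis using Suc by (auto simp: indicator_def not_less)
    next
      case False
      then have "\<not> start_time V (Suc n) \<omega> \<le> T" using start_mono[OF w, of n] by auto
      then show ?thesis using Suc False by (simp add: indicator_def)
    qed
  qed simp
  show "(\<Sum>k<n. indicator {\<omega>. start_time V k \<omega> \<le> T \<and> T < fst V k \<omega>} \<omega>) \<le> (1::ennreal)" using * by blast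
  show "start_time V n \<omega> \<le> T \<Longrightarrow> (\<Sum>k<n. indicator {\<omega>. start_time V k \<omega> \<le> T \<and> T < fst V k \<omega>} \<omega>) = (0::ennreal)" using * by blast
qed

text \<open>An indicator with values in \<open>ennreal\<close>, to be used as a factor. It is
  decided by the coordinates before \<open>k\<close> and is therefore constant when coordinate
  \<open>k\<close> is resampled.\<close>

definition on :: "ennreal \<Rightarrow> nat \<Rightarrow> (nat \<Rightarrow> real \<Rightarrow> 'e) \<Rightarrow> ennreal" where
  "on T k \<omega> = (if start_time V k \<omega> \<le> T then 1 else 0)"

lemma on_measurable: "on T n \<in> borel_measurable (multi_filt n \<top>)"
proof -
  note [measurable] = multi_measurable(4)
  show ?thesis unfolding on_def[abs_def] by measurable
qed

text \<open>The stages begun by \<open>T\<close> last for the elapsed time plus the overshoot beyond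
  \<open>T\<close>. Only the stage running at \<open>T\<close> overshoots, by no more than its
  duration, hence by at most \<open>S\<close> plus the excess of that duration over
  \<open>S\<close>. Summing the excess over all stages begun avoids having to know which one it
  is.\<close>

lemma elapsed_sums:
  assumes w: "\<omega> \<in> space multi_path_space" and T: "T < \<infinity>"
  defines "\<Delta> \<equiv> \<lambda>k. fst V k \<omega> - start_time V k \<omega>"
  shows "(\<Sum>k<n. on T k \<omega> * \<Delta> k) = min (start_time V n \<omega>) T + (\<Sum>k<n. on T k \<omega> * (fst V k \<omega> - T))"
    and "(\<Sum>k<n. on T k \<omega> * (fst V k \<omega> - T)) \<le> S + (\<Sum>k<n. on T k \<omega> * (\<Delta> k - S))"
proof -
  have *: "(\<Sum>k<n. on T k \<omega> * \<Delta> k) = min (start_time V n \<omega>) T + (\<Sum>k<n. on T k \<omega> * (fst V k \<omega> - T))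
    \<and> (start_time V n \<omega> \<le> T \<longrightarrow> (\<Sum>k<n. on T k \<omega> * (fst V k \<omega> - T)) = 0)
    \<and> (\<Sum>k<n. on T k \<omega> * (fst V k \<omega> - T)) \<le> S + (\<Sum>k<n. on T k \<omega> * (\<Delta> k - S))"
  proof (induction n)
    case (Suc n)
    show ?case
    proof (cases "start_time V n \<omega> \<le> T")
      case True
      let ?s = "start_time V n \<omega>" and ?t = "fst V n \<omega>"
      have le: "?s \<le> ?t" by (rule start_mono[OF w])
      have X: "(\<Sum>k<n. on T k \<omega> * (fst V k \<omega> - T)) = 0" using Suc True by blast
      have o: "on T n \<omega> = 1" using True by (simp add: on_def)
      have R: "(\<Sum>k<n. on T k \<omega> * \<Delta> k) = ?s" using Suc X True by (simp add: min_absorb1)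
      have st: "?s + \<Delta> n = ?t" using le True T by (simp add: \<Delta>_def add_diff_inverse_ennreal)
      have "?t = min ?t T + (?t - T)" using T
        by (cases "?t \<le> T") (auto simp: min_def ennreal_diff_zero add_diff_inverse_ennreal)
      moreover have "?t - T = 0" if "?t \<le> T" using that T by (simp add: ennreal_diff_zero)
      moreover have "?t - T \<le> S + (\<Sum>k<Suc n. on T k \<omega> * (\<Delta> k - S))"
      proof -
        have "?t - T \<le> \<Delta> n" unfolding \<Delta>_def using True by (rule ennreal_minus_mono[OF order_refl])
        also have "\<dots> \<le> S + (\<Delta> n - S)" by (metis ennreal_minus_le_iff order_refl)
        also have "\<dots> \<le> S + (\<Sum>k<Suc n. on T k \<omega> * (\<Delta> k - S))" using o by (intro add_left_mono) (simp add: add_increasing)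
        finally show ?thesis .
      qed
      moreover have "(\<Sum>k<Suc n. on T k \<omega> * (fst V k \<omega> - T)) = ?t - T"
        by (simp only: sum.lessThan_Suc X o mult_1_left add_0_left)
      moreover have "(\<Sum>k<Suc n. on T k \<omega> * \<Delta> k) = ?t"
        by (simp only: sum.lessThan_Suc R o mult_1_left st)
      ultimately show ?thesis by (simp only: start_simps) blast
    next
      case False
      then have n: "\<not> start_time V (Suc n) \<omega> \<le> T" using start_mono[OF w, of n] by auto
      have o: "on T n \<omega> = 0" using False by (simp add: on_def)
      have "min (start_time V (Suc n) \<omega>) T = min (start_time V n \<omega>) T" using False n by (simp add: min_def)
      then show ?thesis using Suc n o by simp
    qed
  qed (simp add: min_def)
  show "(\<Sum>k<n. on T k \<omega> * \<Delta> k) = min (start_time V n \<omega>) T + (\<Sum>k<n. on T k \<omega> * (fst V k \<omega> - T))"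
    "(\<Sum>k<n. on T k \<omega> * (fst V k \<omega> - T)) \<le> S + (\<Sum>k<n. on T k \<omega> * (\<Delta> k - S))" using * by blast+
qed

text \<open>Reduces an inequality under the controlled law to one under \<open>P y\<close>, with the
  past \<open>\<omega>\<close> and the start time frozen. Only stages begun by \<open>T\<close>
  count, and their start points lie in \<open>insert x U\<close>, where the uniform bounds are
  available.\<close>

lemma nn_integral_stage_mono:
  fixes F F' :: "(nat \<Rightarrow> real \<Rightarrow> 'e) \<Rightarrow> ennreal"
  assumes F: "F \<in> borel_measurable (multi_filt n \<top>)" and F': "F' \<in> borel_measurable (multi_filt n \<top>)"
    and T: "0 \<le> T" and zero: "\<And>\<omega>. \<omega> \<in> space multi_path_space \<Longrightarrow> \<not> start_time V n \<omega> \<le> ennreal T \<Longrightarrow> F \<omega> = 0"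
    and le: "\<And>\<omega> s0 y. \<omega> \<in> space multi_path_space \<Longrightarrow> y \<in> insert x U \<Longrightarrow> y = start_point V x n \<omega> \<Longrightarrow> 0 \<le> s0 \<Longrightarrow> s0 \<le> T
      \<Longrightarrow> start_time V n \<omega> = ennreal s0 \<Longrightarrow>
      (\<integral>\<^sup>+p. F (fun_upd \<omega> n (restart (ennreal s0) y p)) \<partial>P y) \<le> (\<integral>\<^sup>+p. F' (fun_upd \<omega> n (restart (ennreal s0) y p)) \<partial>P y)"
  shows "(\<integral>\<^sup>+\<omega>. F \<omega> \<partial>Q) \<le> (\<integral>\<^sup>+\<omega>. F' \<omega> \<partial>Q)"
  unfolding nn_integral_stage[OF F] nn_integral_stage[OF F']
proof (rule nn_integral_mono)
  fix \<omega> assume "\<omega> \<in> space Q"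
  then have w: "\<omega> \<in> space multi_path_space" by (simp add: spQ)
  let ?y = "start_point V x n \<omega>" and ?S = "start_time V n \<omega>"
  show "(\<integral>\<^sup>+p. F (fun_upd \<omega> n (restart ?S ?y p)) \<partial>P ?y) \<le> (\<integral>\<^sup>+p. F' (fun_upd \<omega> n (restart ?S ?y p)) \<partial>P ?y)"
  proof (cases "?S \<le> ennreal T")
    case True
    then have "?S \<noteq> \<infinity>" by (metis ennreal_neq_top infinity_ennreal_def neq_top_trans)
    then obtain s where s: "?S = ennreal s" "0 \<le> s" by (cases ?S) auto
    then have "s \<le> T" using True T by (simp add: ennreal_le_iff)
    then show ?thesis using le[OF w start_point_in[OF V w] refl s(2) _ s(1)] s(1) by simp
  next
    case False
    have "F (fun_upd \<omega> n (restart ?S ?y p)) = 0" if p: "p \<in> space (P ?y)" for p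
    proof -
      have p': "p \<in> space path_space" using p markov_family_space[OF P] by simp
      have w': "fun_upd \<omega> n (restart ?S ?y p) \<in> space multi_path_space"
        using w restart_in_space[OF p'] by (simp add: space_multi_path_space)
      have "start_time V n (fun_upd \<omega> n (restart ?S ?y p)) = ?S" by (rule start_depends(1)[OF V w w']) simp
      then show ?thesis using zero[OF w'] False by simp
    qed
    then have "(\<integral>\<^sup>+p. F (fun_upd \<omega> n (restart ?S ?y p)) \<partial>P ?y) = (\<integral>\<^sup>+p. 0 \<partial>P ?y)" by (rule nn_integral_cong)
    then show ?thesis by simp
  qed
qed

end

subsection \<open>The Bellman strategy\<close>

sublocale ergodic_bellman \<subseteq> star: reward_control P U "star_strategy U c w xihat" x f lam G c
  by (rule reward_control[OF star_impulse])

context ergodic_rate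
begin

abbreviation "Qs \<equiv> controlled_law P x star"
abbreviation "\<tau>s \<equiv> fst star"
abbreviation "Ss \<equiv> start_time star"

text \<open>The shift in \<open>star_time\<close> undoes the delay of the resampled path, so every
  stage acts on its path as the first stage acts on coordinate 0.\<close>

lemma star_restart:
  assumes w: "\<omega> \<in> space multi_path_space" and p: "p \<in> space path_space"
    and S: "start_time star n \<omega> = ennreal s0" "0 \<le> s0"
    and \<omega>': "\<omega>' = fun_upd \<omega> n (restart (ennreal s0) y p)"
  shows "\<tau>s n \<omega>' = ennreal s0 + act p"
    and "act p < \<infinity> \<Longrightarrow> snd star n \<omega>' = xihat (p (enn2real (act p)))"
proof -
  have w': "\<omega>' \<in> space multi_path_space" using w restart_in_space[OF p] by (simp add: \<omega>' space_multi_path_space)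
  show \<tau>: "\<tau>s n \<omega>' = ennreal s0 + act p"
  proof (cases n)
    case 0
    then have "s0 = 0" using S by simp
    then show ?thesis using 0 p by (simp add: star_0 \<omega>' restart_0)
  next
    case (Suc k)
    have "\<tau>s k \<omega>' = \<tau>s k \<omega>"
      by (rule impulse_depends(1)[OF star_impulse w w']) (simp add: \<omega>' Suc)
    then have "star_time U c w k \<omega>' = ennreal s0" using S Suc by (simp add: star_strategy_def)
    then show ?thesis
      using shift_restart[OF p, of "ennreal s0" y] S(2)
      by (simp add: Suc star_strategy_def act_def act_set_def) (simp add: \<omega>' Suc)
  qed
  assume "act p < \<infinity>"
  then obtain t where t: "act p = ennreal t" "0 \<le> t" by (cases "act p") auto
  have "snd star n \<omega>' = xihat (\<omega>' n (enn2real (\<tau>s n \<omega>')))" by (simp add: star_strategy_def)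
  also have "\<omega>' n (enn2real (\<tau>s n \<omega>')) = p (enn2real (act p))"
    unfolding \<tau> using t S(2) by (simp add: \<omega>' restart_def ennreal_less_iff ennreal_plus[symmetric] del: ennreal_plus)
  finally show "snd star n \<omega>' = xihat (p (enn2real (act p)))" .
qed

lemma act_AE: "AE p in P y. act p < \<infinity>"
proof -
  have "AE p in completion (P y). act p \<noteq> \<infinity>"
    by (rule nn_integral_PInf_AE[OF P_uc[OF stopping_time_measurable_uc[OF act_stopping]]])
       (use act_finite[of y] in \<open>simp add: nn_integral_completion less_top\<close>)
  then show ?thesis by (simp add: AE_completion_iff less_top)
qed

text \<open>All stages start in the compact set \<open>insert x U\<close>, so each adds at most the
  supremum over it of the mean action time.\<close>

lemma star_mean_time: "mean_time P x star n < \<infinity>"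
proof -
  obtain E where E: "\<And>y. y \<in> insert x U \<Longrightarrow> (\<integral>\<^sup>+p. act p \<partial>P y) \<le> ennreal E"
  proof (cases "SUP y\<in>insert x U. \<integral>\<^sup>+p. act p \<partial>P y")
    case (real E)
    have "(\<integral>\<^sup>+p. act p \<partial>P y) \<le> ennreal E" if "y \<in> insert x U" for y
      using SUP_upper[OF that, of "\<lambda>y. \<integral>\<^sup>+p. act p \<partial>P y"] real by simp
    then show ?thesis by (rule that)
  qed (use act_compact[OF compact_start] in simp)
  have step: "(\<integral>\<^sup>+\<omega>. \<tau>s n \<omega> \<partial>Qs) \<le> (\<integral>\<^sup>+\<omega>. Ss n \<omega> \<partial>Qs) + ennreal E" for n
  proof -
    have "(\<integral>\<^sup>+\<omega>. \<tau>s n \<omega> \<partial>Qs) \<le> (\<integral>\<^sup>+\<omega>. Ss n \<omega> + ennreal E \<partial>Qs)"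
      unfolding star.nn_integral_stage[OF star.multi_measurable(3)]
    proof (rule nn_integral_mono)
      fix \<omega> assume "\<omega> \<in> space Qs"
      then have w: "\<omega> \<in> space multi_path_space" by (simp add: star.spQ)
      let ?y = "start_point star x n \<omega>"
      interpret Py: prob_space "P ?y" by (rule P_prob)
      show "(\<integral>\<^sup>+p. \<tau>s n (fun_upd \<omega> n (restart (Ss n \<omega>) ?y p)) \<partial>P ?y) \<le> Ss n \<omega> + ennreal E"
      proof (cases "Ss n \<omega>")
        case (real s0)
        have "(\<integral>\<^sup>+p. \<tau>s n (fun_upd \<omega> n (restart (Ss n \<omega>) ?y p)) \<partial>P ?y) = (\<integral>\<^sup>+p. ennreal s0 + act p \<partial>completion (P ?y))"
          unfolding nn_integral_completion
          by (intro nn_integral_cong) (simp add: markov_family_space[OF P] star_restart(1)[OF w _ real(2) real(1)] real(2))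
        also have "\<dots> = ennreal s0 + (\<integral>\<^sup>+p. act p \<partial>P ?y)"
          by (subst nn_integral_add) (auto simp: nn_integral_completion Py.emeasure_space_1 intro: P_uc stopping_time_measurable_uc[OF act_stopping])
        also have "\<dots> \<le> Ss n \<omega> + ennreal E"
          unfolding real(2) by (intro add_left_mono E start_point_in[OF star_impulse w])
        finally show ?thesis .
      qed simp
    qed
    also have "\<dots> = (\<integral>\<^sup>+\<omega>. Ss n \<omega> + ennreal E \<partial>completion Qs)" by (simp only: nn_integral_completion)
    also have "\<dots> = (\<integral>\<^sup>+\<omega>. Ss n \<omega> \<partial>Qs) + ennreal E"
      by (subst nn_integral_add) (auto simp: nn_integral_completion star.Q.emeasure_space_1 star.completion_measurable)
    finally show ?thesis .
  qed
  show ?thesis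
    unfolding star.mean_time_eq
  proof (induction n)
    case 0
    show ?case using step[of 0] by (simp add: le_less_trans)
  next
    case (Suc n)
    then show ?case using step[of "Suc n"] by (auto intro: le_less_trans)
  qed
qed

text \<open>The Bellman equality of a single step, integrated over the past of stage
  \<open>n\<close>. The half that bounds the reward from below is the one recorded.\<close>

lemma star_stage:
  assumes T: "0 \<le> T"
  shows "(\<integral>\<^sup>+\<omega>. star.on (ennreal T) n \<omega> * (ennreal (w (start_point star x n \<omega>) + C)
        + (ennreal G * (\<tau>s n \<omega> - Ss n \<omega>) + star.cost n \<omega>)) \<partial>Qs)
    \<le> (\<integral>\<^sup>+\<omega>. star.on (ennreal T) n \<omega> * (seg star n \<top> \<omega> + ennreal (w (snd star n \<omega>) + C)) \<partial>Qs)"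
    (is "integral\<^sup>N Qs ?F \<le> integral\<^sup>N Qs ?F'")
proof (rule star.nn_integral_stage_mono[where T=T])
  note [measurable] = star.multi_measurable star.on_measurable
  have [measurable]: "(\<lambda>\<omega>. w (start_point star x n \<omega>)) \<in> borel_measurable (multi_filt n \<top>)"
    by (rule measurable_compose[OF start_point_measurable[OF star_impulse] borel_measurable_continuous_onI[OF w_cont]])
  have [measurable]: "(\<lambda>\<omega>. w (snd star n \<omega>)) \<in> borel_measurable (multi_filt n \<top>)"
    by (rule measurable_compose[OF star.point_measurable borel_measurable_continuous_onI[OF w_cont]])
  show "?F \<in> borel_measurable (multi_filt n \<top>)" "?F' \<in> borel_measurable (multi_filt n \<top>)" by measurable
  show "0 \<le> T" by (rule T)
  show "?F \<omega> = 0" if "\<not> Ss n \<omega> \<le> ennreal T" for \<omega> using that by (simp add: star.on_def)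
  fix \<omega> s0 y
  assume w: "\<omega> \<in> space multi_path_space" and y: "y \<in> insert x U" "y = start_point star x n \<omega>"
    and s0: "0 \<le> s0" "s0 \<le> T" and S: "Ss n \<omega> = ennreal s0"
  let ?\<omega> = "\<lambda>p. fun_upd \<omega> n (restart (ennreal s0) y p)"
  let ?X = "\<lambda>p. p (enn2real (act p))"
  have st: "Ss n (?\<omega> p) = ennreal s0" "start_point star x n (?\<omega> p) = y" "?\<omega> p \<in> space multi_path_space" if p: "p \<in> space path_space" for p
  proof -
    show w': "?\<omega> p \<in> space multi_path_space" using w restart_in_space[OF p] by (simp add: space_multi_path_space)
    show "Ss n (?\<omega> p) = ennreal s0" "start_point star x n (?\<omega> p) = y"
      using start_depends[OF star_impulse w w', of n] S y(2) by auto
  qed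
  have "(\<integral>\<^sup>+p. ?F (?\<omega> p) \<partial>P y) = (\<integral>\<^sup>+p. ennreal (w y + C) + ennreal G * act p + ennreal (- c (?X p) (xihat (?X p))) \<partial>P y)"
  proof (rule nn_integral_cong_AE)
    show "AE p in P y. ?F (?\<omega> p) = ennreal (w y + C) + ennreal G * act p + ennreal (- c (?X p) (xihat (?X p)))"
      using act_AE[of y] AE_space
    proof eventually_elim
      case (elim p)
      have p: "p \<in> space path_space" using elim(2) by (simp add: markov_family_space[OF P])
      note sr = star_restart[OF w p S s0(1) refl, of y]
      have fin: "\<tau>s n (?\<omega> p) < \<infinity>" unfolding sr(1) using elim(1) by simp
      have "pre_impulse star (?\<omega> p) n = ?X p"
        using star.cost_restart[OF w p S s0(1), of "?\<omega> p" y] fin by (simp add: S sr(1))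
      then show ?case
        using st[OF p] sr(2)[OF elim(1)] s0(2) by (simp add: star.on_def star.cost_def sr(1) ennreal_leI add.assoc)
    qed
  qed
  also have "\<dots> = (\<integral>\<^sup>+p. area p (act p) + ennreal (w (xihat (?X p)) + C) \<partial>P y)"
    by (rule one_step_star[symmetric]) (use C[OF y(1)] C in auto)
  also have "\<dots> = (\<integral>\<^sup>+p. ?F' (?\<omega> p) \<partial>P y)"
  proof (rule nn_integral_cong_AE)
    show "AE p in P y. area p (act p) + ennreal (w (xihat (?X p)) + C) = ?F' (?\<omega> p)"
      using act_AE[of y] AE_space
    proof eventually_elim
      case (elim p)
      have p: "p \<in> space path_space" using elim(2) by (simp add: markov_family_space[OF P])
      note sr = star_restart[OF w p S s0(1) refl, of y]
      have "seg star n \<top> (?\<omega> p) = area p (act p)"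
        using seg_restart[OF star_impulse w p S s0(1), of "?\<omega> p" y \<top>] by (simp add: S sr(1))
      then show ?case
        using st[OF p] sr(2)[OF elim(1)] s0(2) by (simp add: star.on_def ennreal_leI)
    qed
  qed
  finally show "(\<integral>\<^sup>+p. ?F (?\<omega> p) \<partial>P y) \<le> (\<integral>\<^sup>+p. ?F' (?\<omega> p) \<partial>P y)" by simp
qed

lemma star_tail_stage:
  assumes T: "0 \<le> T" and S: "\<And>y. y \<in> insert x U \<Longrightarrow> (\<integral>\<^sup>+p. act p - ennreal S \<partial>P y) \<le> ennreal \<epsilon>"
  shows "(\<integral>\<^sup>+\<omega>. star.on (ennreal T) n \<omega> * (\<tau>s n \<omega> - Ss n \<omega> - ennreal S) \<partial>Qs) \<le> (\<integral>\<^sup>+\<omega>. star.on (ennreal T) n \<omega> * ennreal \<epsilon> \<partial>Qs)"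
    (is "integral\<^sup>N Qs ?F \<le> integral\<^sup>N Qs ?F'")
proof (rule star.nn_integral_stage_mono[where T=T])
  note [measurable] = star.multi_measurable star.on_measurable
  show "?F \<in> borel_measurable (multi_filt n \<top>)" "?F' \<in> borel_measurable (multi_filt n \<top>)" by measurable
  show "0 \<le> T" by (rule T)
  show "?F \<omega> = 0" if "\<not> Ss n \<omega> \<le> ennreal T" for \<omega> using that by (simp add: star.on_def)
  fix \<omega> s0 y
  assume w: "\<omega> \<in> space multi_path_space" and y: "y \<in> insert x U" "y = start_point star x n \<omega>"
    and s0: "0 \<le> s0" "s0 \<le> T" and St: "Ss n \<omega> = ennreal s0"
  let ?\<omega> = "\<lambda>p. fun_upd \<omega> n (restart (ennreal s0) y p)"
  interpret Py: prob_space "P y" by (rule P_prob)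
  have st: "Ss n (?\<omega> p) = ennreal s0" if p: "p \<in> space path_space" for p
  proof -
    have w': "?\<omega> p \<in> space multi_path_space" using w restart_in_space[OF p] by (simp add: space_multi_path_space)
    show ?thesis using start_depends(1)[OF star_impulse w w', of n] St by auto
  qed
  have "(\<integral>\<^sup>+p. ?F (?\<omega> p) \<partial>P y) = (\<integral>\<^sup>+p. act p - ennreal S \<partial>P y)"
  proof (rule nn_integral_cong)
    fix p assume "p \<in> space (P y)"
    then have p: "p \<in> space path_space" by (simp add: markov_family_space[OF P])
    show "?F (?\<omega> p) = act p - ennreal S"
      using st[OF p] star_restart(1)[OF w p St s0(1) refl, of y] s0(2) by (simp add: star.on_def ennreal_leI)
  qed
  also have "\<dots> \<le> ennreal \<epsilon>" by (rule S[OF y(1)])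
  also have "\<dots> = (\<integral>\<^sup>+p. ?F' (?\<omega> p) \<partial>P y)"
  proof -
    have "(\<integral>\<^sup>+p. ?F' (?\<omega> p) \<partial>P y) = (\<integral>\<^sup>+p. ennreal \<epsilon> \<partial>P y)"
      using st s0(2) by (intro nn_integral_cong) (simp add: markov_family_space[OF P] star.on_def ennreal_leI)
    then show ?thesis by (simp add: Py.emeasure_space_1)
  qed
  finally show "(\<integral>\<^sup>+p. ?F (?\<omega> p) \<partial>P y) \<le> (\<integral>\<^sup>+p. ?F' (?\<omega> p) \<partial>P y)" .
qed

text \<open>The target of stage \<open>k\<close> is the start point of stage \<open>k + 1\<close>,
  so the values of \<open>w\<close> telescope. The exception is a stage running at \<open>T\<close>,
  whose successor is not counted; its target contributes at most \<open>2 * C\<close>. There is at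
  most one such stage, and the last value is at most \<open>2 * C\<close> as well, whence the
  \<open>4 * C\<close>.\<close>

lemma star_balance:
  assumes T: "0 \<le> T"
  shows "(\<Sum>k<n. \<integral>\<^sup>+\<omega>. star.on (ennreal T) k \<omega> * (ennreal G * (\<tau>s k \<omega> - Ss k \<omega>) + star.cost k \<omega>) \<partial>Qs)
    \<le> (\<Sum>k<n. \<integral>\<^sup>+\<omega>. star.on (ennreal T) k \<omega> * seg star k \<top> \<omega> \<partial>Qs) + ennreal (4 * C)"
proof -
  note [measurable] = star.completion_measurable star.multi_filt_measurable_completion[OF star.on_measurable]
  have [measurable]: "(\<lambda>\<omega>. w (start_point star x n \<omega>)) \<in> borel_measurable (completion Qs)" for n
    by (rule star.multi_filt_measurable_completion[OF measurable_compose[OF start_point_measurable[OF star_impulse] borel_measurable_continuous_onI[OF w_cont]]])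
  have [measurable]: "(\<lambda>\<omega>. w (snd star n \<omega>)) \<in> borel_measurable (completion Qs)" for n
    by (rule star.multi_filt_measurable_completion[OF measurable_compose[OF star.point_measurable borel_measurable_continuous_onI[OF w_cont]]])
  let ?E = "\<lambda>g. \<integral>\<^sup>+\<omega>. g \<omega> \<partial>completion Qs"
  let ?o = "star.on (ennreal T)"
  let ?u = "\<lambda>k \<omega>. ?o k \<omega> * ennreal (w (start_point star x k \<omega>) + C)"
  let ?F = "\<lambda>k \<omega>. ?o k \<omega> * (ennreal G * (\<tau>s k \<omega> - Ss k \<omega>) + star.cost k \<omega>)"
  let ?F' = "\<lambda>k \<omega>. ?o k \<omega> * seg star k \<top> \<omega>"
  let ?cr = "\<lambda>k. indicator {\<omega>. Ss k \<omega> \<le> ennreal T \<and> ennreal T < \<tau>s k \<omega>}"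
  let ?v = "\<lambda>k \<omega>. ?o k \<omega> * ennreal (w (snd star k \<omega>) + C)"
  have crm [measurable]: "(?cr k :: _ \<Rightarrow> ennreal) \<in> borel_measurable (completion Qs)" for k
  proof -
    have "{\<omega> \<in> space (completion Qs). Ss k \<omega> \<le> ennreal T \<and> ennreal T < \<tau>s k \<omega>} \<in> sets (completion Qs)" by measurable
    then have "(\<lambda>\<omega>. indicator {\<omega> \<in> space (completion Qs). Ss k \<omega> \<le> ennreal T \<and> ennreal T < \<tau>s k \<omega>} \<omega> :: ennreal) \<in> borel_measurable (completion Qs)"
      by (rule borel_measurable_indicator)
    then show ?thesis by (rule measurable_cong[THEN iffD1, rotated]) (auto simp: indicator_def)
  qed
  have step: "?E (?u k) + ?E (?F k) \<le> ?E (?F' k) + (?E (?u (Suc k)) + ennreal (2 * C) * ?E (?cr k))" for k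
  proof -
    have "?E (?u k) + ?E (?F k) = ?E (\<lambda>\<omega>. ?u k \<omega> + ?F k \<omega>)" by (rule nn_integral_add[symmetric]) measurable
    also have "\<dots> \<le> ?E (\<lambda>\<omega>. ?o k \<omega> * (seg star k \<top> \<omega> + ennreal (w (snd star k \<omega>) + C)))"
      using star_stage[OF T, of k] by (simp add: nn_integral_completion distrib_left)
    also have "\<dots> \<le> ?E (\<lambda>\<omega>. ?F' k \<omega> + (?u (Suc k) \<omega> + ennreal (2 * C) * ?cr k \<omega>))"
    proof (rule nn_integral_mono)
      fix \<omega> assume "\<omega> \<in> space (completion Qs)"
      then have w: "\<omega> \<in> space multi_path_space" by (simp add: star.spQ)
      have "w (snd star k \<omega>) + C \<le> 2 * C" using C[of "snd star k \<omega>"] impulse_point_in[OF star_impulse w, of k] by auto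
      then have "ennreal (w (snd star k \<omega>) + C) \<le> ennreal (2 * C)" by (rule ennreal_leI)
      then show "?o k \<omega> * (seg star k \<top> \<omega> + ennreal (w (snd star k \<omega>) + C)) \<le> ?F' k \<omega> + (?u (Suc k) \<omega> + ennreal (2 * C) * ?cr k \<omega>)"
        by (cases "Ss k \<omega> \<le> ennreal T"; cases "\<tau>s k \<omega> \<le> ennreal T") (auto simp: star.on_def indicator_def not_le intro!: add_left_mono)
    qed
    also have "\<dots> = ?E (?F' k) + ?E (\<lambda>\<omega>. ?u (Suc k) \<omega> + ennreal (2 * C) * ?cr k \<omega>)" by (rule nn_integral_add) measurable
    also have "?E (\<lambda>\<omega>. ?u (Suc k) \<omega> + ennreal (2 * C) * ?cr k \<omega>) = ?E (?u (Suc k)) + ?E (\<lambda>\<omega>. ennreal (2 * C) * ?cr k \<omega>)"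
      by (rule nn_integral_add) measurable
    also have "?E (\<lambda>\<omega>. ennreal (2 * C) * ?cr k \<omega>) = ennreal (2 * C) * ?E (?cr k)" by (rule nn_integral_cmult) measurable
    finally show ?thesis .
  qed
  have "?E (?u 0) + (\<Sum>k<n. ?E (?F k)) \<le> (\<Sum>k<n. ?E (?F' k)) + (?E (?u n) + ennreal (2 * C) * (\<Sum>k<n. ?E (?cr k)))"
  proof (induction n)
    case (Suc n)
    have "?E (?u 0) + (\<Sum>k<Suc n. ?E (?F k)) = (?E (?u 0) + (\<Sum>k<n. ?E (?F k))) + ?E (?F n)" by (simp add: ac_simps)
    also have "\<dots> \<le> ((\<Sum>k<n. ?E (?F' k)) + (?E (?u n) + ennreal (2 * C) * (\<Sum>k<n. ?E (?cr k)))) + ?E (?F n)"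
      by (rule add_right_mono[OF Suc])
    also have "\<dots> = (\<Sum>k<n. ?E (?F' k)) + ennreal (2 * C) * (\<Sum>k<n. ?E (?cr k)) + (?E (?u n) + ?E (?F n))" by (simp add: ac_simps)
    also have "\<dots> \<le> (\<Sum>k<n. ?E (?F' k)) + ennreal (2 * C) * (\<Sum>k<n. ?E (?cr k)) + (?E (?F' n) + (?E (?u (Suc n)) + ennreal (2 * C) * ?E (?cr n)))"
      by (rule add_left_mono[OF step])
    also have "\<dots> = (\<Sum>k<Suc n. ?E (?F' k)) + (?E (?u (Suc n)) + ennreal (2 * C) * (\<Sum>k<Suc n. ?E (?cr k)))"
      by (simp add: distrib_left ac_simps)
    finally show ?case .
  qed simp
  moreover have "(\<Sum>k<n. ?E (?F k)) \<le> ?E (?u 0) + (\<Sum>k<n. ?E (?F k))" by (simp add: add_increasing)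
  moreover have "?E (?u n) \<le> ennreal (2 * C)"
  proof -
    have "?E (?u n) \<le> ?E (\<lambda>_. ennreal (2 * C))"
    proof (rule nn_integral_mono)
      fix \<omega> assume "\<omega> \<in> space (completion Qs)"
      then have w: "\<omega> \<in> space multi_path_space" by (simp add: star.spQ)
      have "w (start_point star x n \<omega>) + C \<le> 2 * C" using C[OF start_point_in[OF star_impulse w, of x n]] by auto
      then show "?u n \<omega> \<le> ennreal (2 * C)" by (auto simp: star.on_def intro: ennreal_leI)
    qed
    then show ?thesis by (simp add: star.Q.emeasure_space_1)
  qed
  moreover have "(\<Sum>k<n. ?E (?cr k)) \<le> 1"
  proof -
    have "(\<Sum>k<n. ?E (?cr k)) = ?E (\<lambda>\<omega>. \<Sum>k<n. ?cr k \<omega>)" by (rule nn_integral_sum[symmetric]) measurable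
    also have "\<dots> \<le> ?E (\<lambda>_. 1)" by (rule nn_integral_mono) (rule star.sum_crossing(1), simp add: star.spQ)
    finally show ?thesis by (simp add: star.Q.emeasure_space_1)
  qed
  ultimately have "(\<Sum>k<n. ?E (?F k)) \<le> (\<Sum>k<n. ?E (?F' k)) + (ennreal (2 * C) + ennreal (2 * C) * 1)"
    by (elim order_trans) (intro add_mono mult_left_mono order_refl; assumption?; simp)
  also have "ennreal (2 * C) + ennreal (2 * C) * 1 = ennreal (4 * C)"
    using C_nonneg by (simp add: ennreal_plus[symmetric] del: ennreal_plus)
  finally show ?thesis by (simp only: nn_integral_completion)
qed

end

section \<open>Payoffs up to a fixed time as series over the stages\<close>

context reward_control
begin

lemma seg_le: "\<omega> \<in> space multi_path_space \<Longrightarrow> fst V n \<omega> < \<infinity> \<Longrightarrow> seg V n \<top> \<omega> \<le> ennreal (2 * G) * (fst V n \<omega> - start_time V n \<omega>)"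
proof -
  assume w: "\<omega> \<in> space multi_path_space" and fin: "fst V n \<omega> < \<infinity>"
  obtain s where s: "start_time V n \<omega> = ennreal s" "0 \<le> s"
    using start_mono[OF w, of n] fin by (cases "start_time V n \<omega>") auto
  have "seg V n (ennreal s) \<omega> = (\<integral>\<^sup>+(s::real). 0 \<partial>lborel)"
    unfolding seg_def s(1) using s(2) by (intro nn_integral_cong) (auto simp: indicator_def ennreal_less_iff)
  then show ?thesis using seg_after[OF w fin s(2)] by (simp add: s(1))
qed

lemma seg_mono: "t \<le> t' \<Longrightarrow> seg V n t \<omega> \<le> seg V n t' \<omega>"
  unfolding seg_def by (intro nn_integral_mono mult_left_mono) (auto simp: indicator_def dest: less_le_trans)

lemma seg_zero: "t \<le> start_time V n \<omega> \<Longrightarrow> seg V n t \<omega> = 0"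
proof -
  assume "t \<le> start_time V n \<omega>"
  then have "seg V n t \<omega> = (\<integral>\<^sup>+(s::real). 0 \<partial>lborel)"
    unfolding seg_def by (intro nn_integral_cong) (auto simp: indicator_def)
  then show ?thesis by simp
qed

definition paid :: "real \<Rightarrow> nat \<Rightarrow> (nat \<Rightarrow> real \<Rightarrow> 'e) \<Rightarrow> ennreal" where
  "paid T k \<omega> = (if fst V k \<omega> \<le> ennreal T then cost k \<omega> else 0)"

lemma paid_measurable: "paid T k \<in> borel_measurable (multi_filt k \<top>)"
proof -
  note [measurable] = multi_measurable
  show ?thesis unfolding paid_def[abs_def] by measurable
qed

text \<open>Admissibility leaves finitely many stages before \<open>T\<close>, so almost surely both
  series are finite sums and the total cost is finite pathwise, although its expectation may be
  infinite.\<close>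

lemma J_numerator:
  assumes adm: "AE \<omega> in Q. (\<lambda>i. fst V i \<omega>) \<longlonglongrightarrow> \<top>" and T: "0 \<le> T"
  shows "eexpectation Q (\<lambda>\<omega>. ereal (LBINT s:{0..T}. f (controlled V \<omega> s))
       + (\<Sum>i. if fst V i \<omega> \<le> ennreal T then ereal (c (pre_impulse V \<omega> i) (snd V i \<omega>)) else 0))
    = enn2ereal (\<integral>\<^sup>+\<omega>. (\<Sum>k. seg V k (ennreal T) \<omega>) \<partial>Q)
    - enn2ereal (\<integral>\<^sup>+\<omega>. ennreal ((G - lam) * T) + (\<Sum>k. paid T k \<omega>) \<partial>Q)"
    (is "_ = enn2ereal (integral\<^sup>N Q ?a) - enn2ereal (integral\<^sup>N Q ?b)")
    and "(\<integral>\<^sup>+\<omega>. (\<Sum>k. seg V k (ennreal T) \<omega>) \<partial>Q) \<le> ennreal (2 * G * T)"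
proof -
  note [measurable] = completion_measurable multi_filt_measurable_completion[OF paid_measurable]
  have Gl: "0 \<le> G - lam" using G[of undefined] by linarith
  have a: "?a \<in> borel_measurable (completion Q)" and b: "?b \<in> borel_measurable (completion Q)" by measurable
  have pw: "ereal (LBINT s:{0..T}. f (controlled V \<omega> s))
       + (\<Sum>i. if fst V i \<omega> \<le> ennreal T then ereal (c (pre_impulse V \<omega> i) (snd V i \<omega>)) else 0)
       = enn2ereal (?a \<omega>) - enn2ereal (?b \<omega>) \<and> ?b \<omega> < \<infinity> \<and> ?a \<omega> \<le> ennreal (2 * G * T)"
    if w: "\<omega> \<in> space multi_path_space" and lim: "(\<lambda>i. fst V i \<omega>) \<longlonglongrightarrow> \<top>" for \<omega>
  proof -
    obtain n where n: "ennreal T < fst V n \<omega>"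
      using order_tendstoD(1)[OF lim, of "ennreal T"] by (auto simp: eventually_sequentially)
    have late: "ennreal T < fst V k \<omega>" if "n \<le> k" for k using n impulse_times_mono[OF V w that] by (rule less_le_trans)
    have late': "ennreal T \<le> start_time V k \<omega>" if "k \<notin> {..n}" for k
      using late[of "k - 1"] that by (cases k) (auto intro: less_imp_le)
    have "?a \<omega> = (\<Sum>k\<le>n. seg V k (ennreal T) \<omega>)" by (rule suminf_finite) (auto intro: seg_zero late')
    also have "\<dots> = area (controlled V \<omega>) (ennreal T)"
      using area_controlled[OF V w, of n "ennreal T"] n by (simp add: min_absorb2 less_imp_le)
    finally have aw: "?a \<omega> = area (controlled V \<omega>) (ennreal T)" .
    have ale: "?a \<omega> \<le> ennreal (2 * G * T)" unfolding aw using area_le[of "controlled V \<omega>" "ennreal T"] G_nonneg T by (simp add: ennreal_mult)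
    let ?c = "\<lambda>k. if fst V k \<omega> \<le> ennreal T then c (pre_impulse V \<omega> k) (snd V k \<omega>) else 0"
    have cle: "?c k \<le> 0" for k using c_nonpos impulse_point_in[OF V w] by simp
    have "(\<Sum>k. paid T k \<omega>) = (\<Sum>k<n. paid T k \<omega>)"
      by (rule suminf_finite) (use late in \<open>auto simp: paid_def not_less not_le[symmetric]\<close>)
    also have "\<dots> = (\<Sum>k<n. ennreal (- ?c k))" by (intro sum.cong) (auto simp: paid_def cost_def)
    also have "\<dots> = ennreal (\<Sum>k<n. - ?c k)" by (rule sum_ennreal) (use cle in simp)
    finally have p: "(\<Sum>k. paid T k \<omega>) = ennreal (- (\<Sum>k<n. ?c k))" by (simp add: sum_negf)
    have p0: "0 \<le> - (\<Sum>k<n. ?c k)" using sum_nonpos[of "{..<n}" ?c] cle by simp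
    have "(\<Sum>i. if fst V i \<omega> \<le> ennreal T then ereal (c (pre_impulse V \<omega> i) (snd V i \<omega>)) else 0)
        = (\<Sum>i<n. if fst V i \<omega> \<le> ennreal T then ereal (c (pre_impulse V \<omega> i) (snd V i \<omega>)) else 0)"
      by (rule suminf_finite) (use late in \<open>auto simp: not_less not_le[symmetric]\<close>)
    also have "\<dots> = (\<Sum>i<n. ereal (?c i))" by (intro sum.cong) auto
    also have "\<dots> = ereal (\<Sum>i<n. ?c i)" by simp
    finally have cs: "(\<Sum>i. if fst V i \<omega> \<le> ennreal T then ereal (c (pre_impulse V \<omega> i) (snd V i \<omega>)) else 0) = ereal (\<Sum>i<n. ?c i)" .
    have A: "{s. 0 \<le> s \<and> ennreal s < ennreal T} = {0..<T}" using T by (auto simp: ennreal_less_iff)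
    have "(LBINT s:{0..T}. f (controlled V \<omega> s)) = (LBINT s:{0..<T}. f (controlled V \<omega> s))"
      unfolding set_lebesgue_integral_def
    proof (rule integral_cong_AE)
      have "(\<lambda>s. indicat_real {0..T} s *\<^sub>R f (controlled V \<omega> (max 0 s))) \<in> borel_measurable lborel"
        using controlled_measurable[OF w, of V] by simp
      also have "(\<lambda>s. indicat_real {0..T} s *\<^sub>R f (controlled V \<omega> (max 0 s))) = (\<lambda>s. indicat_real {0..T} s *\<^sub>R f (controlled V \<omega> s))"
        by (auto simp: indicator_def max_def)
      finally show "(\<lambda>s. indicat_real {0..T} s *\<^sub>R f (controlled V \<omega> s)) \<in> borel_measurable lborel" .
      have "(\<lambda>s. indicat_real {0..<T} s *\<^sub>R f (controlled V \<omega> (max 0 s))) \<in> borel_measurable lborel"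
        using controlled_measurable[OF w, of V] by simp
      also have "(\<lambda>s. indicat_real {0..<T} s *\<^sub>R f (controlled V \<omega> (max 0 s))) = (\<lambda>s. indicat_real {0..<T} s *\<^sub>R f (controlled V \<omega> s))"
        by (auto simp: indicator_def max_def)
      finally show "(\<lambda>s. indicat_real {0..<T} s *\<^sub>R f (controlled V \<omega> s)) \<in> borel_measurable lborel" .
      show "AE s in lborel. indicat_real {0..T} s *\<^sub>R f (controlled V \<omega> s) = indicat_real {0..<T} s *\<^sub>R f (controlled V \<omega> s)"
        using AE_lborel_singleton[of T] by eventually_elim (auto simp: indicator_def)
    qed
    also have "\<dots> = enn2real (?a \<omega>) - (G - lam) * T"
      using LBINT_controlled(2)[OF w, of "ennreal T" V] T unfolding A aw by simp
    finally have L: "(LBINT s:{0..T}. f (controlled V \<omega> s)) = enn2real (?a \<omega>) - (G - lam) * T" .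
    obtain \<alpha> where \<alpha>: "?a \<omega> = ennreal \<alpha>" "0 \<le> \<alpha>" using ale by (cases "?a \<omega>") (auto simp: top_unique)
    have GT: "0 \<le> (G - lam) * T" using Gl T by simp
    have bw: "?b \<omega> = ennreal ((G - lam) * T + - (\<Sum>k<n. ?c k))" unfolding p using GT p0 by (rule ennreal_plus[symmetric])
    have b0: "0 \<le> (G - lam) * T + - (\<Sum>k<n. ?c k)" using GT p0 by linarith
    show ?thesis
      unfolding cs L bw using ale \<alpha> b0 by (simp add: algebra_simps)
  qed
  have ae: "AE \<omega> in Q. ereal (LBINT s:{0..T}. f (controlled V \<omega> s))
       + (\<Sum>i. if fst V i \<omega> \<le> ennreal T then ereal (c (pre_impulse V \<omega> i) (snd V i \<omega>)) else 0)
       = enn2ereal (?a \<omega>) - enn2ereal (?b \<omega>) \<and> ?b \<omega> < \<infinity> \<and> ?a \<omega> \<le> ennreal (2 * G * T)"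
    using adm AE_space by eventually_elim (rule pw, simp_all add: spQ)
  have "integral\<^sup>N Q ?a \<le> (\<integral>\<^sup>+\<omega>. ennreal (2 * G * T) \<partial>Q)"
    by (intro nn_integral_mono_AE eventually_mono[OF ae]) blast
  then show fa: "integral\<^sup>N Q ?a \<le> ennreal (2 * G * T)" by (simp add: Q.emeasure_space_1)
  show "eexpectation Q (\<lambda>\<omega>. ereal (LBINT s:{0..T}. f (controlled V \<omega> s))
       + (\<Sum>i. if fst V i \<omega> \<le> ennreal T then ereal (c (pre_impulse V \<omega> i) (snd V i \<omega>)) else 0))
    = enn2ereal (integral\<^sup>N Q ?a) - enn2ereal (integral\<^sup>N Q ?b)"
    by (rule eexpectation_diff[OF a b le_less_trans[OF fa] eventually_mono[OF ae]]) auto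
qed

lemma paid_le_on: "\<omega> \<in> space multi_path_space \<Longrightarrow> paid T k \<omega> \<le> on (ennreal T) k \<omega> * cost k \<omega>"
  using start_mono[of \<omega> k] by (auto simp: paid_def on_def)

lemma on_Suc: "on T (Suc k) \<omega> = (if fst V k \<omega> \<le> T then 1 else 0)"
  by (simp add: on_def)

end

section \<open>Number and overshoot of the stages of the Bellman strategy\<close>

context ergodic_rate
begin

text \<open>Let \<nu> be the expected number of stages begun by \<open>T\<close>, \<kappa> their
  cost, m' the elapsed time, \<xi> the overshoot and \<alpha> the reward. The balance is G (m' +
  \<xi>) + \<kappa> \<le> \<alpha> + 4 C. Inserting \<alpha> \<le> 2 G (m' + \<xi>), \<kappa> \<ge>
  c0 \<nu> and \<xi> \<le> S + \<epsilon> \<nu> gives c0 \<nu> \<le> G (T + S) + 4 C + G \<epsilon>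
  \<nu>, and G \<epsilon> \<le> c0 / 2 absorbs the last term. Inserting instead \<alpha> \<le>
  \<sigma> + 2 G \<xi>, with \<sigma> the reward up to \<open>T\<close>, gives the second estimate,
  whose error grows in \<open>T\<close> only at a rate proportional to \<epsilon>.\<close>

lemma star_estimate:
  assumes T: "0 \<le> T" and S0: "0 \<le> S" and \<epsilon>: "0 \<le> \<epsilon>" "G * \<epsilon> \<le> c0 / 2"
    and S: "\<And>y. y \<in> insert x U \<Longrightarrow> (\<integral>\<^sup>+p. act p - ennreal S \<partial>P y) \<le> ennreal \<epsilon>"
  shows "(\<Sum>k<n. \<integral>\<^sup>+\<omega>. star.on (ennreal T) k \<omega> \<partial>Qs) \<le> ennreal ((G * (T + S) + 4 * C) * 2 / c0)"
    and "(\<Sum>k<n. \<integral>\<^sup>+\<omega>. star.paid T k \<omega> \<partial>Qs) + ennreal G * (\<integral>\<^sup>+\<omega>. min (Ss n \<omega>) (ennreal T) \<partial>Qs)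
      \<le> (\<Sum>k<n. \<integral>\<^sup>+\<omega>. seg star k (ennreal T) \<omega> \<partial>Qs) + ennreal (G * (S + \<epsilon> * ((G * (T + S) + 4 * C) * 2 / c0)) + 4 * C)"
proof -
  note [measurable] = star.completion_measurable star.multi_filt_measurable_completion[OF star.on_measurable]
  let ?E = "\<lambda>g. \<integral>\<^sup>+\<omega>. g \<omega> \<partial>completion Qs"
  let ?o = "star.on (ennreal T)"
  let ?\<Delta> = "\<lambda>k \<omega>. \<tau>s k \<omega> - Ss k \<omega>"
  have le1: "?o k \<omega> \<le> 1" for k \<omega> by (simp add: star.on_def)
  have fin: "AE \<omega> in completion Qs. \<tau>s k \<omega> < \<infinity>" for k
    using star.time_finite_AE[OF star_mean_time] by (rule AE_completion)
  have sp: "AE \<omega> in completion Qs. \<omega> \<in> space multi_path_space" by (rule AE_I2) (simp add: star.spQ)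
  let ?N = "\<Sum>k<n. ?E (?o k)" and ?cs = "\<Sum>k<n. ?E (\<lambda>\<omega>. ?o k \<omega> * star.cost k \<omega>)"
  let ?R = "\<Sum>k<n. ?E (\<lambda>\<omega>. ?o k \<omega> * ?\<Delta> k \<omega>)" and ?X = "\<Sum>k<n. ?E (\<lambda>\<omega>. ?o k \<omega> * (\<tau>s k \<omega> - ennreal T))"
  let ?Z = "\<Sum>k<n. ?E (\<lambda>\<omega>. ?o k \<omega> * (?\<Delta> k \<omega> - ennreal S))" and ?m = "?E (\<lambda>\<omega>. min (Ss n \<omega>) (ennreal T))"
  let ?Sg = "\<Sum>k<n. ?E (\<lambda>\<omega>. ?o k \<omega> * seg star k (ennreal T) \<omega>)" and ?A = "\<Sum>k<n. ?E (\<lambda>\<omega>. ?o k \<omega> * seg star k \<top> \<omega>)"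
  have Es: "(\<Sum>k<n. ?E (g k)) = ?E (\<lambda>\<omega>. \<Sum>k<n. g k \<omega>)" if "\<And>k. g k \<in> borel_measurable (completion Qs)" for g
    by (rule nn_integral_sum[symmetric]) (rule that)
  have f1: "ennreal G * ?R + ?cs \<le> ?A + ennreal (4 * C)"
  proof -
    have "?E (\<lambda>\<omega>. ?o k \<omega> * (ennreal G * ?\<Delta> k \<omega> + star.cost k \<omega>)) = ennreal G * ?E (\<lambda>\<omega>. ?o k \<omega> * ?\<Delta> k \<omega>) + ?E (\<lambda>\<omega>. ?o k \<omega> * star.cost k \<omega>)" for k
    proof -
      have "?E (\<lambda>\<omega>. ?o k \<omega> * (ennreal G * ?\<Delta> k \<omega> + star.cost k \<omega>)) = ?E (\<lambda>\<omega>. ennreal G * (?o k \<omega> * ?\<Delta> k \<omega>) + ?o k \<omega> * star.cost k \<omega>)"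
        by (simp add: distrib_left ac_simps)
      also have "\<dots> = ?E (\<lambda>\<omega>. ennreal G * (?o k \<omega> * ?\<Delta> k \<omega>)) + ?E (\<lambda>\<omega>. ?o k \<omega> * star.cost k \<omega>)" by (rule nn_integral_add) measurable
      also have "?E (\<lambda>\<omega>. ennreal G * (?o k \<omega> * ?\<Delta> k \<omega>)) = ennreal G * ?E (\<lambda>\<omega>. ?o k \<omega> * ?\<Delta> k \<omega>)" by (rule nn_integral_cmult) measurable
      finally show ?thesis .
    qed
    then show ?thesis
      using star_balance[OF T, of n] by (simp add: nn_integral_completion sum.distrib sum_distrib_left)
  qed
  have f2: "?R = ?m + ?X"
  proof -
    have "?R = ?E (\<lambda>\<omega>. \<Sum>k<n. ?o k \<omega> * ?\<Delta> k \<omega>)" by (rule Es) measurable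
    also have "\<dots> = ?E (\<lambda>\<omega>. min (Ss n \<omega>) (ennreal T) + (\<Sum>k<n. ?o k \<omega> * (\<tau>s k \<omega> - ennreal T)))"
      by (intro nn_integral_cong star.elapsed_sums(1)) (simp_all add: star.spQ)
    also have "\<dots> = ?m + ?E (\<lambda>\<omega>. \<Sum>k<n. ?o k \<omega> * (\<tau>s k \<omega> - ennreal T))" by (rule nn_integral_add) measurable
    also have "?E (\<lambda>\<omega>. \<Sum>k<n. ?o k \<omega> * (\<tau>s k \<omega> - ennreal T)) = ?X" by (rule Es[symmetric]) measurable
    finally show ?thesis .
  qed
  have f3: "?X \<le> ennreal S + ?Z"
  proof -
    have "?X = ?E (\<lambda>\<omega>. \<Sum>k<n. ?o k \<omega> * (\<tau>s k \<omega> - ennreal T))" by (rule Es) measurable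
    also have "\<dots> \<le> ?E (\<lambda>\<omega>. ennreal S + (\<Sum>k<n. ?o k \<omega> * (?\<Delta> k \<omega> - ennreal S)))"
      by (intro nn_integral_mono star.elapsed_sums(2)) (simp_all add: star.spQ)
    also have "\<dots> = ?E (\<lambda>\<omega>. ennreal S) + ?E (\<lambda>\<omega>. \<Sum>k<n. ?o k \<omega> * (?\<Delta> k \<omega> - ennreal S))" by (rule nn_integral_add) measurable
    also have "?E (\<lambda>\<omega>. \<Sum>k<n. ?o k \<omega> * (?\<Delta> k \<omega> - ennreal S)) = ?Z" by (rule Es[symmetric]) measurable
    finally show ?thesis by (simp add: star.Q.emeasure_space_1)
  qed
  have f4: "?Z \<le> ennreal \<epsilon> * ?N"
    unfolding sum_distrib_left
  proof (rule sum_mono)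
    fix k
    have "?E (\<lambda>\<omega>. ?o k \<omega> * (?\<Delta> k \<omega> - ennreal S)) \<le> ?E (\<lambda>\<omega>. ennreal \<epsilon> * ?o k \<omega>)"
      using star_tail_stage[OF T S, of k] by (simp add: nn_integral_completion mult.commute)
    also have "\<dots> = ennreal \<epsilon> * ?E (?o k)" by (rule nn_integral_cmult) measurable
    finally show "?E (\<lambda>\<omega>. ?o k \<omega> * (?\<Delta> k \<omega> - ennreal S)) \<le> ennreal \<epsilon> * ?E (?o k)" .
  qed
  have f5: "?A \<le> ?Sg + ennreal (2 * G) * ?X"
    unfolding sum_distrib_left sum.distrib[symmetric]
  proof (rule sum_mono)
    fix k
    have "?E (\<lambda>\<omega>. ?o k \<omega> * seg star k \<top> \<omega>) \<le> ?E (\<lambda>\<omega>. ?o k \<omega> * seg star k (ennreal T) \<omega> + ennreal (2 * G) * (?o k \<omega> * (\<tau>s k \<omega> - ennreal T)))"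
    proof (rule nn_integral_mono_AE)
      show "AE \<omega> in completion Qs. ?o k \<omega> * seg star k \<top> \<omega> \<le> ?o k \<omega> * seg star k (ennreal T) \<omega> + ennreal (2 * G) * (?o k \<omega> * (\<tau>s k \<omega> - ennreal T))"
        using fin[of k] sp
      proof eventually_elim
        case (elim \<omega>)
        show ?case using seg_after[OF elim(2,1) T] by (simp add: star.on_def)
      qed
    qed
    also have "\<dots> = ?E (\<lambda>\<omega>. ?o k \<omega> * seg star k (ennreal T) \<omega>) + ?E (\<lambda>\<omega>. ennreal (2 * G) * (?o k \<omega> * (\<tau>s k \<omega> - ennreal T)))"
      by (rule nn_integral_add) measurable
    also have "?E (\<lambda>\<omega>. ennreal (2 * G) * (?o k \<omega> * (\<tau>s k \<omega> - ennreal T))) = ennreal (2 * G) * ?E (\<lambda>\<omega>. ?o k \<omega> * (\<tau>s k \<omega> - ennreal T))"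
      by (rule nn_integral_cmult) measurable
    finally show "?E (\<lambda>\<omega>. ?o k \<omega> * seg star k \<top> \<omega>) \<le> ?E (\<lambda>\<omega>. ?o k \<omega> * seg star k (ennreal T) \<omega>) + ennreal (2 * G) * ?E (\<lambda>\<omega>. ?o k \<omega> * (\<tau>s k \<omega> - ennreal T))" .
  qed
  have f6: "?A \<le> ennreal (2 * G) * ?R"
    unfolding sum_distrib_left
  proof (rule sum_mono)
    fix k
    have "?E (\<lambda>\<omega>. ?o k \<omega> * seg star k \<top> \<omega>) \<le> ?E (\<lambda>\<omega>. ennreal (2 * G) * (?o k \<omega> * ?\<Delta> k \<omega>))"
    proof (rule nn_integral_mono_AE)
      show "AE \<omega> in completion Qs. ?o k \<omega> * seg star k \<top> \<omega> \<le> ennreal (2 * G) * (?o k \<omega> * ?\<Delta> k \<omega>)"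
        using fin[of k] sp
      proof eventually_elim
        case (elim \<omega>)
        show ?case using star.seg_le[OF elim(2,1)] by (simp add: star.on_def)
      qed
    qed
    also have "\<dots> = ennreal (2 * G) * ?E (\<lambda>\<omega>. ?o k \<omega> * ?\<Delta> k \<omega>)" by (rule nn_integral_cmult) measurable
    finally show "?E (\<lambda>\<omega>. ?o k \<omega> * seg star k \<top> \<omega>) \<le> ennreal (2 * G) * ?E (\<lambda>\<omega>. ?o k \<omega> * ?\<Delta> k \<omega>)" .
  qed
  have f7: "ennreal c0 * ?N \<le> ?cs"
    unfolding sum_distrib_left
  proof (rule sum_mono)
    fix k
    have "ennreal c0 * ?E (?o k) = ?E (\<lambda>\<omega>. ennreal c0 * ?o k \<omega>)" by (rule nn_integral_cmult[symmetric]) measurable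
    also have "\<dots> \<le> ?E (\<lambda>\<omega>. ?o k \<omega> * star.cost k \<omega>)"
    proof (rule nn_integral_mono)
      fix \<omega> assume "\<omega> \<in> space (completion Qs)"
      then have "snd star k \<omega> \<in> U" using impulse_point_in[OF star_impulse] by (simp add: star.spQ)
      then have "ennreal c0 \<le> star.cost k \<omega>" unfolding star.cost_def using c_le[of "snd star k \<omega>" "pre_impulse star \<omega> k"] by (intro ennreal_leI) linarith
      then show "ennreal c0 * ?o k \<omega> \<le> ?o k \<omega> * star.cost k \<omega>" by (simp add: star.on_def)
    qed
    finally show "ennreal c0 * ?E (?o k) \<le> ?E (\<lambda>\<omega>. ?o k \<omega> * star.cost k \<omega>)" .
  qed
  have mT: "?m \<le> ennreal T"
  proof -
    have "?m \<le> ?E (\<lambda>_. ennreal T)" by (intro nn_integral_mono) simp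
    then show ?thesis by (simp add: star.Q.emeasure_space_1)
  qed
  have SA: "?Sg \<le> ?A" by (intro sum_mono nn_integral_mono mult_left_mono star.seg_mono) auto
  \<comment> \<open>The restriction to \<open>n\<close> stages makes the expected number finite,
    without which it could not be absorbed.\<close>
  have "?N \<le> (\<Sum>k<n. 1)"
  proof (rule sum_mono)
    fix k
    have "?E (?o k) \<le> ?E (\<lambda>_. 1)" by (intro nn_integral_mono le1)
    then show "?E (?o k) \<le> 1" by (simp add: star.Q.emeasure_space_1)
  qed
  then have "?N < \<infinity>" by (rule le_less_trans) (simp add: of_nat_less_top)
  then obtain \<nu> where \<nu>: "?N = ennreal \<nu>" "0 \<le> \<nu>" by (cases ?N) auto
  have Z': "?Z \<le> ennreal (\<epsilon> * \<nu>)" using f4 \<nu> \<epsilon>(1) by (simp add: ennreal_mult)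
  have X': "?X \<le> ennreal (S + \<epsilon> * \<nu>)"
    using f3 add_left_mono[OF Z', of "ennreal S"] S0 \<epsilon>(1) \<nu>(2) by (simp add: ennreal_plus[symmetric] del: ennreal_plus)
  then obtain \<xi> where \<xi>: "?X = ennreal \<xi>" "0 \<le> \<xi>" by (cases ?X) (auto simp: top_unique)
  have \<xi>le: "\<xi> \<le> S + \<epsilon> * \<nu>" using X' S0 \<epsilon>(1) \<nu>(2) unfolding \<xi>(1) by (simp add: ennreal_le_iff del: ennreal_plus)
  obtain m' where m': "?m = ennreal m'" "0 \<le> m'" using mT by (cases ?m) (auto simp: top_unique)
  have m'T: "m' \<le> T" using mT T unfolding m'(1) by (simp add: ennreal_le_iff)
  have R: "?R = ennreal (m' + \<xi>)" unfolding f2 m'(1) \<xi>(1) using m'(2) \<xi>(2) by simp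
  have A': "?A \<le> ennreal (2 * G * (m' + \<xi>))" using f6 unfolding R using G_nonneg m'(2) \<xi>(2) by (simp add: ennreal_mult[symmetric] del: ennreal_plus)
  then obtain \<alpha> where \<alpha>: "?A = ennreal \<alpha>" "0 \<le> \<alpha>" by (cases ?A) (auto simp: top_unique)
  have \<alpha>le: "\<alpha> \<le> 2 * G * (m' + \<xi>)" using A' G_nonneg m'(2) \<xi>(2) unfolding \<alpha>(1) by (simp add: ennreal_le_iff del: ennreal_plus)
  obtain \<sigma> where \<sigma>: "?Sg = ennreal \<sigma>" "0 \<le> \<sigma>" using SA unfolding \<alpha>(1) by (cases ?Sg) (auto simp: top_unique)
  have "?cs \<le> ennreal G * ?R + ?cs" by simp
  also note f1
  finally have "?cs \<le> ennreal (\<alpha> + 4 * C)" using \<alpha> C_nonneg by simp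
  then obtain \<kappa> where \<kappa>: "?cs = ennreal \<kappa>" "0 \<le> \<kappa>" by (cases ?cs) (auto simp: top_unique)
  have g1: "G * (m' + \<xi>) + \<kappa> \<le> \<alpha> + 4 * C"
    using f1 unfolding R \<kappa>(1) \<alpha>(1) using G_nonneg m'(2) \<xi>(2) \<kappa>(2) \<alpha>(2) C_nonneg
    by (simp add: ennreal_mult[symmetric] ennreal_plus[symmetric] ennreal_le_iff del: ennreal_plus)
  have g5: "\<alpha> \<le> \<sigma> + 2 * G * \<xi>"
    using f5 unfolding \<alpha>(1) \<sigma>(1) \<xi>(1) using G_nonneg \<xi>(2) \<sigma>(2)
    by (simp add: ennreal_mult[symmetric] ennreal_plus[symmetric] ennreal_le_iff del: ennreal_plus)
  have g7: "c0 * \<nu> \<le> \<kappa>" using f7 unfolding \<nu>(1) \<kappa>(1) using c0 \<kappa>(2) \<nu>(2) by (simp add: ennreal_mult[symmetric] ennreal_le_iff)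
  have Gx: "G * \<xi> \<le> G * (S + \<epsilon> * \<nu>)" using \<xi>le G_nonneg by (rule mult_left_mono)
  have Gm: "G * m' \<le> G * T" using m'T G_nonneg by (rule mult_left_mono)
  have Ge: "G * \<epsilon> * \<nu> \<le> c0 / 2 * \<nu>" using \<epsilon>(2) \<nu>(2) by (rule mult_right_mono)
  have "c0 / 2 * \<nu> \<le> G * (T + S) + 4 * C"
  proof -
    have "G * (S + \<epsilon> * \<nu>) = G * S + G * \<epsilon> * \<nu>" "G * (T + S) = G * T + G * S" "G * (m' + \<xi>) = G * m' + G * \<xi>"
      "2 * G * (m' + \<xi>) = 2 * (G * (m' + \<xi>))" "c0 * \<nu> = 2 * (c0 / 2 * \<nu>)" by (auto simp: algebra_simps)
    then show ?thesis using g1 \<alpha>le g7 Gx Gm Ge by linarith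
  qed
  then have \<nu>le: "\<nu> \<le> (G * (T + S) + 4 * C) * 2 / c0" using c0 by (simp add: field_simps)
  then show "(\<Sum>k<n. \<integral>\<^sup>+\<omega>. ?o k \<omega> \<partial>Qs) \<le> ennreal ((G * (T + S) + 4 * C) * 2 / c0)"
    using \<nu>(1) by (simp add: nn_integral_completion ennreal_leI)
  have "\<kappa> + G * m' \<le> \<sigma> + (G * (S + \<epsilon> * \<nu>) + 4 * C)"
  proof -
    have "G * (m' + \<xi>) = G * m' + G * \<xi>" "2 * G * \<xi> = 2 * (G * \<xi>)" by (auto simp: algebra_simps)
    then show ?thesis using g1 g5 Gx by linarith
  qed
  also have "\<dots> \<le> \<sigma> + (G * (S + \<epsilon> * ((G * (T + S) + 4 * C) * 2 / c0)) + 4 * C)"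
    using \<nu>le \<epsilon>(1) G_nonneg by (intro add_left_mono add_right_mono mult_left_mono) auto
  finally have fin: "\<kappa> + G * m' \<le> \<sigma> + (G * (S + \<epsilon> * ((G * (T + S) + 4 * C) * 2 / c0)) + 4 * C)" .
  have D0: "0 \<le> G * (S + \<epsilon> * ((G * (T + S) + 4 * C) * 2 / c0)) + 4 * C"
    using G_nonneg S0 \<epsilon>(1) T C_nonneg c0 by (intro add_nonneg_nonneg mult_nonneg_nonneg divide_nonneg_pos) auto
  have "(\<Sum>k<n. ?E (star.paid T k)) \<le> ?cs"
    by (intro sum_mono nn_integral_mono star.paid_le_on) (simp add: star.spQ)
  then have "(\<Sum>k<n. ?E (star.paid T k)) + ennreal G * ?m \<le> ennreal \<kappa> + ennreal G * ennreal m'" unfolding \<kappa>(1) m'(1) by (rule add_right_mono)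
  also have "\<dots> = ennreal (\<kappa> + G * m')" using \<kappa>(2) m'(2) G_nonneg by (simp add: ennreal_mult)
  also have "\<dots> \<le> ennreal (\<sigma> + (G * (S + \<epsilon> * ((G * (T + S) + 4 * C) * 2 / c0)) + 4 * C))" by (rule ennreal_leI[OF fin])
  also have "\<dots> = ?Sg + ennreal (G * (S + \<epsilon> * ((G * (T + S) + 4 * C) * 2 / c0)) + 4 * C)"
    unfolding \<sigma>(1) using \<sigma>(2) D0 by (rule ennreal_plus)
  also have "\<dots> \<le> (\<Sum>k<n. ?E (seg star k (ennreal T))) + ennreal (G * (S + \<epsilon> * ((G * (T + S) + 4 * C) * 2 / c0)) + 4 * C)"
    by (intro add_right_mono sum_mono nn_integral_mono) (simp add: star.on_def)
  finally show "(\<Sum>k<n. \<integral>\<^sup>+\<omega>. star.paid T k \<omega> \<partial>Qs) + ennreal G * (\<integral>\<^sup>+\<omega>. min (Ss n \<omega>) (ennreal T) \<partial>Qs)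
      \<le> (\<Sum>k<n. \<integral>\<^sup>+\<omega>. seg star k (ennreal T) \<omega> \<partial>Qs) + ennreal (G * (S + \<epsilon> * ((G * (T + S) + 4 * C) * 2 / c0)) + 4 * C)"
    by (simp only: nn_integral_completion)
qed

text \<open>The bound on the expected number of stages begun by \<open>T\<close> is independent of
  \<open>n\<close>; hence almost surely only finitely many stages begin before each integer
  time.\<close>

lemma star_tends: "AE \<omega> in Qs. (\<lambda>i. \<tau>s i \<omega>) \<longlonglongrightarrow> \<top>"
proof -
  \<comment> \<open>Any positive \<epsilon> with G \<epsilon> \<le> c0 / 2 would do; the
    \<open>+ 1\<close> covers \<open>G = 0\<close>.\<close>
  define \<epsilon> where "\<epsilon> = c0 / (2 * (G + 1))"
  have \<epsilon>: "0 < \<epsilon>" "G * \<epsilon> \<le> c0 / 2" using c0 G_nonneg by (auto simp: \<epsilon>_def field_simps)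
  obtain S where S: "0 < S" "\<And>y. y \<in> insert x U \<Longrightarrow> (\<integral>\<^sup>+p. act p - ennreal S \<partial>P y) \<le> ennreal \<epsilon>"
    by (rule act_tail[OF \<epsilon>(1)]) blast
  have "AE \<omega> in completion Qs. (\<Sum>k. star.on (ennreal (real T)) k \<omega>) \<noteq> \<infinity>" for T :: nat
  proof (rule nn_integral_PInf_AE)
    note [measurable] = star.multi_filt_measurable_completion[OF star.on_measurable]
    show "(\<lambda>\<omega>. \<Sum>k. star.on (ennreal (real T)) k \<omega>) \<in> borel_measurable (completion Qs)" by measurable
    have "(\<integral>\<^sup>+\<omega>. (\<Sum>k. star.on (ennreal (real T)) k \<omega>) \<partial>completion Qs) = (\<Sum>k. \<integral>\<^sup>+\<omega>. star.on (ennreal (real T)) k \<omega> \<partial>completion Qs)"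
      by (rule nn_integral_suminf) measurable
    also have "\<dots> \<le> ennreal ((G * (real T + S) + 4 * C) * 2 / c0)"
      using star_estimate(1)[OF _ _ _ \<epsilon>(2) S(2), of "real T"] S(1) \<epsilon>(1)
      by (intro suminf_le_const[OF summableI]) (simp add: nn_integral_completion)
    finally show "(\<integral>\<^sup>+\<omega>. (\<Sum>k. star.on (ennreal (real T)) k \<omega>) \<partial>completion Qs) \<noteq> \<infinity>" by (auto simp: top_unique)
  qed
  then have "AE \<omega> in Qs. \<forall>T::nat. (\<Sum>k. star.on (ennreal (real T)) k \<omega>) \<noteq> \<infinity>"
    by (simp add: AE_all_countable AE_completion_iff)
  with AE_space show ?thesis
  proof eventually_elim
    case (elim \<omega>)
    then have w: "\<omega> \<in> space multi_path_space" by (simp add: star.spQ)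
    show ?case
    proof (rule order_tendstoI)
      fix a :: ennreal assume "a < \<top>"
      then obtain b where b: "a = ennreal b" "0 \<le> b" by (cases a) auto
      obtain T :: nat where T: "b \<le> real T" using real_arch_simple by blast
      have "\<exists>k. ennreal (real T) < Ss k \<omega>"
      proof (rule ccontr)
        assume "\<not> ?thesis"
        then have o: "star.on (ennreal (real T)) k \<omega> = 1" for k by (auto simp: star.on_def not_less)
        have "of_nat n \<le> (\<Sum>k. star.on (ennreal (real T)) k \<omega>)" for n
          using sum_le_suminf[OF summableI, of "{..<n}" "\<lambda>k. star.on (ennreal (real T)) k \<omega>"] by (simp add: o)
        then show False using elim(2) by (metis ennreal_Ex_less_of_nat infinity_ennreal_def leD top.not_eq_extremum)
      qed
      then obtain k where k: "ennreal (real T) < Ss k \<omega>" by blast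
      have "a < \<tau>s i \<omega>" if "k \<le> i" for i
      proof -
        have "a \<le> ennreal (real T)" unfolding b(1) by (rule ennreal_leI[OF T])
        also note k
        also have "Ss k \<omega> \<le> \<tau>s k \<omega>" by (rule star.start_mono[OF w])
        also have "\<dots> \<le> \<tau>s i \<omega>" by (rule impulse_times_mono[OF star_impulse w that])
        finally show ?thesis .
      qed
      then show "\<forall>\<^sub>F i in sequentially. a < \<tau>s i \<omega>" by (auto simp: eventually_sequentially)
    qed simp
  qed
qed

lemma star_integrable: "integrable_strategy P U x star"
  using star_impulse star_tends star_mean_time by (simp add: integrable_strategy_def admissible_def)

end

section \<open>Cutting an arbitrary strategy at a fixed time\<close>

context reward_control
begin

lemma restart_measurable:
  fixes s0 :: real
  assumes w: "\<omega> \<in> space multi_path_space" and s0: "0 \<le> s0"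
  shows "(\<lambda>p. fun_upd \<omega> n (restart (ennreal s0) y p)) \<in> filt t \<rightarrow>\<^sub>M multi_filt n (ennreal s0 + t)"
  unfolding filt_def multi_filt_def
proof (rule measurable_universal_completion2, rule measurable_raw_multiI)
  show "fun_upd \<omega> n (restart (ennreal s0) y p) \<in> space multi_path_space" if "p \<in> space (raw_filt t)" for p
    using w restart_in_space that by (simp add: space_multi_path_space)
  fix i s assume s: "0 \<le> s" "ennreal s \<le> ennreal s0 + t"
  show "(\<lambda>p. fun_upd \<omega> n (restart (ennreal s0) y p) i s) \<in> raw_filt t \<rightarrow>\<^sub>M borel"
  proof (cases "i = n \<and> s0 \<le> s")
    case True
    have "ennreal (s - s0) \<le> t" using True s s0 by (cases t) (auto simp: ennreal_plus[symmetric] ennreal_le_iff simp del: ennreal_plus)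
    then have "(\<lambda>p. p (s - s0)) \<in> raw_filt t \<rightarrow>\<^sub>M borel" using True by (intro measurable_raw_filt_coord) auto
    then show ?thesis using True s s0 by (simp add: restart_def ennreal_less_iff)
  next
    case False
    then show ?thesis using s s0 by (cases "i = n") (auto simp: restart_def ennreal_less_iff)
  qed
qed

text \<open>With the past of the stage frozen at \<open>\<omega>\<close>, the remaining time until
  the impulse or \<open>T\<close>, and the target, replaced by \<open>z\<close> if the stage is cut,
  are a stopping time and a target for the uncontrolled path: time \<open>t\<close> of
  \<open>p\<close> is time \<open>s0 + t\<close> of the controlled process.\<close>

lemma restart_stopping:
  fixes s0 T :: real and \<omega> n y
  assumes w: "\<omega> \<in> space multi_path_space" and s0: "0 \<le> s0" and z: "z \<in> U"
  defines "\<omega>' \<equiv> \<lambda>p. fun_upd \<omega> n (restart (ennreal s0) y p)"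
  defines "\<sigma> \<equiv> \<lambda>p. min (fst V n (\<omega>' p)) (ennreal T) - ennreal s0"
  shows "stopping_time filt \<sigma>"
    and "(\<lambda>p. if fst V n (\<omega>' p) \<le> ennreal T then snd V n (\<omega>' p) else z) \<in> filtration.pre_sigma (space path_space) filt \<sigma> \<rightarrow>\<^sub>M restrict_space borel U"
      (is "?\<eta> \<in> _")
proof -
  interpret F: filtration "space path_space" "filt :: ennreal \<Rightarrow> (real \<Rightarrow> 'e) measure" by (rule filtration_filt)
  interpret M: filtration "space multi_path_space" "multi_filt n :: ennreal \<Rightarrow> (nat \<Rightarrow> real \<Rightarrow> 'e) measure" by (rule filtration_multi_filt)
  have st: "stopping_time (multi_filt n) (fst V n)" and pt: "snd V n \<in> M.pre_sigma (fst V n) \<rightarrow>\<^sub>M restrict_space borel U"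
    using V by (simp_all add: impulse_strategy_def)
  have R: "\<omega>' \<in> filt t \<rightarrow>\<^sub>M multi_filt n (ennreal s0 + t)" for t
    unfolding \<omega>'_def by (rule restart_measurable[OF w s0])
  have in': "\<omega>' p \<in> space multi_path_space" if "p \<in> space path_space" for p
    using measurable_space[OF R[of 0], of p] that by simp
  have \<sigma>le: "\<sigma> p \<le> t \<longleftrightarrow> fst V n (\<omega>' p) \<le> ennreal s0 + t \<or> ennreal T \<le> ennreal s0 + t" for p t
    by (auto simp: \<sigma>_def ennreal_minus_le_iff min_le_iff_disj)
  have pull: "{p \<in> space path_space. \<omega>' p \<in> A} \<in> sets (filt t)" if "A \<in> sets (multi_filt n u)" "u \<le> ennreal s0 + t" for A u t
  proof -
    have "A \<in> sets (multi_filt n (ennreal s0 + t))" using that sets_multi_filt_mono[OF order_refl] by blast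
    from measurable_sets[OF R this] show ?thesis by (simp add: vimage_def Int_def conj_commute)
  qed
  have D: "{\<omega> \<in> space multi_path_space. fst V n \<omega> \<le> u} \<in> sets (multi_filt n u)" for u
    using stopping_timeD[OF st, of u] by (simp add: pred_def)
  show s: "stopping_time filt \<sigma>"
  proof
    fix t
    show "Measurable.pred (filt t) (\<lambda>p. \<sigma> p \<le> t)"
    proof (cases "ennreal T \<le> ennreal s0 + t")
      case True
      then show ?thesis by (simp add: \<sigma>le)
    next
      case False
      have "{p \<in> space path_space. \<omega>' p \<in> {\<omega> \<in> space multi_path_space. fst V n \<omega> \<le> ennreal s0 + t}} \<in> sets (filt t)"
        by (rule pull[OF D order_refl])
      also have "{p \<in> space path_space. \<omega>' p \<in> {\<omega> \<in> space multi_path_space. fst V n \<omega> \<le> ennreal s0 + t}}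
        = {p \<in> space (filt t). \<sigma> p \<le> t}" using False in' by (auto simp: \<sigma>le)
      finally show ?thesis by (simp only: pred_def)
    qed
  qed
  show "?\<eta> \<in> F.pre_sigma \<sigma> \<rightarrow>\<^sub>M restrict_space borel U"
  proof (rule measurableI)
    fix p assume "p \<in> space (F.pre_sigma \<sigma>)"
    then show "?\<eta> p \<in> space (restrict_space borel U)"
      using z impulse_point_in[OF V in', of p n] by (simp add: F.space_pre_sigma space_restrict_space)
  next
    fix A assume A: "A \<in> sets (restrict_space borel U)"
    have E: "{\<omega> \<in> space multi_path_space. snd V n \<omega> \<in> A \<and> fst V n \<omega> \<le> u} \<in> sets (multi_filt n u)" for u
      using M.sets_pre_sigmaD[OF st measurable_sets[OF pt A], of u]
      by (simp add: M.space_pre_sigma vimage_def Int_def conj_ac)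
    show "?\<eta> -` A \<inter> space (F.pre_sigma \<sigma>) \<in> sets (F.pre_sigma \<sigma>)"
    proof (rule F.sets_pre_sigmaI[OF s])
      fix t
      show "{p \<in> ?\<eta> -` A \<inter> space (F.pre_sigma \<sigma>). \<sigma> p \<le> t} \<in> sets (filt t)"
      proof (cases "ennreal T \<le> ennreal s0 + t")
        \<comment> \<open>From the cut on it is known whether the impulse came by \<open>T\<close>,
          so both branches of the target are observable.\<close>
        case True
        let ?B = "{p \<in> space path_space. \<omega>' p \<in> {\<omega> \<in> space multi_path_space. snd V n \<omega> \<in> A \<and> fst V n \<omega> \<le> ennreal T}}"
        let ?N = "{p \<in> space path_space. \<omega>' p \<in> {\<omega> \<in> space multi_path_space. fst V n \<omega> \<le> ennreal T}}"
        have BN: "?B \<in> sets (filt t)" "?N \<in> sets (filt t)" by (rule pull[OF E True] pull[OF D True])+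
        have "(if z \<in> A then space (filt t) - ?N else {}) \<in> sets (filt t)"
          using sets.compl_sets[OF BN(2)] by (cases "z \<in> A") (simp_all only: if_True if_False sets.empty_sets)
        from sets.Un[OF BN(1) this] have "?B \<union> (if z \<in> A then space (filt t) - ?N else {}) \<in> sets (filt t)" .
        also have "?B \<union> (if z \<in> A then space (filt t) - ?N else {}) = {p \<in> ?\<eta> -` A \<inter> space (F.pre_sigma \<sigma>). \<sigma> p \<le> t}"
          using True in' by (auto simp: \<sigma>le F.space_pre_sigma split: if_splits)
        finally show ?thesis .
      next
        case False
        have "{p \<in> space path_space. \<omega>' p \<in> {\<omega> \<in> space multi_path_space. snd V n \<omega> \<in> A \<and> fst V n \<omega> \<le> ennreal s0 + t}} \<in> sets (filt t)"
          by (rule pull[OF E order_refl])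
        also have "{p \<in> space path_space. \<omega>' p \<in> {\<omega> \<in> space multi_path_space. snd V n \<omega> \<in> A \<and> fst V n \<omega> \<le> ennreal s0 + t}}
          = {p \<in> ?\<eta> -` A \<inter> space (F.pre_sigma \<sigma>). \<sigma> p \<le> t}"
          using False in' by (auto simp: \<sigma>le F.space_pre_sigma split: if_splits)
        finally show ?thesis .
      qed
    qed
  qed
qed

lemma elapsed_sum:
  assumes w: "\<omega> \<in> space multi_path_space" and T: "T < \<infinity>"
  shows "(\<Sum>k<n. on T k \<omega> * (min (fst V k \<omega>) T - start_time V k \<omega>)) = min (start_time V n \<omega>) T"
proof (induction n)
  case (Suc n)
  show ?case
  proof (cases "start_time V n \<omega> \<le> T")
    case True
    have "start_time V n \<omega> + (min (fst V n \<omega>) T - start_time V n \<omega>) = min (fst V n \<omega>) T"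
      using start_mono[OF w, of n] True by (intro add_diff_inverse_ennreal) (simp add: min_def)
    then show ?thesis using Suc True by (simp add: on_def min_absorb1)
  next
    case False
    then have "\<not> fst V n \<omega> \<le> T" using start_mono[OF w, of n] by auto
    then show ?thesis using Suc False by (simp add: on_def min_def)
  qed
qed (simp add: min_def)

end

text \<open>Despite the name, \<open>V\<close> is an arbitrary impulse strategy, to be compared with
  the Bellman function; the Bellman strategy is still \<open>star\<close>.\<close>

locale bellman_strategy = ergodic_rate f lam G P U c z \<mu> w xihat x C c0 K h Cq
  for f :: "'e::metric_space \<Rightarrow> real" and lam G and P :: "'e \<Rightarrow> (real \<Rightarrow> 'e) measure" and U c z \<mu> w xihat x C c0 K h Cq +
  fixes V :: "'e strategy"
  assumes V: "impulse_strategy U V"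

sublocale bellman_strategy \<subseteq> ctl: reward_control P U V x f lam G c
  by (rule reward_control[OF V])

context bellman_strategy
begin

text \<open>The one-step inequality for the stage cut at \<open>T\<close>. A cut stage pays |c _ z|
  for the additional impulse in place of its own cost, and the raised value of \<open>w\<close> at
  the artificial target \<open>z\<close>, which is nonnegative, is dropped on the left.\<close>

lemma stage_le:
  assumes T: "0 \<le> T"
  shows "(\<integral>\<^sup>+\<omega>. ctl.on (ennreal T) n \<omega> * (seg V n (ennreal T) \<omega> + (if fst V n \<omega> \<le> ennreal T then ennreal (w (snd V n \<omega>) + C) else 0)) \<partial>ctl.Q)
    \<le> (\<integral>\<^sup>+\<omega>. ctl.on (ennreal T) n \<omega> * (ennreal (w (start_point V x n \<omega>) + C) + ennreal G * (min (fst V n \<omega>) (ennreal T) - start_time V n \<omega>)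
        + (if fst V n \<omega> \<le> ennreal T then ctl.cost n \<omega> else ennreal \<bar>c (\<omega> n T) z\<bar>)) \<partial>ctl.Q)"
    (is "integral\<^sup>N ctl.Q ?F \<le> integral\<^sup>N ctl.Q ?F'")
proof (rule ctl.nn_integral_stage_mono[where T=T])
  note [measurable] = ctl.multi_measurable ctl.on_measurable
  have [measurable]: "(\<lambda>\<omega>. w (start_point V x n \<omega>)) \<in> borel_measurable (multi_filt n \<top>)"
    by (rule measurable_compose[OF start_point_measurable[OF V] borel_measurable_continuous_onI[OF w_cont]])
  have [measurable]: "(\<lambda>\<omega>. w (snd V n \<omega>)) \<in> borel_measurable (multi_filt n \<top>)"
    by (rule measurable_compose[OF ctl.point_measurable borel_measurable_continuous_onI[OF w_cont]])
  have [measurable]: "(\<lambda>\<omega>. \<bar>c (\<omega> n T) z\<bar>) \<in> borel_measurable (multi_filt n \<top>)"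
    by (rule measurable_compose[OF measurable_compose[OF ctl.coord_multi_filt[OF order_refl] measurable_path_coord[OF T]] cz_measurable])
  show "?F \<in> borel_measurable (multi_filt n \<top>)" "?F' \<in> borel_measurable (multi_filt n \<top>)" by measurable
  show "0 \<le> T" by (rule T)
  show "?F \<omega> = 0" if "\<not> start_time V n \<omega> \<le> ennreal T" for \<omega> using that by (simp add: ctl.on_def)
  fix \<omega> s0 y
  assume w: "\<omega> \<in> space multi_path_space" and y: "y \<in> insert x U" "y = start_point V x n \<omega>"
    and s0: "0 \<le> s0" "s0 \<le> T" and S: "start_time V n \<omega> = ennreal s0"
  let ?\<omega> = "\<lambda>p. fun_upd \<omega> n (restart (ennreal s0) y p)"
  let ?\<sigma> = "\<lambda>p. min (fst V n (?\<omega> p)) (ennreal T) - ennreal s0"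
  let ?\<eta> = "\<lambda>p. if fst V n (?\<omega> p) \<le> ennreal T then snd V n (?\<omega> p) else z"
  interpret Py: prob_space "P y" by (rule P_prob)
  have st: "start_time V n (?\<omega> p) = ennreal s0" "start_point V x n (?\<omega> p) = y" "?\<omega> p \<in> space multi_path_space" if p: "p \<in> space path_space" for p
  proof -
    show w': "?\<omega> p \<in> space multi_path_space" using w restart_in_space[OF p] by (simp add: space_multi_path_space)
    show "start_time V n (?\<omega> p) = ennreal s0" "start_point V x n (?\<omega> p) = y"
      using start_depends[OF V w w', of n] S y(2) by auto
  qed
  have on1: "ctl.on (ennreal T) n (?\<omega> p) = 1" if "p \<in> space path_space" for p
    using st[OF that] s0 by (simp add: ctl.on_def ennreal_leI)
  have "?\<sigma> p \<le> ennreal T" for p by (rule order_trans[OF diff_le_self_ennreal]) simp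
  then have "(\<integral>\<^sup>+p. ?\<sigma> p \<partial>P y) \<le> (\<integral>\<^sup>+p. ennreal T \<partial>P y)" by (intro nn_integral_mono)
  then have fin: "(\<integral>\<^sup>+p. ?\<sigma> p \<partial>P y) < \<infinity>" by (simp add: Py.emeasure_space_1 le_less_trans)
  have "(\<integral>\<^sup>+p. ?F (?\<omega> p) \<partial>P y) \<le> (\<integral>\<^sup>+p. area p (?\<sigma> p) + ennreal (w (?\<eta> p) + C) \<partial>P y)"
  proof (rule nn_integral_mono)
    fix p assume "p \<in> space (P y)"
    then have p: "p \<in> space path_space" by (simp add: markov_family_space[OF P])
    have "min (fst V n (?\<omega> p) - ennreal s0) (ennreal T - ennreal s0) = ?\<sigma> p"
      by (auto simp: min_def ennreal_minus_mono intro: antisym)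
    then have "seg V n (ennreal T) (?\<omega> p) = area p (?\<sigma> p)"
      using seg_restart[OF V w p S s0(1), of "?\<omega> p" y "ennreal T"] by (simp add: S)
    then show "?F (?\<omega> p) \<le> area p (?\<sigma> p) + ennreal (w (?\<eta> p) + C)" by (simp add: on1[OF p])
  qed
  also have "\<dots> \<le> (\<integral>\<^sup>+p. ennreal (w y + C) + ennreal G * ?\<sigma> p + ennreal (- c (p (enn2real (?\<sigma> p))) (?\<eta> p)) \<partial>P y)"
    by (rule one_step_le[OF y(1) ctl.restart_stopping[OF w s0(1) zU] fin])
  also have "\<dots> = (\<integral>\<^sup>+p. ?F' (?\<omega> p) \<partial>P y)"
  proof (rule nn_integral_cong)
    fix p assume "p \<in> space (P y)"
    then have p: "p \<in> space path_space" by (simp add: markov_family_space[OF P])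
    show "ennreal (w y + C) + ennreal G * ?\<sigma> p + ennreal (- c (p (enn2real (?\<sigma> p))) (?\<eta> p)) = ?F' (?\<omega> p)"
    proof (cases "fst V n (?\<omega> p) \<le> ennreal T")
      case True
      then have "fst V n (?\<omega> p) < \<infinity>" by (rule le_less_trans) simp
      then have "pre_impulse V (?\<omega> p) n = p (enn2real (?\<sigma> p))"
        using ctl.cost_restart[OF w p S s0(1), of "?\<omega> p" y] True by (simp add: S min_absorb1)
      then show ?thesis using st[OF p] on1[OF p] True by (simp add: ctl.cost_def)
    next
      case False
      then have \<sigma>: "?\<sigma> p = ennreal (T - s0)" using s0 by (simp add: min_absorb2 ennreal_minus)
      have e: "enn2real (?\<sigma> p) = T - s0" unfolding \<sigma> using s0 by simp
      have "?\<omega> p n T = p (T - s0)" using s0 T by (simp add: restart_def ennreal_less_iff)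
      moreover have "\<bar>c (p (T - s0)) z\<bar> = - c (p (T - s0)) z" using c_le[OF zU, of "p (T - s0)"] c0 by linarith
      ultimately show ?thesis using st[OF p] on1[OF p] False unfolding e by (simp del: fun_upd_apply)
    qed
  qed
  finally show "(\<integral>\<^sup>+p. ?F (?\<omega> p) \<partial>P y) \<le> (\<integral>\<^sup>+p. ?F' (?\<omega> p) \<partial>P y)" .
qed

text \<open>Given that the stage starts at \<open>s0\<close>, its coordinate at time
  \<open>T\<close> is an uncontrolled path at time \<open>T - s0\<close>. This can be any
  nonnegative time, which is why the tail bound is needed uniformly in time.\<close>

lemma tail_stage:
  fixes m :: nat
  assumes T: "0 \<le> T" and m: "\<And>s y. 0 \<le> s \<Longrightarrow> y \<in> insert x U \<Longrightarrow> tail_cost (real m) s y \<le> ennreal \<epsilon>"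
  shows "(\<integral>\<^sup>+\<omega>. ctl.on (ennreal T) n \<omega> * (ennreal \<bar>c (\<omega> n T) z\<bar> * indicator {\<omega>. real m < \<bar>c (\<omega> n T) z\<bar>} \<omega>) \<partial>ctl.Q)
    \<le> (\<integral>\<^sup>+\<omega>. ctl.on (ennreal T) n \<omega> * ennreal \<epsilon> \<partial>ctl.Q)"
    (is "integral\<^sup>N ctl.Q ?F \<le> integral\<^sup>N ctl.Q ?F'")
proof (rule ctl.nn_integral_stage_mono[where T=T])
  note [measurable] = ctl.multi_measurable ctl.on_measurable
  have cm[measurable]: "(\<lambda>\<omega>. \<bar>c (\<omega> n T) z\<bar>) \<in> borel_measurable (multi_filt n \<top>)"
    by (rule measurable_compose[OF measurable_compose[OF ctl.coord_multi_filt[OF order_refl] measurable_path_coord[OF T]] cz_measurable])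
  have "?F = (\<lambda>\<omega>. ctl.on (ennreal T) n \<omega> * (ennreal \<bar>c (\<omega> n T) z\<bar> * indicator {real m<..} \<bar>c (\<omega> n T) z\<bar>))"
    by (simp add: fun_eq_iff indicator_def)
  also have "\<dots> \<in> borel_measurable (multi_filt n \<top>)" by measurable
  finally show "?F \<in> borel_measurable (multi_filt n \<top>)" .
  show "?F' \<in> borel_measurable (multi_filt n \<top>)" by measurable
  show "0 \<le> T" by (rule T)
  show "?F \<omega> = 0" if "\<not> start_time V n \<omega> \<le> ennreal T" for \<omega> using that by (simp add: ctl.on_def)
  fix \<omega> s0 y
  assume w: "\<omega> \<in> space multi_path_space" and y: "y \<in> insert x U" "y = start_point V x n \<omega>"
    and s0: "0 \<le> s0" "s0 \<le> T" and S: "start_time V n \<omega> = ennreal s0"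
  let ?\<omega> = "\<lambda>p. fun_upd \<omega> n (restart (ennreal s0) y p)"
  interpret Py: prob_space "P y" by (rule P_prob)
  have on1: "ctl.on (ennreal T) n (?\<omega> p) = 1" if p: "p \<in> space (P y)" for p
  proof -
    have "p \<in> space path_space" using p by (simp add: markov_family_space[OF P])
    then have w': "?\<omega> p \<in> space multi_path_space" using w restart_in_space by (simp add: space_multi_path_space)
    then show ?thesis using start_depends(1)[OF V w w', of n] S s0 by (simp add: ctl.on_def ennreal_leI)
  qed
  have eT: "?\<omega> p n T = p (T - s0)" for p using s0 T by (simp add: restart_def ennreal_less_iff)
  have "(\<integral>\<^sup>+p. ?F (?\<omega> p) \<partial>P y) = tail_cost (real m) (T - s0) y"
    using s0 by (intro nn_integral_cong) (simp add: on1 eT indicator_def del: fun_upd_apply)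
  also have "\<dots> \<le> ennreal \<epsilon>" using s0 by (intro m y(1)) simp
  also have "\<dots> = (\<integral>\<^sup>+p. ennreal \<epsilon> \<partial>P y)" by (simp add: Py.emeasure_space_1)
  also have "\<dots> = (\<integral>\<^sup>+p. ?F' (?\<omega> p) \<partial>P y)" by (intro nn_integral_cong) (simp add: on1)
  finally show "(\<integral>\<^sup>+p. ?F (?\<omega> p) \<partial>P y) \<le> (\<integral>\<^sup>+p. ?F' (?\<omega> p) \<partial>P y)" .
qed

text \<open>The stage running at \<open>T\<close> pays at most \<open>m\<close> plus the part of its
  cost above level \<open>m\<close>. Which stage that is depends on the path, so that part is
  estimated for every stage begun by \<open>T\<close>, by \<epsilon> each; every such stage but the
  first follows a paid impulse, so their number is at most 1 plus the paid cost over
  \<open>c0\<close>. The term \<open>2 * C\<close> is the raised value of \<open>w\<close> at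
  \<open>x\<close>, and \<open>G * T\<close> stems from the shift of the reward.\<close>

lemma controlled_reward_le:
  fixes m :: nat
  assumes T: "0 \<le> T" and \<epsilon>: "0 \<le> \<epsilon>" and m: "\<And>s y. 0 \<le> s \<Longrightarrow> y \<in> insert x U \<Longrightarrow> tail_cost (real m) s y \<le> ennreal \<epsilon>"
  shows "(\<Sum>k<n. \<integral>\<^sup>+\<omega>. seg V k (ennreal T) \<omega> \<partial>ctl.Q)
    \<le> ennreal (2 * C + G * T + real m + \<epsilon>) + ennreal (1 + \<epsilon> / c0) * (\<Sum>k<n. \<integral>\<^sup>+\<omega>. ctl.paid T k \<omega> \<partial>ctl.Q)"
proof -
  note [measurable] = ctl.completion_measurable ctl.multi_filt_measurable_completion[OF ctl.on_measurable]
    ctl.multi_filt_measurable_completion[OF ctl.paid_measurable]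
  have [measurable]: "(\<lambda>\<omega>. w (start_point V x n \<omega>)) \<in> borel_measurable (completion ctl.Q)" for n
    by (rule ctl.multi_filt_measurable_completion[OF measurable_compose[OF start_point_measurable[OF V] borel_measurable_continuous_onI[OF w_cont]]])
  have [measurable]: "(\<lambda>\<omega>. \<bar>c (\<omega> n T) z\<bar>) \<in> borel_measurable (completion ctl.Q)" for n
    by (rule ctl.multi_filt_measurable_completion[OF measurable_compose[OF measurable_compose[OF ctl.coord_multi_filt[OF order_refl] measurable_path_coord[OF T]] cz_measurable]])
  let ?E = "\<lambda>g. \<integral>\<^sup>+\<omega>. g \<omega> \<partial>completion ctl.Q"
  let ?o = "ctl.on (ennreal T)"
  let ?u = "\<lambda>k \<omega>. ?o k \<omega> * ennreal (w (start_point V x k \<omega>) + C)"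
  let ?d = "\<lambda>k \<omega>. ?o k \<omega> * (min (fst V k \<omega>) (ennreal T) - start_time V k \<omega>)"
  let ?cr = "\<lambda>k \<omega>. indicator {\<omega>. start_time V k \<omega> \<le> ennreal T \<and> ennreal T < fst V k \<omega>} \<omega> :: ennreal"
  let ?tl = "\<lambda>k \<omega>. ?o k \<omega> * (ennreal \<bar>c (\<omega> k T) z\<bar> * indicator {\<omega>. real m < \<bar>c (\<omega> k T) z\<bar>} \<omega>)"
  let ?sg = "\<lambda>k. seg V k (ennreal T)" and ?p = "ctl.paid T"
  have crm [measurable]: "?cr k \<in> borel_measurable (completion ctl.Q)" for k
  proof -
    have "{\<omega> \<in> space (completion ctl.Q). start_time V k \<omega> \<le> ennreal T \<and> ennreal T < fst V k \<omega>} \<in> sets (completion ctl.Q)" by measurable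
    then have "(\<lambda>\<omega>. indicator {\<omega> \<in> space (completion ctl.Q). start_time V k \<omega> \<le> ennreal T \<and> ennreal T < fst V k \<omega>} \<omega> :: ennreal) \<in> borel_measurable (completion ctl.Q)"
      by (rule borel_measurable_indicator)
    then show ?thesis by (rule measurable_cong[THEN iffD1, rotated]) (auto simp: indicator_def)
  qed
  have tlm [measurable]: "?tl k \<in> borel_measurable (completion ctl.Q)" for k
  proof -
    have "?tl k = (\<lambda>\<omega>. ?o k \<omega> * (ennreal \<bar>c (\<omega> k T) z\<bar> * indicator {real m<..} \<bar>c (\<omega> k T) z\<bar>))"
      by (simp add: fun_eq_iff indicator_def)
    also have "\<dots> \<in> borel_measurable (completion ctl.Q)" by measurable
    finally show ?thesis .
  qed
  have step: "?E (?sg k) + ?E (?u (Suc k)) \<le> ?E (?u k) + (ennreal G * ?E (?d k) + (?E (?p k) + (of_nat m * ?E (?cr k) + ennreal \<epsilon> * ?E (?o k))))" for k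
  proof -
    have "?E (?sg k) + ?E (?u (Suc k)) = ?E (\<lambda>\<omega>. ?sg k \<omega> + ?u (Suc k) \<omega>)" by (rule nn_integral_add[symmetric]) measurable
    also have "\<dots> \<le> ?E (\<lambda>\<omega>. ?o k \<omega> * (?sg k \<omega> + (if fst V k \<omega> \<le> ennreal T then ennreal (w (snd V k \<omega>) + C) else 0)))"
    proof (rule nn_integral_mono)
      fix \<omega> assume "\<omega> \<in> space (completion ctl.Q)"
      then have "start_time V k \<omega> \<le> fst V k \<omega>" by (intro ctl.start_mono) (simp add: ctl.spQ)
      then show "?sg k \<omega> + ?u (Suc k) \<omega> \<le> ?o k \<omega> * (?sg k \<omega> + (if fst V k \<omega> \<le> ennreal T then ennreal (w (snd V k \<omega>) + C) else 0))"
        using ctl.seg_zero[of "ennreal T" k \<omega>] by (auto simp: ctl.on_def not_le)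
    qed
    also have "\<dots> \<le> ?E (\<lambda>\<omega>. ?o k \<omega> * (ennreal (w (start_point V x k \<omega>) + C) + ennreal G * (min (fst V k \<omega>) (ennreal T) - start_time V k \<omega>)
        + (if fst V k \<omega> \<le> ennreal T then ctl.cost k \<omega> else ennreal \<bar>c (\<omega> k T) z\<bar>)))"
      using stage_le[OF T, of k] by (simp only: nn_integral_completion)
    also have "\<dots> \<le> ?E (\<lambda>\<omega>. ?u k \<omega> + (ennreal G * ?d k \<omega> + (?p k \<omega> + (of_nat m * ?cr k \<omega> + ?tl k \<omega>))))"
    proof (rule nn_integral_mono)
      fix \<omega>
      define a where "a = ennreal \<bar>c (\<omega> k T) z\<bar>"
      define b where "b = a * indicator {\<omega>. real m < \<bar>c (\<omega> k T) z\<bar>} \<omega>"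
      have "a \<le> of_nat m + b"
        by (auto simp: a_def b_def indicator_def not_less ennreal_of_nat_eq_real_of_nat intro: ennreal_leI)
      then show "?o k \<omega> * (ennreal (w (start_point V x k \<omega>) + C) + ennreal G * (min (fst V k \<omega>) (ennreal T) - start_time V k \<omega>)
        + (if fst V k \<omega> \<le> ennreal T then ctl.cost k \<omega> else ennreal \<bar>c (\<omega> k T) z\<bar>))
        \<le> ?u k \<omega> + (ennreal G * ?d k \<omega> + (?p k \<omega> + (of_nat m * ?cr k \<omega> + ?tl k \<omega>)))"
        unfolding a_def[symmetric] b_def[symmetric]
        by (cases "start_time V k \<omega> \<le> ennreal T"; cases "fst V k \<omega> \<le> ennreal T")
           (simp_all add: ctl.on_def ctl.paid_def indicator_def not_le[symmetric] add.assoc add_left_mono)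
    qed
    also have "\<dots> = ?E (?u k) + ?E (\<lambda>\<omega>. ennreal G * ?d k \<omega> + (?p k \<omega> + (of_nat m * ?cr k \<omega> + ?tl k \<omega>)))" by (rule nn_integral_add) measurable
    also have "?E (\<lambda>\<omega>. ennreal G * ?d k \<omega> + (?p k \<omega> + (of_nat m * ?cr k \<omega> + ?tl k \<omega>)))
      = ?E (\<lambda>\<omega>. ennreal G * ?d k \<omega>) + ?E (\<lambda>\<omega>. ?p k \<omega> + (of_nat m * ?cr k \<omega> + ?tl k \<omega>))" by (rule nn_integral_add) measurable
    also have "?E (\<lambda>\<omega>. ennreal G * ?d k \<omega>) = ennreal G * ?E (?d k)" by (rule nn_integral_cmult) measurable
    also have "?E (\<lambda>\<omega>. ?p k \<omega> + (of_nat m * ?cr k \<omega> + ?tl k \<omega>)) = ?E (?p k) + ?E (\<lambda>\<omega>. of_nat m * ?cr k \<omega> + ?tl k \<omega>)" by (rule nn_integral_add) measurable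
    also have "?E (\<lambda>\<omega>. of_nat m * ?cr k \<omega> + ?tl k \<omega>) = ?E (\<lambda>\<omega>. of_nat m * ?cr k \<omega>) + ?E (?tl k)" by (rule nn_integral_add) measurable
    also have "?E (\<lambda>\<omega>. of_nat m * ?cr k \<omega>) = of_nat m * ?E (?cr k)" by (rule nn_integral_cmult) measurable
    also have "?E (?tl k) \<le> ennreal \<epsilon> * ?E (?o k)"
    proof -
      have "?E (?tl k) \<le> ?E (\<lambda>\<omega>. ennreal \<epsilon> * ?o k \<omega>)"
        using tail_stage[OF T m, of k] by (simp add: nn_integral_completion mult.commute)
      also have "\<dots> = ennreal \<epsilon> * ?E (?o k)" by (rule nn_integral_cmult) measurable
      finally show ?thesis .
    qed
    finally show ?thesis by (simp add: add_left_mono)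
  qed
  let ?D = "\<Sum>k<n. ?E (?d k)" and ?CR = "\<Sum>k<n. ?E (?cr k)" and ?O = "\<Sum>k<n. ?E (?o k)" and ?PD = "\<Sum>k<n. ?E (?p k)"
  have "(\<Sum>k<n. ?E (?sg k)) + ?E (?u n) \<le> ?E (?u 0) + (\<Sum>k<n. ennreal G * ?E (?d k) + (?E (?p k) + (of_nat m * ?E (?cr k) + ennreal \<epsilon> * ?E (?o k))))"
  proof (induction n)
    case (Suc n)
    let ?r = "\<lambda>k. ennreal G * ?E (?d k) + (?E (?p k) + (of_nat m * ?E (?cr k) + ennreal \<epsilon> * ?E (?o k)))"
    have "(\<Sum>k<Suc n. ?E (?sg k)) + ?E (?u (Suc n)) = (\<Sum>k<n. ?E (?sg k)) + (?E (?sg n) + ?E (?u (Suc n)))" by (simp add: add.assoc)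
    also have "\<dots> \<le> (\<Sum>k<n. ?E (?sg k)) + (?E (?u n) + ?r n)" by (rule add_left_mono[OF step])
    also have "\<dots> = ((\<Sum>k<n. ?E (?sg k)) + ?E (?u n)) + ?r n" by (simp only: add.assoc)
    also have "\<dots> \<le> (?E (?u 0) + (\<Sum>k<n. ?r k)) + ?r n" by (rule add_right_mono[OF Suc])
    finally show ?case by (simp only: sum.lessThan_Suc add.assoc)
  qed simp
  then have "(\<Sum>k<n. ?E (?sg k)) \<le> ?E (?u 0) + (\<Sum>k<n. ennreal G * ?E (?d k) + (?E (?p k) + (of_nat m * ?E (?cr k) + ennreal \<epsilon> * ?E (?o k))))"
    by (rule order_trans[rotated]) simp
  also have "\<dots> = ?E (?u 0) + (ennreal G * ?D + (?PD + (of_nat m * ?CR + ennreal \<epsilon> * ?O)))"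
    by (simp add: sum.distrib sum_distrib_left)
  also have "\<dots> \<le> ennreal (2 * C) + (ennreal G * ennreal T + (?PD + (of_nat m * 1 + ennreal \<epsilon> * (1 + ennreal (1 / c0) * ?PD))))"
  proof (intro add_mono mult_left_mono order_refl)
    have "?E (?u 0) \<le> ?E (\<lambda>_. ennreal (2 * C))"
    proof (rule nn_integral_mono)
      fix \<omega>
      have "w x + C \<le> 2 * C" using C[of x] by auto
      then show "?u 0 \<omega> \<le> ennreal (2 * C)" by (auto simp: ctl.on_def intro: ennreal_leI)
    qed
    then show "?E (?u 0) \<le> ennreal (2 * C)" by (simp add: ctl.Q.emeasure_space_1)
    have "?D = ?E (\<lambda>\<omega>. \<Sum>k<n. ?d k \<omega>)" by (rule nn_integral_sum[symmetric]) measurable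
    also have "\<dots> \<le> ?E (\<lambda>_. ennreal T)"
      by (intro nn_integral_mono) (simp add: ctl.elapsed_sum ctl.spQ)
    finally show "?D \<le> ennreal T" by (simp add: ctl.Q.emeasure_space_1)
    have "?CR = ?E (\<lambda>\<omega>. \<Sum>k<n. ?cr k \<omega>)" by (rule nn_integral_sum[symmetric]) measurable
    also have "\<dots> \<le> ?E (\<lambda>_. 1)" by (rule nn_integral_mono) (rule ctl.sum_crossing(1), simp add: ctl.spQ)
    finally show "?CR \<le> 1" by (simp add: ctl.Q.emeasure_space_1)
    have "?O = ?E (\<lambda>\<omega>. \<Sum>k<n. ?o k \<omega>)" by (rule nn_integral_sum[symmetric]) measurable
    also have "\<dots> \<le> ?E (\<lambda>\<omega>. 1 + ennreal (1 / c0) * (\<Sum>k<n. ?p k \<omega>))"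
    proof (rule nn_integral_mono)
      fix \<omega> assume "\<omega> \<in> space (completion ctl.Q)"
      then have w: "\<omega> \<in> space multi_path_space" by (simp add: ctl.spQ)
      have "?o (Suc k) \<omega> \<le> ennreal (1 / c0) * ?p k \<omega>" for k
      proof -
        have "1 = ennreal (1 / c0 * c0)" using c0 by simp
        also have "\<dots> \<le> ennreal (1 / c0 * - c (pre_impulse V \<omega> k) (snd V k \<omega>))"
          using c_le[OF impulse_point_in[OF V w, of k], of "pre_impulse V \<omega> k"] c0 by (intro ennreal_leI mult_left_mono) auto
        also have "\<dots> = ennreal (1 / c0) * ctl.cost k \<omega>" unfolding ctl.cost_def using c0 by (intro ennreal_mult'') (simp add: ctl.c_nonpos impulse_point_in[OF V w])
        finally show ?thesis by (simp add: ctl.on_Suc ctl.paid_def)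
      qed
      then have "(\<Sum>k<n. ?o (Suc k) \<omega>) \<le> ennreal (1 / c0) * (\<Sum>k<n. ?p k \<omega>)"
        unfolding sum_distrib_left by (intro sum_mono)
      then have "?o 0 \<omega> + (\<Sum>k<n. ?o (Suc k) \<omega>) \<le> 1 + ennreal (1 / c0) * (\<Sum>k<n. ?p k \<omega>)"
        by (intro add_mono) (simp_all add: ctl.on_def)
      moreover have "(\<Sum>k<n. ?o k \<omega>) \<le> (\<Sum>k<Suc n. ?o k \<omega>)" by simp
      ultimately show "(\<Sum>k<n. ?o k \<omega>) \<le> 1 + ennreal (1 / c0) * (\<Sum>k<n. ?p k \<omega>)"
        unfolding sum.lessThan_Suc_shift by (rule order_trans[rotated])
    qed
    also have "\<dots> = ?E (\<lambda>_. 1) + ?E (\<lambda>\<omega>. ennreal (1 / c0) * (\<Sum>k<n. ?p k \<omega>))" by (rule nn_integral_add) measurable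
    also have "?E (\<lambda>\<omega>. ennreal (1 / c0) * (\<Sum>k<n. ?p k \<omega>)) = ennreal (1 / c0) * ?E (\<lambda>\<omega>. \<Sum>k<n. ?p k \<omega>)" by (rule nn_integral_cmult) measurable
    also have "?E (\<lambda>\<omega>. \<Sum>k<n. ?p k \<omega>) = ?PD" by (rule nn_integral_sum) measurable
    finally show "?O \<le> 1 + ennreal (1 / c0) * ?PD" by (simp add: ctl.Q.emeasure_space_1)
  qed simp_all
  also have "\<dots> = ennreal (2 * C + G * T + real m + \<epsilon>) + ennreal (1 + \<epsilon> / c0) * ?PD"
  proof -
    have "ennreal (2 * C + G * T + real m + \<epsilon>) = ennreal (2 * C) + ennreal G * ennreal T + of_nat m + ennreal \<epsilon>"
      using C_nonneg G_nonneg T \<epsilon> by (simp add: ennreal_mult ennreal_of_nat_eq_real_of_nat)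
    moreover have "ennreal (1 + \<epsilon> / c0) = 1 + ennreal \<epsilon> * ennreal (1 / c0)"
      using \<epsilon> c0 by (simp add: ennreal_mult[symmetric] ennreal_plus)
    ultimately show ?thesis by (simp add: distrib_left distrib_right ac_simps)
  qed
  finally show ?thesis by (simp only: nn_integral_completion)
qed

end

subsection \<open>Averages over long times\<close>

lemma Liminf_quotient_le:
  fixes N :: "'a \<Rightarrow> ereal" and g :: "'a \<Rightarrow> real"
  assumes F: "F \<noteq> bot" and g: "filterlim g at_top F" and le: "\<forall>\<^sub>F s in F. N s \<le> ereal (a * g s + D)"
  shows "Liminf F (\<lambda>s. N s / ereal (g s)) \<le> ereal a"
proof -
  have "((\<lambda>s. a + D / g s) \<longlongrightarrow> a + 0) F"
    by (rule tendsto_add[OF tendsto_const tendsto_divide_0[OF tendsto_const filterlim_at_top_imp_at_infinity[OF g]]])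
  then have lim: "((\<lambda>s. ereal (a + D / g s)) \<longlongrightarrow> ereal a) F" by simp
  have "\<forall>\<^sub>F s in F. 0 < g s" using g by (simp add: filterlim_at_top_dense)
  with le have "\<forall>\<^sub>F s in F. N s / ereal (g s) \<le> ereal (a + D / g s)"
  proof eventually_elim
    case (elim s)
    then have "N s / ereal (g s) \<le> ereal (a * g s + D) / ereal (g s)" by (intro ereal_divide_right_mono) auto
    then show ?case using elim(2) by (simp add: add_divide_distrib)
  qed
  then have "Liminf F (\<lambda>s. N s / ereal (g s)) \<le> Liminf F (\<lambda>s. ereal (a + D / g s))" by (rule Liminf_mono)
  also have "\<dots> = ereal a" by (rule lim_imp_Liminf[OF F lim])
  finally show ?thesis .
qed

lemma Liminf_quotient_ge:
  fixes N :: "'a \<Rightarrow> ereal" and g :: "'a \<Rightarrow> real"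
  assumes F: "F \<noteq> bot" and g: "filterlim g at_top F" and le: "\<forall>\<^sub>F s in F. ereal (a * g s + D) \<le> N s"
  shows "ereal a \<le> Liminf F (\<lambda>s. N s / ereal (g s))"
proof -
  have "((\<lambda>s. a + D / g s) \<longlongrightarrow> a + 0) F"
    by (rule tendsto_add[OF tendsto_const tendsto_divide_0[OF tendsto_const filterlim_at_top_imp_at_infinity[OF g]]])
  then have lim: "((\<lambda>s. ereal (a + D / g s)) \<longlongrightarrow> ereal a) F" by simp
  have "\<forall>\<^sub>F s in F. 0 < g s" using g by (simp add: filterlim_at_top_dense)
  with le have ev: "\<forall>\<^sub>F s in F. ereal (a + D / g s) \<le> N s / ereal (g s)"
  proof eventually_elim
    case (elim s)
    then have "ereal (a * g s + D) / ereal (g s) \<le> N s / ereal (g s)" by (intro ereal_divide_right_mono) auto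
    then show ?case using elim(2) by (simp add: add_divide_distrib)
  qed
  have "ereal a = Liminf F (\<lambda>s. ereal (a + D / g s))" by (rule lim_imp_Liminf[OF F lim, symmetric])
  also have "\<dots> \<le> Liminf F (\<lambda>s. N s / ereal (g s))" by (rule Liminf_mono[OF ev])
  finally show ?thesis .
qed

lemma ereal_ge_if_approx:
  assumes "\<And>e. 0 < e \<Longrightarrow> e \<le> 1 \<Longrightarrow> ereal (a - e) \<le> X"
  shows "ereal a \<le> X"
proof (rule LIMSEQ_le_const2)
  have "(\<lambda>n. a - inverse (real (Suc n))) \<longlonglongrightarrow> a - 0" by (intro tendsto_diff tendsto_const LIMSEQ_inverse_real_of_nat)
  then show "(\<lambda>n. ereal (a - inverse (real (Suc n)))) \<longlonglongrightarrow> ereal a" by simp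
  show "\<exists>N. \<forall>n\<ge>N. ereal (a - inverse (real (Suc n))) \<le> X"
    by (intro exI allI impI assms) (simp_all add: field_simps)
qed

lemma ereal_le_if_approx:
  assumes "\<And>e. 0 < e \<Longrightarrow> X \<le> ereal (a + e)"
  shows "X \<le> ereal a"
proof (rule LIMSEQ_le_const)
  have "(\<lambda>n. a + inverse (real (Suc n))) \<longlonglongrightarrow> a + 0" by (intro tendsto_add tendsto_const LIMSEQ_inverse_real_of_nat)
  then show "(\<lambda>n. ereal (a + inverse (real (Suc n)))) \<longlonglongrightarrow> ereal a" by simp
  show "\<exists>N. \<forall>n\<ge>N. X \<le> ereal (a + inverse (real (Suc n)))"
    by (intro exI allI impI assms) simp
qed

context reward_control
begin

lemma expected_sums:
  assumes T: "0 \<le> T"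
  shows "(\<integral>\<^sup>+\<omega>. (\<Sum>k. seg V k (ennreal T) \<omega>) \<partial>Q) = (\<Sum>k. \<integral>\<^sup>+\<omega>. seg V k (ennreal T) \<omega> \<partial>Q)"
    and "(\<integral>\<^sup>+\<omega>. ennreal ((G - lam) * T) + (\<Sum>k. paid T k \<omega>) \<partial>Q) = ennreal ((G - lam) * T) + (\<Sum>k. \<integral>\<^sup>+\<omega>. paid T k \<omega> \<partial>Q)"
proof -
  note [measurable] = completion_measurable multi_filt_measurable_completion[OF paid_measurable]
  let ?E = "\<lambda>g. \<integral>\<^sup>+\<omega>. g \<omega> \<partial>completion Q"
  have "?E (\<lambda>\<omega>. \<Sum>k. seg V k (ennreal T) \<omega>) = (\<Sum>k. ?E (seg V k (ennreal T)))" by (rule nn_integral_suminf) measurable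
  then show "(\<integral>\<^sup>+\<omega>. (\<Sum>k. seg V k (ennreal T) \<omega>) \<partial>Q) = (\<Sum>k. \<integral>\<^sup>+\<omega>. seg V k (ennreal T) \<omega> \<partial>Q)"
    by (simp only: nn_integral_completion)
  have "?E (\<lambda>\<omega>. ennreal ((G - lam) * T) + (\<Sum>k. paid T k \<omega>)) = ?E (\<lambda>\<omega>. ennreal ((G - lam) * T)) + ?E (\<lambda>\<omega>. \<Sum>k. paid T k \<omega>)"
    by (rule nn_integral_add) measurable
  also have "?E (\<lambda>\<omega>. \<Sum>k. paid T k \<omega>) = (\<Sum>k. ?E (paid T k))" by (rule nn_integral_suminf) measurable
  finally show "(\<integral>\<^sup>+\<omega>. ennreal ((G - lam) * T) + (\<Sum>k. paid T k \<omega>) \<partial>Q) = ennreal ((G - lam) * T) + (\<Sum>k. \<integral>\<^sup>+\<omega>. paid T k \<omega> \<partial>Q)"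
    by (simp add: nn_integral_completion Q.emeasure_space_1)
qed

text \<open>Monotone convergence along the increasing impulse times. It makes the bounded terms w x
  + C and w x - C negligible in \<open>J_hat\<close>.\<close>

lemma mean_time_tends:
  assumes adm: "AE \<omega> in Q. (\<lambda>i. fst V i \<omega>) \<longlonglongrightarrow> \<top>" and fin: "\<And>i. mean_time P x V i < \<infinity>"
  shows "filterlim (\<lambda>n. enn2real (mean_time P x V n)) at_top sequentially"
  unfolding filterlim_at_top
proof
  fix B :: real
  have sp: "AE \<omega> in completion Q. \<omega> \<in> space multi_path_space" by (rule AE_I2) (simp add: spQ)
  have mono: "AE \<omega> in completion Q. fst V i \<omega> \<le> fst V (Suc i) \<omega>" for i
    using sp by eventually_elim (rule impulse_times_mono[OF V], simp_all)
  have "(\<integral>\<^sup>+\<omega>. (SUP i. fst V i \<omega>) \<partial>completion Q) = (SUP i. \<integral>\<^sup>+\<omega>. fst V i \<omega> \<partial>completion Q)"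
    by (rule nn_integral_monotone_convergence_SUP_AE[where f="fst V"]) (rule mono completion_measurable(3))+
  moreover have "(\<integral>\<^sup>+\<omega>. (SUP i. fst V i \<omega>) \<partial>completion Q) = (\<integral>\<^sup>+\<omega>. \<top> \<partial>completion Q)"
  proof (rule nn_integral_cong_AE)
    show "AE \<omega> in completion Q. (SUP i. fst V i \<omega>) = \<top>"
      using AE_completion[OF adm] sp
    proof eventually_elim
      case (elim \<omega>)
      have "incseq (\<lambda>i. fst V i \<omega>)" using impulse_times_mono[OF V elim(2)] by (simp add: incseq_def)
      from LIMSEQ_unique[OF LIMSEQ_SUP[OF this] elim(1)] show ?case .
    qed
  qed
  ultimately have "(SUP i. mean_time P x V i) = \<top>" by (simp add: mean_time_def Q.emeasure_space_1)
  then have "ennreal B < (SUP i. mean_time P x V i)" by (simp only: ennreal_less_top)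
  then obtain n where n: "ennreal B < mean_time P x V n" by (subst (asm) less_SUP_iff) blast
  have "B \<le> enn2real (mean_time P x V k)" if "n \<le> k" for k
  proof -
    have "mean_time P x V n \<le> mean_time P x V k"
      unfolding mean_time_eq using that by (intro nn_integral_mono impulse_times_mono[OF V]) (simp_all add: spQ)
    then have "ennreal B \<le> ennreal (enn2real (mean_time P x V k))" using n fin[of k] by (simp add: less_top)
    then show ?thesis by (cases "0 \<le> B") (auto simp: ennreal_le_iff intro: order_trans[OF _ enn2real_nonneg])
  qed
  then show "\<forall>\<^sub>F k in sequentially. B \<le> enn2real (mean_time P x V k)" by (auto simp: eventually_sequentially)
qed

end

context bellman_strategy
begin

text \<open>Let \<alpha> be the expected shifted reward and \<pi> the expected paid cost up to
  \<open>T\<close>. If \<pi> \<le> G T, the surplus \<epsilon> \<pi> / c0 in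
  \<open>controlled_reward_le\<close> is at most e T, by the choice of \<epsilon>. If \<pi> > G T,
  the crude bound \<alpha> \<le> 2 G T already keeps the payoff below lam T. If \<pi> is infinite,
  the payoff is minus infinity.\<close>

lemma J_le:
  assumes adm: "AE \<omega> in ctl.Q. (\<lambda>i. fst V i \<omega>) \<longlonglongrightarrow> \<top>"
  shows "J P f c x V \<le> ereal lam"
proof (rule ereal_le_if_approx)
  fix e :: real assume e: "0 < e"
  define \<epsilon> where "\<epsilon> = e * c0 / (G + 1)"
  have \<epsilon>: "0 < \<epsilon>" using e c0 G_nonneg by (simp add: \<epsilon>_def)
  obtain m :: nat where m: "\<And>s y. 0 \<le> s \<Longrightarrow> y \<in> insert x U \<Longrightarrow> tail_cost (real m) s y \<le> ennreal \<epsilon>"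
    by (rule tail_cost_uniform[OF \<epsilon>]) blast
  let ?D = "2 * C + real m + \<epsilon>"
  have D0: "0 \<le> ?D" using C_nonneg \<epsilon> by simp
  show "J P f c x V \<le> ereal (lam + e)"
    unfolding J_def
  proof (rule Liminf_quotient_le[where g="\<lambda>T. T" and D="?D"])
    show "\<forall>\<^sub>F T in at_top. eexpectation ctl.Q (\<lambda>\<omega>. ereal (LBINT s:{0..T}. f (controlled V \<omega> s))
       + (\<Sum>i. if fst V i \<omega> \<le> ennreal T then ereal (c (pre_impulse V \<omega> i) (snd V i \<omega>)) else 0)) \<le> ereal ((lam + e) * T + ?D)"
      using eventually_ge_at_top[of "0::real"]
    proof eventually_elim
      case (elim T)
      let ?A = "\<Sum>k. \<integral>\<^sup>+\<omega>. seg V k (ennreal T) \<omega> \<partial>ctl.Q" and ?P = "\<Sum>k. \<integral>\<^sup>+\<omega>. ctl.paid T k \<omega> \<partial>ctl.Q"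
      have A1: "?A \<le> ennreal (2 * G * T)" using ctl.J_numerator(2)[OF adm elim] by (simp only: ctl.expected_sums(1)[OF elim])
      have A2: "?A \<le> ennreal (2 * C + G * T + real m + \<epsilon>) + ennreal (1 + \<epsilon> / c0) * ?P"
      proof (rule suminf_le_const[OF summableI])
        fix n
        have "(\<Sum>k<n. \<integral>\<^sup>+\<omega>. seg V k (ennreal T) \<omega> \<partial>ctl.Q)
          \<le> ennreal (2 * C + G * T + real m + \<epsilon>) + ennreal (1 + \<epsilon> / c0) * (\<Sum>k<n. \<integral>\<^sup>+\<omega>. ctl.paid T k \<omega> \<partial>ctl.Q)"
          by (rule controlled_reward_le[OF elim less_imp_le[OF \<epsilon>] m])
        also have "\<dots> \<le> ennreal (2 * C + G * T + real m + \<epsilon>) + ennreal (1 + \<epsilon> / c0) * ?P"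
          by (intro add_left_mono mult_left_mono sum_le_suminf summableI) auto
        finally show "(\<Sum>k<n. \<integral>\<^sup>+\<omega>. seg V k (ennreal T) \<omega> \<partial>ctl.Q) \<le> ennreal (2 * C + G * T + real m + \<epsilon>) + ennreal (1 + \<epsilon> / c0) * ?P" .
      qed
      obtain \<alpha> where \<alpha>: "?A = ennreal \<alpha>" "0 \<le> \<alpha>" using A1 by (cases ?A) (auto simp: top_unique)
      have \<alpha>1: "\<alpha> \<le> 2 * G * T" using A1 G_nonneg elim unfolding \<alpha>(1) by (simp add: ennreal_le_iff)
      have GT: "0 \<le> (G - lam) * T" using G[of undefined] elim by (intro mult_nonneg_nonneg) linarith+
      show ?case
      proof (cases ?P)
        case (real \<pi>)
        have X: "0 \<le> 2 * C + G * T + real m + \<epsilon>" and Y: "0 \<le> 1 + \<epsilon> / c0" using C_nonneg G_nonneg elim \<epsilon> c0 by simp_all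
        have "ennreal (1 + \<epsilon> / c0) * ?P = ennreal ((1 + \<epsilon> / c0) * \<pi>)" unfolding real(2) using Y real(1) by (rule ennreal_mult[symmetric])
        with A2 have "?A \<le> ennreal (2 * C + G * T + real m + \<epsilon>) + ennreal ((1 + \<epsilon> / c0) * \<pi>)" by (simp only:)
        also have "\<dots> = ennreal (2 * C + G * T + real m + \<epsilon> + (1 + \<epsilon> / c0) * \<pi>)"
          using X mult_nonneg_nonneg[OF Y real(1)] by (rule ennreal_plus[symmetric])
        finally have "?A \<le> ennreal (2 * C + G * T + real m + \<epsilon> + (1 + \<epsilon> / c0) * \<pi>)" .
        then have \<alpha>2: "\<alpha> \<le> 2 * C + G * T + real m + \<epsilon> + (1 + \<epsilon> / c0) * \<pi>"
          unfolding \<alpha>(1) using X mult_nonneg_nonneg[OF Y real(1)] by (subst (asm) ennreal_le_iff) auto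
        have "\<alpha> - ((G - lam) * T + \<pi>) \<le> (lam + e) * T + ?D"
        proof (cases "\<pi> \<le> G * T")
          case True
          have "\<epsilon> / c0 * \<pi> \<le> \<epsilon> / c0 * (G * T)" using True \<epsilon> c0 by (intro mult_left_mono) auto
          also have "\<dots> = e * T * (G / (G + 1))" using c0 by (simp add: \<epsilon>_def)
          also have "\<dots> \<le> e * T * 1" using e elim G_nonneg by (intro mult_left_mono) auto
          finally show ?thesis using \<alpha>2 by (simp add: algebra_simps)
        next
          case False
          have "0 \<le> e * T" using e elim by simp
          then show ?thesis using \<alpha>1 False D0 by (simp add: algebra_simps)
        qed
        then show ?thesis
          unfolding ctl.J_numerator(1)[OF adm elim] ctl.expected_sums[OF elim] \<alpha>(1) real(2)
          using GT real(1) \<alpha>(2) by (simp add: ennreal_plus[symmetric] del: ennreal_plus)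
      next
        case top
        show ?thesis unfolding ctl.J_numerator(1)[OF adm elim] ctl.expected_sums[OF elim] \<alpha>(1) top using \<alpha>(2) by simp
      qed
    qed
  qed (simp_all add: filterlim_ident)
qed

abbreviation hat_payoff :: "nat \<Rightarrow> ereal" where
  "hat_payoff n \<equiv> eexpectation ctl.Q (\<lambda>\<omega>. ereal (
       (LBINT s:{s. 0 \<le> s \<and> ennreal s < fst V n \<omega>}. f (controlled V \<omega> s))
       + (\<Sum>i\<le>n. c (pre_impulse V \<omega> i) (snd V i \<omega>))))"

text \<open>The payoff of the Bellman inequality has running reward f - lam and an additional
  \<open>w\<close> at the last target, which is between - C and C; removing both yields the multiple
  of the mean time and the constants. An infinite expected cost makes the payoff minus infinity,
  which the equality excludes.\<close>

lemma hat_payoff_bounds: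
  assumes fin: "\<And>i. mean_time P x V i < \<infinity>"
  shows "hat_payoff n \<le> ereal (lam * enn2real (mean_time P x V n) + (w x + C))"
    and "impulse_payoff P f c lam w x V n = ereal (w x) \<Longrightarrow> ereal (lam * enn2real (mean_time P x V n) + (w x - C)) \<le> hat_payoff n"
proof -
  note [measurable] = ctl.completion_measurable
  have [measurable]: "(\<lambda>\<omega>. w (snd V n \<omega>)) \<in> borel_measurable (completion ctl.Q)"
    by (rule ctl.multi_filt_measurable_completion[OF measurable_compose[OF ctl.point_measurable borel_measurable_continuous_onI[OF w_cont]]])
  have Cu: "\<bar>w u\<bar> \<le> C" if "u \<in> U" for u using C that by blast
  let ?E = "\<lambda>g. \<integral>\<^sup>+\<omega>. g \<omega> \<partial>completion ctl.Q"
  let ?A = "?E (\<lambda>\<omega>. \<Sum>k\<le>n. seg V k \<top> \<omega>)" and ?W = "?E (\<lambda>\<omega>. ennreal (w (snd V n \<omega>) + C))" and ?C = "?E (\<lambda>\<omega>. \<Sum>i\<le>n. ctl.cost i \<omega>)"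
  have one: "?E (\<lambda>_. a) = a" for a :: ennreal by (simp add: ctl.Q.emeasure_space_1)
  have "?A < \<infinity>" using ctl.nn_integral_sum_seg_finite[OF fin] by (simp only: nn_integral_completion)
  then obtain \<alpha> where \<alpha>: "?A = ennreal \<alpha>" "0 \<le> \<alpha>" by (cases ?A) auto
  have "?W \<le> ?E (\<lambda>_. ennreal (2 * C))"
  proof (rule nn_integral_mono)
    fix \<omega> assume "\<omega> \<in> space (completion ctl.Q)"
    then have "snd V n \<omega> \<in> U" by (intro impulse_point_in[OF V]) (simp add: ctl.spQ)
    then show "ennreal (w (snd V n \<omega>) + C) \<le> ennreal (2 * C)" using Cu[of "snd V n \<omega>"] by (intro ennreal_leI) linarith
  qed
  then have W2: "?W \<le> ennreal (2 * C)" by (simp only: one)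
  then obtain \<eta> where \<eta>: "?W = ennreal \<eta>" "0 \<le> \<eta>" by (cases ?W) (auto simp: top_unique)
  have \<eta>2: "\<eta> \<le> 2 * C" using W2 C_nonneg unfolding \<eta>(1) by (simp add: ennreal_le_iff)
  define m where "m = enn2real (mean_time P x V n)"
  have m: "?E (fst V n) = ennreal m" "0 \<le> m" using fin[of n] by (simp_all add: m_def mean_time_def less_top)
  have Gl: "0 \<le> G - lam" using G[of undefined] by linarith
  have A: "?E (\<lambda>\<omega>. (\<Sum>k\<le>n. seg V k \<top> \<omega>) + ennreal (w (snd V n \<omega>) + C)) = ennreal (\<alpha> + \<eta>)"
  proof -
    have "?E (\<lambda>\<omega>. (\<Sum>k\<le>n. seg V k \<top> \<omega>) + ennreal (w (snd V n \<omega>) + C)) = ?A + ?W" by (rule nn_integral_add) measurable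
    then show ?thesis using \<alpha> \<eta> by simp
  qed
  have B: "?E (\<lambda>\<omega>. ennreal G * fst V n \<omega> + (\<Sum>i\<le>n. ctl.cost i \<omega>) + ennreal C) = ennreal (G * m + C) + ?C"
  proof -
    have "?E (\<lambda>\<omega>. ennreal G * fst V n \<omega> + (\<Sum>i\<le>n. ctl.cost i \<omega>) + ennreal C) = ?E (\<lambda>\<omega>. ennreal G * fst V n \<omega> + (\<Sum>i\<le>n. ctl.cost i \<omega>)) + ?E (\<lambda>_. ennreal C)"
      by (rule nn_integral_add) measurable
    also have "?E (\<lambda>\<omega>. ennreal G * fst V n \<omega> + (\<Sum>i\<le>n. ctl.cost i \<omega>)) = ?E (\<lambda>\<omega>. ennreal G * fst V n \<omega>) + ?C" by (rule nn_integral_add) measurable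
    also have "?E (\<lambda>\<omega>. ennreal G * fst V n \<omega>) = ennreal G * ?E (fst V n)" by (rule nn_integral_cmult) measurable
    finally have "?E (\<lambda>\<omega>. ennreal G * fst V n \<omega> + (\<Sum>i\<le>n. ctl.cost i \<omega>) + ennreal C) = ennreal G * ennreal m + ?C + ennreal C"
      unfolding one m(1) .
    moreover have "ennreal (G * m + C) = ennreal G * ennreal m + ennreal C" using G_nonneg C_nonneg m(2) by (simp add: ennreal_mult)
    ultimately show ?thesis by (simp only: ac_simps)
  qed
  have B': "?E (\<lambda>\<omega>. ennreal (G - lam) * fst V n \<omega> + (\<Sum>i\<le>n. ctl.cost i \<omega>)) = ennreal ((G - lam) * m) + ?C"
  proof -
    have "?E (\<lambda>\<omega>. ennreal (G - lam) * fst V n \<omega> + (\<Sum>i\<le>n. ctl.cost i \<omega>)) = ?E (\<lambda>\<omega>. ennreal (G - lam) * fst V n \<omega>) + ?C" by (rule nn_integral_add) measurable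
    also have "?E (\<lambda>\<omega>. ennreal (G - lam) * fst V n \<omega>) = ennreal (G - lam) * ?E (fst V n)" by (rule nn_integral_cmult) measurable
    finally show ?thesis using Gl m by (simp add: ennreal_mult)
  qed
  have A_Q: "(\<integral>\<^sup>+\<omega>. (\<Sum>k\<le>n. seg V k \<top> \<omega>) + ennreal (w (snd V n \<omega>) + C) \<partial>ctl.Q) = ennreal (\<alpha> + \<eta>)"
    and B_Q: "(\<integral>\<^sup>+\<omega>. ennreal G * fst V n \<omega> + (\<Sum>i\<le>n. ctl.cost i \<omega>) + ennreal C \<partial>ctl.Q) = ennreal (G * m + C) + ?C"
    and A'_Q: "(\<integral>\<^sup>+\<omega>. (\<Sum>k\<le>n. seg V k \<top> \<omega>) \<partial>ctl.Q) = ennreal \<alpha>"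
    and B'_Q: "(\<integral>\<^sup>+\<omega>. ennreal (G - lam) * fst V n \<omega> + (\<Sum>i\<le>n. ctl.cost i \<omega>) \<partial>ctl.Q) = ennreal ((G - lam) * m) + ?C"
    using A B \<alpha>(1) B' by (simp_all only: nn_integral_completion)
  have pay: "impulse_payoff P f c lam w x V n = enn2ereal (ennreal (\<alpha> + \<eta>)) - enn2ereal (ennreal (G * m + C) + ?C)"
    using ctl.impulse_payoff_eq(1)[OF fin w_cont Cu, of n] by (simp only: A_Q B_Q)
  have N: "hat_payoff n = enn2ereal (ennreal \<alpha>) - enn2ereal (ennreal ((G - lam) * m) + ?C)"
    using ctl.J_hat_numerator[OF fin, of n] by (simp only: A'_Q B'_Q)
  have le: "impulse_payoff P f c lam w x V n \<le> ereal (w x)"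
    using bellman V fin unfolding bellman_pair_def by blast
  have Gm: "0 \<le> G * m + C" "0 \<le> (G - lam) * m" using G_nonneg Gl m(2) C_nonneg by simp_all
  show "hat_payoff n \<le> ereal (lam * enn2real (mean_time P x V n) + (w x + C))"
  proof (cases ?C)
    case (real \<kappa>)
    have "(\<alpha> + \<eta>) - (G * m + C + \<kappa>) \<le> w x"
      using le \<alpha>(2) \<eta>(2) Gm real(1) unfolding pay real(2) by (simp add: ennreal_plus[symmetric] del: ennreal_plus)
    then show ?thesis
      using \<alpha>(2) \<eta>(2) Gm real(1) unfolding N real(2) m_def[symmetric] by (simp add: ennreal_plus[symmetric] algebra_simps del: ennreal_plus)
  next
    case top
    then show ?thesis unfolding N top using \<alpha>(2) by simp
  qed
  show "ereal (lam * enn2real (mean_time P x V n) + (w x - C)) \<le> hat_payoff n" if eq: "impulse_payoff P f c lam w x V n = ereal (w x)"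
  proof (cases ?C)
    case (real \<kappa>)
    have "(\<alpha> + \<eta>) - (G * m + C + \<kappa>) = w x"
      using eq \<alpha>(2) \<eta>(2) Gm real(1) unfolding pay real(2) by (simp add: ennreal_plus[symmetric] del: ennreal_plus)
    then show ?thesis
      using \<alpha>(2) \<eta>2 Gm real(1) unfolding N real(2) m_def[symmetric] by (simp add: ennreal_plus[symmetric] algebra_simps del: ennreal_plus)
  next
    case top
    then show ?thesis using eq \<alpha>(2) \<eta>(2) unfolding pay top by (simp del: ennreal_plus)
  qed
qed

lemma J_hat_le:
  assumes adm: "AE \<omega> in ctl.Q. (\<lambda>i. fst V i \<omega>) \<longlonglongrightarrow> \<top>" and fin: "\<And>i. mean_time P x V i < \<infinity>"
  shows "J_hat P f c x V \<le> ereal lam"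
    and "(\<And>n. impulse_payoff P f c lam w x V n = ereal (w x)) \<Longrightarrow> ereal lam \<le> J_hat P f c x V"
proof -
  have m: "enn2ereal (mean_time P x V n) = ereal (enn2real (mean_time P x V n))" for n
    using fin[of n] by (cases "mean_time P x V n") auto
  show "J_hat P f c x V \<le> ereal lam"
    unfolding J_hat_def m
    by (rule Liminf_quotient_le[OF sequentially_bot ctl.mean_time_tends[OF adm fin] always_eventually[OF allI[OF hat_payoff_bounds(1)[OF fin]]]])
  show "ereal lam \<le> J_hat P f c x V" if "\<And>n. impulse_payoff P f c lam w x V n = ereal (w x)"
    unfolding J_hat_def m
    by (rule Liminf_quotient_ge[OF sequentially_bot ctl.mean_time_tends[OF adm fin] always_eventually[OF allI[OF hat_payoff_bounds(2)[OF fin that]]]])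
qed

end

context ergodic_rate
begin

text \<open>The number of stages tends to infinity in the second part of
  \<open>star_estimate\<close>. By \<open>star_tends\<close> the elapsed time tends to
  \<open>T\<close>, so paid cost plus G T is at most the reward up to \<open>T\<close> plus an error
  that grows in \<open>T\<close> at rate 2 G G \<epsilon> / c0, hence at most at rate e.\<close>

lemma star_J_ge: "ereal lam \<le> J P f c x star"
proof (rule ereal_ge_if_approx)
  fix e :: real assume e: "0 < e" "e \<le> 1"
  \<comment> \<open>Serves two bounds: G \<epsilon> \<le> c0 / 2, as \<open>star_estimate\<close>
    requires (here e \<le> 1 enters), and 2 G G \<epsilon> / c0 \<le> e. The factors G + 1 avoid a
    division by 0.\<close>
  define \<epsilon> where "\<epsilon> = c0 * e / (2 * ((G + 1) * (G + 1)))"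
  have g1: "G / (G + 1) \<le> 1" "0 \<le> G / (G + 1)" "1 / (G + 1) \<le> 1" "0 \<le> 1 / (G + 1)" using G_nonneg by auto
  have \<epsilon>0: "0 < \<epsilon>" using e c0 G_nonneg by (simp add: \<epsilon>_def)
  have g2: "G / (G + 1) * (1 / (G + 1)) \<le> 1 * 1" "G / (G + 1) * (G / (G + 1)) \<le> 1 * 1" by (rule mult_mono; use g1 in simp)+
  have eh: "e * (G / (G + 1) * (1 / (G + 1))) \<le> 1 * (1 * 1)"
    by (rule mult_mono[OF e(2) g2(1) zero_le_one mult_nonneg_nonneg[OF g1(2,4)]])
  have "G * \<epsilon> = c0 / 2 * (e * (G / (G + 1) * (1 / (G + 1))))" by (simp add: \<epsilon>_def)
  also have "\<dots> \<le> c0 / 2 * (1 * (1 * 1))" using c0 by (intro mult_left_mono[OF eh]) simp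
  finally have \<epsilon>1: "G * \<epsilon> \<le> c0 / 2" by simp
  have "2 * G * G * \<epsilon> / c0 = e * (G / (G + 1) * (G / (G + 1)))" using c0 G_nonneg by (simp add: \<epsilon>_def divide_simps)
  also have "\<dots> \<le> e * (1 * 1)" using e by (intro mult_left_mono[OF g2(2)]) simp
  finally have \<epsilon>2: "2 * G * G * \<epsilon> / c0 \<le> e" by simp
  obtain S where S: "0 < S" "\<And>y. y \<in> insert x U \<Longrightarrow> (\<integral>\<^sup>+p. act p - ennreal S \<partial>P y) \<le> ennreal \<epsilon>"
    by (rule act_tail[OF \<epsilon>0]) blast
  \<comment> \<open>The part of the error that does not depend on \<open>T\<close>.\<close>
  let ?D = "G * (S + \<epsilon> * ((G * S + 4 * C) * 2 / c0)) + 4 * C"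
  show "ereal (lam - e) \<le> J P f c x star"
    unfolding J_def
  proof (rule Liminf_quotient_ge[where g="\<lambda>T. T" and D="- ?D"])
    show "\<forall>\<^sub>F T in at_top. ereal ((lam - e) * T + - ?D) \<le> eexpectation Qs (\<lambda>\<omega>. ereal (LBINT s:{0..T}. f (controlled star \<omega> s))
       + (\<Sum>i. if \<tau>s i \<omega> \<le> ennreal T then ereal (c (pre_impulse star \<omega> i) (snd star i \<omega>)) else 0))"
      using eventually_ge_at_top[of "0::real"]
    proof eventually_elim
      case (elim T)
      let ?A = "\<Sum>k. \<integral>\<^sup>+\<omega>. seg star k (ennreal T) \<omega> \<partial>Qs" and ?P = "\<Sum>k. \<integral>\<^sup>+\<omega>. star.paid T k \<omega> \<partial>Qs"
      let ?DT = "G * (S + \<epsilon> * ((G * (T + S) + 4 * C) * 2 / c0)) + 4 * C"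
      have DT: "?DT = ?D + 2 * G * G * \<epsilon> / c0 * T" using c0 by (simp add: field_simps)
      have D0: "0 \<le> ?DT" using G_nonneg S \<epsilon>0 elim C_nonneg c0 by (intro add_nonneg_nonneg mult_nonneg_nonneg divide_nonneg_pos) auto
      have lim: "(\<lambda>n. \<integral>\<^sup>+\<omega>. min (Ss n \<omega>) (ennreal T) \<partial>completion Qs) \<longlonglongrightarrow> (\<integral>\<^sup>+\<omega>. ennreal T \<partial>completion Qs)"
      proof (rule nn_integral_dominated_convergence)
        note [measurable] = star.completion_measurable
        show "(\<lambda>\<omega>. min (Ss n \<omega>) (ennreal T)) \<in> borel_measurable (completion Qs)" for n by measurable
        show "AE \<omega> in completion Qs. (\<lambda>n. min (Ss n \<omega>) (ennreal T)) \<longlonglongrightarrow> ennreal T"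
          using AE_completion[OF star_tends]
        proof eventually_elim
          case (elim \<omega>)
          then have "(\<lambda>n. Ss (Suc n) \<omega>) \<longlonglongrightarrow> \<top>" by simp
          then have "(\<lambda>n. Ss n \<omega>) \<longlonglongrightarrow> \<top>" by (rule LIMSEQ_imp_Suc)
          from tendsto_min[OF this tendsto_const[of "ennreal T"]] show ?case by simp
        qed
        show "(\<integral>\<^sup>+\<omega>. ennreal T \<partial>completion Qs) < \<infinity>" by (simp add: star.Q.emeasure_space_1)
      qed auto
      have "(\<lambda>n. (\<Sum>k<n. \<integral>\<^sup>+\<omega>. star.paid T k \<omega> \<partial>Qs) + ennreal G * (\<integral>\<^sup>+\<omega>. min (Ss n \<omega>) (ennreal T) \<partial>completion Qs))
        \<longlonglongrightarrow> ?P + ennreal G * (\<integral>\<^sup>+\<omega>. ennreal T \<partial>completion Qs)"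
        by (intro tendsto_add summable_LIMSEQ summableI ennreal_tendsto_cmult lim) simp
      moreover have "(\<Sum>k<n. \<integral>\<^sup>+\<omega>. star.paid T k \<omega> \<partial>Qs) + ennreal G * (\<integral>\<^sup>+\<omega>. min (Ss n \<omega>) (ennreal T) \<partial>completion Qs) \<le> ?A + ennreal ?DT" for n
      proof -
        have "(\<Sum>k<n. \<integral>\<^sup>+\<omega>. star.paid T k \<omega> \<partial>Qs) + ennreal G * (\<integral>\<^sup>+\<omega>. min (Ss n \<omega>) (ennreal T) \<partial>completion Qs)
          \<le> (\<Sum>k<n. \<integral>\<^sup>+\<omega>. seg star k (ennreal T) \<omega> \<partial>Qs) + ennreal ?DT"
          unfolding nn_integral_completion
          by (rule star_estimate(2)[OF elim less_imp_le[OF S(1)] less_imp_le[OF \<epsilon>0] \<epsilon>1 S(2)])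
        also have "\<dots> \<le> ?A + ennreal ?DT" by (intro add_right_mono sum_le_suminf summableI) auto
        finally show ?thesis .
      qed
      ultimately have "?P + ennreal G * (\<integral>\<^sup>+\<omega>. ennreal T \<partial>completion Qs) \<le> ?A + ennreal ?DT" by (intro LIMSEQ_le_const2) auto
      then have PA: "?P + ennreal (G * T) \<le> ?A + ennreal ?DT" using G_nonneg elim by (simp add: star.Q.emeasure_space_1 ennreal_mult)
      have "?A \<le> ennreal (2 * G * T)" using star.J_numerator(2)[OF star_tends elim] by (simp only: star.expected_sums(1)[OF elim])
      then obtain \<alpha> where \<alpha>: "?A = ennreal \<alpha>" "0 \<le> \<alpha>" by (cases ?A) (auto simp: top_unique)
      have "?P \<le> ?P + ennreal (G * T)" by simp
      also note PA
      also have "?A + ennreal ?DT = ennreal (\<alpha> + ?DT)" unfolding \<alpha>(1) using \<alpha>(2) D0 by (rule ennreal_plus[symmetric])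
      finally have "?P \<le> ennreal (\<alpha> + ?DT)" .
      then obtain \<pi> where \<pi>: "?P = ennreal \<pi>" "0 \<le> \<pi>" by (cases ?P) (auto simp: top_unique)
      have GT: "0 \<le> (G - lam) * T" "0 \<le> G * T" using G[of undefined] G_nonneg elim by (auto intro!: mult_nonneg_nonneg)
      have "ennreal (\<pi> + G * T) \<le> ennreal (\<alpha> + ?DT)" using PA \<pi>(2) \<alpha>(2) D0 GT unfolding \<alpha>(1) \<pi>(1) by (simp only: ennreal_plus)
      then have "\<pi> + G * T \<le> \<alpha> + ?DT" using \<alpha>(2) D0 by (subst (asm) ennreal_le_iff) auto
      moreover have "2 * G * G * \<epsilon> / c0 * T \<le> e * T" using \<epsilon>2 elim by (rule mult_right_mono)
      ultimately have "(lam - e) * T + - ?D \<le> \<alpha> - ((G - lam) * T + \<pi>)" unfolding DT by (simp add: left_diff_distrib)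
      then show ?case
        unfolding star.J_numerator(1)[OF star_tends elim] star.expected_sums[OF elim] \<alpha>(1) \<pi>(1)
        using GT \<alpha>(2) \<pi>(2) by (simp add: ennreal_plus[symmetric] del: ennreal_plus)
    qed
  qed (simp_all add: filterlim_ident)
qed

lemma bellman_strategy: "impulse_strategy U V \<Longrightarrow> bellman_strategy f lam G P U c z \<mu> w xihat x C c0 K h Cq V"
  by (intro bellman_strategy.intro ergodic_rate_axioms bellman_strategy_axioms.intro)

lemma optimal:
  shows "admissible P U x V \<Longrightarrow> J P f c x V \<le> ereal lam"
    and "integrable_strategy P U x V \<Longrightarrow> J_hat P f c x V \<le> ereal lam"
    and "ereal lam = J_hat P f c x star" and "ereal lam = J P f c x star"
proof -
  have J: "J P f c x V \<le> ereal lam" if "admissible P U x V" for V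
    using bellman_strategy.J_le[OF bellman_strategy] that by (simp add: admissible_def)
  have JH: "J_hat P f c x V \<le> ereal lam" if "integrable_strategy P U x V" for V
    using bellman_strategy.J_hat_le(1)[OF bellman_strategy] that by (simp add: integrable_strategy_def admissible_def)
  show "admissible P U x V \<Longrightarrow> J P f c x V \<le> ereal lam" by (rule J)
  show "integrable_strategy P U x V \<Longrightarrow> J_hat P f c x V \<le> ereal lam" by (rule JH)
  have "impulse_payoff P f c lam w x star n = ereal (w x)" for n using bellman by (simp add: bellman_pair_def)
  from bellman_strategy.J_hat_le(2)[OF bellman_strategy[OF star_impulse] star_tends star_mean_time this]
  show "ereal lam = J_hat P f c x star" using JH[OF star_integrable] by (intro antisym)
  show "ereal lam = J P f c x star"
    using star_J_ge J star_integrable by (intro antisym) (auto simp: integrable_strategy_def)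
qed

end

theorem theorem17:
  fixes P :: "'e::metric_space \<Rightarrow> (real \<Rightarrow> 'e) measure"
    and U :: "'e set" and f :: "'e \<Rightarrow> real" and c :: "'e \<Rightarrow> 'e \<Rightarrow> real"
    and z :: 'e and \<mu> :: "'e measure" and lam :: real
    and w :: "'e \<Rightarrow> real" and xihat :: "'e \<Rightarrow> 'e" and x :: 'e
  assumes "locally compact (UNIV :: 'e set)"
    and "markov_family P"
    and "compact U" and "z \<in> U"
    and "continuous_on UNIV f" and "bounded (range f)"
    and "continuous_on (UNIV \<times> U) (\<lambda>(x, \<xi>). c x \<xi>)"
    and "cond_A1 P" and "cond_A2 P \<mu>"
    and "cond_B1 U c" and "cond_B2 P U c" and "cond_B3 P U"
    and "cond_B4 P f \<mu>" and "cond_B5 P U c"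
    and "ereal lam = Limsup (at_right 0) (\<lambda>\<alpha>. ereal \<alpha> * v_discounted P U f c \<alpha> z)"
    and "lam > (\<integral>y. f y \<partial>\<mu>)"
    and "bellman_pair P U f c z lam w xihat"
  shows "(ereal lam = (SUP V\<in>{V. integrable_strategy P U x V}. J_hat P f c x V)
           \<and> integrable_strategy P U x (star_strategy U c w xihat)
           \<and> ereal lam = J_hat P f c x (star_strategy U c w xihat))
       \<and> (\<forall>V. admissible P U x V \<longrightarrow> J P f c x V \<le> ereal lam)
       \<and> ((\<exists>e. continuous_on U e \<and> (\<forall>y. \<forall>\<xi>\<in>U. c y \<xi> = e \<xi>)) \<or> bdd_above (range w)
            \<longrightarrow> ereal lam = J P f c x (star_strategy U c w xihat))"
proof -
  obtain b where b: "\<And>y. \<bar>f y\<bar> \<le> b" using assms(6) by (auto simp: bounded_iff)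
  have "continuous_on (insert x U) w" using assms(17) by (auto simp: bellman_pair_def intro: continuous_on_subset)
  then have "compact (w ` insert x U)" using assms(3) by (intro compact_continuous_image compact_insert)
  from compact_imp_bounded[OF this] obtain C where C: "\<And>u. u \<in> insert x U \<Longrightarrow> \<bar>w u\<bar> \<le> C" by (auto simp: bounded_iff)
  obtain c0 where c0: "c0 < 0" "\<And>y u. u \<in> U \<Longrightarrow> c y u \<le> c0" using assms(10) by (auto simp: cond_B1_def)
  obtain K h where K: "tv_rate P \<mu> K h" "\<And>y T. 0 \<le> T \<Longrightarrow> (\<integral>\<^sup>+p. ennreal (K (p T)) \<partial>P y) < \<infinity>" "asymp_unif_integrable P K"
    using assms(9) unfolding cond_A2_def by blast
  obtain Cq where "\<And>y. max 0 (- q_pot P f \<mu> 0 y) \<le> Cq" using assms(13) unfolding cond_B4_def by (meson atLeastAtMost_iff order_refl zero_le_one)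
  then have Cq: "- q_pot P f \<mu> 0 y \<le> Cq" "0 \<le> Cq" for y by (meson max.bounded_iff)+
  \<comment> \<open>The sign of \<open>c0\<close> changes: (B1) provides a negative upper bound of
    the cost, while in the locale \<open>c0\<close> is the least price of an impulse.\<close>
  interpret ergodic_rate f lam "b + \<bar>lam\<bar>" P U c z \<mu> w xihat x C "- c0" K h Cq
  proof
    show "\<bar>f y\<bar> + \<bar>lam\<bar> \<le> b + \<bar>lam\<bar>" for y using b by simp
    show "c y u \<le> - (- c0)" if "u \<in> U" for y u using c0(2)[OF that] by simp
  qed (use assms c0 C K Cq in auto)
  have "ereal lam = (SUP V\<in>{V. integrable_strategy P U x V}. J_hat P f c x V)"
  proof (rule antisym)
    show "ereal lam \<le> (SUP V\<in>{V. integrable_strategy P U x V}. J_hat P f c x V)"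
      unfolding optimal(3) by (rule SUP_upper) (simp add: star_integrable)
    show "(SUP V\<in>{V. integrable_strategy P U x V}. J_hat P f c x V) \<le> ereal lam"
      by (rule SUP_least) (simp add: optimal(2))
  qed
  then show ?thesis using star_integrable optimal by blast
qed

end
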